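(* For any $\epsilon>0$, there is a randomized algorithm that, given access to an $n$-vertex simple graph $G$ with maximum degree $\Delta$ in the adjacency list query model, with probability $1-1/\mathrm{poly}(n)$ reports a $(2+\epsilon)$-approximation to the size $\mu(G)$ of a maximum matching and a $(2+\epsilon)$-approximation to the size $\nu(G)$ of a minimum vertex cover, using $O(n)+\widetilde O(\Delta/\epsilon^2)$ time and queries.
   Context: Adjacency list query model: for any vertex $v$ the algorithm may query $\deg(v)$, and for any $1\le i\le \deg(v)$ it may query the $i$-th neighbor of $v$ in an arbitrarily ordered adjacency list. For $\alpha\ge 1$, estimates $\widetilde\mu$ and $\widetilde\nu$ are $\alpha$-approximations of $\mu(G)$ and $\nu(G)$ if $\mu(G)/\alpha \le \widetilde\mu\le \mu(G)$ and $\nu(G)\le\widetilde\nu\le \alpha\,\nu(G)$. $\widetilde O(\cdot)$ hides $\mathrm{poly}\log n$ factors. *)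

theory Defs
  imports "HOL-Probability.Probability_Mass_Function"
begin

text \<open>Simple graphs on the vertex set \<open>{..<n}\<close>, given by their set of edges.\<close>

definition simple_graph :: "nat \<Rightarrow> nat set set \<Rightarrow> bool" where
  "simple_graph n E \<longleftrightarrow> (\<forall>e\<in>E. e \<subseteq> {..<n} \<and> card e = 2)"

definition neighbors :: "nat set set \<Rightarrow> nat \<Rightarrow> nat set" where
  "neighbors E v = {u. {v, u} \<in> E}"

definition max_degree :: "nat \<Rightarrow> nat set set \<Rightarrow> nat" where
  "max_degree n E = Max ((\<lambda>v. card (neighbors E v)) ` {..<n})"

definition matching :: "nat set set \<Rightarrow> nat set set \<Rightarrow> bool" where
  "matching E M \<longleftrightarrow> M \<subseteq> E \<and> (\<forall>e\<in>M. \<forall>f\<in>M. e \<noteq> f \<longrightarrow> e \<inter> f = {})"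

definition matching_number :: "nat set set \<Rightarrow> nat" where
  "matching_number E = Max (card ` {M. matching E M})"

definition vertex_cover :: "nat \<Rightarrow> nat set set \<Rightarrow> nat set \<Rightarrow> bool" where
  "vertex_cover n E S \<longleftrightarrow> S \<subseteq> {..<n} \<and> (\<forall>e\<in>E. e \<inter> S \<noteq> {})"

definition vertex_cover_number :: "nat \<Rightarrow> nat set set \<Rightarrow> nat" where
  "vertex_cover_number n E = Min (card ` {S. vertex_cover n E S})"

definition matching_approx :: "real \<Rightarrow> nat set set \<Rightarrow> real \<Rightarrow> bool" where
  "matching_approx \<alpha> E m \<longleftrightarrow>
     real (matching_number E) / \<alpha> \<le> m \<and> m \<le> real (matching_number E)"

definition vertex_cover_approx :: "real \<Rightarrow> nat \<Rightarrow> nat set set \<Rightarrow> real \<Rightarrow> bool" where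
  "vertex_cover_approx \<alpha> n E c \<longleftrightarrow>
     real (vertex_cover_number n E) \<le> c \<and> c \<le> \<alpha> * real (vertex_cover_number n E)"

text \<open>\<open>adj v\<close> enumerates the neighbors of \<open>v\<close> in an arbitrary order.\<close>

definition adjacency_lists :: "nat \<Rightarrow> nat set set \<Rightarrow> (nat \<Rightarrow> nat list) \<Rightarrow> bool" where
  "adjacency_lists n E adj \<longleftrightarrow>
     (\<forall>v<n. distinct (adj v) \<and> set (adj v) = neighbors E v)"

text \<open>Answers to the two queries. Neighbors are counted from 1; the answer to an ill-formed
  query is 0.\<close>

definition query_degree :: "nat \<Rightarrow> (nat \<Rightarrow> nat list) \<Rightarrow> nat \<Rightarrow> nat" where
  "query_degree n adj v = (if v < n then length (adj v) else 0)"

definition query_neighbor :: "nat \<Rightarrow> (nat \<Rightarrow> nat list) \<Rightarrow> nat \<Rightarrow> nat \<Rightarrow> nat" where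
  "query_neighbor n adj v i =
     (if v < n \<and> 1 \<le> i \<and> i \<le> length (adj v) then adj v ! (i - 1) else 0)"

text \<open>Algorithms are programs of a randomized word RAM with word length \<open>w\<close>. A program has finitely
  many registers and a memory of \<open>2 ^ w\<close> words with indirect addressing. Every instruction
  performs at most one operation on words, one query or one random choice.\<close>

datatype operand = Const nat | Reg nat

datatype binop = Add | Sub | Mul | Div | Mod | Less | Equal

datatype com =
    Skip
  | Compute nat binop operand operand
  | Load nat operand
  | Store operand operand
  | Random nat operand
  | QueryDegree nat operand
  | QueryNeighbor nat operand operand
  | Seq com com
  | If operand com com
  | While operand com

record state =
  regs :: "nat \<Rightarrow> nat"
  mem :: "nat \<Rightarrow> nat"

fun operand_val :: "nat \<Rightarrow> state \<Rightarrow> operand \<Rightarrow> nat" where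
  "operand_val w s (Const c) = c mod 2 ^ w"
| "operand_val w s (Reg r) = regs s r"

text \<open>Addition and multiplication wrap around; subtraction is truncated at 0.\<close>

fun binop_val :: "nat \<Rightarrow> binop \<Rightarrow> nat \<Rightarrow> nat \<Rightarrow> nat" where
  "binop_val w Add x y = (x + y) mod 2 ^ w"
| "binop_val w Sub x y = x - y"
| "binop_val w Mul x y = (x * y) mod 2 ^ w"
| "binop_val w Div x y = x div y"
| "binop_val w Mod x y = x mod y"
| "binop_val w Less x y = (if x < y then 1 else 0)"
| "binop_val w Equal x y = (if x = y then 1 else 0)"

definition set_reg :: "nat \<Rightarrow> nat \<Rightarrow> state \<Rightarrow> state" where
  "set_reg r x s = s\<lparr>regs := (regs s)(r := x)\<rparr>"

text \<open>A configuration consists of the stack of commands still to be executed and the state.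
  \<open>Random r a\<close> draws a uniformly random element of \<open>{..<a}\<close> (and yields 0 if \<open>a = 0\<close>).
  Conditions hold iff they are nonzero.\<close>

type_synonym config = "com list \<times> state"

fun step :: "nat \<Rightarrow> nat \<Rightarrow> (nat \<Rightarrow> nat list) \<Rightarrow> config \<Rightarrow> config pmf" where
  "step w n adj ([], s) = return_pmf ([], s)"
| "step w n adj (Skip # K, s) = return_pmf (K, s)"
| "step w n adj (Compute r f a b # K, s) =
     return_pmf (K, set_reg r (binop_val w f (operand_val w s a) (operand_val w s b)) s)"
| "step w n adj (Load r a # K, s) =
     return_pmf (K, set_reg r (mem s (operand_val w s a)) s)"
| "step w n adj (Store a b # K, s) =
     return_pmf (K, s\<lparr>mem := (mem s)(operand_val w s a := operand_val w s b)\<rparr>)"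
| "step w n adj (Random r a # K, s) =
     map_pmf (\<lambda>x. (K, set_reg r x s)) (pmf_of_set {..<max 1 (operand_val w s a)})"
| "step w n adj (QueryDegree r a # K, s) =
     return_pmf (K, set_reg r (query_degree n adj (operand_val w s a)) s)"
| "step w n adj (QueryNeighbor r a b # K, s) =
     return_pmf (K, set_reg r (query_neighbor n adj (operand_val w s a) (operand_val w s b)) s)"
| "step w n adj (Seq c d # K, s) = return_pmf (c # d # K, s)"
| "step w n adj (If a c d # K, s) =
     return_pmf ((if operand_val w s a \<noteq> 0 then c else d) # K, s)"
| "step w n adj (While a c # K, s) =
     return_pmf (if operand_val w s a \<noteq> 0 then c # While a c # K else K, s)"

text \<open>The distribution of the configuration after \<open>t\<close> steps. Every query is a step, so \<open>t\<close> bounds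
  both the running time and the number of queries.\<close>

primrec run :: "nat \<Rightarrow> nat \<Rightarrow> (nat \<Rightarrow> nat list) \<Rightarrow> nat \<Rightarrow> config \<Rightarrow> config pmf" where
  "run w n adj 0 cfg = return_pmf cfg"
| "run w n adj (Suc t) cfg = bind_pmf (step w n adj cfg) (run w n adj t)"

text \<open>The only input is \<open>n\<close>, in register 0; all other registers and the memory are initially 0.
  In particular the maximum degree is not given. The two estimates are output in registers 0 and
  1; integer outputs lose nothing since both numbers approximated are integers.\<close>

definition initial :: "com \<Rightarrow> nat \<Rightarrow> config" where
  "initial P n = ([P], \<lparr>regs = (\<lambda>_. 0)(0 := n), mem = (\<lambda>_. 0)\<rparr>)"

definition halted :: "config \<Rightarrow> bool" where
  "halted cfg \<longleftrightarrow> fst cfg = []"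

definition matching_estimate :: "config \<Rightarrow> real" where
  "matching_estimate cfg = real (regs (snd cfg) 0)"

definition vertex_cover_estimate :: "config \<Rightarrow> real" where
  "vertex_cover_estimate cfg = real (regs (snd cfg) 1)"

end

theory Submission
  imports Defs "HOL-Probability.Product_PMF"
begin

text \<open>Every edge rings at independent random times, and an edge is matched when it rings while both endpoints
  are free. The edges matched up to time \<open>N\<close> form a maximal matching with high probability, so the number of matched
  vertices lies between \<open>\<nu>\<close> and \<open>2 \<mu>\<close>. Whether a random vertex is matched is decided by a recursive
  exploration whose expected size, by a rotation of the time axis, is proportional to the average degree up to logarithms;
  the exploration reveals the rings block by block. Sampling vertices yields the estimates by a Chernoff bound.\<close>

text \<open>The time bound comes from a cancellation. Let D be the sum of the degrees and n' the
  number of non-isolated vertices. A vertex cover has at least D / (2 \<Delta>) vertices, so a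
  sampled non-isolated vertex is matched with probability of order at least D / (\<Delta> n'), and
  about \<Delta> n' / (D \<epsilon>^2) samples suffice. One exploration costs about 1 + D / n' up to
  logarithms, and n' <= D; the product is \<Delta> / \<epsilon>^2. Two obstacles shape the rest. The
  machine draws only uniform words and cannot afford to toss every cell, so gaps between rings are
  drawn with exactly the geometric law; the conditional law of the ringing is then followed by a
  potential that bounds error and time together. And the constants of the theorem are fixed before
  \<epsilon>: the program may depend on \<epsilon>, but word length and time only as stated. So the
  powers of two that encode \<epsilon> are capped by the size of the instance, and for large
  \<epsilon> fewer samples are drawn, with an estimate from degrees alone when there are few
  hits.\<close>

abbreviation (input) EV :: "'a pmf => ('a => real) => real" where "EV \<equiv> measure_pmf.expectation"
abbreviation (input) PR :: "'a pmf => 'a set => real" where "PR \<equiv> measure_pmf.prob"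


section \<open>Expectations over finitely supported distributions\<close>

lemma E_bind:
 fixes h :: "'b => real"
 assumes "finite (set_pmf p)" "!!x. x \<in> set_pmf p ==> finite (set_pmf (f x))"
 shows "EV (bind_pmf p f) h
 = EV p (%x. EV (f x) h)"
 using assms by (subst pmf_expectation_bind[where A = "set_pmf p"])
 (auto simp: integral_measure_pmf[where A = "set_pmf p"])

lemma E_mono:
 fixes f g :: "'a => real"
 assumes "finite (set_pmf p)" "!!x. x \<in> set_pmf p ==> f x <= g x"
 shows "EV p f <= EV p g"
 using assms by (intro integral_mono_AE AE_pmfI integrable_measure_pmf_finite) auto

lemma E_cong:
 fixes f g :: "'a => real"
 assumes "!!x. x \<in> set_pmf p ==> f x = g x"
 shows "EV p f = EV p g"
 using assms by (intro integral_cong_AE AE_pmfI) auto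

lemma E_nonneg:
 fixes f :: "'a => real"
 assumes "!!x. x \<in> set_pmf p ==> 0 <= f x"
 shows "0 <= EV p f"
 using assms by (intro integral_nonneg_AE AE_pmfI) auto

lemma E_add:
 fixes f g :: "'a => real"
 assumes "finite (set_pmf p)"
 shows "EV p (%x. f x + g x)
 = EV p f + EV p g"
 by (intro Bochner_Integration.integral_add integrable_measure_pmf_finite assms)

lemma E_sum:
 fixes f :: "'i => 'a => real"
 assumes "finite (set_pmf p)"
 shows "EV p (%x. \<Sum>i\<in>I. f i x)
 = (\<Sum>i\<in>I. EV p (f i))"
 by (intro Bochner_Integration.integral_sum integrable_measure_pmf_finite assms)

lemma E_unif:
 fixes f :: "nat => real"
 assumes "0 < m"
 shows "EV (pmf_of_set {..<m}) f = (\<Sum>x<m. f x) / m"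
 using assms by (subst integral_pmf_of_set) auto

lemma E_prob:
 "EV p (%x. of_bool (P x)) = PR p {x. P x}"
proof -
 have "(%x. of_bool (P x) :: real) = indicator {x. P x}" by (auto simp: indicator_def)
 then show ?thesis by simp
qed

text \<open>Coordinates of a product are independent, so coordinate \<open>x\<close> may be
  overwritten by a fresh draw from \<open>p x\<close>. That \<open>q\<close> may differ from
  \<open>p\<close> at \<open>x\<close> lets one law \<open>q\<close> serve for \<open>x\<close>
  known and for \<open>x\<close> unknown.\<close>

lemma Pi_pmf_resample:
 assumes "finite C" "x \<in> C" "!!y. y ~= x ==> q y = p y"
 shows "Pi_pmf C d p = bind_pmf (p x) (%b. map_pmf (%R. R(x := b)) (Pi_pmf C d q))"
proof -
 have C: "C = insert x (C - {x})" using assms(2) by auto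
 have e: "Pi_pmf (C - {x}) d q = Pi_pmf (C - {x}) d p"
 using assms(3) by (intro Pi_pmf_cong) auto
 have 1: "Pi_pmf C d r = do {y \<leftarrow> r x; f \<leftarrow> Pi_pmf (C - {x}) d r; return_pmf (f(x := y))}" for r
 by (subst C, subst Pi_pmf_insert') (use assms(1) in auto)
 have "map_pmf (%R. R(x := b)) (Pi_pmf C d q) = map_pmf (%f. f(x := b)) (Pi_pmf (C - {x}) d p)" for b
 unfolding 1[of q] by (simp add: map_bind_pmf e) (simp add: map_pmf_def)
 then show ?thesis unfolding 1[of p] by (simp add: map_pmf_def)
qed

section \<open>Independent random bits, some of which are already known\<close>

locale bern_field =
 fixes C :: "'c set" and \<rho> :: real
 assumes finC: "finite C" and rho0: "0 <= \<rho>" and rho1: "\<rho> <= 1"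
begin

text \<open>The bits in \<open>Kn\<close> are known, and those among them that are set form \<open>G\<close>.\<close>

definition rp :: "'c set => 'c set => ('c => bool) pmf" where
 "rp Kn G = Pi_pmf C False (%x. if x \<in> Kn then return_pmf (x \<in> G) else bernoulli_pmf \<rho>)"

abbreviation EE :: "(('c => bool) => real) => real" where
 "EE f \<equiv> EV (rp {} {}) f"

lemma rp_support: "R \<in> set_pmf (rp Kn G) ==> R x ==> x \<in> C"
 using set_Pi_pmf_subset[OF finC, of False "%x. if x \<in> Kn then return_pmf (x \<in> G) else bernoulli_pmf \<rho>"]
 unfolding rp_def[symmetric] by auto

lemma finite_rp [simp]: "finite (set_pmf (rp Kn G))"
proof (rule finite_subset)
 show "set_pmf (rp Kn G) \<subseteq> PiE_dflt C False (%_. UNIV)"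
 using rp_support by (auto simp: PiE_dflt_def)
 show "finite (PiE_dflt C False (%_. UNIV :: bool set))"
 by (rule finite_PiE_dflt[OF finC]) simp
qed

lemma rp_known:
 assumes "R \<in> set_pmf (rp Kn G)" "x \<in> C" "x \<in> Kn"
 shows "R x \<longleftrightarrow> x \<in> G"
proof -
 have "R x \<in> set_pmf (if x \<in> Kn then return_pmf (x \<in> G) else bernoulli_pmf \<rho>)"
 using assms(1,2) unfolding rp_def set_Pi_pmf[OF finC] by (simp add: PiE_dflt_def)
 then show ?thesis using assms(3) by simp
qed

lemma rp_cong:
 assumes "Kn \<inter> C = Kn' \<inter> C" "G \<inter> Kn \<inter> C = G' \<inter> Kn \<inter> C"
 shows "rp Kn G = rp Kn' G'"
 unfolding rp_def
proof (rule Pi_pmf_cong)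
 fix x assume x: "x \<in> C"
 have "x \<in> Kn \<longleftrightarrow> x \<in> Kn'" using assms(1) x by (metis IntD1 IntI)
 moreover have "x \<in> Kn ==> x \<in> G \<longleftrightarrow> x \<in> G'" using assms(2) x by (metis IntD1 IntI)
 ultimately show "(if x \<in> Kn then return_pmf (x \<in> G) else bernoulli_pmf \<rho>)
 = (if x \<in> Kn' then return_pmf (x \<in> G') else bernoulli_pmf \<rho>)" by simp
qed simp_all

text \<open>Tossing one unknown bit splits the conditional law into its two continuations, so
  revealing bits lazily preserves expectations on average. A bit known to be unset lies in
  \<open>Kn\<close> but not in \<open>G\<close>, hence \<open>G - {x}\<close>.\<close>

lemma E_reveal:
 assumes "x \<in> C" "x \<notin> Kn"
 shows "EV (rp Kn G) f
 = \<rho> * EV (rp (insert x Kn) (insert x G)) f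
 + (1 - \<rho>) * EV (rp (insert x Kn) (G - {x})) f"
proof -
 define p where "p = (%x. if x \<in> Kn then return_pmf (x \<in> G) else bernoulli_pmf \<rho>)"
 define p' where "p' b = (%y. if y \<in> insert x Kn then return_pmf (y \<in> (if b then insert x G else G - {x}))
 else bernoulli_pmf \<rho>)" for b
 have 2: "rp (insert x Kn) (if b then insert x G else G - {x})
 = map_pmf (%R. R(x := b)) (Pi_pmf C False p)" for b
 proof -
 have "rp (insert x Kn) (if b then insert x G else G - {x}) = Pi_pmf C False (p' b)"
 unfolding rp_def p'_def ..
 also have "... = bind_pmf (p' b x) (%b. map_pmf (%R. R(x := b)) (Pi_pmf C False p))"
 by (rule Pi_pmf_resample[OF finC assms(1)]) (auto simp: p_def p'_def)
 also have "p' b x = return_pmf b" by (auto simp: p'_def)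
 finally show ?thesis by (simp only: bind_return_pmf)
 qed
 have "rp Kn G = Pi_pmf C False p" unfolding rp_def p_def ..
 also have "... = bind_pmf (p x) (%b. map_pmf (%R. R(x := b)) (Pi_pmf C False p))"
 by (rule Pi_pmf_resample[OF finC assms(1)]) simp
 also have "p x = bernoulli_pmf \<rho>" using assms(2) by (simp add: p_def)
 finally have "rp Kn G = bind_pmf (bernoulli_pmf \<rho>)
 (%b. rp (insert x Kn) (if b then insert x G else G - {x}))"
 unfolding 2 .
 then have "EV (rp Kn G) f = EV (bernoulli_pmf \<rho>)
 (%b. EV (rp (insert x Kn) (if b then insert x G else G - {x})) f)"
 by (simp only:) (rule E_bind, auto intro: finite_subset[OF subset_UNIV])
 then show ?thesis using rho0 rho1 by (simp only: integral_bernoulli_pmf if_True if_False mult.commute)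
qed

lemma E_resample:
 assumes "x \<in> C"
 shows "EE f = \<rho> * EE (%R. f (R(x := True))) + (1 - \<rho>) * EE (%R. f (R(x := False)))"
proof -
 have p: "rp {} {} = Pi_pmf C False (%x. bernoulli_pmf \<rho>)" by (simp add: rp_def)
 have "rp {} {} = bind_pmf (bernoulli_pmf \<rho>) (%b. map_pmf (%R. R(x := b)) (rp {} {}))"
 unfolding p by (rule Pi_pmf_resample[OF finC assms]) simp
 then have "EE f = EV (bind_pmf (bernoulli_pmf \<rho>)
 (%b. map_pmf (%R. R(x := b)) (rp {} {}))) f" by (rule arg_cong)
 also have "... = EV (bernoulli_pmf \<rho>)
 (%b. EV (map_pmf (%R. R(x := b)) (rp {} {})) f)"
 by (rule E_bind) (auto intro: finite_subset[OF subset_UNIV])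
 finally show ?thesis using rho0 rho1
 by (simp only: integral_bernoulli_pmf integral_map_pmf mult.commute)
qed

text \<open>\<open>f\<close> ignores the bits in \<open>S\<close> and is therefore independent of
  them; \<open>E_resample\<close> peels them off one at a time.\<close>

lemma E_all_bits:
 assumes "finite S" "S \<subseteq> C"
 and "!!x R b. x \<in> S ==> f (R(x := b)) = f R"
 shows "EE (%R. f R * of_bool (\<forall>x\<in>S. R x = b)) = EE f * (if b then \<rho> else 1 - \<rho>) ^ card S"
 using assms
proof (induction S rule: finite_induct)
 case (insert x S)
 let ?g = "%R. f R * of_bool (\<forall>y\<in>S. R y = b)"
 have e: "f (R(x := c)) * of_bool (\<forall>y\<in>insert x S. (R(x := c)) y = b)
 = (if c = b then ?g R else 0)" for R c
 proof -
 have "(\<forall>y\<in>S. (R(x := c)) y = b) \<longleftrightarrow> (\<forall>y\<in>S. R y = b)"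
 using insert.hyps by auto
 moreover have "f (R(x := c)) = f R" by (rule insert.prems(2)) simp
 ultimately show ?thesis by (simp del: fun_upd_apply) simp
 qed
 have "EE (%R. f R * of_bool (\<forall>y\<in>insert x S. R y = b)) = (if b then \<rho> else 1 - \<rho>) * EE ?g"
 by (subst E_resample[of x]) (use insert.prems in simp, unfold e, cases b, simp_all)
 also have "EE ?g = EE f * (if b then \<rho> else 1 - \<rho>) ^ card S"
 using insert.prems by (intro insert.IH) auto
 finally show ?case using insert.hyps by simp
qed simp

lemma prob_all_bits:
 assumes "S \<subseteq> C"
 shows "EE (%R. of_bool (\<forall>x\<in>S. R x = b)) = (if b then \<rho> else 1 - \<rho>) ^ card S"
 using E_all_bits[of S "%_. 1" b] assms finite_subset[OF assms finC] by simp

lemma E_union_bound: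
 assumes "finite I" "!!R. R \<in> set_pmf (rp {} {}) ==> P R ==> \<exists>i\<in>I. A i R"
 shows "EE (%R. of_bool (P R)) <= (\<Sum>i\<in>I. EE (%R. of_bool (A i R)))"
proof -
 have "EE (%R. of_bool (P R)) <= EE (%R. \<Sum>i\<in>I. of_bool (A i R))"
 proof (rule E_mono, simp)
 fix R assume R: "R \<in> set_pmf (rp {} {})"
 show "of_bool (P R) <= (\<Sum>i\<in>I. of_bool (A i R) :: real)"
 proof (cases "P R")
 case True
 then obtain i where "i \<in> I" "A i R" using assms(2)[OF R] by blast
 then have "(1::real) <= (\<Sum>i\<in>I. of_bool (A i R))"
 using member_le_sum[of i I "%i. of_bool (A i R) :: real"] assms(1) by simp
 then show ?thesis using True by simp
 qed (auto intro: sum_nonneg)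
 qed
 then show ?thesis by (simp add: E_sum)
qed

end


section \<open>Greedy matching driven by rings of edges\<close>

text \<open>\<open>R (e, t)\<close> says that edge \<open>e\<close> rings at tick \<open>t\<close>; \<open>alv R t u\<close> says that \<open>u\<close> is still
  unmatched just before tick \<open>t\<close> when every ringing edge with two unmatched ends is taken.\<close>

type_synonym ringing = "nat set \<times> nat => bool"

primrec alv :: "ringing => nat => nat => bool" where
 "alv R 0 u = True"
| "alv R (Suc t) u \<longleftrightarrow> alv R t u & ~ (\<exists>w. R ({u, w}, t) & alv R t w)"

text \<open>Two edges with a common end that ring at once could both be taken by the rule of
  \<open>alv\<close>. Without ties the rule is sequential greedy matching, and each tick determines
  its edge.\<close>

definition no_tie :: "ringing => bool" where
 "no_tie R \<longleftrightarrow> (\<forall>t e f. R (e, t) --> R (f, t) --> e = f)"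

lemma alv_mono: "alv R t u ==> s <= t ==> alv R s u"
proof (induction t)
 case (Suc t)
 then show ?case by (cases "s = Suc t") auto
qed simp

lemma alv_cong:
 assumes "!!e s. s < t ==> R (e, s) = R' (e, s)"
 shows "alv R t u = alv R' t u"
 using assms by (induction t arbitrary: u) auto

lemma not_alvE:
 assumes "~ alv R t u"
 obtains s w where "s < t" "R ({u, w}, s)" "alv R s u" "alv R s w"
proof -
 have "\<exists>s w. s < t & R ({u, w}, s) & alv R s u & alv R s w"
 using assms by (induction t) (auto, (use less_Suc_eq in blast)+)
 then show thesis using that by blast
qed

lemma alv_killed:
 assumes "R ({u, w}, s)" "alv R s u" "alv R s w" "s < t"
 shows "~ alv R t u"
 using alv_mono[of R t u "Suc s"] assms by auto

section \<open>Query walks\<close>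

text \<open>A branch of the recursion that decides whether \<open>u\<close> is unmatched before
  \<open>t\<close>: a ring at a live vertex raises the question whether the other end is unmatched
  before that ring. So ticks decrease along the walk, and the last vertex need not be alive.\<close>

primrec qwalk :: "ringing => nat => nat => (nat \<times> nat) list => bool" where
 "qwalk R u t [] \<longleftrightarrow> True"
| "qwalk R u t (p # ps) \<longleftrightarrow>
 fst p < t & R ({u, snd p}, fst p) & alv R (fst p) u & qwalk R (snd p) (fst p) ps"

text \<open>For a walk listed backwards, \<open>wend\<close> and \<open>wtick\<close> give the
  vertex and the tick at which it currently ends, or its origin if it is empty.\<close>

definition wend :: "nat => (nat \<times> nat) list => nat" where
 "wend u qs = (case qs of [] => u | q # _ => snd q)"

definition wtick :: "nat => (nat \<times> nat) list => nat" where
 "wtick t qs = (case qs of [] => t | q # _ => fst q)"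

lemma wend_simps [simp]: "wend u [] = u" "wend u (q # qs) = snd q"
 by (simp_all add: wend_def)

lemma wtick_simps [simp]: "wtick u [] = u" "wtick u (q # qs) = fst q"
 by (simp_all add: wtick_def)

lemma qwalk_snoc:
 "qwalk R u t (rev (p # qs)) \<longleftrightarrow> qwalk R u t (rev qs) & fst p < wtick t qs
 & R ({wend u qs, snd p}, fst p) & alv R (fst p) (wend u qs)"
proof -
 have "qwalk R u t (ps @ [p]) \<longleftrightarrow> qwalk R u t ps & fst p < wtick t (rev ps)
 & R ({wend u (rev ps), snd p}, fst p) & alv R (fst p) (wend u (rev ps))" for ps
 proof (induction ps arbitrary: u t)
 case (Cons q ps)
 have "wtick t (rev ps @ [q]) = wtick (fst q) (rev ps)" for t by (cases "rev ps") auto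
 moreover have "wend u (rev ps @ [q]) = wend (snd q) (rev ps)" for u by (cases "rev ps") auto
 ultimately show ?case using Cons.IH by auto
 qed auto
 from this[of "rev qs"] show ?thesis by simp
qed

lemma qwalk_mono: "qwalk R u t ps ==> t <= t' ==> qwalk R u t' ps"
 by (cases ps) auto

definition swp :: "nat => nat => ringing => ringing" where
 "swp s t R = (%(e, r). R (e, if r = s then t else if r = t then s else r))"

lemma swp_swp [simp]: "swp s t (swp s t R) = R"
 by (auto simp: swp_def fun_eq_iff)

lemma no_tie_swp: "no_tie R ==> no_tie (swp s t R)"
 unfolding no_tie_def swp_def by (auto split: if_splits)

text \<open>Walks are listed with the last ring first. \<open>rotr\<close> rotates the contents of the ticks of a walk:
  each ring of the walk moves to the next tick visited by it, the last one to the first tick. The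
  result determines the walk, given its first tick and its last edge: the last but one vertex is
  matched at the last tick, which reveals the previous ring.\<close>

fun rotr :: "ringing => (nat \<times> nat) list => ringing" where
 "rotr R (p # q # qs) = swp (fst p) (fst (last (q # qs))) (rotr R (q # qs))"
| "rotr R qs = R"

definition ascending :: "(nat \<times> nat) list => bool" where
 "ascending qs \<longleftrightarrow> sorted_wrt (%p q. fst p < fst q) qs"

lemma qwalk_ascending: "qwalk R u t (rev qs) ==> ascending qs"
proof (induction qs)
 case (Cons p qs)
 then have 1: "ascending qs" "fst p < wtick t qs" using qwalk_snoc[of R u t p qs] by auto
 have "fst p < fst q" if "q \<in> set qs" for q
 using 1 that by (cases qs) (auto simp: ascending_def)
 then show ?case using 1 by (simp add: ascending_def)
qed (simp add: ascending_def)

lemma ascending_last: "ascending (p # q # qs) ==> fst p < fst (last (q # qs))"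
 unfolding ascending_def by (auto dest: last_in_set)

text \<open>Only ticks of the walk are swapped, and the head carries the earliest of them; so the
  history before \<open>fst p\<close>, and with it \<open>alv\<close> up to \<open>fst p\<close>,
  survives the rotation.\<close>

lemma rotr_agree: "ascending (p # qs) ==> s < fst p ==> rotr R (p # qs) (e, s) = R (e, s)"
proof (induction qs arbitrary: p)
 case (Cons q qs)
 have "fst p < fst q" "ascending (q # qs)" using Cons.prems by (auto simp: ascending_def)
 moreover have "fst p < fst (last (q # qs))" using Cons.prems ascending_last by blast
 ultimately show ?case using Cons.IH[of q] Cons.prems(2) by (simp add: swp_def)
qed simp

lemma rotr_first: "ascending (p # qs) ==> rotr R (p # qs) (e, fst (last (p # qs))) = R (e, fst p)"
proof (induction qs arbitrary: p)
 case (Cons q qs)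
 have "fst p < fst q" "ascending (q # qs)" using Cons.prems by (auto simp: ascending_def)
 then have "rotr R (q # qs) (e, fst p) = R (e, fst p)" by (intro rotr_agree)
 moreover have "fst p ~= fst (last (q # qs))" using ascending_last[OF Cons.prems] by simp
 ultimately show ?case by (simp add: swp_def)
qed simp

lemma rotr_last: "ascending (p # q # qs) ==> rotr R (p # q # qs) (e, fst p) = R (e, fst q)"
 using rotr_first[of q qs R e] by (simp add: swp_def ascending_def)

lemma no_tie_rotr: "no_tie R ==> no_tie (rotr R qs)"
 by (induction R qs rule: rotr.induct) (auto intro: no_tie_swp)

text \<open>After the rotation the previous edge of the walk rings at the last tick. Both its ends
  are alive there: \<open>snd q\<close> because the walk leaves it at \<open>fst p\<close>, the
  other because it was alive at the later tick \<open>fst q\<close>. Hence \<open>fst p\<close> is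
  the tick at which \<open>snd q\<close> gets matched.\<close>

lemma rotr_matched:
 assumes "qwalk R u t (rev (p # q # qs))"
 defines "S \<equiv> rotr R (p # q # qs)"
 shows "alv S (fst p) (snd q)" "~ alv S (Suc (fst p)) (snd q)" "S ({wend u qs, snd q}, fst p)"
proof -
 have asc: "ascending (p # q # qs)" using assms(1) by (rule qwalk_ascending)
 have 1: "alv R (fst p) (snd q)" "fst p < fst q" "qwalk R u t (rev (q # qs))"
 using assms(1) qwalk_snoc[of R u t p "q # qs"] by auto
 then have 2: "R ({wend u qs, snd q}, fst q)" "alv R (fst q) (wend u qs)"
 using qwalk_snoc[of R u t q qs] by auto
 have ag: "alv S (fst p) v = alv R (fst p) v" for v
 unfolding S_def by (rule alv_cong) (rule rotr_agree[OF asc])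
 show a: "alv S (fst p) (snd q)" using 1 ag by simp
 show b: "S ({wend u qs, snd q}, fst p)" unfolding S_def rotr_last[OF asc] by (rule 2)
 have "alv S (fst p) (wend u qs)" using ag 2(2) 1(2) alv_mono[of R "fst q" "wend u qs" "fst p"] by simp
 moreover have "S ({snd q, wend u qs}, fst p)" using b by (simp add: insert_commute)
 ultimately show "~ alv S (Suc (fst p)) (snd q)" by auto
qed

lemma rotr_inj:
 assumes "length qs = k" "length qs' = k" "1 <= k"
 and "qwalk R u t (rev qs)" "qwalk R' u' t (rev qs')" "no_tie R" "no_tie R'"
 and "rotr R qs = rotr R' qs'" "fst (last qs) = fst (last qs')"
 and "wend u (tl qs) = wend u' (tl qs')" "snd (hd qs) = snd (hd qs')"
 shows "R = R' & u = u' & qs = qs'"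
 using assms
proof (induction k arbitrary: qs qs')
 case (Suc k)
 show ?case
 proof (cases "k = 0")
 case True
 then obtain p p' where "qs = [p]" "qs' = [p']"
 using Suc.prems(1,2) by (auto simp: length_Suc_conv)
 then show ?thesis using Suc.prems by (auto intro: prod_eqI)
 next
 case False
 then obtain p q rs p' q' rs' where qs: "qs = p # q # rs" and qs': "qs' = p' # q' # rs'"
 using Suc.prems(1,2) by (auto simp: length_Suc_conv gr0_conv_Suc)
 let ?S = "rotr R qs"
 have S': "rotr R' (p' # q' # rs') = ?S" using Suc.prems(8) qs' by simp
 have S: "rotr R (p # q # rs) = ?S" using qs by simp
 have snd_eq: "snd q = snd q'" "snd p = snd p'" using Suc.prems qs qs' by auto
 have m: "alv ?S (fst p) (snd q)" "~ alv ?S (Suc (fst p)) (snd q)" "?S ({wend u rs, snd q}, fst p)"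
 using rotr_matched[of R u t p q rs] Suc.prems(4) qs by auto
 have m': "alv ?S (fst p') (snd q)" "~ alv ?S (Suc (fst p')) (snd q)" "?S ({wend u' rs', snd q}, fst p')"
 using rotr_matched[of R' u' t p' q' rs'] Suc.prems(5) qs' S' snd_eq by auto
 \<comment> \<open>A vertex gets matched at one tick only, and both walks share the rotated ringing
   and the last but one vertex.\<close>
 have fp: "fst p = fst p'"
 by (meson Suc_leI alv_mono m(1) m(2) m'(1) m'(2) nat_neq_iff)
 \<comment> \<open>By uniqueness of the ring at that tick the previous edges agree, so the outermost
   swap can be undone and the shorter walks compared.\<close>
 have "no_tie ?S" using Suc.prems(6) by (rule no_tie_rotr)
 then have "{wend u rs, snd q} = {wend u' rs', snd q}"
 using m(3) m'(3) fp unfolding no_tie_def by metis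
 then have we: "wend u rs = wend u' rs'" by (auto simp: doubleton_eq_iff)
 have "rotr R (q # rs) = swp (fst p) (fst (last (q # rs))) ?S" using qs by simp
 moreover have "rotr R' (q' # rs') = swp (fst p') (fst (last (q' # rs'))) ?S"
 unfolding S'[symmetric] by simp
 moreover have ll: "fst (last (q # rs)) = fst (last (q' # rs'))" using Suc.prems(9) qs qs' by simp
 ultimately have "rotr R (q # rs) = rotr R' (q' # rs')" using fp by simp
 moreover have "qwalk R u t (rev (q # rs))" using Suc.prems(4) qs qwalk_snoc[of R u t p "q # rs"] by simp
 moreover have "qwalk R' u' t (rev (q' # rs'))" using Suc.prems(5) qs' qwalk_snoc[of R' u' t p' "q' # rs'"] by simp
 ultimately have "R = R' & u = u' & q # rs = q' # rs'"
 using Suc.IH[of "q # rs" "q' # rs'"] Suc.prems(1,2,6,7) qs qs' ll we snd_eq False by simp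
 then show ?thesis using qs qs' fp snd_eq by (auto intro: prod_eqI)
 qed
qed simp


section \<open>Random rings on a graph\<close>

locale rgraph =
 fixes n :: nat and E :: "nat set set" and adj :: "nat => nat list" and Q N :: nat
 assumes sg: "simple_graph n E" and al: "adjacency_lists n E adj" and Q2: "2 <= Q"
begin

text \<open>Rings before tick \<open>N\<close> drive the matching; the margin \<open>Q\<close> is there because ticks are
  inspected in blocks.\<close>

definition H :: nat where "H = N + Q"

definition deg :: "nat => nat" where "deg u = length (adj u)"

definition D :: nat where "D = (\<Sum>v<n. deg v)"

lemma edgeD: "{u, w} \<in> E ==> u < n & w < n & u ~= w"
 using sg unfolding simple_graph_def by (cases "u = w") (force, fastforce)

lemma finite_E: "finite E"
 by (rule finite_subset[of _ "Pow {..<n}"]) (use sg in \<open>auto simp: simple_graph_def\<close>)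

lemma edgeE:
 assumes "e \<in> E"
 obtains u w where "e = {u, w}" "u ~= w" "u < n" "w < n"
proof -
 have "card e = 2" "e \<subseteq> {..<n}" using assms sg by (auto simp: simple_graph_def)
 then obtain u w where "e = {u, w}" "u ~= w" by (auto simp: card_2_iff)
 then show thesis using that \<open>e \<subseteq> {..<n}\<close> by auto
qed

lemma set_adj: "u < n ==> w \<in> set (adj u) \<longleftrightarrow> {u, w} \<in> E"
 using al unfolding adjacency_lists_def neighbors_def by auto

lemma distinct_adj: "u < n ==> distinct (adj u)"
 using al unfolding adjacency_lists_def by auto

definition dirs :: "(nat \<times> nat) set" where "dirs = {(a, b). {a, b} \<in> E}"

lemma dirs_eq: "dirs = (SIGMA u:{..<n}. set (adj u))"
 unfolding dirs_def using edgeD set_adj by auto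

lemma finite_dirs: "finite dirs"
 unfolding dirs_eq by auto

lemma card_dirs: "card dirs = D"
 unfolding dirs_eq D_def deg_def by (simp add: distinct_card distinct_adj)

definition cells :: "(nat set \<times> nat) set" where "cells = E \<times> {..<H}"

sublocale bern_field cells "1 / real Q"
 by unfold_locales (use finite_E Q2 in \<open>auto simp: cells_def\<close>)

abbreviation Om :: "ringing set" where "Om \<equiv> set_pmf (rp {} {})"

lemma Om_edge: "R \<in> Om ==> R (e, t) ==> e \<in> E & t < H"
 using rp_support[of R "{}" "{}" "(e, t)"] by (auto simp: cells_def)

lemma Om_edgeD: "R \<in> Om ==> R ({u, w}, t) ==> u < n & w < n & u ~= w & {u, w} \<in> E"
 using Om_edge edgeD by blast

lemma prob_ring: "{a, b} \<in> E ==> t < H ==> EE (%R. of_bool (R ({a, b}, t))) = 1 / Q"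
 using prob_all_bits[of "{({a, b}, t)}" True] by (simp add: cells_def)

section \<open>Rotations preserve the measure; expected number of query walks\<close>

lemma pmf_swp:
 assumes "s < H" "t < H"
 shows "pmf (rp {} {}) (swp s t R) = pmf (rp {} {}) R"
proof -
 define h :: "nat set \<times> nat => nat set \<times> nat"
 where "h x = (fst x, if snd x = s then t else if snd x = t then s else snd x)" for x
 have hh: "h (h x) = x" for x by (cases x) (simp add: h_def)
 have hc: "h x \<in> cells" if "x \<in> cells" for x
 using that assms by (auto simp: cells_def h_def)
 have hc': "x \<in> cells" if "h x \<in> cells" for x using hc[OF that] unfolding hh .
 have b: "bij_betw h cells cells"
 by (rule bij_betw_byWitness[where f' = h]) (auto simp: hh intro: hc)
 have c: "swp s t R x = R (h x)" for x by (cases x) (simp add: swp_def h_def)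
 have 1: "(\<forall>x. x \<notin> cells --> swp s t R x = False) \<longleftrightarrow> (\<forall>x. x \<notin> cells --> R x = False)"
 unfolding c using hc hc' hh by metis
 have 2: "(\<Prod>x\<in>cells. pmf (bernoulli_pmf (1 / real Q)) (swp s t R x))
 = (\<Prod>x\<in>cells. pmf (bernoulli_pmf (1 / real Q)) (R x))"
 unfolding c by (rule prod.reindex_bij_betw[OF b])
 show ?thesis unfolding rp_def pmf_Pi[OF finC] by (simp only: 1 2 empty_iff if_False)
qed

text \<open>The cells are independent with equal bias, so permuting ticks below \<open>H\<close>
  preserves the weight of a ringing; all ticks of a walk that starts before \<open>t <= H\<close>
  qualify.\<close>

lemma pmf_rotr:
 assumes "qwalk R u t (rev qs)" "t <= H"
 shows "pmf (rp {} {}) (rotr R qs) = pmf (rp {} {}) R"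
 using assms(1)
proof (induction R qs rule: rotr.induct)
 case (1 R p q qs)
 have l: "fst r < t" if "qwalk R u t ps" "r \<in> set ps" for ps r
 using that
 proof (induction ps arbitrary: u t)
 case (Cons p ps)
 then show ?case by (cases "r = p") (auto, force)
 qed simp
 have "fst p < t" "fst (last (q # qs)) < t" using l[OF "1.prems"] last_in_set[of "q # qs"] by auto
 moreover have "qwalk R u t (rev (q # qs))" using "1.prems" qwalk_snoc[of R u t p "q # qs"] by simp
 ultimately show ?case using "1.IH" assms(2) by (simp add: pmf_swp)
qed simp_all

definition walks :: "ringing => nat => (nat \<times> (nat \<times> nat) list) set" where
 "walks R k = {(u, qs). u < n & length qs = k & qwalk R u N (rev qs)}"

lemma qwalk_set:
 assumes "R \<in> Om" "qwalk R u t ps"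
 shows "set ps \<subseteq> {..<t} \<times> {..<n}"
 using assms(2)
proof (induction ps arbitrary: u t)
 case (Cons p ps)
 have "snd p < n" using Cons.prems Om_edgeD[OF assms(1), of u "snd p" "fst p"] by auto
 moreover have "set ps \<subseteq> {..<fst p} \<times> {..<n}" using Cons by auto
 ultimately show ?case using Cons.prems by (cases p) auto
qed simp

lemma finite_walks: "R \<in> Om ==> finite (walks R k)"
proof (rule finite_subset)
 assume "R \<in> Om"
 then show "walks R k \<subseteq> {..<n} \<times> {qs. set qs \<subseteq> {..<N} \<times> {..<n} & length qs = k}"
 using qwalk_set[of R _ N] unfolding walks_def by fastforce
 show "finite ({..<n} \<times> {qs. set qs \<subseteq> {..<N} \<times> {..<n} & length qs = k})"
 by (intro finite_cartesian_product finite_lists_length_eq) auto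
qed

text \<open>Double counting: \<open>rotr\<close> maps pairs of a tie-free ringing and a walk of
  length \<open>k\<close> injectively, without change of weight, to a ringing together with a tick
  and a directed edge that rings at this tick. Such triples have expected number
  \<open>D * N / Q\<close>, whatever \<open>k\<close> is.\<close>

lemma walks_bound:
 assumes "1 <= k"
 shows "EE (%R. of_bool (no_tie R) * real (card (walks R k))) <= real D * real N / real Q"
proof -
 let ?P = "pmf (rp {} {})"
 define S where "S = (SIGMA R:{R\<in>Om. no_tie R}. walks R k)"
 \<comment> \<open>Besides the rotated ringing, exactly the data from which \<open>rotr_inj\<close>
   recovers the walk: its first tick and its last edge.\<close>
 define \<Phi> where "\<Phi> = (%(R, u, qs). (rotr R qs, fst (last qs :: nat \<times> nat), wend u (tl qs), snd (hd qs) :: nat))"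
 define T where "T = (SIGMA \<sigma>:Om. {x\<in>{..<N} \<times> dirs. \<sigma> ({fst (snd x), snd (snd x)}, fst x)})"
 have fT: "finite T" unfolding T_def
 proof (rule finite_SigmaI)
 show "finite {x\<in>{..<N} \<times> dirs. \<sigma> ({fst (snd x), snd (snd x)}, fst x)}" for \<sigma> :: ringing
 by (rule finite_subset[OF Collect_restrict]) (simp add: finite_dirs)
 qed simp
 have inj: "inj_on \<Phi> S"
 proof (rule inj_onI)
 fix x y assume xy: "x \<in> S" "y \<in> S" "\<Phi> x = \<Phi> y"
 obtain R u qs R' u' qs' where e: "x = (R, u, qs)" "y = (R', u', qs')" by (metis surj_pair)
 have "R = R' & u = u' & qs = qs'"
 by (rule rotr_inj[of qs k qs' R u N R' u'])
 (use xy assms in \<open>simp_all add: e S_def walks_def \<Phi>_def\<close>)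
 then show "x = y" by (simp add: e)
 qed
 have im: "\<Phi> ` S \<subseteq> T"
 proof
 fix y assume "y \<in> \<Phi> ` S"
 then obtain R u qs where y: "y = \<Phi> (R, u, qs)" and R: "R \<in> Om" "no_tie R"
 and w: "u < n" "length qs = k" "qwalk R u N (rev qs)" by (auto simp: S_def walks_def)
 obtain p ps where qs: "qs = p # ps" using w(2) assms by (cases qs) auto
 have asc: "ascending (p # ps)" using w(3) qs qwalk_ascending by blast
 have r: "R ({wend u ps, snd p}, fst p)" using w(3) qwalk_snoc[of R u N p ps] qs by simp
 have "rotr R qs \<in> Om" using pmf_rotr[OF w(3)] R(1) by (simp add: H_def set_pmf_iff)
 moreover have "rotr R qs ({wend u ps, snd p}, fst (last qs))"
 using rotr_first[OF asc, of R] r qs by simp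
 moreover have "(wend u ps, snd p) \<in> dirs" using Om_edgeD[OF R(1) r] by (simp add: dirs_def)
 moreover have "fst (last qs) < N"
 using subsetD[OF qwalk_set[OF R(1) w(3)], of "last qs"] last_in_set[of qs] qs
 by (simp add: mem_Times_iff split: if_splits)
 ultimately show "y \<in> T" by (simp add: y T_def \<Phi>_def qs)
 qed
 have "EE (%R. of_bool (no_tie R) * real (card (walks R k)))
 = (\<Sum>R\<in>Om. ?P R * (of_bool (no_tie R) * real (card (walks R k))))"
 by (subst integral_measure_pmf[where A = Om]) auto
 also have "... = (\<Sum>R\<in>{R\<in>Om. no_tie R}. \<Sum>x\<in>walks R k. ?P R)"
 by (intro sum.mono_neutral_cong_right) auto
 also have "... = (\<Sum>x\<in>S. ?P (fst x))"
 unfolding S_def by (subst sum.Sigma) (simp_all add: finite_walks case_prod_beta)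
 also have "... = (\<Sum>x\<in>S. ?P (fst (\<Phi> x)))"
 by (intro sum.cong refl) (auto simp: S_def walks_def \<Phi>_def H_def intro!: pmf_rotr[symmetric])
 also have "... = (\<Sum>y\<in>\<Phi> ` S. ?P (fst y))" by (simp add: sum.reindex[OF inj])
 also have "... <= (\<Sum>y\<in>T. ?P (fst y))" by (rule sum_mono2[OF fT im]) simp
 also have "... = (\<Sum>\<sigma>\<in>Om. \<Sum>x\<in>{x\<in>{..<N} \<times> dirs. \<sigma> ({fst (snd x), snd (snd x)}, fst x)}. ?P \<sigma>)"
 unfolding T_def using finite_subset[OF Collect_restrict, of "{..<N} \<times> dirs"] finite_dirs
 by (subst sum.Sigma) (simp_all add: case_prod_beta)
 also have "... = (\<Sum>\<sigma>\<in>Om. ?P \<sigma> * (\<Sum>x\<in>{..<N} \<times> dirs. of_bool (\<sigma> ({fst (snd x), snd (snd x)}, fst x))))"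
 using finite_dirs by (intro sum.cong refl) (simp add: sum.If_cases of_bool_def Int_def)
 also have "... = EE (%\<sigma>. \<Sum>x\<in>{..<N} \<times> dirs. of_bool (\<sigma> ({fst (snd x), snd (snd x)}, fst x)))"
 by (subst integral_measure_pmf[where A = Om]) auto
 also have "... = (\<Sum>x\<in>{..<N} \<times> dirs. 1 / real Q)"
 unfolding E_sum[OF finite_rp] by (intro sum.cong refl prob_ring) (auto simp: dirs_def H_def)
 also have "... = real D * real N / real Q" by (simp add: card_cartesian_product card_dirs)
 finally show ?thesis .
qed

end


section \<open>Typical behaviour of the rings\<close>

text \<open>The term of index \<open>l\<close> in the series of \<open>exp (exp 1 * y)\<close> gives
  \<open>(exp 1 * y) ^ l / fact l <= exp (exp 1 * y)\<close>; then
  \<open>exp 1 <= 3\<close>.\<close>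

lemma power_div_fact_le:
 assumes "0 <= (y::real)"
 shows "y ^ l / fact l <= exp (3 * y - l)"
proof -
 have "(exp 1 * y) ^ l / fact l <= exp (exp 1 * y)"
 proof -
 have e: "exp (exp 1 * y) = (\<Sum>k. (exp 1 * y) ^ k /\<^sub>R fact k)" by (simp add: exp_def)
 have "(\<Sum>k\<in>{l}. (exp 1 * y) ^ k /\<^sub>R fact k) <= exp (exp 1 * y)" unfolding e
 by (rule sum_le_suminf) (use assms summable_exp_generic[of "exp 1 * y"] in auto)
 then show ?thesis by (simp add: field_simps)
 qed
 also have "... <= exp (3 * y)" using assms exp_le by (simp add: mult_right_mono)
 finally have "exp (real l) * (y ^ l / fact l) <= exp (3 * y)"
 by (simp add: power_mult_distrib exp_of_nat_mult[symmetric])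
 then show ?thesis by (simp add: exp_diff field_simps)
qed

text \<open>A first-moment bound: the left side is the expected number of \<open>l\<close>-subsets
  of \<open>w\<close> independent events of probability \<open>r\<close> that occur
  entirely.\<close>

lemma choose_power_le:
 assumes "0 <= (r::real)" "real w * r <= y"
 shows "real (w choose l) * r ^ l <= exp (3 * y - l)"
proof -
 have "0 <= y" using assms by (meson mult_nonneg_nonneg of_nat_0_le_iff order_trans)
 have "(w choose l) * fact l <= w ^ l"
 using binomial_fact_pow[of w l] by simp
 then have "real (w choose l) * fact l <= real w ^ l"
 by (metis of_nat_fact of_nat_le_iff of_nat_mult of_nat_power)
 then have "real (w choose l) <= real w ^ l / fact l" by (simp add: field_simps)
 then have "real (w choose l) * r ^ l <= real w ^ l / fact l * r ^ l"
 using assms(1) by (intro mult_right_mono) auto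
 also have "... = (real w * r) ^ l / fact l" by (simp add: power_mult_distrib)
 also have "... <= y ^ l / fact l" using assms by (intro divide_right_mono power_mono) auto
 also have "... <= exp (3 * y - l)" using \<open>0 <= y\<close> by (rule power_div_fact_le)
 finally show ?thesis .
qed

context rgraph
begin

lemma one_minus_power_le: "(1 - 1 / real Q) ^ m <= exp (- (real m / real Q))"
proof -
 have "(1 - 1 / real Q) ^ m <= exp (- (1 / real Q)) ^ m"
 using Q2 exp_ge_add_one_self[of "- (1 / real Q)"] by (intro power_mono) auto
 also have "... = exp (- (real m / real Q))" by (simp add: exp_of_nat_mult[symmetric])
 finally show ?thesis .
qed

text \<open>The set \<open>g R\<close> is random but does not depend on tick \<open>t\<close>. After
  splitting by its value, its cells at tick \<open>t\<close>, at least \<open>d\<close> of them, are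
  fresh and independent of \<open>P\<close>.\<close>

lemma E_no_bits_le:
 fixes g :: "ringing => nat set" and P :: "ringing => bool"
 assumes P: "!!R e b. P (R((e, t) := b)) = P R" and g: "!!R e b. g (R((e, t) := b)) = g R"
 and S: "!!R. R \<in> Om ==> P R ==> g R \<subseteq> {w. {v, w} \<in> E} & d <= card (g R)" and t: "t < H"
 shows "EE (%R. of_bool (P R & (\<forall>w\<in>g R. ~ R ({v, w}, t)))) <= EE (%R. of_bool (P R)) * (1 - 1 / real Q) ^ d"
proof -
 define \<W> where "\<W> = {W. W \<subseteq> {w. {v, w} \<in> E} & d <= card W}"
 have fE: "finite {w. {v, w} \<in> E}" by (rule finite_subset[of _ "{..<n}"]) (auto dest: edgeD)
 have fW: "finite \<W>" unfolding \<W>_def by (rule finite_subset[of _ "Pow {w. {v, w} \<in> E}"]) (use fE in auto)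
 have split: "of_bool (P R & X) = (\<Sum>W\<in>\<W>. of_bool (P R & g R = W) * of_bool X :: real)"
 if "R \<in> Om" for R X
 proof -
 have "(\<Sum>W\<in>\<W>. of_bool (P R & g R = W) * of_bool X :: real)
 = (\<Sum>W\<in>\<W>. if g R = W then of_bool (P R & X) else 0)"
 by (rule sum.cong) simp_all
 also have "... = (if g R \<in> \<W> then of_bool (P R & X) else 0)" using fW by (rule sum.delta')
 also have "... = of_bool (P R & X)"
 proof (cases "P R")
 case True
 then have "g R \<in> \<W>" unfolding \<W>_def by (intro CollectI S[OF that])
 then show ?thesis by (simp only: if_True)
 qed simp
 finally show ?thesis by (rule sym)
 qed
 have "EE (%R. of_bool (P R & (\<forall>w\<in>g R. ~ R ({v, w}, t))))
 = EE (%R. \<Sum>W\<in>\<W>. of_bool (P R & g R = W) * of_bool (\<forall>x\<in>(%w. ({v, w}, t)) ` W. R x = False))"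
 proof (rule E_cong)
 fix R assume R: "R \<in> Om"
 show "of_bool (P R & (\<forall>w\<in>g R. ~ R ({v, w}, t))) = (\<Sum>W\<in>\<W>. of_bool (P R & g R = W)
 * of_bool (\<forall>x\<in>(%w. ({v, w}, t)) ` W. R x = False) :: real)"
 by (rule trans[OF split[OF R]]) (intro sum.cong, auto)
 qed
 also have "... = (\<Sum>W\<in>\<W>. EE (%R. of_bool (P R & g R = W)
 * of_bool (\<forall>x\<in>(%w. ({v, w}, t)) ` W. R x = False)))" by (rule E_sum) simp
 also have "... = (\<Sum>W\<in>\<W>. EE (%R. of_bool (P R & g R = W)) * (1 - 1 / real Q) ^ card W)"
 proof (intro sum.cong refl)
 fix W assume W: "W \<in> \<W>"
 let ?S = "(%w. ({v, w}, t)) ` W"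
 have i: "inj_on (%w. ({v, w}, t)) W" by (auto simp: inj_on_def doubleton_eq_iff)
 have W': "W \<subseteq> {w. {v, w} \<in> E}" using W by (simp add: \<W>_def)
 have fin: "finite ?S" using finite_subset[OF W' fE] by simp
 have sub: "?S \<subseteq> cells" using W' t by (auto simp: cells_def)
 show "EE (%R. of_bool (P R & g R = W) * of_bool (\<forall>x\<in>?S. R x = False))
 = EE (%R. of_bool (P R & g R = W)) * (1 - 1 / real Q) ^ card W"
 using E_all_bits[OF fin sub, of "%R. of_bool (P R & g R = W)" False]
 by (force simp: card_image[OF i] P g)
 qed
 also have "... <= (\<Sum>W\<in>\<W>. EE (%R. of_bool (P R & g R = W)) * (1 - 1 / real Q) ^ d)"
 using Q2 by (intro sum_mono mult_left_mono power_decreasing E_nonneg) (simp_all add: \<W>_def)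
 also have "... = EE (%R. \<Sum>W\<in>\<W>. of_bool (P R & g R = W)) * (1 - 1 / real Q) ^ d"
 by (simp only: E_sum[OF finite_rp] sum_distrib_right)
 also have "EE (%R. \<Sum>W\<in>\<W>. of_bool (P R & g R = W)) = EE (%R. of_bool (P R))"
 proof (rule E_cong)
 fix R assume R: "R \<in> Om"
 show "(\<Sum>W\<in>\<W>. of_bool (P R & g R = W)) = (of_bool (P R) :: real)"
 using split[OF R, of True] by simp
 qed
 finally show ?thesis .
qed

section \<open>Decay of the residual graph and rarity of ties\<close>

definition alnb :: "ringing => nat => nat => nat set" where
 "alnb R t v = {w. {v, w} \<in> E & alv R t w}"

lemma finite_alnb: "finite (alnb R t v)"
 by (rule finite_subset[of _ "{..<n}"]) (auto simp: alnb_def dest: edgeD)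

lemma alv_upd: "s <= t ==> alv (R((e, t) := b)) s u = alv R s u"
 by (rule alv_cong) auto

text \<open>Live neighbourhoods only shrink, so a live vertex with \<open>d\<close> live neighbours
  had that many at every earlier tick. At each of these ticks none of the edges to them rang, which
  costs a factor \<open>(1 - 1 / Q) ^ d\<close>.\<close>

lemma residual_degree:
 assumes "t <= H"
 shows "EE (%R. of_bool (alv R t v & d <= card (alnb R t v))) <= (1 - 1 / real Q) ^ (d * t)"
 using assms
proof (induction t)
 case 0
 show ?case by (rule order.trans[OF E_mono[of _ _ "%_. 1"]]) auto
next
 case (Suc t)
 let ?P = "%R. alv R t v & d <= card (alnb R t v)"
 have "EE (%R. of_bool (alv R (Suc t) v & d <= card (alnb R (Suc t) v)))
 <= EE (%R. of_bool (?P R & (\<forall>w\<in>alnb R t v. ~ R ({v, w}, t))))"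
 proof (rule E_mono, simp)
 fix R
 have "alnb R (Suc t) v \<subseteq> alnb R t v" by (auto simp: alnb_def)
 then have "card (alnb R (Suc t) v) <= card (alnb R t v)" by (rule card_mono[OF finite_alnb])
 moreover have "\<forall>w\<in>alnb R t v. ~ R ({v, w}, t)" if "alv R (Suc t) v" using that by (auto simp: alnb_def)
 ultimately show "of_bool (alv R (Suc t) v & d <= card (alnb R (Suc t) v))
 <= (of_bool (?P R & (\<forall>w\<in>alnb R t v. ~ R ({v, w}, t))) :: real)"
 by (auto simp del: alv.simps dest: alv_mono[of R "Suc t" v t])
 qed
 also have "... <= EE (%R. of_bool (?P R)) * (1 - 1 / real Q) ^ d"
 using Suc.prems by (intro E_no_bits_le) (auto simp: alnb_def alv_upd)
 also have "... <= (1 - 1 / real Q) ^ (d * t) * (1 - 1 / real Q) ^ d"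
 using Suc Q2 by (intro mult_right_mono) auto
 finally show ?case by (simp add: power_add[symmetric] algebra_simps)
qed

text \<open>An edge left free is a live vertex with a live neighbour, so this is
  \<open>residual_degree\<close> with \<open>d = 1\<close>; \<open>b * Q\<close> ticks make the
  factor \<open>exp (- b)\<close>.\<close>

lemma prob_not_maximal:
 assumes "N = b * Q"
 shows "EE (%R. of_bool (\<exists>e\<in>E. \<forall>u\<in>e. alv R N u)) <= n * exp (- real b)"
proof -
 have "EE (%R. of_bool (\<exists>e\<in>E. \<forall>u\<in>e. alv R N u))
 <= (\<Sum>v<n. EE (%R. of_bool (alv R N v & 1 <= card (alnb R N v))))"
 proof (rule E_union_bound)
 fix R assume "\<exists>e\<in>E. \<forall>u\<in>e. alv R N u"
 then obtain e where e: "e \<in> E" "\<forall>u\<in>e. alv R N u" by auto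
 obtain u w where uw: "e = {u, w}" "u < n" using e(1) by (rule edgeE)
 then have "w \<in> alnb R N u" using e by (auto simp: alnb_def)
 then have "1 <= card (alnb R N u)"
 using finite_alnb by (metis One_nat_def Suc_leI card_gt_0_iff empty_iff)
 then show "\<exists>i\<in>{..<n}. alv R N i & 1 <= card (alnb R N i)" using uw e by auto
 qed simp
 also have "... <= (\<Sum>v<n. exp (- real b))"
 proof (intro sum_mono)
 fix v
 have "EE (%R. of_bool (alv R N v & 1 <= card (alnb R N v))) <= (1 - 1 / real Q) ^ (1 * N)"
 by (rule residual_degree) (simp add: H_def)
 also have "... <= exp (- real b)" using one_minus_power_le[of N] Q2 by (simp add: assms)
 finally show "EE (%R. of_bool (alv R N v & 1 <= card (alnb R N v))) <= exp (- real b)" .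
 qed
 finally show ?thesis by simp
qed

text \<open>Union over ticks and ordered pairs of distinct edges. One factor \<open>H\<close> stands
  against two factors \<open>1 / Q\<close>, so a fine time scale makes ties rare.\<close>

lemma prob_tie: "EE (%R. of_bool (~ no_tie R)) <= real H * (real (card E))\<^sup>2 / (real Q)\<^sup>2"
proof -
 define I where "I = {(t, e, f). t < H & e \<in> E & f \<in> E & e ~= f}"
 have I: "I \<subseteq> {..<H} \<times> E \<times> E" by (auto simp: I_def)
 have fI: "finite ({..<H} \<times> E \<times> E)" using finite_E by simp
 have "EE (%R. of_bool (~ no_tie R)) <= (\<Sum>i\<in>I. EE (%R. of_bool (R (fst (snd i), fst i) & R (snd (snd i), fst i))))"
 proof (rule E_union_bound)
 show "finite I" using I fI by (rule finite_subset)
 fix R assume R: "R \<in> Om" "~ no_tie R"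
 then obtain t e f where "R (e, t)" "R (f, t)" "e ~= f" by (auto simp: no_tie_def)
 moreover have "e \<in> E" "f \<in> E" "t < H" using Om_edge[OF R(1)] calculation by blast+
 ultimately show "\<exists>i\<in>I. R (fst (snd i), fst i) & R (snd (snd i), fst i)"
 by (intro bexI[of _ "(t, e, f)"]) (simp_all add: I_def)
 qed
 also have "... = (\<Sum>i\<in>I. (1 / real Q) ^ 2)"
 proof (intro sum.cong refl)
 fix i assume i: "i \<in> I"
 obtain t e f where ie: "i = (t, e, f)" by (cases i)
 have "{(e, t), (f, t)} \<subseteq> cells" using i ie by (simp add: cells_def I_def)
 then have "EE (%R. of_bool (\<forall>x\<in>{(e, t), (f, t)}. R x = True)) = (1 / real Q) ^ card {(e, t), (f, t)}"
 using prob_all_bits[of "{(e, t), (f, t)}" True] by simp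
 then show "EE (%R. of_bool (R (fst (snd i), fst i) & R (snd (snd i), fst i))) = (1 / real Q) ^ 2"
 using i ie by (simp add: power2_eq_square I_def)
 qed
 also have "... = real (card I) * (1 / real Q) ^ 2" by simp
 also have "... <= real (H * (card E * card E)) * (1 / real Q) ^ 2"
 using card_mono[OF fI I] unfolding card_cartesian_product
 by (intro mult_right_mono) (simp_all only: of_nat_le_iff card_lessThan zero_le_power2)
 finally show ?thesis by (simp add: power2_eq_square field_simps)
qed

end


context rgraph
begin

section \<open>Query walks are short\<close>

fun epath :: "nat list => bool" where
 "epath [] \<longleftrightarrow> False"
| "epath [y] \<longleftrightarrow> y < n"
| "epath (y # z # zs) \<longleftrightarrow> {y, z} \<in> E & epath (z # zs)"

fun ccells :: "nat list => nat list => (nat set \<times> nat) set" where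
 "ccells (y # z # zs) (t # ts) = insert ({y, z}, t) (ccells (z # zs) ts)"
| "ccells _ _ = {}"

lemma ccells_ticks: "snd ` ccells ys ts \<subseteq> set ts"
 by (induction ys ts rule: ccells.induct) auto

lemma finite_ccells: "finite (ccells ys ts)"
 by (induction ys ts rule: ccells.induct) auto

lemma card_ccells: "distinct ts ==> length ys = Suc (length ts) ==> card (ccells ys ts) = length ts"
proof (induction ys ts rule: ccells.induct)
 case (1 y z zs t ts)
 have "({y, z}, t) \<notin> ccells (z # zs) ts"
 using ccells_ticks[of "z # zs" ts] "1.prems"(1) by force
 then show ?case using 1 finite_ccells by simp
qed auto

lemma ccells_sub: "epath ys ==> set ts \<subseteq> {..<H} ==> ccells ys ts \<subseteq> cells"
 by (induction ys ts rule: ccells.induct) (auto simp: cells_def)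

lemma epath_lt: "epath ys ==> y \<in> set ys ==> y < n"
 by (induction ys rule: epath.induct) (auto dest: edgeD)

text \<open>Being alive at the tick of a step is weakened to being alive at \<theta>. That condition
  depends on rings before \<theta> only and is independent of the cells that must ring. The final
  pair is dropped since the vertex it leads to may be dead.\<close>

lemma qwalk_chain:
 assumes "R \<in> Om" "qwalk R u t ps" "ps ~= []" "\<forall>p\<in>set ps. \<theta> <= fst p"
 defines "ys \<equiv> u # map snd (butlast ps)" and "ts \<equiv> map fst (butlast ps)"
 shows "epath ys & (\<forall>y\<in>set ys. alv R \<theta> y) & (\<forall>x\<in>ccells ys ts. R x) & sorted_wrt (>) ts
 & (\<forall>s\<in>set ts. \<theta> <= s & s < t)"
 using assms(2-4) unfolding ys_def ts_def
proof (induction ps arbitrary: u t)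
 case (Cons p ps)
 have r: "R ({u, snd p}, fst p)" "alv R (fst p) u" "fst p < t" "qwalk R (snd p) (fst p) ps"
 using Cons.prems by auto
 have a: "alv R \<theta> u" using alv_mono[OF r(2)] Cons.prems(3) by simp
 have e: "u < n" "{u, snd p} \<in> E" using Om_edgeD[OF assms(1) r(1)] by auto
 show ?case
 proof (cases ps)
 case Nil
 then show ?thesis using a e by simp
 next
 case (Cons p' ps')
 have ih: "epath (snd p # map snd (butlast ps)) & (\<forall>y\<in>set (snd p # map snd (butlast ps)). alv R \<theta> y)
 & (\<forall>x\<in>ccells (snd p # map snd (butlast ps)) (map fst (butlast ps)). R x)
 & sorted_wrt (>) (map fst (butlast ps)) & (\<forall>s\<in>set (map fst (butlast ps)). \<theta> <= s & s < fst p)"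
 using Cons.IH[OF r(4)] Cons.prems(3) Cons by simp
 then show ?thesis using a e r Cons.prems(3) Cons by fastforce
 qed
qed simp

definition lowdeg :: "nat => nat => ringing => bool" where
 "lowdeg \<theta> d R \<longleftrightarrow> (\<forall>v<n. alv R \<theta> v --> card (alnb R \<theta> v) <= d)"

definition apaths :: "ringing => nat => nat => nat list set" where
 "apaths R \<theta> l = {ys. epath ys & length ys = Suc l & (\<forall>y\<in>set ys. alv R \<theta> y)}"

text \<open>Paths grow at their front: \<open>n\<close> choices for the last vertex, then at most
  \<open>d\<close> live neighbours of the current head.\<close>

lemma card_apaths:
 assumes "lowdeg \<theta> d R"
 shows "finite (apaths R \<theta> l) & card (apaths R \<theta> l) <= n * d ^ l"
proof (induction l)
 case 0
 have "apaths R \<theta> 0 \<subseteq> (%y. [y]) ` {..<n}"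
 by (auto simp: apaths_def length_Suc_conv)
 then have "finite (apaths R \<theta> 0)" "card (apaths R \<theta> 0) <= card ((%y. [y]) ` {..<n})"
 by (auto intro: finite_subset card_mono)
 then show ?case using card_image_le[of "{..<n}" "%y. [y]"] by simp
next
 case (Suc l)
 let ?U = "\<Union>zs\<in>apaths R \<theta> l. (%y. y # zs) ` alnb R \<theta> (hd zs)"
 have "apaths R \<theta> (Suc l) \<subseteq> ?U"
 proof
 fix ys assume "ys \<in> apaths R \<theta> (Suc l)"
 then obtain y z zs where "ys = y # z # zs" and "z # zs \<in> apaths R \<theta> l" "{y, z} \<in> E" "alv R \<theta> y"
 by (auto simp: apaths_def length_Suc_conv)
 then show "ys \<in> ?U" by (auto simp: alnb_def insert_commute intro!: bexI[of _ "z # zs"])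
 qed
 moreover have fU: "finite ?U" using Suc finite_alnb by auto
 moreover have "card ?U <= (\<Sum>zs\<in>apaths R \<theta> l. card ((%y. y # zs) ` alnb R \<theta> (hd zs)))"
 using Suc by (intro card_UN_le) auto
 moreover have "... <= (\<Sum>zs\<in>apaths R \<theta> l. d)"
 proof (rule sum_mono)
 fix zs assume "zs \<in> apaths R \<theta> l"
 then obtain z zs' where "zs = z # zs'" "z < n" "alv R \<theta> z"
 using epath_lt[of zs "hd zs"] by (cases zs) (auto simp: apaths_def)
 then have "card (alnb R \<theta> (hd zs)) <= d" using assms by (auto simp: lowdeg_def)
 then show "card ((%y. y # zs) ` alnb R \<theta> (hd zs)) <= d"
 by (rule order.trans[OF card_image_le[OF finite_alnb]])
 qed
 moreover have "... <= n * d ^ Suc l" using Suc by simp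
 ultimately show ?case by (meson card_mono finite_subset order_trans)
qed

definition has_chain :: "nat => nat => nat => ringing => bool" where
 "has_chain \<theta> \<theta>' l R \<longleftrightarrow> (\<exists>ys ts. epath ys & length ys = Suc l & length ts = l & (\<forall>y\<in>set ys. alv R \<theta> y)
 & (\<forall>x\<in>ccells ys ts. R x) & sorted_wrt (>) ts & set ts \<subseteq> {\<theta>..<\<theta>'})"

definition tseqs :: "nat => nat => nat => nat list set" where
 "tseqs \<theta> \<theta>' l = {ts. sorted_wrt (>) ts & set ts \<subseteq> {\<theta>..<\<theta>'} & length ts = l}"

lemma tseqs_distinct: "ts \<in> tseqs \<theta> \<theta>' l ==> distinct ts"
 using strict_sorted_iff[of "rev ts"] by (simp add: tseqs_def sorted_wrt_rev)

lemma card_tseqs: "finite (tseqs \<theta> \<theta>' l) & card (tseqs \<theta> \<theta>' l) <= (\<theta>' - \<theta>) choose l"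
proof -
 have inj: "inj_on set (tseqs \<theta> \<theta>' l)"
 proof (rule inj_onI)
 fix xs ys assume a: "xs \<in> tseqs \<theta> \<theta>' l" "ys \<in> tseqs \<theta> \<theta>' l" "set xs = set ys"
 have "sorted_wrt (<) (rev xs)" "sorted_wrt (<) (rev ys)"
 using a by (auto simp: tseqs_def sorted_wrt_rev)
 then have "rev xs = rev ys" using a(3) by (intro strict_sorted_equal) auto
 then show "xs = ys" by simp
 qed
 have im: "set ` tseqs \<theta> \<theta>' l \<subseteq> {B. B \<subseteq> {\<theta>..<\<theta>'} & card B = l}"
 using tseqs_distinct by (auto simp: tseqs_def distinct_card)
 have fin: "finite {B. B \<subseteq> {\<theta>..<\<theta>'} & card B = l}" by simp
 show ?thesis
 using finite_imageD[OF finite_subset[OF im fin] inj] card_inj_on_le[OF inj im fin]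
 n_subsets[of "{\<theta>..<\<theta>'}" l] by simp
qed

text \<open>Liveness and the degree bound are settled before \<theta>, the cells of a chain lie at
  or after it, so independence gives \<open>(1 / Q) ^ l\<close> for each choice of vertices and
  ticks. There are at most \<open>(\<theta>' - \<theta>) choose l\<close> tick sequences and, in
  every outcome with low degrees, at most \<open>n * d ^ l\<close> live paths.\<close>

lemma prob_chain_lowdeg:
 assumes "\<theta>' <= H" "real (\<theta>' - \<theta>) * (real d / real Q) <= y"
 shows "EE (%R. of_bool (lowdeg \<theta> d R & has_chain \<theta> \<theta>' l R)) <= n * exp (3 * y - l)"
proof -
 define Y where "Y = {ys. epath ys & length ys = Suc l}"
 define T where "T = tseqs \<theta> \<theta>' l"
 have fT: "finite T" using card_tseqs by (simp add: T_def)
 have "Y \<subseteq> {ys. set ys \<subseteq> {..<n} & length ys = Suc l}" using epath_lt by (auto simp: Y_def)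
 then have fY: "finite Y" by (rule finite_subset) (rule finite_lists_length_eq, simp)
 let ?P = "%ys R. lowdeg \<theta> d R & (\<forall>y\<in>set ys. alv R \<theta> y)"
 have "EE (%R. of_bool (lowdeg \<theta> d R & has_chain \<theta> \<theta>' l R))
 <= (\<Sum>i\<in>Y \<times> T. EE (%R. of_bool (?P (fst i) R & (\<forall>x\<in>ccells (fst i) (snd i). R x))))"
 proof (rule E_union_bound)
 show "finite (Y \<times> T)" using fY fT by simp
 fix R assume "lowdeg \<theta> d R & has_chain \<theta> \<theta>' l R"
 then obtain ys ts where "lowdeg \<theta> d R" "ys \<in> Y" "ts \<in> T" "\<forall>y\<in>set ys. alv R \<theta> y" "\<forall>x\<in>ccells ys ts. R x"
 unfolding has_chain_def Y_def T_def tseqs_def by blast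
 then show "\<exists>i\<in>Y \<times> T. ?P (fst i) R & (\<forall>x\<in>ccells (fst i) (snd i). R x)"
 by (intro bexI[of _ "(ys, ts)"]) auto
 qed
 also have "... = (\<Sum>i\<in>Y \<times> T. EE (%R. of_bool (?P (fst i) R)) * (1 / real Q) ^ l)"
 proof (intro sum.cong refl)
 fix i assume i: "i \<in> Y \<times> T"
 obtain ys ts where ie: "i = (ys, ts)" by (cases i)
 have ts: "set ts \<subseteq> {\<theta>..<\<theta>'}" "distinct ts" "length ts = l"
 using i ie tseqs_distinct by (auto simp: T_def tseqs_def)
 have ys: "epath ys" "length ys = Suc l" using i ie by (auto simp: Y_def)
 have sub: "ccells ys ts \<subseteq> cells" using ts(1) assms(1) ys(1) by (intro ccells_sub) auto
 have upd: "?P ys (R(x := b)) = ?P ys R" if "x \<in> ccells ys ts" for R x b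
 proof -
 have "\<theta> <= snd x" using that ccells_ticks[of ys ts] ts(1) by force
 then have "alv (R(x := b)) \<theta> v = alv R \<theta> v" for v
 using alv_upd[of \<theta> "snd x" R "fst x" b v] by simp
 then show ?thesis by (simp add: lowdeg_def alnb_def)
 qed
 have "EE (%R. of_bool (?P ys R) * of_bool (\<forall>x\<in>ccells ys ts. R x = True))
 = EE (%R. of_bool (?P ys R)) * (if True then 1 / real Q else 1 - 1 / real Q) ^ card (ccells ys ts)"
 by (rule E_all_bits[OF finite_ccells sub]) (simp only: upd)
 then show "EE (%R. of_bool (?P (fst i) R & (\<forall>x\<in>ccells (fst i) (snd i). R x)))
 = EE (%R. of_bool (?P (fst i) R)) * (1 / real Q) ^ l"
 using card_ccells[of ts ys] ts ys by (simp only: ie fst_conv snd_conv of_bool_conj) simp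
 qed
 also have "... = card T * ((1 / real Q) ^ l * (\<Sum>ys\<in>Y. EE (%R. of_bool (?P ys R))))"
 proof -
 have "(\<Sum>i\<in>Y \<times> T. g (fst i) * c) = real (card T) * (c * sum g Y)" for g :: "nat list => real" and c
 by (simp add: sum.cartesian_product' sum_distrib_left mult_ac)
 then show ?thesis .
 qed
 \<comment> \<open>The sum goes inside the expectation before it is bounded: \<open>lowdeg\<close>
   does not restrict which paths may be live, but how many are live at the same time.\<close>
 also have "(\<Sum>ys\<in>Y. EE (%R. of_bool (?P ys R))) = EE (%R. \<Sum>ys\<in>Y. of_bool (?P ys R))"
 by (rule E_sum[symmetric]) simp
 also have "... <= EE (%R. real (n * d ^ l))"
 proof (rule E_mono, simp)
 fix R
 show "(\<Sum>ys\<in>Y. of_bool (?P ys R)) <= real (n * d ^ l)"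
 proof (cases "lowdeg \<theta> d R")
 case True
 have "{ys\<in>Y. \<forall>y\<in>set ys. alv R \<theta> y} = apaths R \<theta> l" by (auto simp: Y_def apaths_def)
 then have "(\<Sum>ys\<in>Y. of_bool (?P ys R)) = real (card (apaths R \<theta> l))"
 using True fY by (simp add: of_bool_def sum.If_cases Int_def)
 then show ?thesis using card_apaths[OF True, of l] by (simp only: of_nat_le_iff)
 qed simp
 qed
 also have "EE (%R. real (n * d ^ l)) = real (n * d ^ l)" by simp
 finally have "EE (%R. of_bool (lowdeg \<theta> d R & has_chain \<theta> \<theta>' l R))
 <= card T * ((1 / real Q) ^ l * real (n * d ^ l))" by (simp add: mult_left_mono)
 also have "... <= real ((\<theta>' - \<theta>) choose l) * ((1 / real Q) ^ l * real (n * d ^ l))"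
 using card_tseqs[of \<theta> \<theta>' l] by (intro mult_right_mono) (auto simp: T_def)
 also have "... = n * (real ((\<theta>' - \<theta>) choose l) * (real d / real Q) ^ l)"
 by (simp add: power_divide)
 also have "... <= n * exp (3 * y - l)"
 using assms(2) by (intro mult_left_mono choose_power_le) auto
 finally show ?thesis .
qed

end


lemma qwalk_append:
 assumes "qwalk R u t (xs @ ys)"
 shows "qwalk R u t xs & (\<exists>v s. s <= t & qwalk R v s ys)"
 using assms
proof (induction xs arbitrary: u t)
 case (Cons x xs)
 then have "qwalk R (snd x) (fst x) (xs @ ys)" "fst x < t" by auto
 then obtain v s where "s <= fst x" "qwalk R v s ys" "qwalk R (snd x) (fst x) xs"
 using Cons.IH[of "snd x" "fst x"] by blast
 moreover have "fst x < t" using Cons.prems by simp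
 ultimately have "s <= t & qwalk R v s ys" by simp
 then have "\<exists>v s. s <= t & qwalk R v s ys" by blast
 then show ?case using Cons.prems \<open>qwalk R (snd x) (fst x) xs\<close> by simp
qed auto

text \<open>\<open>b\<close> sets the confidence, since failures have probability about
  \<open>exp (- b)\<close>; \<open>q0\<close> refines the time scale until ties are rare. As
  \<open>Q\<close> is a multiple of \<open>n\<close>, the multiples of \<open>Q / n\<close> that
  bound the windows below are integral.\<close>

locale rgraph_par = rgraph +
 fixes b q0 :: nat
 assumes NbQ: "N = b * Q" and Qn: "Q = n * q0" and nb: "n <= 2 ^ b" and b1: "1 <= b"
begin

lemma n1: "1 <= n" and q01: "1 <= q0" and nQ: "n <= Q"
 using Q2 Qn by (cases n; cases q0; simp)+

text \<open>The time axis is cut into windows of doubling length; in each window the residual graph has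
  degree about \<open>b\<close> divided by the probability of a ring in the window.\<close>

definition th :: "nat => nat" where "th j = (if j = 0 then 0 else 2 ^ (j - 1) * q0)"
definition dw :: "nat => nat" where "dw j = (if j = 0 then n else b * n div 2 ^ (j - 1) + 1)"

text \<open>At \<open>th j\<close> the residual degree is at most \<open>dw j\<close> up to
  probability \<open>n * exp (- b)\<close>. Window length times \<open>dw j / Q\<close> is at most
  \<open>2 * b\<close>, so a chain of \<open>7 * b\<close> ticks has probability at most
  \<open>n * exp (3 * (2 * b) - 7 * b)\<close>, the other half of the bound.\<close>

lemma prob_window_chain:
 "EE (%R. of_bool (has_chain (th j) (min (th (Suc j)) N) (7 * b) R)) <= 2 * n * exp (- real b)"
proof (cases "th j < N")
 case False
 have "~ has_chain (th j) (min (th (Suc j)) N) (7 * b) R" for R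
 proof
 assume "has_chain (th j) (min (th (Suc j)) N) (7 * b) R"
 then obtain ts :: "nat list" where "length ts = 7 * b" "set ts \<subseteq> {th j..<min (th (Suc j)) N}"
 unfolding has_chain_def by blast
 then have "ts = []" using False by (cases ts) auto
 then show False using \<open>length ts = 7 * b\<close> b1 by simp
 qed
 then show ?thesis by simp
next
 case True
 let ?d = "dw j" and ?\<theta>' = "min (th (Suc j)) N"
 have low: "EE (%R. of_bool (~ lowdeg (th j) ?d R)) <= n * exp (- real b)"
 proof (cases "j = 0")
 case True
 have "card (alnb R (th j) v) <= card {..<n}" for R v
 by (rule card_mono) (auto simp: alnb_def dest: edgeD)
 then have "lowdeg (th j) ?d R" for R using True by (auto simp: lowdeg_def dw_def)
 then show ?thesis by simp
 next
 case False
 have "EE (%R. of_bool (~ lowdeg (th j) ?d R))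
 <= (\<Sum>v<n. EE (%R. of_bool (alv R (th j) v & Suc ?d <= card (alnb R (th j) v))))"
 by (rule E_union_bound) (auto simp: lowdeg_def not_le Suc_le_eq)
 also have "... <= (\<Sum>v<n. exp (- real b))"
 proof (rule sum_mono)
 fix v
 let ?p = "2 ^ (j - 1) :: nat"
 have "b * n <= ?p * (b * n div ?p + 1)"
 by (metis Suc_eq_plus1 dividend_less_times_div less_imp_le_nat mult_Suc_right add.commute zero_less_numeral zero_less_power)
 then have "b * n * q0 <= ?p * (b * n div ?p + 1) * q0" by (rule mult_right_mono) simp
 also have "... = ?d * th j" using False by (simp add: dw_def th_def algebra_simps)
 finally have "b * Q <= Suc ?d * th j" by (simp add: Qn mult.assoc)
 then have "real b * real Q <= real (Suc ?d * th j)" by (metis of_nat_le_iff of_nat_mult)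
 then have le: "real b <= real (Suc ?d * th j) / real Q" using Q2 by (simp add: pos_le_divide_eq)
 have "EE (%R. of_bool (alv R (th j) v & Suc ?d <= card (alnb R (th j) v))) <= (1 - 1 / real Q) ^ (Suc ?d * th j)"
 using \<open>th j < N\<close> by (intro residual_degree) (simp add: H_def)
 also have "... <= exp (- (real (Suc ?d * th j) / real Q))" by (rule one_minus_power_le)
 also have "... <= exp (- real b)" using le by (simp only: exp_le_cancel_iff neg_le_iff_le)
 finally show "EE (%R. of_bool (alv R (th j) v & Suc ?d <= card (alnb R (th j) v))) <= exp (- real b)" .
 qed
 finally show ?thesis by simp
 qed
 have wd: "real (?\<theta>' - th j) * (real ?d / real Q) <= 2 * real b"
 proof (cases "j = 0")
 case True
 have "real (?\<theta>' - th j) <= real q0" using True by (simp add: th_def)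
 then have "real (?\<theta>' - th j) * (real ?d / real Q) <= real q0 * (real n / real Q)"
 using True by (intro mult_mono) (auto simp: dw_def)
 also have "... = 1" using Qn q01 n1 by simp
 also have "... <= 2 * real b" using b1 by simp
 finally show ?thesis .
 next
 case False
 let ?p = "2 ^ (j - 1) :: nat"
 \<comment> \<open>By doubling, the window is no longer than the time elapsed before it, which is
   the time that thinned the graph.\<close>
 have "th (Suc j) = 2 * th j" using False by (cases j) (auto simp: th_def)
 then have "?\<theta>' - th j <= th j" by linarith
 also have "th j = ?p * q0" using False by (simp add: th_def)
 finally have "?\<theta>' - th j <= ?p * q0" .
 then have "real (?\<theta>' - th j) <= real (?p * q0)" by (simp only: of_nat_le_iff)
 then have "real (?\<theta>' - th j) * (real ?d / real Q) <= real (?p * q0) * (real ?d / real Q)"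
 by (intro mult_right_mono) auto
 also have "... = real (?p * ?d) / real n" using Qn q01 by simp
 also have "... <= real (2 * b * n) / real n"
 proof (intro divide_right_mono)
 \<comment> \<open>The summand 1 in \<open>dw j\<close> contributes \<open>th j / Q\<close>, which
   stays below \<open>b\<close> because the window starts before \<open>N\<close>.\<close>
 have "?p * q0 < b * n * q0" using True False by (simp add: th_def NbQ Qn)
 then have "?p < b * n" by simp
 moreover have "?p * (b * n div ?p) <= b * n" by simp
 moreover have "?p * ?d = ?p * (b * n div ?p) + ?p" using False by (simp add: dw_def)
 ultimately have "?p * ?d <= 2 * b * n" by linarith
 then show "real (?p * ?d) <= real (2 * b * n)" by (simp only: of_nat_le_iff)
 qed simp
 also have "... = 2 * real b" using n1 by simp
 finally show ?thesis .
 qed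
 have "EE (%R. of_bool (has_chain (th j) ?\<theta>' (7 * b) R))
 <= EE (%R. of_bool (~ lowdeg (th j) ?d R) + of_bool (lowdeg (th j) ?d R & has_chain (th j) ?\<theta>' (7 * b) R))"
 by (rule E_mono) auto
 also have "... = EE (%R. of_bool (~ lowdeg (th j) ?d R))
 + EE (%R. of_bool (lowdeg (th j) ?d R & has_chain (th j) ?\<theta>' (7 * b) R))" by (rule E_add) simp
 also have "... <= n * exp (- real b) + n * exp (3 * (2 * real b) - real (7 * b))"
 by (intro add_mono low prob_chain_lowdeg wd) (simp add: H_def)
 finally show ?thesis by simp
qed

text \<open>A walk runs backwards through the windows. Its part in the topmost one has at most
  \<open>7 * b\<close> steps, as otherwise its beginning would contain a chain there; the rest
  starts below \<open>th j\<close>.\<close>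

lemma depth_bound:
 assumes R: "R \<in> Om" and nc: "!!j. j <= J ==> ~ has_chain (th j) (min (th (Suc j)) N) (7 * b) R"
 shows "j <= Suc J ==> t <= th j ==> t <= N ==> qwalk R u t ps ==> length ps <= j * (7 * b + 1)"
proof (induction j arbitrary: u t ps)
 case 0
 then show ?case by (cases ps) (auto simp: th_def)
next
 case (Suc j)
 define xs where "xs = takeWhile (%p. th j <= fst p) ps"
 define ys where "ys = dropWhile (%p. th j <= fst p) ps"
 have ps: "ps = xs @ ys" by (simp add: xs_def ys_def)
 have qx: "qwalk R u t xs" and "\<exists>v s. s <= t & qwalk R v s ys"
 using qwalk_append[of R u t xs ys] Suc.prems(4) ps by auto
 then obtain v s where v: "s <= t" "qwalk R v s ys" by blast
 have lx: "length xs <= 7 * b"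
 proof (rule ccontr)
 assume a: "~ length xs <= 7 * b"
 \<comment> \<open>One step more than the chain has ticks, because \<open>qwalk_chain\<close> drops
   the last.\<close>
 let ?zs = "take (Suc (7 * b)) xs"
 have l: "length ?zs = Suc (7 * b)" using a by simp
 have "qwalk R u t (?zs @ drop (Suc (7 * b)) xs)" using qx by simp
 then have q: "qwalk R u t ?zs" using qwalk_append by blast
 have "\<forall>p\<in>set ?zs. th j <= fst p"
 proof
 fix p assume "p \<in> set ?zs"
 then have "p \<in> set xs" by (rule in_set_takeD)
 then show "th j <= fst p" unfolding xs_def by (auto dest: set_takeWhileD)
 qed
 from qwalk_chain[OF R q _ this] l
 have c: "epath (u # map snd (butlast ?zs)) & (\<forall>y\<in>set (u # map snd (butlast ?zs)). alv R (th j) y)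
 & (\<forall>x\<in>ccells (u # map snd (butlast ?zs)) (map fst (butlast ?zs)). R x)
 & sorted_wrt (>) (map fst (butlast ?zs)) & (\<forall>s\<in>set (map fst (butlast ?zs)). th j <= s & s < t)"
 by fastforce
 have "has_chain (th j) (min (th (Suc j)) N) (7 * b) R"
 unfolding has_chain_def
 proof (rule exI[of _ "u # map snd (butlast ?zs)"], rule exI[of _ "map fst (butlast ?zs)"], intro conjI)
 show "set (map fst (butlast ?zs)) \<subseteq> {th j..<min (th (Suc j)) N}"
 proof
 fix s assume "s \<in> set (map fst (butlast ?zs))"
 then have "th j <= s & s < t" using c by blast
 then show "s \<in> {th j..<min (th (Suc j)) N}" using Suc.prems(2,3) by simp
 qed
 show "length (u # map snd (butlast ?zs)) = Suc (7 * b)" "length (map fst (butlast ?zs)) = 7 * b"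
 using l by simp_all
 qed (use c in blast)+
 then show False using nc[of j] Suc.prems(1) by simp
 qed
 have ly: "length ys <= j * (7 * b + 1)"
 proof (cases ys)
 case (Cons p ys')
 then have "fst p < th j" unfolding ys_def by (auto simp: dropWhile_eq_Cons_conv)
 moreover have "fst p < s" using v(2) Cons by simp
 ultimately have "qwalk R v (min (th j) N) ys" using v Suc.prems(3) Cons by simp
 then show ?thesis using Suc.prems(1) by (intro Suc.IH[of "min (th j) N" v]) auto
 qed simp
 show ?case using lx ly ps by simp
qed

text \<open>As \<open>b * n <= 2 ^ (2 * b)\<close>, a number of windows logarithmic in
  \<open>n\<close> is enough.\<close>

lemma th_final: "N <= th (2 * b + 1)"
proof -
 have "b <= 2 ^ b" using less_exp[of b] by simp
 then have "b * n <= 2 ^ b * 2 ^ b" using nb by (intro mult_mono) auto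
 also have "... = 2 ^ (2 * b)" by (simp add: mult_2 power_add)
 finally have "b * n * q0 <= 2 ^ (2 * b) * q0" by (rule mult_right_mono) simp
 then show ?thesis by (simp add: th_def NbQ Qn mult.assoc)
qed

definition L :: nat where "L = (2 * b + 1) * (7 * b + 1)"

definition shallow :: "ringing => bool" where
 "shallow R \<longleftrightarrow> (\<forall>u ps. qwalk R u N ps --> length ps <= L)"

lemma prob_deep: "EE (%R. of_bool (~ shallow R)) <= (2 * b + 1) * (2 * n * exp (- real b))"
proof -
 have "EE (%R. of_bool (~ shallow R))
 <= (\<Sum>j<2 * b + 1. EE (%R. of_bool (has_chain (th j) (min (th (Suc j)) N) (7 * b) R)))"
 proof (rule E_union_bound)
 fix R assume R: "R \<in> Om" "~ shallow R"
 show "\<exists>j\<in>{..<2 * b + 1}. has_chain (th j) (min (th (Suc j)) N) (7 * b) R"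
 proof (rule ccontr)
 assume a: "~ ?thesis"
 have nc: "~ has_chain (th j) (min (th (Suc j)) N) (7 * b) R" if "j <= 2 * b" for j
 using a that by (metis Suc_eq_plus1 le_imp_less_Suc lessThan_iff)
 have "length ps <= L" if "qwalk R u N ps" for u ps
 unfolding L_def by (rule depth_bound[OF R(1) nc _ th_final _ that]) auto
 then show False using R(2) by (auto simp: shallow_def)
 qed
 qed simp
 also have "... <= (\<Sum>j<2 * b + 1. 2 * n * exp (- real b))"
 by (intro sum_mono prob_window_chain)
 finally show ?thesis by simp
qed

section \<open>Blocks of ticks\<close>

text \<open>The block length is adapted to the degree: a block of a non-isolated \<open>u\<close>
  has \<open>deg u * len u\<close> cells, between \<open>Q / 2\<close> and \<open>Q\<close>, hence
  between one half and one ring on average.\<close>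

definition len :: "nat => nat" where "len u = Q div deg u"

lemma deg_lt:
 assumes "u < n" shows "deg u < n"
proof -
 have "set (adj u) \<subseteq> {..<n} - {u}" using set_adj[OF assms] edgeD by fastforce
 then have "card (set (adj u)) <= card ({..<n} - {u})" by (intro card_mono) auto
 then show ?thesis using assms distinct_adj[OF assms] by (simp add: deg_def distinct_card)
qed

lemma len_facts:
 assumes "u < n" "0 < deg u"
 shows "1 <= len u" "deg u * len u <= Q" "Q <= 2 * (deg u * len u)"
proof -
 have d: "deg u <= Q" using deg_lt[OF assms(1)] nQ by simp
 show l: "1 <= len u" using d assms(2) by (simp add: len_def div_greater_zero_iff Suc_le_eq)
 show "deg u * len u <= Q" by (simp add: len_def)
 have "Q < deg u * (len u + 1)" using assms(2)
 by (simp add: len_def) (metis add.commute dividend_less_times_div)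
 also have "... <= deg u * (2 * len u)" using l by (intro mult_left_mono) auto
 finally show "Q <= 2 * (deg u * len u)" by simp
qed

definition ucells :: "nat => nat => nat => (nat set \<times> nat) set" where
 "ucells u lo hi = (%(w, t). ({u, w}, t)) ` (set (adj u) \<times> {lo..<hi})"

lemma card_ucells: "u < n ==> card (ucells u lo hi) = deg u * (hi - lo)"
proof -
 assume u: "u < n"
 have "inj_on (%(w, t). ({u, w}, t)) (set (adj u) \<times> {lo..<hi})"
 by (auto simp: inj_on_def doubleton_eq_iff)
 then show ?thesis unfolding ucells_def
 by (simp add: card_image card_cartesian_product deg_def distinct_card distinct_adj[OF u])
qed

lemma ucells_sub: "u < n ==> hi <= H ==> ucells u lo hi \<subseteq> cells"
 by (auto simp: ucells_def cells_def set_adj)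

text \<open>Limits the empty blocks passed before the next ring: \<open>2 * b\<close> blocks have at
  least \<open>b * Q\<close> cells and are all silent with probability at most
  \<open>exp (- b)\<close>.\<close>

definition dense :: "ringing => bool" where
 "dense R \<longleftrightarrow> (\<forall>u<n. 0 < deg u --> (\<forall>i. (i + 2 * b) * len u <= N -->
 (\<exists>w t. R ({u, w}, t) & i * len u <= t & t < (i + 2 * b) * len u)))"

definition block :: "ringing => nat => nat => (nat \<times> nat) set" where
 "block R u i = {(t, w). R ({u, w}, t) & i * len u <= t & t < (i + 1) * len u}"

text \<open>Limits the cost of reading the rings of one block.\<close>

definition sparse :: "ringing => bool" where
 "sparse R \<longleftrightarrow> (\<forall>u<n. 0 < deg u --> (\<forall>i. i * len u < N --> card (block R u i) <= b + 3))"

lemma prob_not_dense: "EE (%R. of_bool (~ dense R)) <= real n * (N + 1) * exp (- real b)"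
proof -
 let ?I = "{u. u < n & 0 < deg u} \<times> {..N}"
 let ?A = "%i R. (fst i < n & 0 < deg (fst i) & (snd i + 2 * b) * len (fst i) <= N) &
 (\<forall>x\<in>ucells (fst i) (snd i * len (fst i)) ((snd i + 2 * b) * len (fst i)). R x = False)"
 have "EE (%R. of_bool (~ dense R)) <= (\<Sum>i\<in>?I. EE (%R. of_bool (?A i R)))"
 proof (rule E_union_bound)
 fix R assume R: "R \<in> Om" "~ dense R"
 then obtain u i where u: "u < n" "0 < deg u" "(i + 2 * b) * len u <= N"
 and no: "!!w t. R ({u, w}, t) ==> i * len u <= t ==> ~ t < (i + 2 * b) * len u"
 unfolding dense_def by blast
 have "i <= N"
 using u(3) len_facts(1)[OF u(1,2)] by (metis le_add1 le_trans mult.right_neutral mult_le_mono)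
 then have "?A (u, i) R & (u, i) \<in> ?I" using u no by (auto simp: ucells_def)
 then show "\<exists>i\<in>?I. ?A i R" by blast
 qed simp
 also have "... <= (\<Sum>i\<in>?I. exp (- real b))"
 proof (rule sum_mono)
 fix i assume i: "i \<in> ?I"
 obtain u j where ij: "i = (u, j)" by (cases i)
 have u: "u < n" "0 < deg u" using i ij by auto
 show "EE (%R. of_bool (?A i R)) <= exp (- real b)"
 proof (cases "(j + 2 * b) * len u <= N")
 case True
 have sub: "ucells u (j * len u) ((j + 2 * b) * len u) \<subseteq> cells"
 using u True by (intro ucells_sub) (auto simp: H_def)
 have c: "card (ucells u (j * len u) ((j + 2 * b) * len u)) = 2 * b * (deg u * len u)"
 using u(1) by (simp add: card_ucells algebra_simps)
 have "EE (%R. of_bool (?A i R)) = EE (%R. of_bool (\<forall>x\<in>ucells u (j * len u) ((j + 2 * b) * len u). R x = False))"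
 using u True ij by simp
 also have "... = (1 - 1 / real Q) ^ (2 * b * (deg u * len u))"
 using prob_all_bits[OF sub, of False] by (simp only: c if_False)
 also have "... <= exp (- (real (2 * b * (deg u * len u)) / real Q))" by (rule one_minus_power_le)
 also have "... <= exp (- real b)"
 proof -
 have "real Q <= real (2 * (deg u * len u))" using len_facts(3)[OF u] by (simp only: of_nat_le_iff)
 then have "real b * real Q <= real b * real (2 * (deg u * len u))" by (intro mult_left_mono) auto
 then have "real b <= real (2 * b * (deg u * len u)) / real Q"
 using Q2 by (simp add: pos_le_divide_eq algebra_simps)
 then show ?thesis by simp
 qed
 finally show ?thesis .
 qed (use ij in simp)
 qed
 also have "... = real (card ?I) * exp (- real b)" by simp
 also have "... <= real (n * (N + 1)) * exp (- real b)"
 proof (intro mult_right_mono)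
 have "card {u. u < n & 0 < deg u} <= card {..<n}" by (rule card_mono) auto
 then have "card ?I <= n * (N + 1)" by (simp add: card_cartesian_product mult_right_mono del: mult_Suc_right)
 then show "real (card ?I) <= real (n * (N + 1))" by (simp only: of_nat_le_iff)
 qed simp
 finally show ?thesis by (simp add: algebra_simps)
qed

text \<open>First moment over sets of \<open>b + 4\<close> cells of one block. With at most one ring
  expected, \<open>choose_power_le\<close> gives \<open>exp (3 - (b + 4))\<close>.\<close>

lemma prob_not_sparse: "EE (%R. of_bool (~ sparse R)) <= real n * N * exp (- real b)"
proof -
 define blk where "blk u i = ucells u (i * len u) ((i + 1) * len u)" for u i
 have fin: "finite (blk u i)" for u i by (simp add: blk_def ucells_def)
 define I where "I = (SIGMA x:{u. u < n & 0 < deg u} \<times> {i. i < N}.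
 {S. S \<subseteq> blk (fst x) (snd x) & card S = b + 4 & snd x * len (fst x) < N})"
 define A where "A x R \<longleftrightarrow> (\<forall>c\<in>snd x. R c = True)"
 for x :: "(nat \<times> nat) \<times> (nat set \<times> nat) set" and R :: ringing
 have fS: "finite {S. S \<subseteq> blk u i & card S = b + 4 & i * len u < N}" for u i
 by (rule finite_subset[of _ "Pow (blk u i)"]) (use fin in auto)
 have "EE (%R. of_bool (~ sparse R)) <= (\<Sum>i\<in>I. EE (%R. of_bool (A i R)))"
 proof (rule E_union_bound)
 show "finite I" unfolding I_def by (intro finite_SigmaI fS) auto
 fix R assume R: "R \<in> Om" "~ sparse R"
 then obtain u i where u: "u < n" "0 < deg u" "i * len u < N" "b + 3 < card (block R u i)"
 unfolding sparse_def by auto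
 let ?f = "%(t, w). ({u, w}, t)"
 have inj: "inj_on ?f (block R u i)" by (auto simp: inj_on_def doubleton_eq_iff)
 have im: "?f ` block R u i \<subseteq> blk u i"
 using Om_edgeD[OF R(1)] set_adj[OF u(1)] by (force simp: block_def blk_def ucells_def)
 have "b + 4 <= card (?f ` block R u i)" using u(4) by (simp add: card_image[OF inj])
 then obtain S where S: "S \<subseteq> ?f ` block R u i" "card S = b + 4"
 by (meson obtain_subset_with_card_n)
 have "i < N" using u(3) len_facts(1)[OF u(1,2)]
 by (metis le_trans linorder_not_less mult.right_neutral mult_le_mono2)
 then have "((u, i), S) \<in> I" using u S im by (auto simp: I_def)
 moreover have "A ((u, i), S) R" using S(1) by (auto simp: A_def block_def)
 ultimately show "\<exists>x\<in>I. A x R" by blast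
 qed
 also have "... <= (\<Sum>x\<in>I. (1 / real Q) ^ (b + 4))"
 proof (rule sum_mono)
 fix x assume x: "x \<in> I"
 obtain u i S where xe: "x = ((u, i), S)" by (metis surj_pair)
 have u: "u < n" "0 < deg u" "i * len u < N" "S \<subseteq> blk u i" "card S = b + 4"
 using x xe by (auto simp: I_def)
 have "len u <= Q" by (simp add: len_def)
 then have "blk u i \<subseteq> cells" unfolding blk_def using u by (intro ucells_sub) (auto simp: H_def)
 then have "S \<subseteq> cells" using u by blast
 from prob_all_bits[OF this, of True]
 show "EE (%R. of_bool (A x R)) <= (1 / real Q) ^ (b + 4)"
 by (simp only: A_def xe snd_conv u if_True order_refl)
 qed
 also have "... = (\<Sum>x\<in>{u. u < n & 0 < deg u} \<times> {i. i < N}. real (card {S. S \<subseteq> blk (fst x) (snd x) & card S = b + 4 & snd x * len (fst x) < N})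
 * (1 / real Q) ^ (b + 4))"
 by (simp add: I_def card_SigmaI fS sum_distrib_right)
 also have "... <= (\<Sum>x\<in>{u. u < n & 0 < deg u} \<times> {i. i < N}. exp (- real b))"
 proof (rule sum_mono)
 fix x assume x: "x \<in> {u. u < n & 0 < deg u} \<times> {i. i < N}"
 obtain u i where xe: "x = (u, i)" by (cases x)
 have u: "u < n" "0 < deg u" using x xe by auto
 have "card {S. S \<subseteq> blk u i & card S = b + 4 & i * len u < N} <= card {S. S \<subseteq> blk u i & card S = b + 4}"
 by (rule card_mono) (auto intro: finite_subset[of _ "Pow (blk u i)"] fin)
 also have "... = deg u * len u choose (b + 4)"
 using n_subsets[OF fin, of u i "b + 4"] u by (simp add: blk_def card_ucells)
 finally have "real (card {S. S \<subseteq> blk u i & card S = b + 4 & i * len u < N}) * (1 / real Q) ^ (b + 4)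
 <= real (deg u * len u choose (b + 4)) * (1 / real Q) ^ (b + 4)"
 by (intro mult_right_mono) (simp_all only: of_nat_le_iff zero_le_power zero_le_divide_1_iff of_nat_0_le_iff)
 also have "... <= exp (3 * 1 - real (b + 4))"
 proof (rule choose_power_le)
 have "real (deg u * len u) <= real Q" using len_facts(2)[OF u] by (simp only: of_nat_le_iff)
 then show "real (deg u * len u) * (1 / real Q) <= 1" using Q2 by simp
 qed simp
 also have "... <= exp (- real b)" by simp
 finally show "real (card {S. S \<subseteq> blk (fst x) (snd x) & card S = b + 4 & snd x * len (fst x) < N})
 * (1 / real Q) ^ (b + 4) <= exp (- real b)" by (simp only: xe fst_conv snd_conv)
 qed
 also have "... = real (card {u. u < n & 0 < deg u} * N) * exp (- real b)"
 by (simp add: card_cartesian_product)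
 also have "... <= real (n * N) * exp (- real b)"
 proof (intro mult_right_mono)
 have "card {u. u < n & 0 < deg u} <= card {..<n}" by (rule card_mono) auto
 then show "real (card {u. u < n & 0 < deg u} * N) <= real (n * N)"
 by (simp add: mult_right_mono del: of_nat_mult flip: of_nat_le_iff)
 qed simp
 finally show ?thesis by simp
qed

end


section \<open>The stack machine exploring a fixed ringing\<close>

lemma less_next_block: "0 < l ==> c < (c div l + 1) * (l :: nat)"
 using dividend_less_div_times[of l c] by simp

lemma block_start_le: "i <= x div l ==> i * l <= (x :: nat)"
 by (rule order.trans[OF mult_le_mono1 div_times_less_eq_dividend])

lemma alv_no_ring:
 assumes "alv R c u" "c <= t" "!!s w. c <= s ==> s < t ==> ~ R ({u, w}, s)"
 shows "alv R t u"
 using assms(2,3)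
proof (induction t)
 case (Suc t)
 then show ?case using assms(1) by (cases "c = Suc t") auto
qed (use assms in simp)

lemma qwalk_length: "qwalk R u t ps ==> length ps <= t"
 by (induction ps arbitrary: u t) fastforce+

type_synonym frame = "nat \<times> nat \<times> nat"

context rgraph_par
begin

text \<open>A frame \<open>(u, t, c)\<close> is the question whether \<open>u\<close> is unmatched before tick \<open>t\<close>, where the ticks
  below \<open>c\<close> have already been ruled out. If \<open>u\<close> survives, then the ring that led to it kills the
  vertex of the frame below, so two frames are popped. The lowest frame is a dummy; it is left over
  iff the vertex asked about is matched.\<close>

definition nxt :: "ringing => nat => nat => nat => (nat \<times> nat) option" where
 "nxt R u lo hi = (if \<exists>\<tau> w. lo <= \<tau> & \<tau> < hi & R ({u, w}, \<tau>)
 then (let \<tau> = (LEAST \<tau>. lo <= \<tau> & \<tau> < hi & (\<exists>w. R ({u, w}, \<tau>))) in Some (\<tau>, THE w. R ({u, w}, \<tau>)))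
 else None)"

text \<open>One step inspects at most one block: the scan moves to the next ring or to the start of
  the next block. If the partner \<open>w\<close> turns out to be matched before the ring, its frame
  vanishes and the frame of \<open>u\<close>, already advanced to \<open>\<tau> + 1\<close>,
  resumes.\<close>

fun estep :: "ringing => frame list => frame list" where
 "estep R ((u, t, c) # y # r) = (if t <= c then r else
 (case nxt R u c (min t ((c div len u + 1) * len u)) of
 Some (\<tau>, w) => (w, \<tau>, 0) # (u, t, \<tau> + 1) # y # r
 | None => (u, t, (c div len u + 1) * len u) # y # r))"
| "estep R fs = fs"

lemma no_tie_unique: "no_tie R ==> R ({u, w}, t) ==> R ({u, w'}, t) ==> w = w'"
 unfolding no_tie_def by (metis doubleton_eq_iff)

lemma nxt_Some:
 assumes "no_tie R" "R ({u, w}, \<tau>)" "lo <= \<tau>" "\<tau> < hi" "!!s x. lo <= s ==> s < \<tau> ==> ~ R ({u, x}, s)"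
 shows "nxt R u lo hi = Some (\<tau>, w)"
proof -
 have "(LEAST \<tau>. lo <= \<tau> & \<tau> < hi & (\<exists>w. R ({u, w}, \<tau>))) = \<tau>"
 by (rule Least_equality) (use assms in \<open>auto simp: not_less[symmetric]\<close>)
 moreover have "(THE w. R ({u, w}, \<tau>)) = w"
 using assms(1,2) no_tie_unique by (intro the_equality) blast+
 ultimately show ?thesis using assms unfolding nxt_def by (auto simp: Let_def)
qed

lemma nxt_None: "(!!s x. lo <= s ==> s < hi ==> ~ R ({u, x}, s)) ==> nxt R u lo hi = None"
 unfolding nxt_def by auto

text \<open>One step for every block boundary crossed, and one for the ring itself.\<close>

lemma advance_found:
 assumes "no_tie R" "0 < len u" "R ({u, w}, \<tau>)" "\<tau> < t"
 shows "c <= \<tau> ==> (!!s x. c <= s ==> s < \<tau> ==> ~ R ({u, x}, s)) ==> \<tau> div len u - c div len u = k ==>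
 (estep R ^^ Suc k) ((u, t, c) # y # r) = (w, \<tau>, 0) # (u, t, \<tau> + 1) # y # r"
proof (induction k arbitrary: c)
 case 0
 have "c div len u <= \<tau> div len u" using 0 by (intro div_le_mono)
 then have "\<tau> div len u = c div len u" using 0 by simp
 then have "\<tau> < (c div len u + 1) * len u" using less_next_block[OF assms(2), of \<tau>] by simp
 then have "nxt R u c (min t ((c div len u + 1) * len u)) = Some (\<tau>, w)"
 using assms 0 by (intro nxt_Some) auto
 then show ?case using 0 assms(4) by simp
next
 case (Suc k)
 let ?c = "(c div len u + 1) * len u"
 have "c div len u + 1 <= \<tau> div len u" using Suc.prems(3) by simp
 then have c\<tau>: "?c <= \<tau>" by (rule block_start_le)
 have cc: "c <= ?c" using less_next_block[OF assms(2), of c] by simp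
 have "nxt R u c (min t ?c) = None" using c\<tau> Suc.prems(2) by (intro nxt_None) auto
 then have e: "estep R ((u, t, c) # y # r) = (u, t, ?c) # y # r" using Suc.prems(1) assms(4) by simp
 have "(estep R ^^ Suc k) ((u, t, ?c) # y # r) = (w, \<tau>, 0) # (u, t, \<tau> + 1) # y # r"
 using c\<tau> cc Suc.prems assms(2) by (intro Suc.IH) auto
 then show ?case using e by (simp only: funpow_Suc_right[of "Suc k"] o_apply)
qed

text \<open>\<open>k + 1\<close> steps pass the blocks that meet the remaining interval, and a last
  one pops the two frames.\<close>

lemma advance_none:
 assumes "0 < len u"
 shows "c < t ==> (!!s x. c <= s ==> s < t ==> ~ R ({u, x}, s)) ==> (t - 1) div len u - c div len u = k ==>
 (estep R ^^ Suc (Suc k)) ((u, t, c) # y # r) = r"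
proof (induction k arbitrary: c)
 case 0
 let ?c = "(c div len u + 1) * len u"
 have "c div len u <= (t - 1) div len u" using 0 by (intro div_le_mono) simp
 then have "(t - 1) div len u = c div len u" using 0 by simp
 then have "t - 1 < ?c" using less_next_block[OF assms, of "t - 1"] by simp
 then have c: "t <= ?c" by simp
 have "nxt R u c (min t ?c) = None" using 0 by (intro nxt_None) auto
 then have e: "estep R ((u, t, c) # y # r) = (u, t, ?c) # y # r" using 0 by simp
 have e2: "estep R ((u, t, ?c) # y # r) = r" using c by simp
 have "(estep R ^^ Suc (Suc 0)) ((u, t, c) # y # r) = estep R (estep R ((u, t, c) # y # r))"
 by (simp del: estep.simps)
 then show ?case unfolding e e2 .
next
 case (Suc k)
 let ?c = "(c div len u + 1) * len u"
 have "c div len u + 1 <= (t - 1) div len u" using Suc.prems(3) by simp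
 then have "?c <= t - 1" by (rule block_start_le)
 then have ct: "?c < t" using Suc.prems(1) by simp
 have cc: "c <= ?c" using less_next_block[OF assms, of c] by simp
 have "nxt R u c (min t ?c) = None" using ct Suc.prems(2) by (intro nxt_None) auto
 then have e: "estep R ((u, t, c) # y # r) = (u, t, ?c) # y # r" using Suc.prems(1) by simp
 have "(estep R ^^ Suc (Suc k)) ((u, t, ?c) # y # r) = r"
 using ct cc Suc.prems assms by (intro Suc.IH) auto
 then show ?case using e by (simp only: funpow_Suc_right[of "Suc (Suc k)"] o_apply)
qed

text \<open>The walks still ahead of a frame; their number measures the recursion that remains. The
  empty walk stands for the frame itself.\<close>

definition qset :: "ringing => nat => nat => nat => (nat \<times> nat) list set" where
 "qset R u t c = {ps. qwalk R u t ps & (ps = [] \<or> c <= fst (hd ps))}"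

lemma finite_qset: "R \<in> Om ==> finite (qset R u t c)"
proof (rule finite_subset)
 assume R: "R \<in> Om"
 show "qset R u t c \<subseteq> {ps. set ps \<subseteq> {..<t} \<times> {..<n} & length ps <= t}"
 using qwalk_set[OF R] qwalk_length by (auto simp: qset_def)
qed (rule finite_lists_length_le, simp)

lemma card_qset_pos: "R \<in> Om ==> 1 <= card (qset R u t c)"
proof -
 assume "R \<in> Om"
 then have "card {[] :: (nat \<times> nat) list} <= card (qset R u t c)"
 by (intro card_mono finite_qset) (auto simp: qset_def)
 then show ?thesis by simp
qed

text \<open>Walks with first step \<open>(\<tau>, w)\<close> correspond to walks from
  \<open>w\<close> before \<tau> and are disjoint from those that start later, just as
  \<open>estep\<close> splits a question at a ring.\<close>

lemma card_qset_ring: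
 assumes "R \<in> Om" "R ({u, w}, \<tau>)" "c <= \<tau>" "\<tau> < t" "alv R \<tau> u"
 shows "card (qset R w \<tau> 0) + card (qset R u t (\<tau> + 1)) <= card (qset R u t c)"
proof -
 have "card (qset R w \<tau> 0) = card ((#) (\<tau>, w) ` qset R w \<tau> 0)"
 by (rule card_image[symmetric]) (auto simp: inj_on_def)
 moreover have "card ((#) (\<tau>, w) ` qset R w \<tau> 0) + card (qset R u t (\<tau> + 1))
 = card ((#) (\<tau>, w) ` qset R w \<tau> 0 \<union> qset R u t (\<tau> + 1))"
 by (intro card_Un_disjoint[symmetric] finite_imageI finite_qset[OF assms(1)]) (auto simp: qset_def)
 moreover have "... <= card (qset R u t c)"
 using assms by (intro card_mono finite_qset) (auto simp: qset_def)
 ultimately show ?thesis by simp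
qed

text \<open>The block of \<open>c\<close> may be partly consumed, so the \<open>2 * b\<close> blocks
  granted by \<open>dense\<close> are counted from the next one.\<close>

lemma block_ring:
 assumes "dense R" "u < n" "0 < deg u" "t <= N" "x < t" "c div len u + 2 * b + 1 <= x div len u"
 shows "\<exists>w s. R ({u, w}, s) & c <= s & s < x"
proof -
 let ?i = "c div len u + 1"
 have l: "1 <= len u" using len_facts(1)[OF assms(2,3)] .
 have "(?i + 2 * b) * len u <= x div len u * len u" using assms(6) by (intro mult_le_mono1) simp
 then have x: "(?i + 2 * b) * len u <= x" using div_times_less_eq_dividend le_trans by blast
 then obtain w s where "R ({u, w}, s)" "?i * len u <= s" "s < (?i + 2 * b) * len u"
 using assms(1-5) unfolding dense_def by (meson less_imp_le_nat le_trans)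
 moreover have "c <= ?i * len u" using l less_next_block[of "len u" c] by simp
 ultimately show ?thesis using x by (meson le_trans less_le_trans)
qed

definition "B0 = 2 * b + 3"

text \<open>Outer induction on \<open>t\<close> for the questions raised at earlier ticks, inner
  induction on \<open>t - c\<close> for the scan. Stating the bound for \<open>K + B0\<close> leaves
  a spare \<open>B0\<close> in each subproblem: of the two spares, one pays for the at most
  \<open>2 * b + 1\<close> steps up to the next ring and one is passed on.\<close>

lemma resolve:
 assumes R: "R \<in> Om" "no_tie R" "dense R"
 shows "u < n ==> 0 < deg u ==> t <= N ==> c <= t ==> alv R c u ==>
 \<exists>K. K + B0 <= B0 * (2 * card (qset R u t c)) &
 (\<forall>y r. (estep R ^^ K) ((u, t, c) # y # r) = (if alv R t u then r else y # r))"
proof (induction t arbitrary: u c rule: less_induct)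
 case (less t)
 note outer = less.IH
 show ?case using less.prems
 proof (induction "t - c" arbitrary: c rule: less_induct)
 case (less c)
 have l: "0 < len u" using len_facts(1)[OF less.prems(1,2)] by simp
 show ?case
 proof (cases "\<exists>s x. c <= s & s < t & R ({u, x}, s)")
 case False
 then have nr: "~ R ({u, x}, s)" if "c <= s" "s < t" for s x using that by blast
 have a: "alv R t u" by (rule alv_no_ring[OF less.prems(5,4)]) (use nr in blast)
 have Q: "B0 * 2 <= B0 * (2 * card (qset R u t c))" using card_qset_pos[OF R(1)] by simp
 show ?thesis
 proof (cases "c = t")
 case True
 then have "\<forall>y r. (estep R ^^ 1) ((u, t, c) # y # r) = (if alv R t u then r else y # r)"
 using a by simp
 moreover have "1 + B0 <= B0 * 2" by (simp add: B0_def)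
 then have "1 + B0 <= B0 * (2 * card (qset R u t c))" using Q by (rule order.trans)
 ultimately show ?thesis by (intro exI[of _ 1] conjI)
 next
 case False
 define k where "k = (t - 1) div len u - c div len u"
 have s: "(estep R ^^ Suc (Suc k)) ((u, t, c) # y # r) = (if alv R t u then r else y # r)" for y r
 using advance_none[OF l, of c t R k y r] nr False less.prems(4) a k_def by simp
 have kb: "k <= 2 * b"
 proof (rule ccontr)
 assume "~ k <= 2 * b"
 then have "c div len u + 2 * b + 1 <= (t - 1) div len u" by (simp add: k_def)
 then have "\<exists>w s. R ({u, w}, s) & c <= s & s < t - 1"
 using less.prems False by (intro block_ring[OF R(3)]) auto
 then show False using nr by force
 qed
 have "Suc (Suc k) + B0 <= B0 * 2" using kb by (simp add: B0_def)
 then have "Suc (Suc k) + B0 <= B0 * (2 * card (qset R u t c))" using Q by (rule order.trans)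
 then show ?thesis using s by (intro exI[of _ "Suc (Suc k)"] conjI allI)
 qed
 next
 case True
 define P where "P s \<longleftrightarrow> c <= s & s < t & (\<exists>x. R ({u, x}, s))" for s
 define \<tau> where "\<tau> = (LEAST s. P s)"
 have "P \<tau>" unfolding \<tau>_def by (rule LeastI_ex) (use True in \<open>simp add: P_def\<close>)
 then obtain w where w: "R ({u, w}, \<tau>)" and \<tau>: "c <= \<tau>" "\<tau> < t" by (auto simp: P_def)
 have nr: "~ R ({u, x}, s)" if "c <= s" "s < \<tau>" for s x
 proof -
 have "~ P s" using that(2) unfolding \<tau>_def by (rule not_less_Least)
 then show ?thesis using that \<tau>(2) by (auto simp: P_def)
 qed
 have a\<tau>: "alv R \<tau> u" by (rule alv_no_ring[OF less.prems(5) \<tau>(1)]) (use nr in blast)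
 have uw: "w < n" "{u, w} \<in> E" using Om_edgeD[OF R(1) w] by auto
 have dw: "0 < deg w" using uw set_adj[of w u] by (auto simp: deg_def insert_commute)
 define k where "k = \<tau> div len u - c div len u"
 have s: "(estep R ^^ Suc k) ((u, t, c) # y # r) = (w, \<tau>, 0) # (u, t, \<tau> + 1) # y # r" for y r
 by (rule advance_found[OF R(2) l w \<tau>(2) \<tau>(1)]) (use nr k_def in auto)
 have k: "k <= 2 * b"
 proof (rule ccontr)
 assume "~ k <= 2 * b"
 then have "c div len u + 2 * b + 1 <= \<tau> div len u" by (simp add: k_def)
 then have "\<exists>w s. R ({u, w}, s) & c <= s & s < \<tau>"
 using less.prems \<tau> by (intro block_ring[OF R(3)]) auto
 then show False using nr by blast
 qed
 obtain K1 where K1: "K1 + B0 <= B0 * (2 * card (qset R w \<tau> 0))"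
 "!!y r. (estep R ^^ K1) ((w, \<tau>, 0) # y # r) = (if alv R \<tau> w then r else y # r)"
 using outer[of \<tau> w 0] \<tau> uw(1) dw less.prems(3) by auto
 have q: "card (qset R w \<tau> 0) + card (qset R u t (\<tau> + 1)) <= card (qset R u t c)"
 by (rule card_qset_ring[OF R(1) w \<tau> a\<tau>])
 have q1: "1 <= card (qset R u t (\<tau> + 1))" by (rule card_qset_pos[OF R(1)])
 have s1: "(estep R ^^ (K1 + Suc k)) ((u, t, c) # y # r)
 = (if alv R \<tau> w then y # r else (u, t, \<tau> + 1) # y # r)" for y r
 by (simp only: funpow_add o_apply s K1(2))
 show ?thesis
 proof (cases "alv R \<tau> w")
 case True
 \<comment> \<open>The live partner kills \<open>u\<close>, and popping two frames has already
   removed the frame of \<open>u\<close>.\<close>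
 have "~ alv R t u" by (rule alv_killed[OF w a\<tau> True \<tau>(2)])
 then have "\<forall>y r. (estep R ^^ (K1 + Suc k)) ((u, t, c) # y # r) = (if alv R t u then r else y # r)"
 using s1 True by simp
 moreover have "K1 + Suc k + B0 <= B0 * (2 * card (qset R u t c))"
 proof -
 have "B0 * (2 * (card (qset R w \<tau> 0) + 1)) <= B0 * (2 * card (qset R u t c))"
 using q q1 by (intro mult_le_mono2) simp
 moreover have "Suc k <= B0" using k by (simp add: B0_def)
 moreover have "B0 * (2 * (card (qset R w \<tau> 0) + 1)) = B0 * (2 * card (qset R w \<tau> 0)) + 2 * B0"
 by (simp add: algebra_simps)
 ultimately show ?thesis using K1(1) by linarith
 qed
 ultimately show ?thesis by (intro exI[of _ "K1 + Suc k"] conjI)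
 next
 case False
 have a1: "alv R (\<tau> + 1) u" using a\<tau> False no_tie_unique[OF R(2) w] by auto
 have "t - (\<tau> + 1) < t - c" using \<tau> by linarith
 from less.hyps[OF this less.prems(1-3) _ a1] obtain K2 where K2: "K2 + B0 <= B0 * (2 * card (qset R u t (\<tau> + 1)))"
 "!!y r. (estep R ^^ K2) ((u, t, \<tau> + 1) # y # r) = (if alv R t u then r else y # r)"
 using \<tau>(2) by auto
 have "\<forall>y r. (estep R ^^ (K2 + (K1 + Suc k))) ((u, t, c) # y # r) = (if alv R t u then r else y # r)"
 by (intro allI) (simp only: funpow_add[of K2] o_apply s1 if_not_P[OF False] K2(2))
 moreover have "K2 + (K1 + Suc k) + B0 <= B0 * (2 * card (qset R u t c))"
 proof -
 have "B0 * (2 * card (qset R w \<tau> 0)) + B0 * (2 * card (qset R u t (\<tau> + 1)))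
 <= B0 * (2 * card (qset R u t c))"
 using mult_le_mono2[OF q, of "2 * B0"] by (simp add: algebra_simps)
 moreover have "Suc k <= B0" using k by (simp add: B0_def)
 ultimately show ?thesis using K1(1) K2(1) by linarith
 qed
 ultimately show ?thesis by (intro exI[of _ "K2 + (K1 + Suc k)"] conjI)
 qed
 qed
 qed
qed

end


section \<open>Matchings and vertex covers\<close>

context rgraph
begin

lemma finite_matchings: "finite {M. matching E M}"
 by (rule finite_subset[of _ "Pow E"]) (use finite_E in \<open>auto simp: matching_def\<close>)

lemma card_le_matching_number: "matching E M ==> card M <= matching_number E"
 unfolding matching_number_def using finite_matchings by (intro Max_ge) auto

lemma finite_covers: "finite {S. vertex_cover n E S}"
 by (rule finite_subset[of _ "Pow {..<n}"]) (auto simp: vertex_cover_def)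

lemma cover_number_le: "vertex_cover n E S ==> vertex_cover_number n E <= card S"
 unfolding vertex_cover_number_def using finite_covers by (intro Min_le) auto

lemma ex_min_cover: "\<exists>S. vertex_cover n E S & card S = vertex_cover_number n E"
proof -
 have "vertex_cover n E {..<n}" by (auto simp: vertex_cover_def elim: edgeE)
 then have "vertex_cover_number n E \<in> card ` {S. vertex_cover n E S}"
 unfolding vertex_cover_number_def using finite_covers by (intro Min_in) auto
 then show ?thesis by auto
qed

lemma ex_max_matching: "\<exists>M. matching E M & card M = matching_number E"
proof -
 have "matching E {}" by (simp add: matching_def)
 then have "matching_number E \<in> card ` {M. matching E M}"
 unfolding matching_number_def using finite_matchings by (intro Max_in) auto
 then show ?thesis by auto
qed

lemma matching_le_cover:
 assumes "matching E M" "vertex_cover n E S"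
 shows "card M <= card S"
proof -
 have "\<forall>e\<in>M. \<exists>u. u \<in> e & u \<in> S" using assms by (auto simp: matching_def vertex_cover_def)
 then obtain f where f: "!!e. e \<in> M ==> f e \<in> e & f e \<in> S" by metis
 have "finite S" using assms(2) finite_subset by (auto simp: vertex_cover_def)
 moreover have "inj_on f M"
 proof (rule inj_onI)
 fix x y assume a: "x \<in> M" "y \<in> M" "f x = f y"
 then have "f x \<in> x \<inter> y" using f by (metis IntI)
 then show "x = y" using assms(1) a(1,2) unfolding matching_def by blast
 qed
 moreover have "f ` M \<subseteq> S" using f by auto
 ultimately show ?thesis by (metis card_inj_on_le)
qed

lemma mu_le_nu: "matching_number E <= vertex_cover_number n E"
 using ex_min_cover ex_max_matching matching_le_cover by metis

definition matched :: "ringing => nat set" where "matched R = {u. u < n & ~ alv R N u}"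

definition taken :: "ringing => nat set set" where
 "taken R = {{u, w} | u w. \<exists>s<N. R ({u, w}, s) & alv R s u & alv R s w}"

lemma taken_iff:
 "{u, w} \<in> taken R \<longleftrightarrow> (\<exists>s<N. R ({u, w}, s) & alv R s u & alv R s w)"
 unfolding taken_def by (auto simp: doubleton_eq_iff insert_commute)

text \<open>Two taken edges at \<open>a\<close> are taken at the same tick, since the earlier one
  would have killed \<open>a\<close>; then \<open>no_tie\<close> identifies them.\<close>

lemma matching_taken:
 assumes "R \<in> Om" "no_tie R"
 shows "matching E (taken R)"
 unfolding matching_def
proof (intro conjI ballI impI)
 show "taken R \<subseteq> E" using Om_edge[OF assms(1)] unfolding taken_def by auto
 have key: "e = f" if e: "e \<in> taken R" "f \<in> taken R" and a: "a \<in> e" "a \<in> f" for e f a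
 proof -
 have "\<exists>w. e = {a, w}" "\<exists>w. f = {a, w}" using e a by (auto simp: taken_def)
 then obtain w w' where ef: "e = {a, w}" "f = {a, w'}" by auto
 then obtain s s' where s: "s < N" "R ({a, w}, s)" "alv R s a" "alv R s w"
 and s': "s' < N" "R ({a, w'}, s')" "alv R s' a" "alv R s' w'"
 using e by (auto simp: taken_iff)
 have "s = s'" using alv_killed[OF s(2-4), of s'] alv_killed[OF s'(2-4), of s] s(3) s'(3) by force
 then show ?thesis using s(2) s'(2) assms(2) ef unfolding no_tie_def by blast
 qed
 fix e f assume "e \<in> taken R" "f \<in> taken R" "e ~= f"
 then show "e \<inter> f = {}" using key by blast
qed

lemma matched_taken:
 assumes "R \<in> Om" shows "matched R = \<Union> (taken R)"
proof
 show "matched R \<subseteq> \<Union> (taken R)"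
 proof
 fix u assume "u \<in> matched R"
 then have "~ alv R N u" by (simp add: matched_def)
 then obtain s w where "s < N" "R ({u, w}, s)" "alv R s u" "alv R s w" by (rule not_alvE)
 then have "{u, w} \<in> taken R" by (auto simp: taken_iff)
 then show "u \<in> \<Union> (taken R)" by blast
 qed
 show "\<Union> (taken R) \<subseteq> matched R"
 proof
 fix u assume "u \<in> \<Union> (taken R)"
 then obtain e where "e \<in> taken R" "u \<in> e" by blast
 then obtain w where "{u, w} \<in> taken R" by (auto simp: taken_def)
 then obtain s where s: "s < N" "R ({u, w}, s)" "alv R s u" "alv R s w" by (auto simp: taken_iff)
 then show "u \<in> matched R"
 using alv_killed[OF s(2-4,1)] Om_edgeD[OF assms s(2)] by (simp add: matched_def)
 qed
qed

lemma card_matched: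
 assumes "R \<in> Om" "no_tie R"
 shows "card (matched R) = 2 * card (taken R)"
proof -
 have m: "matching E (taken R)" by (rule matching_taken[OF assms])
 then have c: "card e = 2" "finite e" if "e \<in> taken R" for e
 using that sg by (auto simp: matching_def simple_graph_def intro: finite_subset)
 have "card (\<Union> (taken R)) = (\<Sum>e\<in>taken R. card e)"
 using m c by (intro card_Union_disjoint) (auto simp: matching_def pairwise_def disjnt_def)
 also have "... = 2 * card (taken R)" using c by simp
 finally show ?thesis by (simp add: matched_taken[OF assms(1)])
qed

definition maximal :: "ringing => bool" where "maximal R \<longleftrightarrow> ~ (\<exists>e\<in>E. \<forall>u\<in>e. alv R N u)"

lemma matched_bounds:
 assumes "R \<in> Om" "no_tie R" "maximal R"
 shows "vertex_cover_number n E <= card (matched R)" "card (matched R) <= 2 * matching_number E"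
proof -
 have "vertex_cover n E (matched R)"
 using assms(3) sg unfolding vertex_cover_def maximal_def matched_def simple_graph_def by fastforce
 then show "vertex_cover_number n E <= card (matched R)" by (rule cover_number_le)
 show "card (matched R) <= 2 * matching_number E"
 using card_matched[OF assms(1,2)] card_le_matching_number[OF matching_taken[OF assms(1,2)]] by simp
qed

definition nonis :: "nat set" where "nonis = {u. u < n & 0 < deg u}"

lemma finite_nonis [simp]: "finite nonis" by (simp add: nonis_def)

lemma matched_nonis: "R \<in> Om ==> matched R \<subseteq> nonis"
proof
 fix u assume R: "R \<in> Om" and "u \<in> matched R"
 then have u: "u < n" "~ alv R N u" by (auto simp: matched_def)
 from u(2) obtain s w where "R ({u, w}, s)" by (rule not_alvE)
 then have "w \<in> set (adj u)" using Om_edgeD[OF R] set_adj by blast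
 then show "u \<in> nonis" using u(1) by (auto simp: nonis_def deg_def)
qed

text \<open>Every directed edge starts or ends in the cover. This lower bound on the cover number is
  what guarantees enough matched vertices among the sampled ones.\<close>

lemma D_le_cover:
 assumes "!!u. u < n ==> deg u <= \<Delta>"
 shows "D <= 2 * \<Delta> * vertex_cover_number n E"
proof -
 obtain S where S: "vertex_cover n E S" "card S = vertex_cover_number n E" using ex_min_cover by blast
 have Sn: "S \<subseteq> {..<n}" "finite S" using S(1) finite_subset by (auto simp: vertex_cover_def)
 let ?A = "SIGMA u:S. set (adj u)"
 have fA: "finite ?A" using Sn by auto
 have "dirs \<subseteq> ?A \<union> prod.swap ` ?A"
 proof
 fix p assume "p \<in> dirs"
 then obtain u w where p: "p = (u, w)" "{u, w} \<in> E" by (auto simp: dirs_def)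
 then have "u \<in> S \<or> w \<in> S" using S(1) by (auto simp: vertex_cover_def)
 moreover have "u < n" "w < n" using edgeD[OF p(2)] by auto
 ultimately show "p \<in> ?A \<union> prod.swap ` ?A"
 using p set_adj[of u w] set_adj[of w u] by (auto simp: insert_commute image_iff)
 qed
 then have "D <= card (?A \<union> prod.swap ` ?A)" using fA by (subst card_dirs[symmetric]) (intro card_mono, auto)
 also have "... <= 2 * card ?A" using card_Un_le[of ?A "prod.swap ` ?A"] card_image_le[OF fA, of prod.swap] by simp
 also have "card ?A = (\<Sum>u\<in>S. deg u)"
 using Sn by (subst card_SigmaI) (auto simp: deg_def distinct_card distinct_adj intro!: sum.cong)
 also have "... <= card S * \<Delta>" using Sn assms by (intro sum_bounded_above[of S deg \<Delta>, simplified]) auto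
 finally show ?thesis using S(2) by (simp add: mult_ac)
qed

end

section \<open>Good ringings\<close>

context rgraph_par
begin

definition good :: "ringing => bool" where
 "good R \<longleftrightarrow> no_tie R & dense R & sparse R & shallow R & maximal R"

definition \<eta> :: real where
 "\<eta> = real H * (real (card E))\<^sup>2 / (real Q)\<^sup>2 + real n * (2 * N + 4 * b + 4) * exp (- real b)"

lemma prob_bad: "EE (%R. of_bool (~ good R)) <= \<eta>"
proof -
 have "EE (%R. of_bool (~ good R)) <= EE (%R. of_bool (~ no_tie R) + (of_bool (~ dense R)
 + (of_bool (~ sparse R) + (of_bool (~ shallow R) + of_bool (\<exists>e\<in>E. \<forall>u\<in>e. alv R N u)))))"
 by (rule E_mono) (auto simp: good_def maximal_def)
 also have "... = EE (%R. of_bool (~ no_tie R)) + (EE (%R. of_bool (~ dense R))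
 + (EE (%R. of_bool (~ sparse R)) + (EE (%R. of_bool (~ shallow R))
 + EE (%R. of_bool (\<exists>e\<in>E. \<forall>u\<in>e. alv R N u)))))"
 by (simp only: E_add[OF finite_rp])
 also have "... <= real H * (real (card E))\<^sup>2 / (real Q)\<^sup>2 + (real n * (N + 1) * exp (- real b)
 + (real n * N * exp (- real b) + ((2 * b + 1) * (2 * n * exp (- real b)) + n * exp (- real b))))"
 by (intro add_mono prob_tie prob_not_dense prob_not_sparse prob_deep prob_not_maximal NbQ)
 also have "... = \<eta>" by (simp add: \<eta>_def algebra_simps)
 finally show ?thesis .
qed

definition start :: "nat => frame list" where "start v = [(v, N, 0), (0, 0, 0)]"

definition stops :: "ringing => frame list => bool" where
 "stops R fs \<longleftrightarrow> (\<exists>j. length ((estep R ^^ j) fs) <= 1)"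

definition its :: "ringing => frame list => nat" where
 "its R fs = (LEAST j. length ((estep R ^^ j) fs) <= 1)"

definition ans :: "ringing => frame list => nat" where
 "ans R fs = length ((estep R ^^ its R fs) fs)"

lemma stops_step: "2 <= length fs ==> stops R (estep R fs) \<longleftrightarrow> stops R fs"
 unfolding stops_def
proof
 assume l: "2 <= length fs" and "\<exists>j. length ((estep R ^^ j) fs) <= 1"
 then obtain j where j: "length ((estep R ^^ j) fs) <= 1" by blast
 then obtain i where "j = Suc i" using l by (cases j) auto
 then show "\<exists>j. length ((estep R ^^ j) (estep R fs)) <= 1"
 using j by (intro exI[of _ i]) (simp only: funpow_Suc_right o_apply)
next
 assume "\<exists>j. length ((estep R ^^ j) (estep R fs)) <= 1"
 then obtain j where "length ((estep R ^^ Suc j) fs) <= 1" by (auto simp only: funpow_Suc_right o_apply)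
 then show "\<exists>j. length ((estep R ^^ j) fs) <= 1" by blast
qed

lemma its_step:
 assumes "2 <= length fs" "stops R fs"
 shows "its R fs = Suc (its R (estep R fs))" "ans R fs = ans R (estep R fs)"
proof -
 obtain j where "length ((estep R ^^ j) fs) <= 1" using assms(2) by (auto simp: stops_def)
 then have "(LEAST j. length ((estep R ^^ j) fs) <= 1) = Suc (LEAST j. length ((estep R ^^ Suc j) fs) <= 1)"
 using assms(1) by (intro Least_Suc) auto
 then show i: "its R fs = Suc (its R (estep R fs))"
 unfolding its_def by (simp only: funpow_Suc_right o_apply)
 show "ans R fs = ans R (estep R fs)" unfolding ans_def i by (simp only: funpow_Suc_right o_apply)
qed

lemma stops_done:
 assumes "length fs <= 1"
 shows "stops R fs" "its R fs = 0" "ans R fs = length fs"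
proof -
 show "stops R fs" unfolding stops_def using assms by (intro exI[of _ 0]) simp
 show i: "its R fs = 0" unfolding its_def by (rule Least_eq_0) (use assms in simp)
 show "ans R fs = length fs" by (simp add: ans_def i)
qed

lemma resolve_start:
 assumes R: "R \<in> Om" "good R" and v: "v < n" "0 < deg v"
 shows "stops R (start v)" "its R (start v) <= 2 * B0 * card (qset R v N 0)"
 "ans R (start v) = (if alv R N v then 0 else 1)"
proof -
 obtain K where K: "K + B0 <= B0 * (2 * card (qset R v N 0))"
 "(estep R ^^ K) (start v) = (if alv R N v then [] else [(0, 0, 0)])"
 using resolve[of R v N 0] R v by (auto simp: good_def start_def)
 then have l: "length ((estep R ^^ K) (start v)) <= 1" by auto
 then show s: "stops R (start v)" by (auto simp: stops_def)
 have le: "its R (start v) <= K" unfolding its_def by (rule Least_le) (rule l)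
 then show "its R (start v) <= 2 * B0 * card (qset R v N 0)" using K(1) by simp
 have fin: "length ((estep R ^^ its R (start v)) (start v)) <= 1"
 unfolding its_def by (rule LeastI[where P = "%j. length ((estep R ^^ j) (start v)) <= 1"]) (rule l)
 have fix1: "(estep R ^^ m) fs = fs" if "length fs <= 1" for m and fs :: "frame list"
 proof -
 have "estep R fs = fs" using that by (cases fs; cases "tl fs") auto
 then show ?thesis by (induction m) auto
 qed
 have "(estep R ^^ K) (start v) = (estep R ^^ (K - its R (start v))) ((estep R ^^ its R (start v)) (start v))"
 using le by (simp only: funpow_add[symmetric, THEN fun_cong, unfolded o_apply] le_add_diff_inverse2)
 then have "(estep R ^^ K) (start v) = (estep R ^^ its R (start v)) (start v)" using fix1[OF fin] by simp
 then have "ans R (start v) = length ((estep R ^^ K) (start v))" by (simp only: ans_def)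
 then show "ans R (start v) = (if alv R N v then 0 else 1)" unfolding K(2) by simp
qed

text \<open>Splitting by length: one empty walk for each start, and shallowness bounds the other
  lengths, so that \<open>walks_bound\<close> has to be summed over \<open>L\<close> values of
  \<open>k\<close> only.\<close>

lemma sum_card_qset:
 assumes "R \<in> Om" "shallow R"
 shows "(\<Sum>v\<in>nonis. card (qset R v N 0)) <= card nonis + (\<Sum>k\<in>{1..L}. card (walks R k))"
proof -
 let ?S = "SIGMA v:nonis. qset R v N 0"
 let ?W = "%k. (%(u, qs). (u, rev qs)) ` walks R k"
 have "(\<Sum>v\<in>nonis. card (qset R v N 0)) = card ?S"
 using finite_qset[OF assms(1)] by (subst card_SigmaI) auto
 also have "?S \<subseteq> (%u. (u, [])) ` nonis \<union> (\<Union>k\<in>{1..L}. ?W k)"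
 proof
 fix x assume "x \<in> ?S"
 then obtain u ps where x: "x = (u, ps)" "u \<in> nonis" "qwalk R u N ps" by (auto simp: qset_def)
 then have l: "length ps <= L" using assms(2) by (auto simp: shallow_def)
 show "x \<in> (%u. (u, [])) ` nonis \<union> (\<Union>k\<in>{1..L}. ?W k)"
 proof (cases "ps = []")
 case False
 have "(u, rev ps) \<in> walks R (length ps)" using x by (auto simp: walks_def nonis_def)
 then have "x \<in> ?W (length ps)" using x by force
 moreover have "length ps \<in> {1..L}" using False l by (cases ps) auto
 ultimately show ?thesis by blast
 qed (use x in simp)
 qed
 then have "card ?S <= card ((%u. (u, [] :: (nat \<times> nat) list)) ` nonis \<union> (\<Union>k\<in>{1..L}. ?W k))"
 using finite_walks[OF assms(1)] by (intro card_mono) auto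
 also have "... <= card ((%u. (u, [] :: (nat \<times> nat) list)) ` nonis) + card (\<Union>k\<in>{1..L}. ?W k)"
 by (rule card_Un_le)
 also have "... <= card nonis + (\<Sum>k\<in>{1..L}. card (?W k))"
 by (intro add_mono card_image_le card_UN_le) auto
 also have "... <= card nonis + (\<Sum>k\<in>{1..L}. card (walks R k))"
 using finite_walks[OF assms(1)] by (intro add_mono sum_mono card_image_le) auto
 finally show ?thesis .
qed

text \<open>\<open>walks_bound\<close> counts walks from all starts together, so the cost is
  controlled in the sum, not for a single vertex. On average over the start it is of order
  \<open>1 + D / card nonis\<close> up to logarithms.\<close>

lemma expected_its:
 "(\<Sum>v\<in>nonis. EE (%R. of_bool (good R) * real (its R (start v))))
 <= 2 * B0 * (card nonis + L * D * b)"
proof -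
 have "(\<Sum>v\<in>nonis. EE (%R. of_bool (good R) * real (its R (start v))))
 = EE (%R. \<Sum>v\<in>nonis. of_bool (good R) * real (its R (start v)))"
 by (rule E_sum[symmetric]) simp
 also have "... <= EE (%R. real (2 * B0) * (real (card nonis) + (\<Sum>k\<in>{1..L}. of_bool (no_tie R) * real (card (walks R k)))))"
 proof (rule E_mono, simp)
 fix R assume R: "R \<in> Om"
 show "(\<Sum>v\<in>nonis. of_bool (good R) * real (its R (start v)))
 <= real (2 * B0) * (real (card nonis) + (\<Sum>k\<in>{1..L}. of_bool (no_tie R) * real (card (walks R k))))"
 proof (cases "good R")
 case True
 have "(\<Sum>v\<in>nonis. its R (start v)) <= (\<Sum>v\<in>nonis. 2 * B0 * card (qset R v N 0))"
 using resolve_start(2)[OF R True] by (intro sum_mono) (auto simp: nonis_def)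
 also have "... = 2 * B0 * (\<Sum>v\<in>nonis. card (qset R v N 0))" by (simp add: sum_distrib_left)
 also have "... <= 2 * B0 * (card nonis + (\<Sum>k\<in>{1..L}. card (walks R k)))"
 using True by (intro mult_le_mono2 sum_card_qset R) (auto simp: good_def)
 finally have "real (\<Sum>v\<in>nonis. its R (start v)) <= real (2 * B0 * (card nonis + (\<Sum>k\<in>{1..L}. card (walks R k))))"
 by (simp only: of_nat_le_iff)
 then show ?thesis using True by (simp add: good_def)
 qed (simp add: sum_nonneg)
 qed
 also have "... = real (2 * B0) * (real (card nonis) + (\<Sum>k\<in>{1..L}. EE (%R. of_bool (no_tie R) * real (card (walks R k)))))"
 proof -
 have "EE (%R. real (card nonis) + (\<Sum>k\<in>{1..L}. of_bool (no_tie R) * real (card (walks R k))))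
 = real (card nonis) + (\<Sum>k\<in>{1..L}. EE (%R. of_bool (no_tie R) * real (card (walks R k))))"
 by (subst E_add[OF finite_rp], subst E_sum[OF finite_rp]) simp
 then show ?thesis by simp
 qed
 also have "... <= real (2 * B0) * (real (card nonis) + (\<Sum>k\<in>{1..L}. real D * real N / real Q))"
 by (intro mult_left_mono add_mono sum_mono walks_bound) auto
 also have "real D * real N / real Q = real D * real b" using Q2 by (simp add: NbQ)
 finally show ?thesis by (simp add: mult_ac)
qed

lemma matched_good_bounds:
 assumes "\<eta> < 1"
 shows "vertex_cover_number n E * (1 - \<eta>) <= EE (%R. of_bool (good R) * real (card (matched R)))"
 "EE (%R. of_bool (good R) * real (card (matched R))) <= 2 * matching_number E"
 "vertex_cover_number n E <= 2 * matching_number E"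
proof -
 have g1: "EE (%R. of_bool (good R)) = 1 - EE (%R. of_bool (~ good R))"
 proof -
 have "EE (%R. of_bool (good R) + of_bool (~ good R)) = EE (%R. 1)"
 by (rule E_cong) simp
 then show ?thesis unfolding E_add[OF finite_rp] by simp
 qed
 have "vertex_cover_number n E * (1 - \<eta>) <= vertex_cover_number n E * EE (%R. of_bool (good R))"
 using prob_bad g1 by (intro mult_left_mono) auto
 also have "... = EE (%R. vertex_cover_number n E * of_bool (good R))" by simp
 also have "... <= EE (%R. of_bool (good R) * real (card (matched R)))"
 by (rule E_mono) (use matched_bounds in \<open>auto simp: good_def\<close>)
 finally show "vertex_cover_number n E * (1 - \<eta>) <= EE (%R. of_bool (good R) * real (card (matched R)))" .
 have "EE (%R. of_bool (good R) * real (card (matched R))) <= EE (%R. 2 * matching_number E)"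
 proof (rule E_mono, simp)
 fix R assume R: "R \<in> Om"
 show "of_bool (good R) * real (card (matched R)) <= real (2 * matching_number E)"
 using matched_bounds(2)[OF R] by (cases "good R") (simp_all add: good_def flip: of_nat_mult)
 qed
 then show "EE (%R. of_bool (good R) * real (card (matched R))) <= 2 * matching_number E" by simp
 \<comment> \<open>Failure probability below 1 leaves at least one good ringing, and its matching
   proves the deterministic inequality.\<close>
 have "\<exists>R\<in>Om. good R"
 proof (rule ccontr)
 assume "~ (\<exists>R\<in>Om. good R)"
 then have "EE (%R. of_bool (~ good R)) = EE (%R. 1)" by (intro E_cong) auto
 then show False using prob_bad assms by simp
 qed
 then show "vertex_cover_number n E <= 2 * matching_number E"
 using matched_bounds unfolding good_def by (meson le_trans)
qed

end


section \<open>The sampling machine\<close>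

text \<open>A sample draws a vertex and explores a fresh ringing, which is revealed block by block. In a
  block the cells \<open>c\<close> are tried in order: the next ringing cell is at distance \<open>g\<close> with probability
  \<open>(1 / Q) * (1 - 1 / Q) ^ g\<close>. \<open>Draw\<close> proposes a uniform \<open>g\<close> and \<open>Fact\<close> accepts it with probability
  exactly \<open>(1 - 1 / Q) ^ g\<close>, by counting successes of probabilities \<open>(g + 1 - k) / (k * Q)\<close>.\<close>

datatype mode = Pick | Main | Draw nat | Fact nat nat nat | Push nat | Scan nat nat nat

text \<open>Outside the drawing of a block, \<open>mX u\<close> is the tick below which every cell
  at \<open>u\<close> is revealed, and \<open>mG\<close> lists the rings among the revealed cells.
  \<open>mleft\<close> includes the sample in progress.\<close>

record mst =
 mleft :: nat
 mhits :: nat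
 mfr :: "frame list"
 mX :: "nat => nat"
 mG :: "(nat \<times> nat \<times> nat) list"
 md :: mode

definition scanf :: "nat => nat \<times> nat => nat \<times> nat => nat \<times> nat" where
 "scanf c bst x = (if c <= fst x & fst x < fst bst then x else bst)"

text \<open>Finds the earliest listed ring not before \<open>c\<close>; the initial value
  \<open>(t, 0)\<close> makes \<open>t\<close> the answer when there is none before
  \<open>t\<close>.\<close>

definition scanl :: "nat => nat => (nat \<times> nat) list => nat \<times> nat" where
 "scanl c t xs = foldl (scanf c) (t, 0) xs"

lemma scanl_spec:
 assumes "scanl c t xs = (bt, bw)"
 shows "bt <= t & (\<forall>x\<in>set xs. c <= fst x --> bt <= fst x) & (bt < t --> (bt, bw) \<in> set xs & c <= bt)"
 using assms
proof (induction xs arbitrary: bt bw rule: rev_induct)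
 case (snoc x xs)
 obtain bt' bw' where 1: "scanl c t xs = (bt', bw')" by (metis surj_pair)
 have 2: "scanl c t (xs @ [x]) = scanf c (bt', bw') x" using 1 by (simp add: scanl_def)
 note ih = snoc.IH[OF 1]
 show ?case
 proof (cases "c <= fst x & fst x < bt'")
 case True
 then have "x = (bt, bw)" using 2 snoc.prems by (simp add: scanf_def)
 then show ?thesis using ih True by auto
 next
 case False
 then have "bt = bt'" "bw = bw'" using 2 snoc.prems by (auto simp: scanf_def)
 then show ?thesis using ih False by auto
 qed
qed (auto simp: scanl_def)

context rgraph_par
begin

definition VL :: "nat list" where "VL = filter (%u. 0 < deg u) [0..<n]"

lemma VL_facts: "set VL = nonis" "distinct VL" "length VL = card nonis"
proof -
 show s: "set VL = nonis" by (auto simp: VL_def nonis_def)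
 show d: "distinct VL" by (simp add: VL_def)
 show "length VL = card nonis" using distinct_card[OF d] s by simp
qed

text \<open>A ring found from one end must be visible from the other, whose blocks have a different
  length; so each ring belongs to two lists.\<close>

definition bucket :: "(nat \<times> nat \<times> nat) list => nat => nat => (nat \<times> nat) list" where
 "bucket G u i = concat (map (%(a, w, \<tau>).
 (if a = u & \<tau> div len u = i then [(\<tau>, w)] else []) @ (if w = u & \<tau> div len u = i then [(\<tau>, a)] else [])) G)"

definition CC :: "nat => nat" where "CC u = deg u * len u"

text \<open>The cells of a block are numbered neighbour by neighbour, so that a single geometric gap
  can jump across many neighbours.\<close>

definition mw :: "nat => nat => nat" where "mw u c = adj u ! (c div len u)"

definition mt :: "(nat => nat) => nat => nat => nat" where "mt X u c = X u + c mod len u"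

text \<open>The cell may already have been revealed from its other end; then the known bit stands
  and the new ring is discarded.\<close>

definition pushG :: "(nat => nat) => nat => nat => (nat \<times> nat \<times> nat) list => (nat \<times> nat \<times> nat) list" where
 "pushG X u c G = (if mt X u c < X (mw u c) then G else G @ [(u, mw u c, mt X u c)])"

definition mstep :: "mst => mst pmf" where
 "mstep s = (let (u, t, c0) = hd (mfr s) in case md s of
 Pick => if mleft s = 0 then return_pmf s
 else map_pmf (%i. s\<lparr>mfr := start (VL ! i), mX := (%_. 0), mG := [], md := Main\<rparr>)
 (pmf_of_set {..<length VL})
 | Main => return_pmf (
 if length (mfr s) <= 1 then s\<lparr>mhits := mhits s + length (mfr s), mleft := mleft s - 1, md := Pick\<rparr>
 else if t <= c0 then s\<lparr>mfr := drop 2 (mfr s)\<rparr>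
 else if mX s u <= c0 then s\<lparr>md := Draw 0\<rparr> else s\<lparr>md := Scan 0 t 0\<rparr>)
 | Draw c => if c < CC u then map_pmf (%g. s\<lparr>md := Fact c g 1\<rparr>) (pmf_of_set {..<Q})
 else return_pmf (s\<lparr>mX := (mX s)(u := mX s u + len u), md := Scan 0 t 0\<rparr>)
 | Fact c g k => map_pmf (%x. s\<lparr>md := if x + k <= g then Fact c g (k + 1)
 else if odd k then Push (c + g) else Draw (CC u)\<rparr>) (pmf_of_set {..<k * Q})
 | Push c => return_pmf (if c < CC u then s\<lparr>mG := pushG (mX s) u c (mG s), md := Draw (c + 1)\<rparr>
 else s\<lparr>md := Draw c\<rparr>)
 | Scan j bt bw => return_pmf (
 if j < length (bucket (mG s) u (c0 div len u))
 then s\<lparr>md := (case scanf c0 (bt, bw) (bucket (mG s) u (c0 div len u) ! j) of (bt', bw') => Scan (j + 1) bt' bw')\<rparr>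
 else s\<lparr>mfr := (if bt < t then (bw, bt, 0) # (u, t, bt + 1) # tl (mfr s)
 else (u, t, (c0 div len u + 1) * len u) # tl (mfr s)), md := Main\<rparr>))"

subsection \<open>Known cells\<close>

definition KX :: "(nat => nat) => (nat set \<times> nat) set" where
 "KX X = {(e, \<tau>). \<exists>a\<in>e. \<tau> < X a}"

definition xc :: "(nat => nat) => nat => nat => nat set \<times> nat" where
 "xc X u c = ({u, mw u c}, mt X u c)"

definition KD :: "(nat => nat) => nat => nat => (nat set \<times> nat) set" where
 "KD X u c = KX X \<union> xc X u ` {c'. c' < c & c' < CC u}"

definition Rg :: "(nat \<times> nat \<times> nat) list => (nat set \<times> nat) set" where
 "Rg G = (%(a, w, \<tau>). ({a, w}, \<tau>)) ` set G"

lemma nonis_len: "u \<in> nonis ==> u < n & 0 < deg u & 1 <= len u & CC u <= Q & 0 < CC u"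
 using len_facts[of u] Q2 by (auto simp: nonis_def CC_def)

lemma mw_mem: "u \<in> nonis ==> c < CC u ==> mw u c \<in> set (adj u) & c div len u < deg u"
proof -
 assume u: "u \<in> nonis" "c < CC u"
 then have "c div len u < deg u" using nonis_len[OF u(1)]
 by (simp add: CC_def div_less_iff_less_mult mult.commute)
 then show ?thesis unfolding mw_def deg_def by (simp add: nth_mem)
qed

lemma xc_cells:
 assumes "u \<in> nonis" "c < CC u" "X u < N"
 shows "xc X u c \<in> cells" "{u, mw u c} \<in> E" "mt X u c < H" "mw u c \<in> nonis" "mw u c ~= u"
proof -
 have m: "mw u c \<in> set (adj u)" using mw_mem assms by blast
 then show e: "{u, mw u c} \<in> E" using assms(1) set_adj by (auto simp: nonis_def)
 have "c mod len u < len u" using nonis_len[OF assms(1)] by simp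
 moreover have "len u <= Q" by (simp add: len_def)
 ultimately show "mt X u c < H" using assms(3) by (simp add: mt_def H_def)
 then show "xc X u c \<in> cells" using e by (simp add: xc_def cells_def)
 have "u \<in> set (adj (mw u c))" "mw u c < n" using e edgeD[OF e] set_adj[of "mw u c" u] by (auto simp: insert_commute)
 then show "mw u c \<in> nonis" by (auto simp: nonis_def deg_def)
 show "mw u c ~= u" using edgeD[OF e] by simp
qed

lemma xc_inj:
 assumes "u \<in> nonis" "c < CC u" "c' < CC u" "xc X u c = xc X u c'"
 shows "c = c'"
proof -
 have "adj u ! (c div len u) = adj u ! (c' div len u)" "c mod len u = c' mod len u"
 using assms(4) by (auto simp: xc_def mt_def mw_def doubleton_eq_iff)
 moreover have "c div len u = c' div len u"
 using calculation(1) mw_mem[OF assms(1,2)] mw_mem[OF assms(1,3)] distinct_adj[of u] assms(1)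
 by (auto simp: nonis_def deg_def nth_eq_iff_index_eq)
 ultimately show ?thesis by (metis div_mult_mod_eq)
qed

lemma KD_mono: "c <= c' ==> KD X u c \<subseteq> KD X u c'"
 by (auto simp: KD_def)

lemma KD_0: "KD X u 0 = KX X" by (simp add: KD_def)

text \<open>The \<open>CC u\<close> cells run through all neighbours and all offsets, so finishing a
  block amounts to advancing \<open>X u\<close>.\<close>

lemma KD_final:
 assumes "u \<in> nonis" "CC u <= c"
 shows "KD X u c \<inter> cells = KX (X(u := X u + len u)) \<inter> cells"
proof (intro equalityI subsetI)
 fix x assume x: "x \<in> KD X u c \<inter> cells"
 then consider "x \<in> KX X" | c' where "c' < CC u" "x = xc X u c'" by (auto simp: KD_def)
 then show "x \<in> KX (X(u := X u + len u)) \<inter> cells"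
 proof cases
 case 1
 then obtain e \<tau> a where e: "x = (e, \<tau>)" "a \<in> e" "\<tau> < X a" by (auto simp: KX_def)
 then have "\<tau> < (X(u := X u + len u)) a" by (cases "a = u") auto
 then show ?thesis using x e unfolding KX_def by blast
 next
 case 2
 have "c' mod len u < len u" using nonis_len[OF assms(1)] by simp
 then show ?thesis using x 2 by (simp add: KX_def xc_def mt_def)
 qed
next
 fix x assume x: "x \<in> KX (X(u := X u + len u)) \<inter> cells"
 then obtain e \<tau> a where e: "x = (e, \<tau>)" "e \<in> E" "a \<in> e" "\<tau> < (X(u := X u + len u)) a"
 by (auto simp: KX_def cells_def)
 show "x \<in> KD X u c \<inter> cells"
 proof (cases "x \<in> KX X")
 case False
 then have a: "a = u" "X u <= \<tau>" "\<tau> < X u + len u" using e by (auto simp: KX_def split: if_splits)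
 obtain w where w: "e = {u, w}" using edgeE[OF e(2)] e(3) a(1) by (metis insertE insert_commute singletonD)
 then have "w \<in> set (adj u)" using e(2) set_adj[of u w] assms(1) by (simp add: nonis_def)
 then obtain i where i: "i < deg u" "adj u ! i = w" by (auto simp: in_set_conv_nth deg_def)
 let ?c = "i * len u + (\<tau> - X u)"
 have l: "\<tau> - X u < len u" using a by simp
 have "?c < (i + 1) * len u" using l by simp
 also have "... <= CC u" unfolding CC_def using i by (intro mult_le_mono1) simp
 finally have cc: "?c < CC u" .
 have "?c div len u = i" "?c mod len u = \<tau> - X u" using l by simp_all
 then have "x = xc X u ?c" using e(1) w i a by (simp add: xc_def mw_def mt_def)
 then show ?thesis using cc assms(2) x by (auto simp: KD_def)
 qed (use x in \<open>simp add: KD_def\<close>)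
qed

lemma Rg_push: "Rg (pushG X u c G) = (if mt X u c < X (mw u c) then Rg G else insert (xc X u c) (Rg G))"
 by (simp add: pushG_def Rg_def xc_def)

text \<open>For an unknown cell this is \<open>E_reveal\<close>. For a known one both expectations
  on the right agree, because \<open>pushG\<close> discards the ring, so a toss may be spent on it
  without harm.\<close>

lemma reveal_cell:
 assumes "u \<in> nonis" "c < CC u" "X u < N" "Rg G \<subseteq> KD X u c"
 shows "EV (rp (KD X u c) (Rg G)) f
 = (1 / Q) * EV (rp (KD X u (c + 1)) (Rg (pushG X u c G))) f
 + (1 - 1 / Q) * EV (rp (KD X u (c + 1)) (Rg G)) f"
proof -
 have ins: "KD X u (c + 1) = insert (xc X u c) (KD X u c)"
 using assms(2) by (auto simp: KD_def less_Suc_eq)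
 show ?thesis
 proof (cases "mt X u c < X (mw u c)")
 case True
 then have "xc X u c \<in> KD X u c" by (auto simp: KD_def KX_def xc_def)
 then have "KD X u (c + 1) = KD X u c" using ins by auto
 then show ?thesis using True by (simp add: Rg_push left_diff_distrib)
 next
 case False
 have nk: "xc X u c \<notin> KD X u c"
 proof
 assume "xc X u c \<in> KD X u c"
 then consider "xc X u c \<in> KX X" | c' where "c' < c" "xc X u c = xc X u c'"
 by (auto simp: KD_def)
 then show False
 proof cases
 case 1
 then show ?thesis using False by (auto simp: KX_def xc_def mt_def)
 next
 case 2
 then show ?thesis using xc_inj[OF assms(1,2), of c' X] assms(2) by simp
 qed
 qed
 then have "Rg G - {xc X u c} = Rg G" using assms(4) by auto
 then show ?thesis
 using E_reveal[OF xc_cells(1)[of u c X, OF assms(1-3)] nk, of "Rg G" f] False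
 by (simp add: Rg_push ins[simplified])
 qed
qed

text \<open>\<open>reveal_cell\<close> iterated: the gap to the next ring is geometric, cut off at
  the end of the block.\<close>

lemma reveal_next:
 fixes f :: "ringing => real"
 assumes "u \<in> nonis" "X u < N" "Rg G \<subseteq> KD X u c"
 defines "P \<equiv> %c G. EV (rp (KD X u c) (Rg G)) f"
 shows "c <= CC u ==> CC u - c = m ==> P c G = (\<Sum>g<m. (1 / Q) * (1 - 1 / Q) ^ g * P (c + g + 1) (pushG X u (c + g) G))
 + (1 - 1 / Q) ^ m * P (CC u) G"
 using assms(3)
proof (induction m arbitrary: c)
 case (Suc m)
 have "P c G = (1 / Q) * P (c + 1) (pushG X u c G) + (1 - 1 / Q) * P (c + 1) G"
 unfolding P_def using Suc.prems by (intro reveal_cell assms) auto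
 also have "P (c + 1) G = (\<Sum>g<m. (1 / Q) * (1 - 1 / Q) ^ g * P (c + 1 + g + 1) (pushG X u (c + 1 + g) G))
 + (1 - 1 / Q) ^ m * P (CC u) G"
 using Suc.prems KD_mono[of c "c + 1" X u] by (intro Suc.IH) auto
 finally show ?case
 by (simp add: sum.lessThan_Suc_shift sum_distrib_left algebra_simps del: sum.lessThan_Suc)
qed simp

subsection \<open>Invariants\<close>

definition ginv :: "(nat set \<times> nat) set => (nat \<times> nat \<times> nat) list => bool" where
 "ginv K G \<longleftrightarrow> Rg G \<subseteq> K & Rg G \<subseteq> cells & distinct (map (%(a, w, \<tau>). ({a, w}, \<tau>)) G)"

text \<open>\<open>butlast\<close> exempts the dummy frame, whose vertex 0 may be isolated.\<close>

definition finv :: "(nat => nat) => frame list => bool" where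
 "finv X fs \<longleftrightarrow> (\<forall>f\<in>set (butlast fs). fst f \<in> nonis & fst (snd f) <= N & snd (snd f) <= X (fst f))
 & (\<forall>u\<in>nonis. len u dvd X u)"

definition topinv :: "mst => bool" where
 "topinv s \<longleftrightarrow> 2 <= length (mfr s) & snd (snd (hd (mfr s))) < fst (snd (hd (mfr s)))"

definition minv :: "mst => bool" where
 "minv s \<longleftrightarrow> md s = Pick \<or> (1 <= mleft s & finv (mX s) (mfr s) &
 (let (u, t, c0) = hd (mfr s); X = mX s; G = mG s in case md s of
 Main => ginv (KX X) G
 | Draw c => topinv s & X u = c0 & ginv (KD X u c) G
 | Fact c g k => topinv s & X u = c0 & ginv (KD X u c) G & c < CC u & g < Q & 1 <= k & k <= g + 1
 | Push c => topinv s & X u = c0 & ginv (KD X u c) G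
 | Scan j bt bw => topinv s & c0 < X u & ginv (KX X) G & j <= length (bucket G u (c0 div len u))
 & scanl c0 t (take j (bucket G u (c0 div len u))) = (bt, bw)
 | Pick => True))"

lemma topinvE:
 assumes "topinv s" "finv (mX s) (mfr s)"
 obtains u t c0 y r where "mfr s = (u, t, c0) # y # r" "c0 < t" "u \<in> nonis" "t <= N" "c0 <= mX s u"
proof -
 obtain u t c0 y r where e: "mfr s = (u, t, c0) # y # r"
 using assms(1) unfolding topinv_def by (cases "mfr s"; cases "tl (mfr s)") auto
 then have "(u, t, c0) \<in> set (butlast (mfr s))" by simp
 then have "u \<in> nonis" "t <= N" "c0 <= mX s u" using assms(2) unfolding finv_def by fastforce+
 then show thesis using that e assms(1) by (simp add: topinv_def)
qed

lemma ginv_mono: "ginv K G ==> K \<inter> cells \<subseteq> K' ==> ginv K' G"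
 unfolding ginv_def by blast

lemma finv_drop2: "finv X fs ==> finv X (drop 2 fs)"
 unfolding finv_def by (metis butlast_drop in_set_dropD)

lemma bucket_mem:
 assumes "Rg G \<subseteq> cells"
 shows "(\<tau>, w) \<in> set (bucket G u i) \<longleftrightarrow> ({u, w}, \<tau>) \<in> Rg G & \<tau> div len u = i"
 unfolding bucket_def Rg_def by (auto simp: doubleton_eq_iff split: if_splits; force)

lemma bucket_distinct:
 assumes "Rg G \<subseteq> cells" "distinct (map (%(a, w, \<tau>). ({a, w}, \<tau>)) G)"
 shows "distinct (bucket G u i)"
 using assms
proof (induction G rule: rev_induct)
 case (snoc x G)
 obtain a w \<tau> where x: "x = (a, w, \<tau>)" by (cases x)
 have sub: "Rg G \<subseteq> cells" using snoc.prems(1) by (auto simp: Rg_def)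
 have "({a, w}, \<tau>) \<in> cells" using snoc.prems(1) x by (auto simp: Rg_def)
 then have aw: "a ~= w" using edgeD by (auto simp: cells_def)
 have nin: "({a, w}, \<tau>) \<notin> Rg G" using snoc.prems(2) x by (auto simp: Rg_def)
 have e: "bucket (G @ [x]) u i = bucket G u i @
 ((if a = u & \<tau> div len u = i then [(\<tau>, w)] else []) @ (if w = u & \<tau> div len u = i then [(\<tau>, a)] else []))"
 by (simp add: bucket_def x)
 have "distinct (bucket G u i)" using snoc sub by simp
 moreover have "(\<tau>, w) \<notin> set (bucket G u i)" if "a = u"
 using nin that bucket_mem[OF sub] by simp
 moreover have "(\<tau>, a) \<notin> set (bucket G u i)" if "w = u"
 using nin that bucket_mem[OF sub, of \<tau> a u i] by (simp add: insert_commute)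
 ultimately show ?case unfolding e using aw by auto
qed (simp add: bucket_def)

text \<open>In a fully revealed block the list agrees with every ringing compatible with the
  revealed bits.\<close>

lemma bucket_R:
 assumes "ginv (KX X) G" "u \<in> nonis" "(i + 1) * len u <= X u" "R \<in> set_pmf (rp (KX X) (Rg G))"
 shows "(\<tau>, w) \<in> set (bucket G u i) \<longleftrightarrow> R ({u, w}, \<tau>) & i * len u <= \<tau> & \<tau> < (i + 1) * len u"
proof -
 have l: "0 < len u" using nonis_len[OF assms(2)] by simp
 have d: "\<tau> div len u = i \<longleftrightarrow> i * len u <= \<tau> & \<tau> < (i + 1) * len u"
 using l by (metis Suc_eq_plus1 div_nat_eqI div_times_less_eq_dividend less_next_block mult.commute)
 have r: "R ({u, w}, \<tau>) \<longleftrightarrow> ({u, w}, \<tau>) \<in> Rg G" if "\<tau> < X u"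
 proof (cases "({u, w}, \<tau>) \<in> cells")
 case True
 moreover have "({u, w}, \<tau>) \<in> KX X" using that by (auto simp: KX_def)
 ultimately show ?thesis using rp_known[OF assms(4)] by blast
 next
 case False
 then show ?thesis using rp_support[OF assms(4)] assms(1) by (auto simp: ginv_def)
 qed
 have "Rg G \<subseteq> cells" using assms(1) by (simp add: ginv_def)
 from bucket_mem[OF this] show ?thesis using d r assms(3) by auto
qed

lemma next_block:
 assumes "u \<in> nonis" "len u dvd X" "c < X"
 shows "(c div len u + 1) * len u <= X"
proof -
 obtain m where m: "X = len u * m" using assms(2) by (auto simp: dvd_def)
 have l: "0 < len u" using nonis_len[OF assms(1)] by simp
 have "c div len u < m" using assms(3) m l by (simp add: div_less_iff_less_mult mult.commute)
 then have "(c div len u + 1) * len u <= m * len u" by (intro mult_le_mono1) simp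
 then show ?thesis using m by (simp add: mult.commute)
qed

text \<open>The scan does what \<open>estep\<close> does on all compatible tie-free ringings at
  once, so it changes the stack without conditioning the ringing further.\<close>

lemma estep_scan:
 assumes "ginv (KX X) G" "u \<in> nonis" "len u dvd X u" "c < X u" "R \<in> set_pmf (rp (KX X) (Rg G))"
 and "no_tie R" "c < t" "scanl c t (bucket G u (c div len u)) = (bt, bw)"
 shows "estep R ((u, t, c) # y # r) = (if bt < t then (bw, bt, 0) # (u, t, bt + 1) # y # r
 else (u, t, (c div len u + 1) * len u) # y # r)"
proof -
 let ?i = "c div len u" and ?L = "bucket G u (c div len u)"
 have l: "0 < len u" using nonis_len[OF assms(2)] by simp
 have nb: "(?i + 1) * len u <= X u" by (rule next_block[OF assms(2-4)])
 note mem = bucket_R[OF assms(1,2) nb assms(5)]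
 have ci: "?i * len u <= c" by simp
 note sp = scanl_spec[OF assms(8)]
 have none: "~ R ({u, x}, s)" if "c <= s" "s < min bt ((?i + 1) * len u)" for s x
 proof
 assume "R ({u, x}, s)"
 moreover have "?i * len u <= s" using ci that(1) by (rule le_trans)
 ultimately have "(s, x) \<in> set ?L" using mem that by simp
 then show False using sp that by force
 qed
 show ?thesis
 proof (cases "bt < t")
 case True
 then have "(bt, bw) \<in> set ?L" "c <= bt" using sp by auto
 then have r: "R ({u, bw}, bt)" "bt < (?i + 1) * len u" using mem by auto
 have "nxt R u c (min t ((?i + 1) * len u)) = Some (bt, bw)"
 using True r \<open>c <= bt\<close> none by (intro nxt_Some assms(6)) auto
 then show ?thesis using True assms(7) by simp
 next
 case False
 then have "bt = t" using sp by simp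
 then have "nxt R u c (min t ((?i + 1) * len u)) = None" using none by (intro nxt_None) auto
 then show ?thesis using False assms(7) by simp
 qed
qed

lemma bucket_length:
 assumes "ginv (KX X) G" "u \<in> nonis" "len u dvd X u" "c < X u" "R \<in> set_pmf (rp (KX X) (Rg G))"
 and "sparse R" "c < N"
 shows "length (bucket G u (c div len u)) <= b + 3"
proof -
 let ?i = "c div len u"
 note mem = bucket_R[OF assms(1,2) next_block[OF assms(2-4)] assms(5)]
 have "distinct (bucket G u ?i)" using assms(1) by (intro bucket_distinct) (auto simp: ginv_def)
 then have "length (bucket G u ?i) = card (set (bucket G u ?i))" by (simp add: distinct_card)
 also have "set (bucket G u ?i) = block R u ?i" using mem by (auto simp: block_def)
 also have "card ... <= b + 3"
 proof -
 have "?i * len u < N" using assms(7) by (metis div_times_less_eq_dividend le_less_trans)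
 then show ?thesis using assms(2,6) by (auto simp: sparse_def nonis_def)
 qed
 finally show ?thesis .
qed

end


context rgraph_par
begin

subsection \<open>The acceptance probability\<close>

function acc :: "nat => nat => real" where
 "acc g k = (if g < k then of_bool (odd k) else
 real (g + 1 - k) / real (k * Q) * acc g (k + 1) + (1 - real (g + 1 - k) / real (k * Q)) * of_bool (odd k))"
 by auto
termination by (relation "Wellfounded.measure (%(g, k). Suc g - k)") auto

declare acc.simps [simp del]

definition qk :: "nat => nat => real" where "qk g k = real (g + 1 - k) / real (k * Q)"

lemma acc_rec: "k <= g + 1 ==> acc g k = qk g k * acc g (k + 1) + (1 - qk g k) * of_bool (odd k)"
 by (subst acc.simps) (auto simp: qk_def)

lemma qk_bounds:
 assumes "g < Q" "1 <= k" "k <= g + 1"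
 shows "0 <= qk g k" "qk g k <= 1" "2 <= k ==> qk g k <= 1 / 2"
proof -
 show "0 <= qk g k" by (simp add: qk_def)
 have "g + 1 - k <= Q" using assms by simp
 then have 1: "qk g k <= real Q / real (k * Q)" unfolding qk_def by (intro divide_right_mono) auto
 also have "... = 1 / real k" using Q2 by simp
 finally have k: "qk g k <= 1 / real k" .
 also have "... <= 1" using assms(2) by simp
 finally show "qk g k <= 1" .
 show "qk g k <= 1 / 2" if "2 <= k"
 using k that by (intro order.trans[OF k]) (simp add: divide_simps)
qed

lemma acc_range: "g < Q ==> 1 <= k ==> 0 <= acc g k & acc g k <= 1"
proof (induction g k rule: acc.induct)
 case (1 g k)
 show ?case
 proof (cases "g < k")
 case False
 have q: "0 <= qk g k" "qk g k <= 1" using qk_bounds[of g k] 1 False by auto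
 have i: "0 <= acc g (k + 1)" "acc g (k + 1) <= 1" using 1 False by auto
 have r: "acc g k = qk g k * acc g (k + 1) + (1 - qk g k) * of_bool (odd k)"
 using False by (intro acc_rec) simp
 have "qk g k * acc g (k + 1) + (1 - qk g k) * of_bool (odd k) <= qk g k * 1 + (1 - qk g k) * 1"
 using q i by (intro add_mono mult_left_mono) auto
 then show ?thesis unfolding r using q i by auto
 qed (subst acc.simps, simp)+
qed

text \<open>The first \<open>j\<close> stages all succeed with probability
  \<open>(g choose j) / Q ^ j\<close>. Stopping at an odd stage accepts, so the total acceptance is
  the sum of these with alternating signs, the binomial expansion of \<open>(1 - 1 / Q) ^ g\<close>.
  Here the series is taken from stage \<open>k\<close> on, weighted by the probability of reaching
  it; for even \<open>k\<close> the extra term cancels the leading one.\<close>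

lemma acc_sum:
 "1 <= k ==> k <= g + 1 ==> real (g choose (k - 1)) / real Q ^ (k - 1) * acc g k
 = (\<Sum>j\<in>{k - 1..g}. (- 1) ^ j * (real (g choose j) / real Q ^ j))
 + (if even k then real (g choose (k - 1)) / real Q ^ (k - 1) else 0)"
proof (induction "g + 1 - k" arbitrary: k)
 case 0
 then have "k = g + 1" by simp
 then show ?case by (subst acc.simps) auto
next
 case (Suc m)
 let ?c = "%j. real (g choose j) / real Q ^ j"
 obtain k' where k: "k = Suc k'" using Suc.prems(1) by (cases k) auto
 have kg: "Suc k' <= g" using Suc k by simp
 have "(g choose Suc k') * Suc k' = (g choose k') * (g - k')"
 using binomial_absorb_comp[of g k'] binomial_absorption[of k' "g - 1"] kg
 by (metis Suc_diff_1 add.commute binomial_absorption less_le_trans mult.commute zero_less_Suc)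
 then have "real (g choose Suc k') * real (Suc k') = real (g choose k') * real (g - k')"
 by (metis of_nat_mult)
 note absorb = this
 have cq: "?c k' * qk g k = ?c (Suc k')"
 proof -
 have "?c k' * qk g k = real (g choose k') * real (g - k') / (real (Suc k') * real Q ^ Suc k')"
 by (simp add: qk_def k algebra_simps)
 also have "... = ?c (Suc k')" unfolding absorb[symmetric] by simp
 finally show ?thesis .
 qed
 have ih: "?c (Suc k') * acc g (k + 1) = (\<Sum>j\<in>{Suc k'..g}. (- 1) ^ j * ?c j) + (if even (k + 1) then ?c (Suc k') else 0)"
 using Suc.hyps(1)[of "k + 1"] Suc.hyps(2) kg k by simp
 have "?c k' * acc g k = ?c k' * qk g k * acc g (k + 1) + (?c k' - ?c k' * qk g k) * of_bool (odd k)"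
 using kg k by (subst acc_rec) (auto simp: algebra_simps)
 also have "... = (\<Sum>j\<in>{Suc k'..g}. (- 1) ^ j * ?c j) + (if even (k + 1) then ?c (Suc k') else 0)
 + (?c k' - ?c (Suc k')) * of_bool (odd k)" unfolding cq ih ..
 also have "... = (\<Sum>j\<in>{k'..g}. (- 1) ^ j * ?c j) + (if even k then ?c k' else 0)"
 using kg k by (subst (2) sum.atLeast_Suc_atMost) auto
 finally show ?case using k by simp
qed

lemma acc_1: "acc g 1 = (1 - 1 / real Q) ^ g"
proof -
 have "acc g 1 = (\<Sum>j\<le>g. (- 1) ^ j * (real (g choose j) / real Q ^ j))"
 using acc_sum[of 1 g] by (simp add: atMost_atLeast0)
 also have "... = (\<Sum>j\<le>g. real (g choose j) * (- (1 / real Q)) ^ j * 1 ^ (g - j))"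
 by (intro sum.cong refl) (simp add: power_minus' power_divide power_minus[of "1 / real Q"])
 also have "... = (- (1 / real Q) + 1) ^ g" by (rule binomial_ring[symmetric])
 finally show ?thesis by (simp add: algebra_simps)
qed

text \<open>Averaged over a uniform \<open>g\<close>, a proposal is accepted with probability
  \<open>1 - (1 - 1 / Q) ^ Q\<close>, hence at most 5/6; a rejection ends the block. The proof uses
  that \<open>1 - 1 / Q\<close> is the reciprocal of \<open>1 + 1 / m\<close> with
  \<open>m = Q - 1\<close>.\<close>

lemma no_hit_ge: "1 / 6 <= (1 - 1 / real Q) ^ Q"
proof -
 obtain m where Q: "Q = Suc m" and m: "1 <= m" using Q2 by (cases Q) auto
 have "(1 + 1 / real m) ^ m <= exp (1 / real m) ^ m"
 by (intro power_mono) (auto intro: exp_ge_add_one_self)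
 also have "... = exp 1" using m by (simp add: exp_of_nat_mult[symmetric])
 also have "... <= 3" by (rule exp_le)
 finally have e: "(1 + 1 / real m) ^ m <= 3" .
 have "1 - 1 / real Q = real m / real Q" "1 + 1 / real m = real Q / real m"
 using m Q by (simp_all add: field_simps)
 then have "(1 - 1 / real Q) * (1 + 1 / real m) = 1" using m Q by simp
 then have p: "(1 - 1 / real Q) ^ m * (1 + 1 / real m) ^ m = 1" by (simp add: power_mult_distrib[symmetric])
 have r: "1 / 2 <= 1 - 1 / real Q" using Q2 by (simp add: field_simps)
 have "(1 - 1 / real Q) ^ m * (1 + 1 / real m) ^ m <= (1 - 1 / real Q) ^ m * 3"
 using e r by (intro mult_left_mono) auto
 then have "1 / 3 <= (1 - 1 / real Q) ^ m" using p by simp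
 then have "1 / 2 * (1 / 3) <= (1 - 1 / real Q) * (1 - 1 / real Q) ^ m"
 using r by (intro mult_mono) auto
 then show ?thesis by (simp add: Q)
qed

end

subsection \<open>A potential that does not increase in expectation\<close>

text \<open>\<open>a t h\<close> is the value of having \<open>t\<close> samples left and
  \<open>h\<close> hits, \<open>lam\<close> the price of a machine step, \<open>F\<close> the fuel
  and \<open>Ib\<close> a bound for the mean exploration. Price 0 with a tail probability for
  \<open>a\<close> yields correctness, price \<open>1 / F\<close> with \<open>a = 0\<close> yields
  termination.\<close>

locale potential = rgraph_par +
 fixes F :: nat and lam Ib :: real and a :: "nat => nat => real"
 assumes ne: "nonis ~= {}"
 and lam0: "0 <= lam" and lamF: "lam * F <= 1"
 and a0: "!!t h. 0 <= a t h" and a1: "!!t h. a t h <= 1"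
 and Ib: "(\<Sum>v\<in>nonis. EE (%R. of_bool (good R) * real (its R (start v)))) / card nonis + 2 <= Ib"
 and arec: "!!t h. (let p = (\<Sum>v\<in>nonis. EE (%R. of_bool (good R & ~ alv R N v))) / card nonis
 in p * a t (h + 1) + (1 - p) * a t h) <= a (t + 1) h"
begin

text \<open>The steps paid for one step of \<open>estep\<close>: 1 for leaving \<open>Main\<close>,
  29 for drawing a block, \<open>b + 6\<close> for closing it and reading its list.\<close>

definition wb :: real where "wb = b + 36"

text \<open>A ringing that is not good is valued at the worst: error 1 and every remaining unit of
  fuel charged.\<close>

definition psi :: "nat => nat => nat => ringing => frame list => real" where
 "psi fl t h R fs = (if good R & stops R fs then a t (h + ans R fs) + lam * wb * (real (its R fs) + 1)
 else 1 + lam * wb * real fl)"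

definition cost :: real where "cost = \<eta> * (1 + wb) + lam * wb * Ib"

text \<open>\<open>DV\<close> is the conditional expectation when the cells before \<open>c\<close>
  are revealed, \<open>PV\<close> when moreover cell \<open>c\<close> has just been found to
  ring.\<close>

definition DV :: "nat => mst => nat => real" where
 "DV fl s c = EV (rp (KD (mX s) (fst (hd (mfr s))) c) (Rg (mG s)))
 (%R. psi fl (mleft s - 1) (mhits s) R (estep R (mfr s)))"

definition PV :: "nat => mst => nat => real" where
 "PV fl s c = (let u = fst (hd (mfr s)) in
 if c < CC u then EV (rp (KD (mX s) u (c + 1)) (Rg (pushG (mX s) u c (mG s))))
 (%R. psi fl (mleft s - 1) (mhits s) R (estep R (mfr s)))
 else DV fl s (CC u))"

text \<open>The sum of the steps already paid, the later samples at \<open>cost\<close> each, the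
  conditional value of the current sample, and the expected steps left in the current block. The 30
  weighted by \<open>acc\<close> is what \<open>Push\<close> needs after an acceptance; 3 and 2 pay
  for the stages of \<open>Fact\<close>.\<close>

definition Psi :: "nat => mst => real" where
 "Psi fl s = lam * (real F - real fl) + (case md s of
 Pick => a (mleft s) (mhits s) + mleft s * cost
 | Main => (real (mleft s) - 1) * cost + EV (rp (KX (mX s)) (Rg (mG s)))
 (%R. psi fl (mleft s - 1) (mhits s) R (mfr s))
 | Draw c => (real (mleft s) - 1) * cost + lam * ((if c < CC (fst (hd (mfr s))) then 29 else 0) + b + 6) + DV fl s c
 | Fact c g k => (real (mleft s) - 1) * cost
 + lam * ((if k = 1 then 3 else 2) + 30 * acc g k + b + 6)
 + (acc g k * PV fl s (c + g) + (1 - acc g k) * DV fl s (CC (fst (hd (mfr s)))))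
 | Push c => (real (mleft s) - 1) * cost + lam * (30 + b + 6) + PV fl s c
 | Scan j bt bw => (real (mleft s) - 1) * cost + lam * real (b + 5 - j)
 + EV (rp (KX (mX s)) (Rg (mG s)))
 (%R. psi fl (mleft s - 1) (mhits s) R (estep R (mfr s))))"

lemma wb1: "1 <= wb" by (simp add: wb_def)

lemma lamwb0: "0 <= lam * wb" using lam0 wb1 by simp

lemma eta0: "0 <= \<eta>" unfolding \<eta>_def by (intro add_nonneg_nonneg mult_nonneg_nonneg divide_nonneg_nonneg) auto

lemma cost0: "0 <= cost"
proof -
 have "0 <= (\<Sum>v\<in>nonis. EE (%R. of_bool (good R) * real (its R (start v)))) / card nonis"
 by (intro divide_nonneg_nonneg sum_nonneg E_nonneg) auto
 then have "0 <= Ib" using Ib by simp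
 then show ?thesis unfolding cost_def using eta0 wb1 lamwb0 by simp
qed

lemma psi0: "0 <= psi fl t h R fs"
 unfolding psi_def using a0[of t "h + ans R fs"] lamwb0 by (auto intro!: add_nonneg_nonneg mult_nonneg_nonneg)

lemma psi_mono: "psi (fl - 1) t h R fs <= psi fl t h R fs"
 unfolding psi_def using lamwb0 by (auto intro!: mult_left_mono)

lemma psi_step:
 assumes "2 <= length fs" "1 <= fl"
 shows "psi (fl - 1) t h R (estep R fs) + lam * wb = psi fl t h R fs"
 using stops_step[OF assms(1), of R] its_step[OF assms(1), of R] assms(2)
 by (auto simp: psi_def of_nat_diff algebra_simps)

lemma psi_bad: "~ good R ==> 1 <= fl ==> psi (fl - 1) t h R fs' + lam * wb = psi fl t h R fs"
 by (auto simp: psi_def of_nat_diff algebra_simps)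

lemma E_shift:
 fixes f g :: "ringing => real"
 assumes "!!R. R \<in> set_pmf (rp K G) ==> f R + c <= g R"
 shows "EV (rp K G) f + c <= EV (rp K G) g"
proof -
 have "EV (rp K G) f + c = EV (rp K G) (%R. f R + c)"
 using E_add[OF finite_rp, of K G f "%_. c"] by simp
 also have "... <= EV (rp K G) g" by (rule E_mono) (use assms in auto)
 finally show ?thesis .
qed

lemma DV_mono: "DV (fl - 1) s c <= DV fl s c"
 unfolding DV_def by (intro E_mono psi_mono finite_rp)

lemma PV_mono: "PV (fl - 1) s c <= PV fl s c"
 unfolding PV_def Let_def by (auto intro!: E_mono psi_mono[simplified] DV_mono[simplified])

lemma DV_ge: "CC (fst (hd (mfr s))) <= c ==> DV fl s c = DV fl s (CC (fst (hd (mfr s))))"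
proof -
 assume "CC (fst (hd (mfr s))) <= c"
 then have "KD (mX s) (fst (hd (mfr s))) c = KD (mX s) (fst (hd (mfr s))) (CC (fst (hd (mfr s))))"
 by (auto simp: KD_def)
 then show ?thesis by (simp add: DV_def)
qed

text \<open>The weight \<open>(1 / Q) * (1 - 1 / Q) ^ g\<close> is a uniform proposal followed by
  acceptance. A rejected proposal and a gap reaching beyond the block both mean that the block holds
  no further ring.\<close>

lemma DV_split:
 assumes "fst (hd (mfr s)) = u" "u \<in> nonis" "mX s u < N" "Rg (mG s) \<subseteq> KD (mX s) u c" "c < CC u"
 shows "DV fl s c = (\<Sum>g<Q. (1 / real Q) * ((1 - 1 / real Q) ^ g * PV fl s (c + g) + (1 - (1 - 1 / real Q) ^ g) * DV fl s (CC u)))"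
proof -
 let ?r = "1 - 1 / real Q" and ?d = "DV fl s (CC u)"
 define m where "m = CC u - c"
 have mQ: "m <= Q" using nonis_len[OF assms(2)] unfolding m_def by linarith
 have geo: "(\<Sum>g\<in>{i..<j}. (1 / real Q) * ?r ^ g) = ?r ^ i - ?r ^ j" if "i <= j" for i j
 using that
 proof (induction j rule: dec_induct)
 case (step j)
 then show ?case by (simp add: algebra_simps)
 qed simp
 have "DV fl s c = (\<Sum>g<m. (1 / real Q) * ?r ^ g * PV fl s (c + g)) + ?r ^ m * ?d"
 proof -
 have "DV fl s c = (\<Sum>g<m. (1 / real Q) * ?r ^ g * EV
 (rp (KD (mX s) u (c + g + 1)) (Rg (pushG (mX s) u (c + g) (mG s))))
 (%R. psi fl (mleft s - 1) (mhits s) R (estep R (mfr s)))) + ?r ^ m * ?d"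
 unfolding DV_def assms(1) using assms by (intro reveal_next) (auto simp: m_def)
 also have "(\<Sum>g<m. (1 / real Q) * ?r ^ g * EV
 (rp (KD (mX s) u (c + g + 1)) (Rg (pushG (mX s) u (c + g) (mG s))))
 (%R. psi fl (mleft s - 1) (mhits s) R (estep R (mfr s)))) = (\<Sum>g<m. (1 / real Q) * ?r ^ g * PV fl s (c + g))"
 by (intro sum.cong refl) (auto simp: PV_def assms(1) m_def)
 finally show ?thesis .
 qed
 moreover have "(\<Sum>g<Q. (1 / real Q) * (?r ^ g * PV fl s (c + g) + (1 - ?r ^ g) * ?d))
 = (\<Sum>g<m. (1 / real Q) * ?r ^ g * PV fl s (c + g)) + ?r ^ m * ?d"
 proof -
 have "(\<Sum>g<Q. (1 / real Q) * (?r ^ g * PV fl s (c + g) + (1 - ?r ^ g) * ?d))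
 = (\<Sum>g<Q. (1 / real Q) * ?r ^ g * PV fl s (c + g)) + (\<Sum>g<Q. 1 / real Q) * ?d - (\<Sum>g<Q. (1 / real Q) * ?r ^ g) * ?d"
 unfolding sum_distrib_right sum.distrib[symmetric] sum_subtractf[symmetric]
 by (intro sum.cong refl) (simp add: algebra_simps)
 also have "(\<Sum>g<Q. 1 / real Q) = 1" using Q2 by simp
 also have "(\<Sum>g<Q. (1 / real Q) * ?r ^ g) = 1 - ?r ^ Q" using geo[of 0 Q] by (simp add: lessThan_atLeast0)
 also have "(\<Sum>g<Q. (1 / real Q) * ?r ^ g * PV fl s (c + g))
 = (\<Sum>g<m. (1 / real Q) * ?r ^ g * PV fl s (c + g)) + (\<Sum>g\<in>{m..<Q}. (1 / real Q) * ?r ^ g * PV fl s (c + g))"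
 proof -
 have "{..<Q} = {..<m} \<union> {m..<Q}" using mQ by auto
 then show ?thesis by (simp add: sum.union_disjoint ivl_disj_int)
 qed
 also have "(\<Sum>g\<in>{m..<Q}. (1 / real Q) * ?r ^ g * PV fl s (c + g)) = (\<Sum>g\<in>{m..<Q}. (1 / real Q) * ?r ^ g) * ?d"
 unfolding sum_distrib_right by (intro sum.cong refl) (auto simp: PV_def assms(1) m_def)
 also have "(\<Sum>g\<in>{m..<Q}. (1 / real Q) * ?r ^ g) = ?r ^ m - ?r ^ Q" by (rule geo[OF mQ])
 finally show ?thesis by (simp add: algebra_simps)
 qed
 ultimately show ?thesis by simp
qed

end


lemma set_unif: "0 < m ==> set_pmf (pmf_of_set {..<m::nat}) = {..<m}"
 by (rule set_pmf_of_set) auto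

context rgraph_par
begin

lemma finite_mstep: "nonis ~= {} ==> minv s ==> finite (set_pmf (mstep s))"
proof -
 assume ne: "nonis ~= {}" and "minv s"
 have "length VL ~= 0" using ne VL_facts(1) by auto
 moreover have "0 < k * Q" if "md s = Fact c g k" for c g k
 using \<open>minv s\<close> that Q2 by (cases "hd (mfr s)") (auto simp: minv_def Let_def)
 ultimately show ?thesis unfolding mstep_def using Q2
 by (auto simp: Let_def set_unif split: mode.splits prod.splits)
qed

lemma minv_step:
 assumes inv: "minv s" and s': "s' \<in> set_pmf (mstep s)" and ne: "nonis ~= {}"
 shows "minv s'"
proof (cases "md s")
 case Pick
 have L0: "length VL ~= 0" using ne VL_facts(1) by auto
 show ?thesis
 proof (cases "mleft s = 0")
 case True
 then show ?thesis using s' Pick inv by (simp add: mstep_def Let_def split: prod.splits)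
 next
 case False
 then obtain i where i: "i < length VL" "s' = s\<lparr>mfr := start (VL ! i), mX := (%_. 0), mG := [], md := Main\<rparr>"
 using s' Pick set_unif[of "length VL"] L0 by (auto simp: mstep_def Let_def split: prod.splits)
 have "VL ! i \<in> nonis" using i VL_facts(1) nth_mem by blast
 then show ?thesis using i False by (auto simp: minv_def Let_def finv_def start_def ginv_def Rg_def)
 qed
next
 case Main
 obtain u t c0 where h: "hd (mfr s) = (u, t, c0)" by (metis surj_pair)
 have I: "1 <= mleft s" "finv (mX s) (mfr s)" "ginv (KX (mX s)) (mG s)"
 using inv Main h by (auto simp: minv_def Let_def)
 show ?thesis
 proof (cases "length (mfr s) <= 1")
 case True
 then show ?thesis using s' Main by (auto simp: mstep_def Let_def minv_def split: prod.splits)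
 next
 case len: False
 show ?thesis
 proof (cases "t <= c0")
 case True
 then have "s' = s\<lparr>mfr := drop 2 (mfr s)\<rparr>" using s' Main len h by (simp add: mstep_def)
 then show ?thesis using I finv_drop2 Main by (auto simp: minv_def Let_def split: prod.splits)
 next
 case tc: False
 have top: "topinv s" using len tc h by (auto simp: topinv_def)
 from top I(2) have c0: "c0 <= mX s u" by (rule topinvE) (use h in auto)
 show ?thesis
 proof (cases "mX s u <= c0")
 case True
 then have "s' = s\<lparr>md := Draw 0\<rparr>" using s' Main len tc h by (simp add: mstep_def)
 then show ?thesis using I c0 True top h by (simp add: minv_def Let_def KD_0 topinv_def)
 next
 case False
 then have "s' = s\<lparr>md := Scan 0 t 0\<rparr>" using s' Main len tc h by (simp add: mstep_def)
 then show ?thesis using I False top h by (simp add: minv_def Let_def topinv_def scanl_def)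
 qed
 qed
 qed
next
 case (Draw c)
 obtain u t c0 where h: "hd (mfr s) = (u, t, c0)" by (metis surj_pair)
 have I: "1 <= mleft s" "finv (mX s) (mfr s)" "ginv (KD (mX s) u c) (mG s)" "topinv s" "mX s u = c0"
 using inv Draw h by (auto simp: minv_def Let_def)
 from I(4,2) have u: "u \<in> nonis" "c0 < t" by (rule topinvE, use h in auto)+
 show ?thesis
 proof (cases "c < CC u")
 case True
 then obtain g where "g < Q" "s' = s\<lparr>md := Fact c g 1\<rparr>"
 using s' Draw h Q2 by (auto simp: mstep_def Let_def set_unif)
 then show ?thesis using I h True by (simp add: minv_def Let_def topinv_def)
 next
 case False
 then have s'e: "s' = s\<lparr>mX := (mX s)(u := mX s u + len u), md := Scan 0 t 0\<rparr>"
 using s' Draw h by (simp add: mstep_def)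
 have l: "0 < len u" using nonis_len[OF u(1)] by simp
 have f: "finv ((mX s)(u := mX s u + len u)) (mfr s)"
 using I(2) unfolding finv_def by (auto simp: trans_le_add1)
 have g: "ginv (KX ((mX s)(u := mX s u + len u))) (mG s)"
 by (rule ginv_mono[OF I(3)]) (use KD_final[OF u(1), of c "mX s"] False in auto)
 show ?thesis unfolding s'e using I f g h l by (simp add: minv_def Let_def topinv_def scanl_def)
 qed
next
 case (Fact c g k)
 obtain u t c0 where h: "hd (mfr s) = (u, t, c0)" by (metis surj_pair)
 have I: "1 <= mleft s" "finv (mX s) (mfr s)" "ginv (KD (mX s) u c) (mG s)" "topinv s" "mX s u = c0"
 "c < CC u" "g < Q" "1 <= k" "k <= g + 1"
 using inv Fact h by (auto simp: minv_def Let_def)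
 have "k * Q ~= 0" using I(8) Q2 by simp
 then obtain x where x: "s' = s\<lparr>md := if x + k <= g then Fact c g (k + 1)
 else if odd k then Push (c + g) else Draw (CC u)\<rparr>"
 using s' Fact h by (auto simp: mstep_def Let_def)
 have m: "ginv (KD (mX s) u c') (mG s)" if "c <= c'" for c'
 using ginv_mono[OF I(3)] KD_mono[OF that, of "mX s" u] by blast
 consider "x + k <= g" | "~ x + k <= g" "odd k" | "~ x + k <= g" "even k" by blast
 then show ?thesis
 proof cases
 case 1
 then show ?thesis using x I h by (simp add: minv_def Let_def topinv_def)
 next
 case 2
 then show ?thesis using x I h m[of "c + g"] by (simp add: minv_def Let_def topinv_def)
 next
 case 3
 then show ?thesis using x I h m[of "CC u"] by (simp add: minv_def Let_def topinv_def)
 qed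
next
 case (Push c)
 obtain u t c0 where h: "hd (mfr s) = (u, t, c0)" by (metis surj_pair)
 have I: "1 <= mleft s" "finv (mX s) (mfr s)" "ginv (KD (mX s) u c) (mG s)" "topinv s" "mX s u = c0"
 using inv Push h by (auto simp: minv_def Let_def)
 from I(4,2) have u: "u \<in> nonis" "c0 < t" "t <= N" by (rule topinvE, use h in auto)+
 show ?thesis
 proof (cases "c < CC u")
 case True
 then have s'e: "s' = s\<lparr>mG := pushG (mX s) u c (mG s), md := Draw (c + 1)\<rparr>"
 using s' Push h by (simp add: mstep_def)
 have x: "mX s u < N" using u I(5) by simp
 have ins: "KD (mX s) u (c + 1) = insert (xc (mX s) u c) (KD (mX s) u c)"
 using True by (auto simp: KD_def less_Suc_eq)
 have "ginv (KD (mX s) u (c + 1)) (pushG (mX s) u c (mG s))"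
 proof (cases "mt (mX s) u c < mX s (mw u c)")
 case True
 then show ?thesis using ginv_mono[OF I(3), of "KD (mX s) u (c + 1)"] ins by (auto simp: pushG_def)
 next
 case False
 have nk: "xc (mX s) u c \<notin> KD (mX s) u c"
 proof
 assume "xc (mX s) u c \<in> KD (mX s) u c"
 then consider "xc (mX s) u c \<in> KX (mX s)" | c' where "c' < c" "xc (mX s) u c = xc (mX s) u c'"
 by (auto simp: KD_def)
 then show False
 proof cases
 case 1
 then show ?thesis using False by (auto simp: KX_def xc_def mt_def)
 next
 case 2
 then show ?thesis using xc_inj[OF u(1) True, of c' "mX s"] True by simp
 qed
 qed
 have "distinct (map (%(a, w, \<tau>). ({a, w}, \<tau>)) (pushG (mX s) u c (mG s)))"
 using I(3) nk False unfolding ginv_def Rg_def by (auto simp: pushG_def xc_def)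
 moreover have "Rg (pushG (mX s) u c (mG s)) = insert (xc (mX s) u c) (Rg (mG s))"
 using False by (simp add: Rg_push)
 ultimately show ?thesis using I(3) ins xc_cells(1)[of u c "mX s", OF u(1) True x]
 unfolding ginv_def by auto
 qed
 then show ?thesis unfolding s'e using I h by (simp add: minv_def Let_def topinv_def)
 next
 case False
 then have "s' = s\<lparr>md := Draw c\<rparr>" using s' Push h by (simp add: mstep_def)
 then show ?thesis using I h by (simp add: minv_def Let_def topinv_def)
 qed
next
 case (Scan j bt bw)
 obtain u t c0 where h: "hd (mfr s) = (u, t, c0)" by (metis surj_pair)
 let ?L = "bucket (mG s) u (c0 div len u)"
 have I: "1 <= mleft s" "finv (mX s) (mfr s)" "ginv (KX (mX s)) (mG s)" "topinv s" "c0 < mX s u"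
 "j <= length ?L" "scanl c0 t (take j ?L) = (bt, bw)"
 using inv Scan h by (auto simp: minv_def Let_def)
 obtain y r where fr: "mfr s = (u, t, c0) # y # r" "u \<in> nonis" "t <= N" "c0 < t"
 using I(4,2) by (rule topinvE) (use h in auto)
 have dv: "len u dvd mX s u" using I(2) fr(2) by (simp add: finv_def)
 show ?thesis
 proof (cases "j < length ?L")
 case True
 obtain bt' bw' where b': "scanf c0 (bt, bw) (?L ! j) = (bt', bw')" by (metis surj_pair)
 have "s' = s\<lparr>md := Scan (j + 1) bt' bw'\<rparr>" using s' Scan h True b' by (simp add: mstep_def)
 moreover have "scanl c0 t (take (j + 1) ?L) = (bt', bw')"
 using I(7) True b' by (simp add: scanl_def take_Suc_conv_app_nth)
 ultimately show ?thesis using I h True by (simp add: minv_def Let_def topinv_def)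
 next
 case False
 then have sc: "scanl c0 t ?L = (bt, bw)" using I(6,7) by simp
 let ?fr = "if bt < t then (bw, bt, 0) # (u, t, bt + 1) # tl (mfr s)
 else (u, t, (c0 div len u + 1) * len u) # tl (mfr s)"
 have s'e: "s' = s\<lparr>mfr := ?fr, md := Main\<rparr>" using s' Scan h False by (simp add: mstep_def)
 have nb: "(c0 div len u + 1) * len u <= mX s u" by (rule next_block[OF fr(2) dv I(5)])
 have rest: "\<forall>f\<in>set (butlast (y # r)). fst f \<in> nonis & fst (snd f) <= N & snd (snd f) <= mX s (fst f)"
 using I(2) fr(1) by (simp add: finv_def)
 have "finv (mX s) ?fr"
 proof (cases "bt < t")
 case True
 then have m: "(bt, bw) \<in> set ?L" using scanl_spec[OF sc] by simp
 have sub: "Rg (mG s) \<subseteq> cells" using I(3) by (simp add: ginv_def)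
 have mm: "({u, bw}, bt) \<in> Rg (mG s)" "bt div len u = c0 div len u" using m bucket_mem[OF sub] by auto
 then have e: "{u, bw} \<in> E" using sub by (auto simp: cells_def)
 then have "u \<in> set (adj bw)" "bw < n" using edgeD[OF e] set_adj[of bw u] by (auto simp: insert_commute)
 then have bw: "bw \<in> nonis" by (auto simp: nonis_def deg_def)
 have "bt < (bt div len u + 1) * len u" using nonis_len[OF fr(2)] less_next_block[of "len u" bt] by simp
 then have "bt + 1 <= mX s u" using nb mm(2) by simp
 then show ?thesis using True fr rest bw I(2) by (simp add: finv_def)
 next
 case False
 then show ?thesis using fr rest nb I(2) by (simp add: finv_def)
 qed
 then show ?thesis unfolding s'e using I(1,3) by (simp add: minv_def Let_def split: prod.splits)
 qed
qed

end

context potential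
begin

lemma fact_expectation:
 assumes "g < Q" "1 <= k" "k <= g + 1"
 shows "EV (pmf_of_set {..<k * Q}) (%x. if x + k <= g then A else B)
 = qk g k * A + (1 - qk g k) * (B :: real)"
proof -
 have kQ: "0 < k * Q" using assms Q2 by simp
 have sub: "{x\<in>{..<k * Q}. x + k <= g} = {..<g + 1 - k}"
 proof -
 have "g + 1 - k <= k * Q" using assms by (cases k) auto
 then show ?thesis by auto
 qed
 have "(\<Sum>x<k * Q. if x + k <= g then A else B)
 = (\<Sum>x<k * Q. B + (if x + k <= g then A - B else 0))" by (intro sum.cong) auto
 also have "... = real (k * Q) * B + (\<Sum>x\<in>{x\<in>{..<k * Q}. x + k <= g}. A - B)"
 unfolding sum.distrib sum.inter_filter[OF finite_lessThan] by (simp only: sum_constant card_lessThan)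
 also have "... = real (k * Q) * B + real (g + 1 - k) * (A - B)" unfolding sub by simp
 finally show ?thesis using kQ
 by (subst E_unif[OF kQ]) (simp add: qk_def divide_simps, simp add: algebra_simps)
qed

text \<open>One machine step spends a unit of fuel, worth \<open>lam\<close>; in every mode the rest
  of the potential drops by at least that much on average, so \<open>Psi\<close> is a
  supermartingale.\<close>

lemma mstep_super:
 assumes inv: "minv s" and fl: "1 <= fl" "fl <= F" and nd: "~ (md s = Pick & mleft s = 0)"
 shows "EV (mstep s) (Psi (fl - 1)) <= Psi fl s"
proof (cases "md s")
 case Pick
 then have l: "1 <= mleft s" using nd by simp
 then obtain t where t: "mleft s = Suc t" by (cases "mleft s") auto
 let ?n = "real (card nonis)"
 have n0: "0 < ?n" using ne by (simp add: card_gt_0_iff)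
 have V0: "0 < length VL" using n0 VL_facts(3) by simp
 have fl1: "real F - real (fl - 1) = real F - real fl + 1" using fl by simp
 have st: "mstep s = map_pmf (%i. s\<lparr>mfr := start (VL ! i), mX := (%_. 0), mG := [], md := Main\<rparr>) (pmf_of_set {..<length VL})"
 using Pick t by (simp add: mstep_def split: prod.splits)
 define g where "g v = EE (%R. psi (fl - 1) t (mhits s) R (start v))" for v
 have K0: "KX (%_. 0) = {}" "Rg [] = {}" by (auto simp: KX_def Rg_def)
 have "EV (mstep s) (Psi (fl - 1))
 = (\<Sum>i<length VL. lam * (real F - real (fl - 1)) + (real t * cost + g (VL ! i))) / length VL"
 unfolding st integral_map_pmf E_unif[OF V0] using t by (simp add: Psi_def g_def K0)
 also have "... = lam * (real F - real fl + 1) + real t * cost + (\<Sum>i<length VL. g (VL ! i)) / length VL"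
 using V0 unfolding fl1 by (simp add: sum.distrib add_divide_distrib)
 also have "(\<Sum>i<length VL. g (VL ! i)) = (\<Sum>v\<in>nonis. g v)"
 using sum.distinct_set_conv_list[OF VL_facts(2), of g] VL_facts(1) by (simp add: sum_list_sum_nth lessThan_atLeast0)
 finally have 1: "EV (mstep s) (Psi (fl - 1))
 = lam * (real F - real fl + 1) + real t * cost + (\<Sum>v\<in>nonis. g v) / ?n" by (simp add: VL_facts(3))
 let ?a0 = "a t (mhits s)" and ?a1 = "a t (mhits s + 1)"
 define G where "G v = EE (%R. of_bool (good R & ~ alv R N v))" for v
 define J where "J v = EE (%R. of_bool (good R) * real (its R (start v)))" for v
 have gv: "g v <= (1 - G v) * ?a0 + G v * ?a1 + lam * wb * J v + lam * wb + \<eta> * (1 + wb)"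
 if v: "v \<in> nonis" for v
 proof -
 have "g v <= EE (%R. ?a0 + (?a1 - ?a0) * of_bool (good R & ~ alv R N v)
 + lam * wb * (of_bool (good R) * real (its R (start v))) + lam * wb + (1 + wb) * of_bool (~ good R))"
 unfolding g_def
 proof (rule E_mono, simp)
 fix R assume R: "R \<in> Om"
 show "psi (fl - 1) t (mhits s) R (start v) <= ?a0 + (?a1 - ?a0) * of_bool (good R & ~ alv R N v)
 + lam * wb * (of_bool (good R) * real (its R (start v))) + lam * wb + (1 + wb) * of_bool (~ good R)"
 proof (cases "good R")
 case True
 have "stops R (start v)" "ans R (start v) = (if alv R N v then 0 else 1)"
 using resolve_start[OF R True] v by (auto simp: nonis_def)
 then show ?thesis using True by (auto simp: psi_def algebra_simps)
 next
 case False
 \<comment> \<open>As \<open>lam * F <= 1\<close>, even a bad ringing costs at most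
   \<open>1 + wb\<close>, the factor of \<open>\<eta>\<close> in \<open>cost\<close>.\<close>
 have "lam * real (fl - 1) <= 1"
 using lamF mult_left_mono[OF _ lam0, of "real (fl - 1)" "real F"] fl by simp
 then have "lam * real (fl - 1) * wb <= 1 * wb" using wb1 by (intro mult_right_mono) auto
 then show ?thesis using False a0[of t "mhits s"] lamwb0 by (simp add: psi_def mult_ac)
 qed
 qed
 also have "... = ?a0 + (?a1 - ?a0) * G v + lam * wb * J v + lam * wb + (1 + wb) * EE (%R. of_bool (~ good R))"
 unfolding G_def J_def by (simp add: E_add)
 also have "... <= ?a0 + (?a1 - ?a0) * G v + lam * wb * J v + lam * wb + (1 + wb) * \<eta>"
 using prob_bad wb1 by (intro add_left_mono mult_left_mono) auto
 finally show ?thesis by (simp add: algebra_simps)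
 qed
 have "(\<Sum>v\<in>nonis. g v) <= (\<Sum>v\<in>nonis. (1 - G v) * ?a0 + G v * ?a1 + lam * wb * J v + lam * wb + \<eta> * (1 + wb))"
 by (intro sum_mono gv)
 also have "... = (?n - sum G nonis) * ?a0 + sum G nonis * ?a1 + lam * wb * sum J nonis + ?n * (lam * wb + \<eta> * (1 + wb))"
 by (simp add: sum.distrib sum_subtractf sum_distrib_right sum_distrib_left algebra_simps)
 finally have "(\<Sum>v\<in>nonis. g v) / ?n <= ((?n - sum G nonis) * ?a0 + sum G nonis * ?a1 + lam * wb * sum J nonis
 + ?n * (lam * wb + \<eta> * (1 + wb))) / ?n" using n0 by (intro divide_right_mono) auto
 also have "... = ((sum G nonis / ?n) * ?a1 + (1 - sum G nonis / ?n) * ?a0) + lam * wb * (sum J nonis / ?n + 1) + \<eta> * (1 + wb)"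
 using n0 ne by (simp add: add_divide_distrib diff_divide_distrib left_diff_distrib ring_distribs)
 also have "... <= a (t + 1) (mhits s) + lam * wb * (sum J nonis / ?n + 1) + \<eta> * (1 + wb)"
 using arec[of t "mhits s"] unfolding G_def Let_def by (intro add_right_mono) simp
 \<comment> \<open>Of the summand 2 in the assumption on \<open>Ib\<close>, one unit is the 1 in
   \<open>psi\<close>, the other pays for the present step.\<close>
 also have "... <= a (t + 1) (mhits s) + lam * wb * (Ib - 1) + \<eta> * (1 + wb)"
 using Ib lamwb0 unfolding J_def by (intro add_right_mono add_left_mono mult_left_mono) auto
 finally have 2: "(\<Sum>v\<in>nonis. g v) / ?n <= a (t + 1) (mhits s) + lam * wb * (Ib - 1) + \<eta> * (1 + wb)" .
 have "lam <= lam * wb" using wb1 lam0 by (simp add: mult_le_cancel_left1)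
 moreover have "Psi fl s = lam * (real F - real fl) + a (t + 1) (mhits s) + (real t + 1) * cost"
 using Pick t by (simp add: Psi_def)
 ultimately show ?thesis unfolding 1 using 2 by (simp add: cost_def algebra_simps)
next
 case Main
 obtain u t c0 where h: "hd (mfr s) = (u, t, c0)" by (metis surj_pair)
 have fl1: "lam * (real F - real (fl - 1)) = lam * (real F - real fl) + lam" using fl by (simp add: algebra_simps)
 have lw: "lam <= lam * wb" using wb1 lam0 by (simp add: mult_le_cancel_left1)
 have l1: "1 <= mleft s" using inv Main by (simp add: minv_def Let_def)
 let ?rp = "rp (KX (mX s)) (Rg (mG s))"
 have step: "EV ?rp (%R. psi (fl - 1) (mleft s - 1) (mhits s) R (estep R (mfr s))) + lam * wb
 <= EV ?rp (%R. psi fl (mleft s - 1) (mhits s) R (mfr s))" if "~ length (mfr s) <= 1"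
 by (rule E_shift) (use psi_step[of "mfr s" fl] that fl in auto)
 show ?thesis
 proof (cases "length (mfr s) <= 1")
 case True
 have "EV ?rp (%R. a (mleft s - 1) (mhits s + length (mfr s))) + lam * wb
 <= EV ?rp (%R. psi fl (mleft s - 1) (mhits s) R (mfr s))"
 proof (rule E_shift)
 fix R
 have "lam * wb * 1 <= lam * wb * real fl" using fl lamwb0 by (intro mult_left_mono) auto
 then show "a (mleft s - 1) (mhits s + length (mfr s)) + lam * wb <= psi fl (mleft s - 1) (mhits s) R (mfr s)"
 using stops_done[OF True, of R] a1[of "mleft s - 1" "mhits s + length (mfr s)"] by (auto simp: psi_def)
 qed
 then show ?thesis using Main True l1 lw fl1 by (simp add: mstep_def Psi_def of_nat_diff split: prod.splits)
 next
 case len: False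
 show ?thesis
 proof (cases "t <= c0")
 case True
 obtain y r where "mfr s = (u, t, c0) # y # r" using len h by (cases "mfr s"; cases "tl (mfr s)") auto
 then have e: "estep R (mfr s) = drop 2 (mfr s)" for R using True by simp
 show ?thesis using step[OF len] Main True len h lw fl1 by (simp add: mstep_def Psi_def e)
 next
 case tc: False
 show ?thesis
 proof (cases "mX s u <= c0")
 case True
 have "lam * (1 + ((if 0 < CC u then 29 else 0) + b + 6)) <= lam * wb"
 using lam0 by (intro mult_left_mono) (auto simp: wb_def)
 then show ?thesis using step[OF len] Main tc len h True fl1
 by (simp add: mstep_def Psi_def DV_def KD_0 algebra_simps)
 next
 case False
 have "lam * (1 + real (b + 5)) <= lam * wb" using lam0 by (intro mult_left_mono) (auto simp: wb_def)
 then show ?thesis using step[OF len] Main tc len h False fl1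
 by (simp add: mstep_def Psi_def algebra_simps)
 qed
 qed
 qed
next
 case (Draw c)
 obtain u t c0 where h: "hd (mfr s) = (u, t, c0)" by (metis surj_pair)
 have fl1: "lam * (real F - real (fl - 1)) = lam * (real F - real fl) + lam" using fl by (simp add: algebra_simps)
 have I: "finv (mX s) (mfr s)" "ginv (KD (mX s) u c) (mG s)" "topinv s" "mX s u = c0"
 using inv Draw h by (auto simp: minv_def Let_def)
 from I(3,1) have u: "u \<in> nonis" "c0 < t" "t <= N" by (rule topinvE, use h in auto)+
 show ?thesis
 proof (cases "c < CC u")
 case True
 let ?r = "1 - 1 / real Q"
 have Q0: "0 < Q" using Q2 by simp
 define base where "base = lam * (real F - real fl) + lam + (real (mleft s) - 1) * cost"
 have pv: "Psi (fl - 1) (s\<lparr>md := Fact c g 1\<rparr>) = (base + lam * (3 + b + 6)) + lam * 30 * ?r ^ g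
 + (?r ^ g * PV (fl - 1) s (c + g) + (1 - ?r ^ g) * DV (fl - 1) s (CC u))" for g
 proof -
 have "PV (fl - 1) (s\<lparr>md := Fact c g 1\<rparr>) x = PV (fl - 1) s x" "DV (fl - 1) (s\<lparr>md := Fact c g 1\<rparr>) x = DV (fl - 1) s x" for x
 by (simp_all add: PV_def DV_def Let_def)
 then show ?thesis unfolding Psi_def fl1 base_def using h by (simp add: acc_1[simplified] algebra_simps)
 qed
 have "EV (mstep s) (Psi (fl - 1)) = (\<Sum>g<Q. Psi (fl - 1) (s\<lparr>md := Fact c g 1\<rparr>)) / real Q"
 using Draw True h by (simp add: mstep_def E_unif[OF Q0])
 also have "... = base + lam * (3 + b + 6) + lam * 30 * ((\<Sum>g<Q. ?r ^ g) / real Q)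
 + (\<Sum>g<Q. (1 / real Q) * (?r ^ g * PV (fl - 1) s (c + g) + (1 - ?r ^ g) * DV (fl - 1) s (CC u)))"
 proof -
 have "(\<Sum>g<Q. (1 / real Q) * (?r ^ g * PV (fl - 1) s (c + g) + (1 - ?r ^ g) * DV (fl - 1) s (CC u)))
 = (\<Sum>g<Q. ?r ^ g * PV (fl - 1) s (c + g) + (1 - ?r ^ g) * DV (fl - 1) s (CC u)) / real Q"
 by (simp add: sum_divide_distrib)
 then show ?thesis unfolding pv using Q0
 by (simp only: sum.distrib sum_distrib_left[symmetric] add_divide_distrib) simp
 qed
 also have "(\<Sum>g<Q. (1 / real Q) * (?r ^ g * PV (fl - 1) s (c + g) + (1 - ?r ^ g) * DV (fl - 1) s (CC u))) = DV (fl - 1) s c"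
 by (rule DV_split[symmetric]) (use h u I True in \<open>auto simp: ginv_def\<close>)
 also have "(\<Sum>g<Q. ?r ^ g) / real Q = 1 - ?r ^ Q"
 using Q2 by (simp add: sum_gp_strict)
 \<comment> \<open>1 + 3 + 30 * 5/6 = 29: the step itself, the first stage, and the averaged payment
   for an acceptance.\<close>
 also have "base + lam * (3 + b + 6) + lam * 30 * (1 - ?r ^ Q) + DV (fl - 1) s c
 <= base + lam * (3 + b + 6) + lam * 30 * (5 / 6) + DV fl s c"
 using no_hit_ge lam0 DV_mono[of fl s c] by (intro add_mono mult_left_mono) auto
 also have "... = Psi fl s" using Draw True h by (simp add: Psi_def base_def algebra_simps)
 finally show ?thesis .
 next
 case False
 let ?X = "(mX s)(u := mX s u + len u)"
 have K: "KD (mX s) u c \<inter> cells = KX ?X \<inter> cells" using False by (intro KD_final u) simp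
 have r: "rp (KX ?X) (Rg (mG s)) = rp (KD (mX s) u c) (Rg (mG s))"
 by (rule rp_cong) (use K in blast)+
 have "EV (rp (KX ?X) (Rg (mG s))) (%R. psi (fl - 1) (mleft s - 1) (mhits s) R (estep R (mfr s))) <= DV fl s c"
 unfolding r using DV_mono[of fl s c] h by (simp add: DV_def)
 then show ?thesis using Draw False h fl1 by (simp add: mstep_def Psi_def algebra_simps)
 qed
next
 case (Fact c g k)
 obtain u t c0 where h: "hd (mfr s) = (u, t, c0)" by (metis surj_pair)
 have fl1: "lam * (real F - real (fl - 1)) = lam * (real F - real fl) + lam" using fl by (simp add: algebra_simps)
 have I: "c < CC u" "g < Q" "1 <= k" "k <= g + 1" using inv Fact h by (auto simp: minv_def Let_def)
 define base where "base = lam * (real F - real fl) + lam + (real (mleft s) - 1) * cost + lam * (b + 6)"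
 let ?P = "PV (fl - 1) s (c + g)" and ?D = "DV (fl - 1) s (CC u)" and ?A = "acc g (k + 1)" and ?q = "qk g k"
 define A where "A = base + lam * 2 + lam * 30 * ?A + (?A * ?P + (1 - ?A) * ?D)"
 define B where "B = base + of_bool (odd k) * (lam * 30) + (of_bool (odd k) * ?P + (1 - of_bool (odd k)) * ?D)"
 have inv': "PV fl (s\<lparr>md := m\<rparr>) x = PV fl s x" "DV fl (s\<lparr>md := m\<rparr>) x = DV fl s x" for fl m x
 by (simp_all add: PV_def DV_def Let_def)
 have "Psi (fl - 1) (s\<lparr>md := if x + k <= g then Fact c g (k + 1) else if odd k then Push (c + g) else Draw (CC u)\<rparr>)
 = (if x + k <= g then A else B)" for x
 proof -
 have "Psi (fl - 1) (s\<lparr>md := Fact c g (k + 1)\<rparr>) = A"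
 unfolding Psi_def fl1 A_def base_def using h I by (simp add: inv' algebra_simps)
 moreover have "Psi (fl - 1) (s\<lparr>md := Push (c + g)\<rparr>) = B" if "odd k"
 unfolding Psi_def fl1 B_def base_def using h that by (simp add: inv' algebra_simps)
 moreover have "Psi (fl - 1) (s\<lparr>md := Draw (CC u)\<rparr>) = B" if "even k"
 unfolding Psi_def fl1 B_def base_def using h that by (simp add: inv' algebra_simps)
 ultimately show ?thesis by simp
 qed
 then have "EV (mstep s) (Psi (fl - 1)) = ?q * A + (1 - ?q) * B"
 using Fact h fact_expectation[OF I(2-4), of A B] by (simp add: mstep_def)
 also have "... = base + ?q * lam * 2 + lam * 30 * acc g k + (acc g k * ?P + (1 - acc g k) * ?D)"
 unfolding A_def B_def acc_rec[OF I(4)] by (simp add: algebra_simps)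
 also have "... <= base + (if k = 1 then 2 else 1) * lam + lam * 30 * acc g k + (acc g k * PV fl s (c + g) + (1 - acc g k) * DV fl s (CC u))"
 proof -
 \<comment> \<open>A further stage costs 2; the chance of reaching it is at most 1 after the first
   stage and at most 1/2 later.\<close>
 have "2 * ?q <= (if k = 1 then 2 else 1)" using qk_bounds[OF I(2-4)] I(3) by auto
 then have "?q * lam * 2 <= (if k = 1 then 2 else 1) * lam"
 using mult_right_mono[OF _ lam0, of "2 * ?q" "if k = 1 then 2 else 1"] by (simp add: mult_ac)
 moreover have "acc g k * ?P + (1 - acc g k) * ?D <= acc g k * PV fl s (c + g) + (1 - acc g k) * DV fl s (CC u)"
 using acc_range[OF I(2,3)] PV_mono DV_mono by (intro add_mono mult_left_mono) auto
 ultimately show ?thesis by simp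
 qed
 also have "... = Psi fl s" using Fact h by (simp add: Psi_def base_def algebra_simps)
 finally show ?thesis .
next
 case (Push c)
 obtain u t c0 where h: "hd (mfr s) = (u, t, c0)" by (metis surj_pair)
 have fl1: "lam * (real F - real (fl - 1)) = lam * (real F - real fl) + lam" using fl by (simp add: algebra_simps)
 show ?thesis
 proof (cases "c < CC u")
 case True
 have "DV (fl - 1) (s\<lparr>mG := pushG (mX s) u c (mG s), md := Draw (c + 1)\<rparr>) (c + 1) = PV (fl - 1) s c"
 using True h by (simp add: PV_def DV_def Let_def)
 moreover have "lam * ((if c + 1 < CC u then 29 else 0) + real b + 6) <= lam * (29 + real b + 6)"
 using lam0 by (intro mult_left_mono) auto
 moreover have "0 <= lam * 29" using lam0 by simp
 ultimately show ?thesis using Push True h fl1 PV_mono[of fl s c]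
 by (simp add: mstep_def Psi_def algebra_simps)
 next
 case False
 have "DV (fl - 1) (s\<lparr>md := Draw c\<rparr>) c = PV (fl - 1) s c"
 using False h DV_ge[of s c "fl - 1"] by (simp add: PV_def DV_def Let_def)
 then show ?thesis using Push False h fl1 PV_mono[of fl s c] lam0
 by (simp add: mstep_def Psi_def algebra_simps)
 qed
next
 case (Scan j bt bw)
 obtain u t c0 where h: "hd (mfr s) = (u, t, c0)" by (metis surj_pair)
 let ?L = "bucket (mG s) u (c0 div len u)" and ?rp = "rp (KX (mX s)) (Rg (mG s))"
 have fl1: "lam * (real F - real (fl - 1)) = lam * (real F - real fl) + lam" using fl by (simp add: algebra_simps)
 have I: "finv (mX s) (mfr s)" "ginv (KX (mX s)) (mG s)" "topinv s" "c0 < mX s u"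
 "j <= length ?L" "scanl c0 t (take j ?L) = (bt, bw)"
 using inv Scan h by (auto simp: minv_def Let_def)
 obtain y r where fr: "mfr s = (u, t, c0) # y # r" "u \<in> nonis" "t <= N" "c0 < t"
 using I(3,1) by (rule topinvE) (use h in auto)
 have dv: "len u dvd mX s u" using I(1) fr(2) by (simp add: finv_def)
 have short: "j <= b + 3" if "R \<in> set_pmf ?rp" "good R" for R
 using bucket_length[OF I(2) fr(2) dv I(4) that(1)] that(2) fr I(5) by (simp add: good_def)
 define f where "f fl' R = psi fl' (mleft s - 1) (mhits s) R (estep R (mfr s))" for fl' R
 have Ps: "Psi fl s = lam * (real F - real fl) + (real (mleft s) - 1) * cost + lam * real (b + 5 - j)
 + EV ?rp (f fl)"
 using Scan unfolding f_def by (simp add: Psi_def)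
 \<comment> \<open>The scan is prepaid up to \<open>b + 5\<close> steps. A longer one contradicts
   \<open>sparse\<close>, so no compatible ringing is good, and the fuel charged for bad ringings
   pays for the step.\<close>
 have main: "EV ?rp (f (fl - 1)) + lam + lam * l' <= EV ?rp (f fl) + lam * real (b + 5 - j)"
 if l': "l' <= real (b + 5 - j)" "j < b + 5 ==> l' + 1 <= real (b + 5 - j)" for l'
 proof (cases "j < b + 5")
 case True
 have "lam * (l' + 1) <= lam * real (b + 5 - j)" using l'(2)[OF True] lam0 by (rule mult_left_mono)
 moreover have "EV ?rp (f (fl - 1)) <= EV ?rp (f fl)"
 unfolding f_def by (intro E_mono psi_mono finite_rp)
 ultimately show ?thesis by (simp add: algebra_simps)
 next
 case False
 have "EV ?rp (f (fl - 1)) + lam * wb <= EV ?rp (f fl)"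
 proof (rule E_shift)
 fix R assume "R \<in> set_pmf ?rp"
 then have "~ good R" using short False by fastforce
 then show "f (fl - 1) R + lam * wb <= f fl R" unfolding f_def by (intro eq_refl psi_bad fl(1))
 qed
 moreover have "lam <= lam * wb" using wb1 lam0 by (simp add: mult_le_cancel_left1)
 moreover have "lam * l' <= lam * real (b + 5 - j)" using l'(1) lam0 by (rule mult_left_mono)
 ultimately show ?thesis by linarith
 qed
 show ?thesis
 proof (cases "j < length ?L")
 case True
 obtain bt' bw' where b': "scanf c0 (bt, bw) (?L ! j) = (bt', bw')" by (metis surj_pair)
 have "mstep s = return_pmf (s\<lparr>md := Scan (j + 1) bt' bw'\<rparr>)" using Scan h True b' by (simp add: mstep_def)
 then have "EV (mstep s) (Psi (fl - 1)) = lam * (real F - real fl) + lam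
 + (real (mleft s) - 1) * cost + lam * real (b + 5 - (j + 1)) + EV ?rp (f (fl - 1))"
 unfolding f_def by (simp add: Psi_def fl1[simplified])
 also have "... <= Psi fl s"
 proof -
 have "real (b + 5 - (j + 1)) <= real (b + 5 - j)" "j < b + 5 ==> real (b + 5 - (j + 1)) + 1 <= real (b + 5 - j)"
 by auto
 from main[OF this] show ?thesis unfolding Ps by linarith
 qed
 finally show ?thesis .
 next
 case False
 then have sc: "scanl c0 t ?L = (bt, bw)" using I(5,6) by simp
 let ?fr = "if bt < t then (bw, bt, 0) # (u, t, bt + 1) # y # r
 else (u, t, (c0 div len u + 1) * len u) # y # r"
 have "mstep s = return_pmf (s\<lparr>mfr := ?fr, md := Main\<rparr>)" using Scan h False fr(1) by (simp add: mstep_def)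
 then have "EV (mstep s) (Psi (fl - 1)) = lam * (real F - real fl) + lam
 + (real (mleft s) - 1) * cost + EV ?rp (%R. psi (fl - 1) (mleft s - 1) (mhits s) R ?fr)"
 by (simp add: Psi_def fl1[simplified])
 also have "EV ?rp (%R. psi (fl - 1) (mleft s - 1) (mhits s) R ?fr) = EV ?rp (f (fl - 1))"
 proof (rule E_cong)
 fix R assume R: "R \<in> set_pmf ?rp"
 show "psi (fl - 1) (mleft s - 1) (mhits s) R ?fr = f (fl - 1) R"
 proof (cases "good R")
 case True
 then have "estep R (mfr s) = ?fr"
 unfolding fr(1) using I fr sc dv R by (intro estep_scan) (auto simp: good_def)
 then show ?thesis by (simp add: f_def)
 qed (simp add: f_def psi_def)
 qed
 also have "lam * (real F - real fl) + lam + (real (mleft s) - 1) * cost + EV ?rp (f (fl - 1)) <= Psi fl s"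
 unfolding Ps using main[of 0] by simp
 finally show ?thesis .
 qed
qed

end


section \<open>Tails of the number of hits\<close>

text \<open>The probability that \<open>h\<close> plus a binomial variable with parameters \<open>t\<close> and \<open>p\<close> is bad.\<close>

primrec tail :: "real => (nat => bool) => nat => nat => real" where
 "tail p B 0 h = of_bool (B h)"
| "tail p B (Suc t) h = p * tail p B t (h + 1) + (1 - p) * tail p B t h"

context
 fixes p :: real
 assumes p: "0 <= p" "p <= 1"
begin

lemma tail_range: "0 <= tail p B t h & tail p B t h <= 1"
proof (induction t arbitrary: h)
 case (Suc t)
 have "p * tail p B t (h + 1) + (1 - p) * tail p B t h <= p * 1 + (1 - p) * 1"
 using Suc p by (intro add_mono mult_left_mono) auto
 then show ?case using Suc p by simp
qed simp

lemma tail_union: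
 assumes "!!h. B h ==> B1 h \<or> B2 h"
 shows "tail p B t h <= tail p B1 t h + tail p B2 t h"
proof (induction t arbitrary: h)
 case (Suc t)
 have "p * tail p B t (h + 1) + (1 - p) * tail p B t h
 <= p * (tail p B1 t (h + 1) + tail p B2 t (h + 1)) + (1 - p) * (tail p B1 t h + tail p B2 t h)"
 using Suc p by (intro add_mono mult_left_mono) auto
 then show ?case by (simp add: algebra_simps)
qed (use assms in \<open>auto simp: of_bool_def\<close>)

text \<open>Exponential moment of a binomial variable, \<open>(1 + p * (exp l - 1)) ^ t\<close>; the
  sign of \<open>l\<close> selects the upper or the lower tail.\<close>

lemma tail_exp:
 assumes "!!h. B h ==> 0 <= l * (real h - thr)"
 shows "tail p B t 0 <= exp (real t * p * (exp l - 1) - l * thr)"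
proof -
 have q: "0 <= 1 + p * (exp l - 1)"
 proof -
 have "p * - 1 <= p * (exp l - 1)" using p by (intro mult_left_mono) auto
 then show ?thesis using p by simp
 qed
 have "tail p B t h <= exp (l * (real h - thr)) * (1 + p * (exp l - 1)) ^ t" for h
 proof (induction t arbitrary: h)
 case 0
 then show ?case using assms[of h] by simp
 next
 case (Suc t)
 have "tail p B (Suc t) h <= p * (exp (l * (real (h + 1) - thr)) * (1 + p * (exp l - 1)) ^ t)
 + (1 - p) * (exp (l * (real h - thr)) * (1 + p * (exp l - 1)) ^ t)"
 unfolding tail.simps using p by (intro add_mono mult_left_mono Suc.IH) auto
 also have "exp (l * (real (h + 1) - thr)) = exp (l * (real h - thr)) * exp l"
 by (simp add: exp_add[symmetric] algebra_simps)
 finally show ?case by (simp add: algebra_simps)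
 qed
 from this[of 0] have "tail p B t 0 <= exp (l * (real 0 - thr)) * (1 + p * (exp l - 1)) ^ t" .
 also have "... <= exp (l * (real 0 - thr)) * exp (p * (exp l - 1)) ^ t"
 using q exp_ge_add_one_self[of "p * (exp l - 1)"] by (intro mult_left_mono power_mono) auto
 also have "... = exp (real t * p * (exp l - 1) - l * thr)"
 by (simp add: exp_of_nat_mult[symmetric] exp_add[symmetric] algebra_simps)
 finally show ?thesis .
qed

lemma exp_quadratic: "\<bar>x\<bar> <= 1 ==> exp x - 1 <= x + (x::real)\<^sup>2"
proof (cases "0 <= x")
 case True
 then show "\<bar>x\<bar> <= 1 ==> exp x - 1 <= x + x\<^sup>2" using exp_bound[of x] by simp
next
 case False
 assume "\<bar>x\<bar> <= 1"
 define y where "y = - x"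
 have y: "0 < y" "y <= 1" using False \<open>\<bar>x\<bar> <= 1\<close> by (auto simp: y_def)
 \<comment> \<open>The product is \<open>1 + y ^ 3\<close>.\<close>
 have "1 <= (1 - y + y\<^sup>2) * (1 + y)" using y by (simp add: power2_eq_square algebra_simps)
 also have "... <= (1 - y + y\<^sup>2) * exp y"
 proof (intro mult_left_mono exp_ge_add_one_self)
 show "0 <= 1 - y + y\<^sup>2" using y by simp
 qed
 finally have "exp (- y) <= 1 - y + y\<^sup>2" by (simp add: exp_minus field_simps)
 then show "exp x - 1 <= x + x\<^sup>2" by (simp add: y_def)
qed

text \<open>\<open>tail_exp\<close> with \<open>l\<close> equal to minus and plus
  \<open>\<delta> / 2\<close>; for the mean \<open>m\<close>, \<open>exp_quadratic\<close> bounds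
  both exponents by \<open>- m * \<delta>^2 / 4\<close>.\<close>

lemma chernoff:
 assumes d: "0 < \<delta>" "\<delta> <= 1"
 and B: "!!h. B h ==> real h <= (1 - \<delta>) * (real t * p) \<or> (1 + \<delta>) * (real t * p) <= real h"
 shows "tail p B t 0 <= 2 * exp (- (real t * p * \<delta>\<^sup>2 / 4))"
proof -
 let ?m = "real t * p"
 have m0: "0 <= ?m" using p by simp
 have "tail p (%h. real h <= (1 - \<delta>) * ?m) t 0 <= exp (?m * (exp (- (\<delta> / 2)) - 1) - (- (\<delta> / 2)) * ((1 - \<delta>) * ?m))"
 by (rule tail_exp) (use d in \<open>simp add: mult_le_0_iff\<close>)
 also have "... <= exp (- (?m * \<delta>\<^sup>2 / 4))"
 proof -
 have "?m * (exp (- (\<delta> / 2)) - 1) <= ?m * (- (\<delta> / 2) + (- (\<delta> / 2))\<^sup>2)"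
 using d by (intro mult_left_mono exp_quadratic m0) auto
 then show ?thesis by (simp add: power2_eq_square algebra_simps)
 qed
 finally have 1: "tail p (%h. real h <= (1 - \<delta>) * ?m) t 0 <= exp (- (?m * \<delta>\<^sup>2 / 4))" .
 have "tail p (%h. (1 + \<delta>) * ?m <= real h) t 0 <= exp (?m * (exp (\<delta> / 2) - 1) - (\<delta> / 2) * ((1 + \<delta>) * ?m))"
 by (rule tail_exp) (use d in simp)
 also have "... <= exp (- (?m * \<delta>\<^sup>2 / 4))"
 proof -
 have "?m * (exp (\<delta> / 2) - 1) <= ?m * (\<delta> / 2 + (\<delta> / 2)\<^sup>2)"
 using d by (intro mult_left_mono exp_quadratic m0) auto
 then show ?thesis by (simp add: power2_eq_square algebra_simps)
 qed
 finally have 2: "tail p (%h. (1 + \<delta>) * ?m <= real h) t 0 <= exp (- (?m * \<delta>\<^sup>2 / 4))" .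
 have "tail p B t 0 <= tail p (%h. real h <= (1 - \<delta>) * ?m) t 0 + tail p (%h. (1 + \<delta>) * ?m <= real h) t 0"
 by (rule tail_union) (use B in auto)
 then show ?thesis using 1 2 by simp
qed

text \<open>\<open>tail_exp\<close> with \<open>l = 1\<close>, where
  \<open>exp 1 - 1 <= 2\<close>.\<close>

lemma tail_large:
 assumes "real t * p <= thr / 4" and "!!h. B h ==> thr <= real h"
 shows "tail p B t 0 <= exp (- (thr / 2))"
proof -
 have "tail p B t 0 <= exp (real t * p * (exp 1 - 1) - 1 * thr)"
 by (rule tail_exp) (use assms(2) in simp)
 also have "... <= exp (- (thr / 2))"
 proof -
 have "real t * p * (exp 1 - 1) <= real t * p * 2" using exp_le p by (intro mult_left_mono) auto
 then show ?thesis using assms(1) by simp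
 qed
 finally show ?thesis .
qed

end

section \<open>One trial\<close>

context rgraph_par
begin

definition mdone :: "mst => bool" where "mdone s \<longleftrightarrow> md s = Pick & mleft s = 0"

primrec mrun :: "nat => mst => mst pmf" where
 "mrun 0 s = return_pmf s"
| "mrun (Suc fl) s = (if mdone s then return_pmf s else bind_pmf (mstep s) (mrun fl))"

lemma finite_mrun: "nonis ~= {} ==> minv s ==> finite (set_pmf (mrun fl s))"
proof (induction fl arbitrary: s)
 case (Suc fl)
 show ?case
 proof (cases "mdone s")
 case False
 have "finite (\<Union>s'\<in>set_pmf (mstep s). set_pmf (mrun fl s'))"
 using Suc finite_mstep minv_step by (intro finite_UN_I) auto
 then show ?thesis using False by simp
 qed simp
qed simp

definition mstart :: "nat => mst" where
 "mstart t = \<lparr>mleft = t, mhits = 0, mfr = [], mX = (%_. 0), mG = [], md = Pick\<rparr>"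

lemma minv_mstart: "minv (mstart t)" by (simp add: minv_def mstart_def)

end

context potential
begin

lemma Psi_final:
 assumes inv: "minv s" and fl: "fl <= F"
 shows "mdone s ==> a 0 (mhits s) <= Psi fl s" "lam * (real F - real fl) <= Psi fl s"
proof -
 have e: "0 <= lam * (real F - real fl)" using lam0 fl by simp
 show "a 0 (mhits s) <= Psi fl s" if "mdone s" using that e by (simp add: Psi_def mdone_def)
 have l: "md s ~= Pick ==> 0 <= (real (mleft s) - 1) * cost"
 using inv cost0 by (auto simp: minv_def)
 have D: "0 <= DV fl s c" for c unfolding DV_def by (intro E_nonneg psi0)
 have P: "0 <= PV fl s c" for c unfolding PV_def Let_def using D by (auto intro!: E_nonneg psi0)
 have M: "0 <= EV (rp K G) (%R. psi fl t h R (fs R))" for K G t h fs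
 by (intro E_nonneg psi0)
 show "lam * (real F - real fl) <= Psi fl s"
 proof (cases "md s")
 case Pick
 then show ?thesis using a0 cost0 by (simp add: Psi_def)
 next
 case Main
 then show ?thesis using l M by (simp add: Psi_def)
 next
 case (Draw c)
 then show ?thesis using l D lam0 by (simp add: Psi_def)
 next
 case (Fact c g k)
 obtain u t c0 where h: "hd (mfr s) = (u, t, c0)" by (metis surj_pair)
 have "g < Q" "1 <= k" using inv Fact h by (auto simp: minv_def Let_def)
 then have "0 <= acc g k" "acc g k <= 1" using acc_range by auto
 then show ?thesis using Fact l P D lam0 by (simp add: Psi_def)
 next
 case (Push c)
 then show ?thesis using l P lam0 by (simp add: Psi_def)
 next
 case (Scan j bt bw)
 then show ?thesis using l M lam0 by (simp add: Psi_def)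
 qed
qed

text \<open>Optional stopping for the supermartingale \<open>Psi\<close>: a finished run is worth at
  least its payoff, and a run out of fuel has paid \<open>lam * F\<close>.\<close>

lemma mrun_le:
 assumes \<phi>: "!!s. mdone s ==> \<phi> s <= a 0 (mhits s)" "!!s. ~ mdone s ==> \<phi> s <= lam * F"
 shows "minv s ==> fl <= F ==> EV (mrun fl s) \<phi> <= Psi fl s"
proof (induction fl arbitrary: s)
 case 0
 then show ?case using Psi_final[of s 0] \<phi>[of s] by (cases "mdone s") auto
next
 case (Suc fl)
 show ?case
 proof (cases "mdone s")
 case True
 then show ?thesis using Psi_final(1)[of s "Suc fl"] \<phi>(1)[of s] Suc.prems by simp
 next
 case False
 have "EV (mrun (Suc fl) s) \<phi> = EV (mstep s) (%s'. EV (mrun fl s') \<phi>)"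
 using False Suc.prems finite_mstep[OF ne] finite_mrun[OF ne] minv_step[OF _ _ ne] by (simp add: E_bind)
 also have "... <= EV (mstep s) (Psi fl)"
 using Suc finite_mstep[OF ne] minv_step[OF _ _ ne] by (intro E_mono) auto
 also have "... <= Psi (Suc fl) s"
 using mstep_super[OF Suc.prems(1), of "Suc fl"] Suc.prems(2) False by (simp add: mdone_def)
 finally show ?thesis .
 qed
qed

lemma Psi_mstart: "Psi F (mstart t) = a t 0 + t * cost"
 by (simp add: Psi_def mstart_def)

end

context rgraph_par
begin

text \<open>Bad ringings count as misses, which makes the hits follow the recursion of
  \<open>tail\<close>; the difference is charged to \<open>\<eta>\<close>.\<close>

definition pm :: real where
 "pm = (\<Sum>v\<in>nonis. EE (%R. of_bool (good R & ~ alv R N v))) / card nonis"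

lemma pm_eq: "nonis ~= {} ==> card nonis * pm = EE (%R. of_bool (good R) * real (card (matched R)))"
proof -
 assume ne: "nonis ~= {}"
 have "card nonis * pm = (\<Sum>v\<in>nonis. EE (%R. of_bool (good R & ~ alv R N v)))"
 using ne by (simp add: pm_def)
 also have "... = EE (%R. \<Sum>v\<in>nonis. of_bool (good R & ~ alv R N v))" by (rule E_sum[symmetric]) simp
 also have "... = EE (%R. of_bool (good R) * real (card (matched R)))"
 proof (rule E_cong)
 fix R assume R: "R \<in> Om"
 have "{v\<in>nonis. ~ alv R N v} = matched R"
 using matched_nonis[OF R] by (auto simp: matched_def nonis_def)
 then have "(\<Sum>v\<in>nonis. of_bool (~ alv R N v)) = real (card (matched R))"
 by (simp add: of_bool_def sum.inter_filter[symmetric])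
 then show "(\<Sum>v\<in>nonis. of_bool (good R & ~ alv R N v)) = of_bool (good R) * real (card (matched R))"
 by (simp add: of_bool_conj sum_distrib_left[symmetric])
 qed
 finally show ?thesis .
qed

lemma pm_range: "0 <= pm & pm <= 1"
proof -
 have "(\<Sum>v\<in>nonis. EE (%R. of_bool (good R & ~ alv R N v))) <= (\<Sum>v\<in>nonis. EE (%R. 1))"
 by (intro sum_mono E_mono) auto
 then have "(\<Sum>v\<in>nonis. EE (%R. of_bool (good R & ~ alv R N v))) <= card nonis" by simp
 moreover have "0 <= (\<Sum>v\<in>nonis. EE (%R. of_bool (good R & ~ alv R N v)))" by (intro sum_nonneg E_nonneg) auto
 ultimately show ?thesis unfolding pm_def by (cases "card nonis = 0") (auto simp: divide_simps)
qed

definition Ibar :: real where "Ibar = 2 * B0 * (card nonis + L * D * b) / card nonis + 2"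

lemma Ibar_ok:
 "(\<Sum>v\<in>nonis. EE (%R. of_bool (good R) * real (its R (start v)))) / card nonis + 2 <= Ibar"
 unfolding Ibar_def using expected_its by (intro add_right_mono divide_right_mono) auto

text \<open>Steps are free here, and the value is the tail of the number of hits; each sample adds
  \<open>\<eta> * (1 + wb)\<close>.\<close>

lemma prob_trial_bad:
 assumes "nonis ~= {}"
 shows "PR (mrun F (mstart t)) {s. mdone s & B (mhits s)}
 <= tail pm B t 0 + t * (\<eta> * (b + 37))"
proof -
 interpret potential n E adj Q N b q0 F 0 Ibar "tail pm B"
 using assms pm_range Ibar_ok tail_range
 by unfold_locales (auto simp: pm_def[symmetric] Let_def)
 have "EV (mrun F (mstart t)) (%s. of_bool (mdone s & B (mhits s))) <= Psi F (mstart t)"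
 by (rule mrun_le) (auto simp: minv_mstart)
 then show ?thesis unfolding E_prob Psi_mstart by (simp add: cost_def wb_def add.commute)
qed

text \<open>Markov's inequality for the number of steps: at price \<open>1 / F\<close> a run out of
  fuel has paid 1.\<close>

lemma prob_trial_unfinished:
 assumes "nonis ~= {}" "1 <= F"
 shows "PR (mrun F (mstart t)) {s. ~ mdone s}
 <= t * (\<eta> * (b + 37) + (b + 36) * Ibar / F)"
proof -
 interpret potential n E adj Q N b q0 F "1 / F" Ibar "%_ _. 0"
 using assms Ibar_ok by unfold_locales auto
 have "EV (mrun F (mstart t)) (%s. of_bool (~ mdone s)) <= Psi F (mstart t)"
 by (rule mrun_le) (use assms in \<open>auto simp: minv_mstart\<close>)
 then show ?thesis unfolding E_prob Psi_mstart by (simp add: cost_def wb_def add.commute)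
qed

end


section \<open>Running commands\<close>

context
 fixes w n :: nat and adj :: "nat => nat list"
begin

text \<open>Started in state \<open>s\<close>, the command \<open>c\<close> terminates within \<open>\<tau>\<close> steps, with final states
  distributed according to \<open>D\<close>. The number of steps may depend on the random choices.\<close>

definition cmp :: "com => state => nat => state pmf => bool" where
 "cmp c s \<tau> D \<longleftrightarrow> (\<exists>\<Phi>. (\<forall>x\<in>set_pmf \<Phi>. fst x <= \<tau>) & map_pmf snd \<Phi> = D &
 (\<forall>K T. \<tau> <= T --> run w n adj T (c # K, s) = bind_pmf \<Phi> (%x. run w n adj (T - fst x) (K, snd x))))"

lemma cmp_mono: "cmp c s \<tau> D ==> \<tau> <= \<tau>' ==> cmp c s \<tau>' D"
proof -
 assume a: "cmp c s \<tau> D" "\<tau> <= \<tau>'"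
 then obtain \<Phi> where \<Phi>: "\<forall>x\<in>set_pmf \<Phi>. fst x <= \<tau>" "map_pmf snd \<Phi> = D"
 "\<forall>K T. \<tau> <= T --> run w n adj T (c # K, s) = bind_pmf \<Phi> (%x. run w n adj (T - fst x) (K, snd x))"
 unfolding cmp_def by blast
 show ?thesis unfolding cmp_def
 by (rule exI[of _ \<Phi>]) (use \<Phi> a(2) in \<open>simp, meson order_trans\<close>)
qed

lemma cmp_one:
 assumes "!!K. step w n adj (c # K, s) = map_pmf (%s'. (K, s')) D"
 shows "cmp c s 1 D"
 unfolding cmp_def
proof (intro exI[of _ "map_pmf (Pair 1) D"] conjI allI impI ballI)
 fix K T assume "1 <= (T::nat)"
 then obtain T' where "T = Suc T'" by (cases T) auto
 then show "run w n adj T (c # K, s) = bind_pmf (map_pmf (Pair 1) D) (%x. run w n adj (T - fst x) (K, snd x))"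
 by (simp add: assms bind_map_pmf)
qed (auto simp: pmf.map_comp o_def)

text \<open>\<open>c2\<close> is what stays on the stack below \<open>c1\<close>: nothing for
  \<open>If\<close>, one command for \<open>Seq\<close> and \<open>While\<close>.\<close>

lemma cmp_bind:
 assumes first: "!!K T. run w n adj (Suc T) (c # K, s) = run w n adj T (c1 # c2 @ K, s)"
 and c1: "cmp c1 s \<tau>1 D1"
 and c2: "!!s'. s' \<in> set_pmf D1 ==> (case c2 of [] => D2 s' = return_pmf s' | [d] => cmp d s' \<tau>2 (D2 s') | _ => False)"
 shows "cmp c s (Suc (\<tau>1 + \<tau>2)) (bind_pmf D1 D2)"
proof -
 obtain \<Phi>1 where P1: "\<forall>x\<in>set_pmf \<Phi>1. fst x <= \<tau>1" "map_pmf snd \<Phi>1 = D1"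
 "!!K T. \<tau>1 <= T ==> run w n adj T (c1 # K, s) = bind_pmf \<Phi>1 (%x. run w n adj (T - fst x) (K, snd x))"
 using c1 unfolding cmp_def by blast
 define P where "P s' \<Phi> \<longleftrightarrow> (\<forall>x\<in>set_pmf \<Phi>. fst x <= \<tau>2) & map_pmf snd \<Phi> = D2 s' &
 (\<forall>K T. \<tau>2 <= T --> run w n adj T (c2 @ K, s') = bind_pmf \<Phi> (%x. run w n adj (T - fst x) (K, snd x)))"
 for s' \<Phi>
 have ex: "\<exists>\<Phi>. P s' \<Phi>"
 if "s' \<in> set_pmf D1" for s'
 proof (cases c2)
 case Nil
 then show ?thesis using c2[OF that]
 by (intro exI[of _ "return_pmf (0, s')"]) (simp add: P_def bind_return_pmf)
 next
 case (Cons d ds)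
 then have "ds = []" "cmp d s' \<tau>2 (D2 s')" using c2[OF that] by (auto split: list.splits)
 then show ?thesis using Cons unfolding cmp_def P_def by simp
 qed
 define \<Phi>2 where "\<Phi>2 s' = (SOME \<Phi>. P s' \<Phi>)" for s'
 have P2: "P s' (\<Phi>2 s')" if "s' \<in> set_pmf D1" for s'
 unfolding \<Phi>2_def by (rule someI_ex[OF ex[OF that]])
 have D1: "snd x \<in> set_pmf D1" if "x \<in> set_pmf \<Phi>1" for x using that P1(2) by auto
 define \<Phi> where "\<Phi> = bind_pmf \<Phi>1 (%x. map_pmf (%y. (Suc (fst x + fst y), snd y)) (\<Phi>2 (snd x)))"
 show ?thesis unfolding cmp_def
 proof (intro exI[of _ \<Phi>] conjI allI impI)
 show "\<forall>x\<in>set_pmf \<Phi>. fst x <= Suc (\<tau>1 + \<tau>2)"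
 proof
 fix y assume "y \<in> set_pmf \<Phi>"
 then obtain x z where x: "x \<in> set_pmf \<Phi>1" "z \<in> set_pmf (\<Phi>2 (snd x))" "y = (Suc (fst x + fst z), snd z)"
 by (auto simp: \<Phi>_def)
 then show "fst y <= Suc (\<tau>1 + \<tau>2)"
 using P1(1) P2[OF D1[OF x(1)]] unfolding P_def by (auto intro: add_mono)
 qed
 have "map_pmf snd \<Phi> = bind_pmf \<Phi>1 (%x. map_pmf snd (\<Phi>2 (snd x)))"
 by (simp add: \<Phi>_def map_bind_pmf pmf.map_comp o_def)
 also have "... = bind_pmf \<Phi>1 (%x. D2 (snd x))"
 proof (intro bind_pmf_cong refl)
 fix x assume "x \<in> set_pmf \<Phi>1"
 then show "map_pmf snd (\<Phi>2 (snd x)) = D2 (snd x)" using P2[OF D1] by (simp add: P_def)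
 qed
 also have "... = bind_pmf D1 D2" unfolding P1(2)[symmetric] by (simp add: bind_map_pmf)
 finally show "map_pmf snd \<Phi> = bind_pmf D1 D2" .
 fix K T assume T: "Suc (\<tau>1 + \<tau>2) <= T"
 then obtain T' where T': "T = Suc T'" "\<tau>1 + \<tau>2 <= T'" by (cases T) auto
 have "run w n adj T (c # K, s) = bind_pmf \<Phi>1 (%x. run w n adj (T' - fst x) (c2 @ K, snd x))"
 using T' first P1(3) by simp
 also have "... = bind_pmf \<Phi>1 (%x. bind_pmf (\<Phi>2 (snd x)) (%y. run w n adj (T' - fst x - fst y) (K, snd y)))"
 proof (intro bind_pmf_cong refl)
 fix x assume x: "x \<in> set_pmf \<Phi>1"
 have "\<tau>2 <= T' - fst x" using P1(1) x T'(2) by fastforce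
 then show "run w n adj (T' - fst x) (c2 @ K, snd x) = bind_pmf (\<Phi>2 (snd x)) (%y. run w n adj (T' - fst x - fst y) (K, snd y))"
 using P2[OF D1[OF x]] unfolding P_def by blast
 qed
 also have "... = bind_pmf \<Phi> (%x. run w n adj (T - fst x) (K, snd x))"
 unfolding \<Phi>_def T'(1) by (simp add: bind_assoc_pmf bind_map_pmf)
 finally show "run w n adj T (c # K, s) = bind_pmf \<Phi> (%x. run w n adj (T - fst x) (K, snd x))" .
 qed
qed

lemma cmp_Seq:
 assumes "cmp c s \<tau>1 D1" "!!s'. s' \<in> set_pmf D1 ==> cmp d s' \<tau>2 (D2 s')"
 shows "cmp (Seq c d) s (Suc (\<tau>1 + \<tau>2)) (bind_pmf D1 D2)"
 by (rule cmp_bind[of _ _ c "[d]"]) (use assms in \<open>auto simp: bind_return_pmf\<close>)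

lemma cmp_If:
 assumes "cmp (if operand_val w s a ~= 0 then c else d) s \<tau> D"
 shows "cmp (If a c d) s (Suc \<tau>) D"
proof -
 have "cmp (If a c d) s (Suc (\<tau> + 0)) (bind_pmf D return_pmf)"
 by (rule cmp_bind[of _ _ "if operand_val w s a ~= 0 then c else d" "[]"])
 (use assms in \<open>auto simp: bind_return_pmf\<close>)
 then show ?thesis by (simp add: bind_return_pmf')
qed

lemma cmp_While_False: "operand_val w s a = 0 ==> cmp (While a c) s 1 (return_pmf s)"
 by (rule cmp_one) simp

lemma cmp_While_True:
 assumes "operand_val w s a ~= 0" "cmp c s \<tau>1 D1" "!!s'. s' \<in> set_pmf D1 ==> cmp (While a c) s' \<tau>2 (D2 s')"
 shows "cmp (While a c) s (Suc (\<tau>1 + \<tau>2)) (bind_pmf D1 D2)"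
 by (rule cmp_bind[of _ _ c "[While a c]"]) (use assms in \<open>auto simp: bind_return_pmf\<close>)

text \<open>A semantics without stack and clock, meant for loop-free commands; loops are unfolded by
  \<open>loop\<close>.\<close>

fun exec :: "com => state => state pmf" where
 "exec Skip s = return_pmf s"
| "exec (Compute r f a b) s = return_pmf (set_reg r (binop_val w f (operand_val w s a) (operand_val w s b)) s)"
| "exec (Load r a) s = return_pmf (set_reg r (mem s (operand_val w s a)) s)"
| "exec (Store a b) s = return_pmf (s\<lparr>mem := (mem s)(operand_val w s a := operand_val w s b)\<rparr>)"
| "exec (Random r a) s = map_pmf (%x. set_reg r x s) (pmf_of_set {..<max 1 (operand_val w s a)})"
| "exec (QueryDegree r a) s = return_pmf (set_reg r (query_degree n adj (operand_val w s a)) s)"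
| "exec (QueryNeighbor r a b) s = return_pmf (set_reg r (query_neighbor n adj (operand_val w s a) (operand_val w s b)) s)"
| "exec (Seq c d) s = bind_pmf (exec c s) (exec d)"
| "exec (If a c d) s = (if operand_val w s a ~= 0 then exec c s else exec d s)"
| "exec (While a c) s = return_pmf s"

text \<open>The final state of a deterministic command.\<close>

fun dex :: "com => state => state" where
 "dex (Compute r f a b) s = set_reg r (binop_val w f (operand_val w s a) (operand_val w s b)) s"
| "dex (Load r a) s = set_reg r (mem s (operand_val w s a)) s"
| "dex (Store a b) s = s\<lparr>mem := (mem s)(operand_val w s a := operand_val w s b)\<rparr>"
| "dex (QueryDegree r a) s = set_reg r (query_degree n adj (operand_val w s a)) s"
| "dex (QueryNeighbor r a b) s = set_reg r (query_neighbor n adj (operand_val w s a) (operand_val w s b)) s"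
| "dex (Seq c d) s = dex d (dex c s)"
| "dex (If a c d) s = (if operand_val w s a ~= 0 then dex c s else dex d s)"
| "dex c s = s"

fun deterministic :: "com => bool" where
 "deterministic (Seq c d) \<longleftrightarrow> deterministic c & deterministic d"
| "deterministic (If a c d) \<longleftrightarrow> deterministic c & deterministic d"
| "deterministic (While a c) \<longleftrightarrow> False"
| "deterministic (Random r a) \<longleftrightarrow> False"
| "deterministic c \<longleftrightarrow> True"

lemma exec_dex: "deterministic c ==> exec c s = return_pmf (dex c s)"
 by (induction c arbitrary: s) (auto simp: bind_return_pmf)

fun writes :: "com => nat set" where
 "writes (Compute r f a b) = {r}"
| "writes (Load r a) = {r}"
| "writes (Random r a) = {r}"
| "writes (QueryDegree r a) = {r}"
| "writes (QueryNeighbor r a b) = {r}"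
| "writes (Seq c d) = writes c \<union> writes d"
| "writes (If a c d) = writes c \<union> writes d"
| "writes c = {}"

lemma exec_writes: "s' \<in> set_pmf (exec c s) ==> r \<notin> writes c ==> regs s' r = regs s r"
 by (induction c arbitrary: s s') (auto simp: set_reg_def split: if_splits)

fun loopfree :: "com => bool" where
 "loopfree (Seq c d) \<longleftrightarrow> loopfree c & loopfree d"
| "loopfree (If a c d) \<longleftrightarrow> loopfree c & loopfree d"
| "loopfree (While a c) \<longleftrightarrow> False"
| "loopfree c \<longleftrightarrow> True"

fun time :: "com => nat" where
 "time (Seq c d) = Suc (time c + time d)"
| "time (If a c d) = Suc (max (time c) (time d))"
| "time c = 1"

lemma cmp_exec: "loopfree c ==> cmp c s (time c) (exec c s)"
proof (induction c arbitrary: s)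
 case (Seq c d)
 then show ?case unfolding exec.simps time.simps by (intro cmp_Seq) auto
next
 case (If a c d)
 show ?case unfolding exec.simps time.simps
 proof (rule cmp_If)
 show "cmp (if operand_val w s a ~= 0 then c else d) s (max (time c) (time d))
 (if operand_val w s a ~= 0 then exec c s else exec d s)"
 using If cmp_mono[of c s "time c" "exec c s" "max (time c) (time d)"]
 cmp_mono[of d s "time d" "exec d s" "max (time c) (time d)"] by simp
 qed
next
 case (While a c)
 then show ?case by simp
qed (unfold time.simps exec.simps, (rule cmp_one, simp add: pmf.map_comp o_def)+)

lemma finite_exec: "finite (set_pmf (exec c s))"
proof (induction c arbitrary: s)
 case (Random r a)
 have "set_pmf (pmf_of_set {..<max 1 (operand_val w s a)}) = {..<max 1 (operand_val w s a)}"
 by (rule set_unif) simp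
 then show ?case by simp
qed auto

text \<open>The loops below decrease a counter in every round.\<close>

fun loop :: "(state => bool) => (state => state pmf) => nat => state => state pmf" where
 "loop P f 0 s = return_pmf s"
| "loop P f (Suc m) s = (if P s then bind_pmf (f s) (loop P f m) else return_pmf s)"

text \<open>\<open>V\<close> is a ranking function, so \<open>m >= V s\<close> unfoldings of the
  loop reach a state in which the guard fails.\<close>

lemma cmp_While:
 assumes body: "!!s. I s ==> regs s r ~= 0 ==> cmp c s \<tau> (f s)"
 and pres: "!!s s'. I s ==> regs s r ~= 0 ==> s' \<in> set_pmf (f s) ==> I s' & V s' < V s"
 shows "I s ==> V s <= m ==> cmp (While (Reg r) c) s (m * Suc \<tau> + 1) (loop (%s. regs s r ~= 0) f m s)"
proof (induction m arbitrary: s)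
 case 0
 have "regs s r = 0"
 proof (rule ccontr)
 assume a: "regs s r ~= 0"
 obtain s' where "s' \<in> set_pmf (f s)" using set_pmf_not_empty by fastforce
 then show False using pres[OF 0(1) a] 0 by fastforce
 qed
 then show ?case using cmp_While_False[of s "Reg r" c] by simp
next
 case (Suc m)
 show ?case
 proof (cases "regs s r = 0")
 case True
 then show ?thesis using cmp_mono[OF cmp_While_False[of s "Reg r" c]] by simp
 next
 case False
 have "cmp (While (Reg r) c) s (Suc (\<tau> + (m * Suc \<tau> + 1))) (bind_pmf (f s) (loop (%s. regs s r ~= 0) f m))"
 proof (rule cmp_While_True)
 fix s' assume "s' \<in> set_pmf (f s)"
 then have "I s'" "V s' < V s" using pres[OF Suc.prems(1) False] by auto
 then show "cmp (While (Reg r) c) s' (m * Suc \<tau> + 1) (loop (%s. regs s r ~= 0) f m s')"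
 using Suc by (intro Suc.IH) auto
 qed (use False body Suc in auto)
 then show ?thesis using False by (simp add: algebra_simps)
 qed
qed

text \<open>Halted configurations stay put, so at time \<tau> all runs show their final state
  although they halt at different times.\<close>

lemma cmp_run:
 assumes "cmp P s \<tau> D"
 shows "run w n adj \<tau> ([P], s) = map_pmf (Pair []) D"
proof -
 obtain \<Phi> where \<Phi>: "map_pmf snd \<Phi> = D"
 "run w n adj \<tau> ([P], s) = bind_pmf \<Phi> (%x. run w n adj (\<tau> - fst x) ([], snd x))"
 using assms unfolding cmp_def by blast
 have h: "run w n adj T ([], s') = return_pmf ([], s')" for T s'
 by (induction T) (simp_all add: bind_return_pmf)
 have "run w n adj \<tau> ([P], s) = bind_pmf \<Phi> (%x. return_pmf ([], snd x))" by (simp only: \<Phi>(2) h)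
 then show ?thesis unfolding \<Phi>(1)[symmetric] by (simp add: map_pmf_def[symmetric] pmf.map_comp o_def)
qed

end

primrec seqs :: "com list => com" where
 "seqs [] = Skip"
| "seqs (c # cs) = Seq c (seqs cs)"


section \<open>The program for one step of the sampling machine\<close>

text \<open>Registers: 0 \<open>n\<close>, 1 number of vertices of positive degree, 2 \<open>Q\<close>, 3 \<open>N\<close>, 6 start of the stack,
  7 size of the memory region of a sample, 8 start of the unused memory, 9 number of blocks of a
  vertex, 40 size of the list of a block; 10 mode, 11 samples left, 12 hits, 13 stack height,
  14 start of the current region, 15 fuel, 16 whether to continue, 20--25 arguments of the mode.
  A region holds \<open>mX\<close> and then, for each vertex and block, the length of its list of rings and the
  rings \<open>(t, w)\<close>, coded as \<open>t * n + w\<close>.\<close>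

definition c_pre :: com where "c_pre = seqs [
 Compute 15 Sub (Reg 15) (Const 1),
 Compute 30 Sub (Reg 13) (Const 1),
 Compute 30 Mul (Reg 30) (Const 3),
 Compute 30 Add (Reg 30) (Reg 6),
 Load 17 (Reg 30),
 Compute 31 Add (Reg 30) (Const 1),
 Load 18 (Reg 31),
 Compute 31 Add (Reg 30) (Const 2),
 Load 19 (Reg 31),
 QueryDegree 26 (Reg 17),
 Compute 27 Div (Reg 2) (Reg 26),
 Compute 28 Mul (Reg 26) (Reg 27),
 Compute 31 Add (Reg 14) (Reg 17),
 Load 29 (Reg 31)]"

text \<open>The registers are parameters because every ring is filed at both of its ends.\<close>

definition c_push :: "nat => nat => nat => nat => com" where "c_push rv rt ro rl = seqs [
 Compute 50 Div (Reg rt) (Reg rl),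
 Compute 51 Mul (Reg rv) (Reg 9),
 Compute 50 Add (Reg 51) (Reg 50),
 Compute 50 Mul (Reg 50) (Reg 40),
 Compute 51 Add (Reg 14) (Reg 0),
 Compute 50 Add (Reg 51) (Reg 50),
 Load 51 (Reg 50),
 Compute 51 Add (Reg 51) (Const 1),
 Store (Reg 50) (Reg 51),
 Compute 51 Add (Reg 50) (Reg 51),
 Compute 52 Mul (Reg rt) (Reg 0),
 Compute 52 Add (Reg 52) (Reg ro),
 Store (Reg 51) (Reg 52)]"

text \<open>Memory starts as 0 and every sample takes a fresh region, so no time is spent on
  clearing tables.\<close>

definition c_pick :: com where "c_pick = seqs [
 Random 30 (Reg 1),
 Load 31 (Reg 30),
 Compute 14 Add (Reg 8) (Const 0),
 Compute 8 Add (Reg 8) (Reg 7),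
 Store (Reg 6) (Const 0),
 Compute 30 Add (Reg 6) (Const 1), Store (Reg 30) (Const 0),
 Compute 30 Add (Reg 6) (Const 2), Store (Reg 30) (Const 0),
 Compute 30 Add (Reg 6) (Const 3), Store (Reg 30) (Reg 31),
 Compute 30 Add (Reg 6) (Const 4), Store (Reg 30) (Reg 3),
 Compute 30 Add (Reg 6) (Const 5), Store (Reg 30) (Const 0),
 Compute 13 Add (Const 2) (Const 0),
 Compute 10 Add (Const 1) (Const 0)]"

definition c_scan0 :: com where "c_scan0 = seqs [
 Compute 10 Add (Const 5) (Const 0),
 Compute 23 Add (Const 0) (Const 0),
 Compute 24 Add (Reg 18) (Const 0),
 Compute 25 Add (Const 0) (Const 0)]"

definition c_main :: com where "c_main = seqs [
 Compute 30 Less (Reg 13) (Const 2),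
 If (Reg 30)
 (seqs [Compute 12 Add (Reg 12) (Reg 13), Compute 11 Sub (Reg 11) (Const 1), Compute 10 Add (Const 0) (Const 0)])
 (seqs [Compute 30 Less (Reg 19) (Reg 18),
 If (Reg 30)
 (seqs [Compute 30 Less (Reg 19) (Reg 29),
 If (Reg 30) c_scan0
 (seqs [Compute 10 Add (Const 2) (Const 0), Compute 20 Add (Const 0) (Const 0)])])
 (Compute 13 Sub (Reg 13) (Const 2))])]"

definition c_draw :: com where "c_draw = seqs [
 Compute 30 Less (Reg 20) (Reg 28),
 If (Reg 30)
 (seqs [Random 21 (Reg 2), Compute 22 Add (Const 1) (Const 0), Compute 10 Add (Const 3) (Const 0)])
 (seqs [Compute 30 Add (Reg 29) (Reg 27), Store (Reg 31) (Reg 30), c_scan0])]"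

definition c_fact :: com where "c_fact = seqs [
 Compute 30 Mul (Reg 22) (Reg 2),
 Random 31 (Reg 30),
 Compute 31 Add (Reg 31) (Reg 22),
 Compute 30 Less (Reg 21) (Reg 31),
 If (Reg 30)
 (seqs [Compute 30 Mod (Reg 22) (Const 2),
 If (Reg 30)
 (seqs [Compute 20 Add (Reg 20) (Reg 21), Compute 10 Add (Const 4) (Const 0)])
 (seqs [Compute 20 Add (Reg 28) (Const 0), Compute 10 Add (Const 2) (Const 0)])])
 (Compute 22 Add (Reg 22) (Const 1))]"

definition c_hit1 :: com where "c_hit1 = seqs [
 Compute 30 Div (Reg 20) (Reg 27),
 Compute 30 Add (Reg 30) (Const 1),
 QueryNeighbor 32 (Reg 17) (Reg 30),
 Compute 30 Mod (Reg 20) (Reg 27),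
 Compute 33 Add (Reg 29) (Reg 30),
 Compute 30 Add (Reg 14) (Reg 32),
 Load 30 (Reg 30),
 Compute 30 Less (Reg 33) (Reg 30)]"

definition c_hit2 :: com where "c_hit2 = seqs [
 c_push 17 33 32 27,
 QueryDegree 34 (Reg 32),
 Compute 34 Div (Reg 2) (Reg 34),
 c_push 32 33 17 34]"

definition c_hit :: com where "c_hit = seqs [
 Compute 30 Less (Reg 20) (Reg 28),
 If (Reg 30) (seqs [c_hit1, If (Reg 30) Skip c_hit2, Compute 20 Add (Reg 20) (Const 1)]) Skip,
 Compute 10 Add (Const 2) (Const 0)]"

definition c_scan1 :: com where "c_scan1 = seqs [
 Compute 50 Div (Reg 19) (Reg 27),
 Compute 51 Mul (Reg 17) (Reg 9),
 Compute 51 Add (Reg 51) (Reg 50),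
 Compute 51 Mul (Reg 51) (Reg 40),
 Compute 52 Add (Reg 14) (Reg 0),
 Compute 51 Add (Reg 52) (Reg 51),
 Load 52 (Reg 51),
 Compute 53 Less (Reg 23) (Reg 52)]"

definition c_scan2 :: com where "c_scan2 = seqs [
 Compute 23 Add (Reg 23) (Const 1),
 Compute 51 Add (Reg 51) (Reg 23),
 Load 51 (Reg 51),
 Compute 52 Div (Reg 51) (Reg 0),
 Compute 53 Mod (Reg 51) (Reg 0),
 Compute 54 Less (Reg 52) (Reg 19),
 If (Reg 54) Skip
 (seqs [Compute 54 Less (Reg 52) (Reg 24),
 If (Reg 54) (seqs [Compute 24 Add (Reg 52) (Const 0), Compute 25 Add (Reg 53) (Const 0)]) Skip])]"

definition c_scan3 :: com where "c_scan3 = seqs [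
 Compute 10 Add (Const 1) (Const 0),
 Compute 53 Add (Reg 30) (Const 2),
 Compute 54 Less (Reg 24) (Reg 18),
 If (Reg 54)
 (seqs [
 Compute 54 Add (Reg 24) (Const 1), Store (Reg 53) (Reg 54),
 Compute 53 Add (Reg 30) (Const 3), Store (Reg 53) (Reg 25),
 Compute 53 Add (Reg 30) (Const 4), Store (Reg 53) (Reg 24),
 Compute 53 Add (Reg 30) (Const 5), Store (Reg 53) (Const 0),
 Compute 13 Add (Reg 13) (Const 1)])
 (seqs [Compute 54 Add (Reg 50) (Const 1), Compute 54 Mul (Reg 54) (Reg 27), Store (Reg 53) (Reg 54)])]"

definition c_scan :: com where "c_scan = seqs [c_scan1, If (Reg 53) c_scan2 c_scan3]"

definition c_dispatch :: com where "c_dispatch =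
 If (Reg 10)
 (seqs [Compute 32 Equal (Reg 10) (Const 1), If (Reg 32) c_main
 (seqs [Compute 32 Equal (Reg 10) (Const 2), If (Reg 32) c_draw
 (seqs [Compute 32 Equal (Reg 10) (Const 3), If (Reg 32) c_fact
 (seqs [Compute 32 Equal (Reg 10) (Const 4), If (Reg 32) c_hit c_scan])])])])
 c_pick"

text \<open>The trial is over in mode 0 with no samples left, that is, when mode plus samples
  vanishes.\<close>

definition c_post :: com where "c_post = seqs [
 Compute 30 Add (Reg 10) (Reg 11),
 Compute 31 Less (Const 0) (Reg 15),
 Compute 32 Less (Const 0) (Reg 30),
 Compute 16 Mul (Reg 31) (Reg 32)]"

definition c_body :: com where "c_body = seqs [c_pre, c_dispatch, c_post]"

lemma loopfree_body: "loopfree c_body"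
 by (simp add: c_body_def c_pre_def c_dispatch_def c_post_def c_pick_def c_main_def c_draw_def c_fact_def
 c_hit_def c_hit1_def c_hit2_def c_scan_def c_scan1_def c_scan2_def c_scan3_def c_scan0_def c_push_def)

definition body_time :: nat where "body_time = time c_body"

text \<open>\<open>TOP\<close> bounds all words that occur, so arithmetic never wraps. The memory
  holds the list of non-isolated vertices below \<open>S0\<close>, the stack from \<open>S0\<close>
  up to \<open>B0'\<close>, and then the regions of the samples.\<close>

locale ram = rgraph_par +
 fixes w F S0 B0' TOP :: nat
 assumes ne: "nonis ~= {}"
 and nS: "n <= S0" and SB: "S0 + 3 * (F + 3) <= B0'"
 and TOPw: "TOP < 2 ^ w" and smallT: "5 <= TOP" and QT: "Q * Q + H * n + Q + H + n + F + 5 <= TOP" and BT: "B0' <= TOP"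
begin

text \<open>The sizes are generous, a slot having room for every conceivable ring: they affect only
  the range of addresses, not the time.\<close>

definition NB :: nat where "NB = H + 1"
definition ST :: nat where "ST = H * n + 1"
definition RS :: nat where "RS = n + n * NB * ST"

lemma nowrap: "x <= TOP ==> x mod 2 ^ w = x"
 using TOPw by simp

lemma w0: "0 < w"
 using TOPw smallT by (cases w) auto

lemma const_small [simp]: "0 < w" "2 mod 2 ^ w = (2::nat)" "3 mod 2 ^ w = (3::nat)"
 "4 mod 2 ^ w = (4::nat)" "5 mod 2 ^ w = (5::nat)"
 using smallT w0 by (simp_all add: nowrap)

definition badr :: "nat => nat => nat => nat" where
 "badr base u i = base + n + (u * NB + i) * ST"

lemma badr_range:
 assumes "u < n" "i < NB" "j < ST"
 shows "base + n <= badr base u i + j" "badr base u i + j < base + RS"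
proof -
 show "base + n <= badr base u i + j" by (simp add: badr_def)
 have "u * NB + i < n * NB"
 proof -
 have "u * NB + i < (u + 1) * NB" using assms(2) by simp
 also have "... <= n * NB" using assms(1) by (intro mult_le_mono1) simp
 finally show ?thesis .
 qed
 then have "(u * NB + i + 1) * ST <= n * NB * ST" by (intro mult_le_mono1) simp
 then show "badr base u i + j < base + RS" using assms(3) by (simp add: badr_def RS_def)
qed

lemma badr_inj:
 assumes "badr base u i + j = badr base u' i' + j'" "i < NB" "i' < NB" "j < ST" "j' < ST"
 shows "u = u' & i = i' & j = j'"
proof -
 have e: "(u * NB + i) * ST + j = (u' * NB + i') * ST + j'" using assms(1) by (simp add: badr_def)
 have "u * NB + i = u' * NB + i'" "j = j'"
 using arg_cong[OF e, of "%x. x div ST"] arg_cong[OF e, of "%x. x mod ST"] assms(4,5) by simp_all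
 moreover have "u = u'" "i = i'"
 using arg_cong[OF calculation(1), of "%x. x div NB"] arg_cong[OF calculation(1), of "%x. x mod NB"] assms(2,3) by simp_all
 ultimately show ?thesis by simp
qed

fun frel :: "(nat => nat) => frame list => bool" where
 "frel m [] \<longleftrightarrow> True"
| "frel m ((u, t, c) # r) \<longleftrightarrow> m (S0 + 3 * length r) = u & m (S0 + 3 * length r + 1) = t
 & m (S0 + 3 * length r + 2) = c & frel m r"

lemma frel_cong: "(!!x. S0 <= x ==> x < S0 + 3 * length fs ==> m x = m' x) ==> frel m fs = frel m' fs"
 by (induction m fs rule: frel.induct) auto

lemma frel_upd [simp]: "x < S0 \<or> S0 + 3 * length fs <= x ==> frel (m(x := v)) fs = frel m fs"
 by (rule frel_cong) auto

definition xrel :: "(nat => nat) => nat => (nat => nat) => bool" where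
 "xrel m base X \<longleftrightarrow> (\<forall>u<n. m (base + u) = X u)"

definition brel :: "(nat => nat) => nat => (nat => nat => nat list) => bool" where
 "brel m base B \<longleftrightarrow> (\<forall>u<n. \<forall>i<NB. m (badr base u i) = length (B u i) &
 (\<forall>j<length (B u i). m (badr base u i + (j + 1)) = B u i ! j))"

lemma brel_push:
 assumes "brel m base B" "u < n" "i < NB" "length (B u i) + 1 < ST" "!!v k. v < n ==> k < NB ==> length (B v k) < ST"
 shows "brel (m(badr base u i := length (B u i) + 1, badr base u i + (length (B u i) + 1) := e)) base
 (%v k. if v = u & k = i then B u i @ [e] else B v k)"
 unfolding brel_def
proof (intro allI impI conjI)
 let ?m = "m(badr base u i := length (B u i) + 1, badr base u i + (length (B u i) + 1) := e)"
 fix v k assume v: "v < n" "k < NB"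
 note inj = badr_inj[of base v k _ u i]
 have b0: "badr base v k = badr base v k + 0" "badr base u i = badr base u i + 0" by simp_all
 have st: "0 < ST" by (simp add: ST_def)
 show "?m (badr base v k) = length (if v = u & k = i then B u i @ [e] else B v k)"
 proof (cases "v = u & k = i")
 case False
 have "badr base v k ~= badr base u i + (length (B u i) + 1)" "badr base v k ~= badr base u i"
 using inj[of 0 "length (B u i) + 1"] inj[of 0 0] False v(2) assms(3,4) st by auto
 then show ?thesis using False assms(1) v by (simp add: brel_def)
 qed (simp)
 fix j assume j: "j < length (if v = u & k = i then B u i @ [e] else B v k)"
 show "?m (badr base v k + (j + 1)) = (if v = u & k = i then B u i @ [e] else B v k) ! j"
 proof (cases "v = u & k = i")
 case True
 show ?thesis
 proof (cases "j = length (B u i)")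
 case False
 then show ?thesis using True j assms(1,2,3) by (auto simp: brel_def nth_append)
 qed (use True in simp)
 next
 case False
 then have jl: "j + 1 < ST" using j assms(5)[OF v] by (auto split: if_splits)
 have "badr base v k + (j + 1) ~= badr base u i + (length (B u i) + 1)" "badr base v k + (j + 1) ~= badr base u i"
 using inj[of "j + 1" "length (B u i) + 1"] inj[of "j + 1" 0] False v(2) assms(3,4) st jl by auto
 moreover have "(if v = u & k = i then B u i @ [e] else B v k) = B v k" using False by (rule if_not_P)
 moreover have "j < length (B v k)" using j False by (auto split: if_splits)
 ultimately show ?thesis using assms(1) v by (simp add: brel_def)
 qed
qed

lemma brel_cong:
 assumes "!!x. base + n <= x ==> x < base + RS ==> m x = m' x"
 and "!!v k. v < n ==> k < NB ==> length (B v k) < ST"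
 shows "brel m base B = brel m' base B"
proof -
 have 1: "m (badr base u i + j) = m' (badr base u i + j)" if "u < n" "i < NB" "j < ST" for u i j
 using badr_range[OF that, of base] assms(1) by simp
 have st: "0 < ST" by (simp add: ST_def)
 have 2: "m (badr base u i) = m' (badr base u i)" if "u < n" "i < NB" for u i
 using 1[OF that, of 0] st by simp
 have 3: "m (badr base u i + (j + 1)) = m' (badr base u i + (j + 1))" if "u < n" "i < NB" "j < length (B u i)" for u i j
 using 1[OF that(1,2), of "j + 1"] assms(2)[OF that(1,2)] that(3) by simp
 show ?thesis unfolding brel_def using 2 3 by auto
qed

definition enc :: "nat \<times> nat => nat" where "enc x = fst x * n + snd x"

definition encB :: "(nat \<times> nat \<times> nat) list => nat => nat => nat list" where
 "encB G u i = map enc (bucket G u i)"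

lemma bucket_facts:
 assumes "Rg G \<subseteq> cells" "distinct (map (%(a, w, \<tau>). ({a, w}, \<tau>)) G)"
 shows "length (bucket G u i) < ST" "x \<in> set (bucket G u i) ==> fst x < H & snd x < n"
proof -
 show m: "fst x < H & snd x < n" if "x \<in> set (bucket G u i)" for x
 using bucket_mem[OF assms(1), of "fst x" "snd x" u i] that assms(1) edgeD by (auto simp: cells_def)
 then have "set (bucket G u i) \<subseteq> {..<H} \<times> {..<n}" by auto
 then have "card (set (bucket G u i)) <= card ({..<H} \<times> {..<n})" by (intro card_mono) auto
 then show "length (bucket G u i) < ST"
 using bucket_distinct[OF assms] by (simp add: distinct_card ST_def card_cartesian_product)
qed

definition rmode :: "state => mode => bool" where
 "rmode s m = (case m of Pick => regs s 10 = 0 | Main => regs s 10 = 1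
 | Draw c => regs s 10 = 2 & regs s 20 = c
 | Fact c g k => regs s 10 = 3 & regs s 20 = c & regs s 21 = g & regs s 22 = k
 | Push c => regs s 10 = 4 & regs s 20 = c
 | Scan j bt bw => regs s 10 = 5 & regs s 23 = j & regs s 24 = bt & regs s 25 = bw)"

definition prel :: "state => bool" where
 "prel s \<longleftrightarrow> regs s 0 = n & regs s 1 = card nonis & regs s 2 = Q & regs s 3 = N & regs s 6 = S0
 & regs s 7 = RS & regs s 9 = NB & regs s 40 = ST & (\<forall>i<length VL. mem s i = VL ! i)"

definition srel :: "nat => state => mst => bool" where
 "srel fl s A \<longleftrightarrow> regs s 13 = length (mfr A) & length (mfr A) + fl <= F + 2 & frel (mem s) (mfr A)
 & B0' <= regs s 14 & regs s 14 + RS <= regs s 8 & xrel (mem s) (regs s 14) (mX A)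
 & brel (mem s) (regs s 14) (encB (mG A))"

text \<open>\<open>cap\<close> bounds the memory used up to the end of the trial.\<close>

definition core :: "nat => nat => state => mst => bool" where
 "core cap fl s A \<longleftrightarrow> prel s & regs s 11 = mleft A & regs s 12 = mhits A & rmode s (md A)
 & (\<forall>x\<ge>regs s 8. mem s x = 0) & B0' <= regs s 8 & regs s 8 + RS * fl <= cap
 & mhits A + fl <= F & mleft A + 5 <= TOP & cap <= TOP & (md A ~= Pick --> srel fl s A)"

definition rel :: "nat => nat => state => mst => bool" where
 "rel cap fl s A \<longleftrightarrow> core cap fl s A & regs s 15 = fl & (regs s 16 ~= 0 \<longleftrightarrow> fl ~= 0 & ~ mdone A)"

end


context ram
begin

abbreviation xx :: "com => state => state" where "xx \<equiv> dex w n adj"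

definition tops :: "state => mst => bool" where
 "tops s A \<longleftrightarrow> (md A ~= Pick --> 2 <= length (mfr A) --> (case hd (mfr A) of (u, t, c) =>
 u \<in> nonis & regs s 17 = u & regs s 18 = t & regs s 19 = c & regs s 30 = S0 + 3 * (length (mfr A) - 1)
 & regs s 26 = deg u & regs s 27 = len u & regs s 28 = CC u & regs s 29 = mX A u & regs s 31 = regs s 14 + u))"

lemma core_cong:
 assumes "core cap fl s A" "mem s' = mem s"
 and "!!r. r \<in> {0..14} \<union> {20..25} \<union> {40} ==> regs s' r = regs s r"
 shows "core cap fl s' A"
proof -
 have r: "regs s' 0 = regs s 0" "regs s' 1 = regs s 1" "regs s' 2 = regs s 2" "regs s' 3 = regs s 3"
 "regs s' 6 = regs s 6" "regs s' 7 = regs s 7" "regs s' 8 = regs s 8" "regs s' 9 = regs s 9"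
 "regs s' 10 = regs s 10" "regs s' 11 = regs s 11" "regs s' 12 = regs s 12" "regs s' 13 = regs s 13"
 "regs s' 14 = regs s 14" "regs s' 20 = regs s 20" "regs s' 21 = regs s 21" "regs s' 22 = regs s 22"
 "regs s' 23 = regs s 23" "regs s' 24 = regs s 24" "regs s' 25 = regs s 25" "regs s' 40 = regs s 40"
 by (rule assms(3); simp)+
 have r1: "regs s' (Suc 0) = regs s (Suc 0)" by (rule assms(3)) simp
 show ?thesis using assms(1)
 unfolding core_def prel_def srel_def rmode_def assms(2) r by (simp add: r1 split: mode.splits)
qed

lemma nonis_n: "u \<in> nonis ==> u < n" by (simp add: nonis_def)

lemma pre_state:
 assumes c: "core cap fl s A" and "regs s 15 = fl" "1 <= fl" "minv A"
 shows "core cap fl (xx c_pre s) A" "regs (xx c_pre s) 15 = fl - 1" "tops (xx c_pre s) A"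
proof -
 have e: "r \<notin> {15, 17, 18, 19, 26, 27, 28, 29, 30, 31} ==> regs (xx c_pre s) r = regs s r"
 "mem (xx c_pre s) = mem s" for r
 by (simp_all add: c_pre_def set_reg_def)
 show "core cap fl (xx c_pre s) A" by (rule core_cong[OF c e(2)]) (rule e(1), auto)
 show "regs (xx c_pre s) 15 = fl - 1" using assms(2) by (simp add: c_pre_def set_reg_def)
 show "tops (xx c_pre s) A"
 unfolding tops_def
 proof (intro impI)
 assume p: "md A ~= Pick" and l: "2 <= length (mfr A)"
 then obtain u t c' y r where fr: "mfr A = (u, t, c') # y # r" by (cases "mfr A"; cases "tl (mfr A)") auto
 have fv: "finv (mX A) (mfr A)" using assms(4) p by (auto simp: minv_def)
 then have u: "u \<in> nonis" unfolding finv_def fr by fastforce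
 have S: "srel fl s A" and P: "prel s" using c p by (auto simp: core_def)
 have sp: "regs s 13 = Suc (Suc (length r))" using S fr by (simp add: srel_def)
 have le: "Suc (Suc (length r)) + fl <= F + 2" using S fr by (simp add: srel_def)
 have "S0 + 3 * Suc (length r) + 2 <= TOP" using le SB BT by simp
 then have nw: "(3 + 3 * length r) mod 2 ^ w = 3 + 3 * length r" "(3 + 3 * length r + S0) mod 2 ^ w = 3 + 3 * length r + S0"
 "(4 + 3 * length r + S0) mod 2 ^ w = 4 + 3 * length r + S0" "(5 + 3 * length r + S0) mod 2 ^ w = 5 + 3 * length r + S0"
 by (intro nowrap; simp)+
 have base: "regs s 14 + u <= TOP"
 proof -
 have "regs s 14 + RS <= cap" using S c by (simp add: srel_def core_def)
 moreover have "u <= RS" using nonis_n[OF u] by (simp add: RS_def)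
 moreover have "cap <= TOP" using c by (simp add: core_def)
 ultimately show ?thesis by simp
 qed
 have CQ: "deg u * len u mod 2 ^ w = deg u * len u"
 using nonis_len[OF u] QT by (intro nowrap) (simp add: CC_def)
 have m: "mem s (S0 + 3 * Suc (length r)) = u" "mem s (S0 + 3 * Suc (length r) + 1) = t"
 "mem s (S0 + 3 * Suc (length r) + 2) = c'" "mem s (regs s 14 + u) = mX A u"
 using S fr nonis_n[OF u] by (auto simp: srel_def xrel_def)
 then have m': "mem s (3 + 3 * length r + S0) = u" "mem s (4 + 3 * length r + S0) = t" "mem s (5 + 3 * length r + S0) = c'"
 by (simp_all add: algebra_simps)
 have q: "query_degree n adj u = deg u" using nonis_n[OF u] by (simp add: query_degree_def deg_def)
 have r: "regs s 2 = Q" "regs s 6 = S0" using P by (auto simp: prel_def)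
 show "case hd (mfr A) of (u, t, c) => u \<in> nonis & regs (xx c_pre s) 17 = u & regs (xx c_pre s) 18 = t &
 regs (xx c_pre s) 19 = c & regs (xx c_pre s) 30 = S0 + 3 * (length (mfr A) - 1) & regs (xx c_pre s) 26 = deg u
 & regs (xx c_pre s) 27 = len u & regs (xx c_pre s) 28 = CC u & regs (xx c_pre s) 29 = mX A u
 & regs (xx c_pre s) 31 = regs (xx c_pre s) 14 + u"
 using u m m' nw base nowrap[OF base] CQ q r sp fr
 by (simp add: c_pre_def set_reg_def CC_def len_def algebra_simps)
 qed
qed

lemma post_state:
 assumes c: "core cap fl s A" and "regs s 15 = fl"
 shows "rel cap fl (xx c_post s) A"
proof -
 have e: "r \<notin> {16, 30, 31, 32} ==> regs (xx c_post s) r = regs s r"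
 "mem (xx c_post s) = mem s" for r
 by (simp_all add: c_post_def set_reg_def)
 have 1: "core cap fl (xx c_post s) A" by (rule core_cong[OF c e(2)]) (rule e(1), auto)
 have 2: "regs (xx c_post s) 15 = fl" using assms(2) e(1)[of 15] by simp
 have m: "regs s 11 = mleft A" "mleft A + 5 <= TOP" "rmode s (md A)" using c by (auto simp: core_def)
 have "regs s 10 <= 5" using m(3) by (auto simp: rmode_def split: mode.splits)
 then have nw: "(regs s 10 + regs s 11) mod 2 ^ w = regs s 10 + regs s 11" using m by (intro nowrap) simp
 have "regs s 10 = 0 \<longleftrightarrow> md A = Pick" using m(3) by (auto simp: rmode_def split: mode.splits)
 then have "regs (xx c_post s) 16 ~= 0 \<longleftrightarrow> fl ~= 0 & ~ mdone A"
 using nw m(1) assms(2) by (auto simp: c_post_def set_reg_def mdone_def)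
 then show ?thesis using 1 2 by (simp add: rel_def)
qed

section \<open>Each mode of the program simulates the sampling machine\<close>

lemma main_state:
 assumes c: "core cap fl s A" and t: "tops s A" and fl: "1 <= fl" and m: "md A = Main" and inv: "minv A"
 shows "\<exists>A'. mstep A = return_pmf A' & core cap (fl - 1) (xx c_main s) A'"
proof -
 obtain u t c0 where h: "hd (mfr A) = (u, t, c0)" by (metis surj_pair)
 have C: "prel s" "regs s 11 = mleft A" "regs s 12 = mhits A" "\<forall>x\<ge>regs s 8. mem s x = 0" "B0' <= regs s 8"
 "regs s 8 + RS * fl <= cap" "mhits A + fl <= F" "mleft A + 5 <= TOP" "cap <= TOP" "srel fl s A"
 using c m by (auto simp: core_def)
 have m10: "regs s 10 = 1" using c m by (simp add: core_def rmode_def)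
 have RSfl: "regs s 8 + RS * (fl - 1) <= cap" using C(6) mult_le_mono2[of "fl - 1" fl RS] by linarith
 have l1: "1 <= mleft A" using inv m by (simp add: minv_def)
 have sp: "regs s 13 = length (mfr A)" "length (mfr A) + fl <= F + 2" using C by (auto simp: srel_def)
 have srel1: "srel (fl - 1) s A" using C(10) by (auto simp: srel_def)
 show ?thesis
 proof (cases "length (mfr A) <= 1")
 case True
 have "mhits A + length (mfr A) <= TOP" using True C(7) QT fl by simp
 then have nw: "(mhits A + length (mfr A)) mod 2 ^ w = mhits A + length (mfr A)" by (rule nowrap)
 have "mstep A = return_pmf (A\<lparr>mhits := mhits A + length (mfr A), mleft := mleft A - 1, md := Pick\<rparr>)"
 using True m by (simp add: mstep_def split: prod.splits)
 moreover have "core cap (fl - 1) (xx c_main s) (A\<lparr>mhits := mhits A + length (mfr A), mleft := mleft A - 1, md := Pick\<rparr>)"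
 using True C RSfl sp nw fl by (auto simp: c_main_def set_reg_def core_def prel_def rmode_def)
 ultimately show ?thesis by blast
 next
 case len: False
 then have T: "u \<in> nonis" "regs s 18 = t" "regs s 19 = c0" "regs s 29 = mX A u"
 using t m h by (auto simp: tops_def)
 show ?thesis
 proof (cases "t <= c0")
 case True
 obtain y r where fr: "mfr A = (u, t, c0) # y # r" using len h by (cases "mfr A"; cases "tl (mfr A)") auto
 have "mstep A = return_pmf (A\<lparr>mfr := r\<rparr>)"
 using True m h len fr by (simp add: mstep_def)
 moreover have "core cap (fl - 1) (xx c_main s) (A\<lparr>mfr := r\<rparr>)"
 using True len T C RSfl sp fr m fl m10 by (cases y) (auto simp: c_main_def set_reg_def core_def prel_def rmode_def srel_def)
 ultimately show ?thesis by blast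
 next
 case tc: False
 show ?thesis
 proof (cases "mX A u <= c0")
 case True
 have "mstep A = return_pmf (A\<lparr>md := Draw 0\<rparr>)" using True tc m h len by (simp add: mstep_def)
 moreover have "core cap (fl - 1) (xx c_main s) (A\<lparr>md := Draw 0\<rparr>)"
 using True tc len T C RSfl sp srel1 fl by (simp add: c_main_def set_reg_def core_def prel_def rmode_def srel_def)
 ultimately show ?thesis by blast
 next
 case False
 have "mX A u <= mX A u" by simp
 have "t <= N"
 proof -
 have "finv (mX A) (mfr A)" "topinv A" using inv m h len tc by (auto simp: minv_def topinv_def)
 from this(2,1) show ?thesis by (rule topinvE) (use h in auto)
 qed
 then have nw: "t mod 2 ^ w = t" using QT by (intro nowrap) (simp add: H_def)
 have "mstep A = return_pmf (A\<lparr>md := Scan 0 t 0\<rparr>)" using False tc m h len by (simp add: mstep_def)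
 moreover have "core cap (fl - 1) (xx c_main s) (A\<lparr>md := Scan 0 t 0\<rparr>)"
 using False tc len T C RSfl sp srel1 nw fl by (simp add: c_main_def c_scan0_def set_reg_def core_def prel_def rmode_def srel_def)
 ultimately show ?thesis by blast
 qed
 qed
 qed
qed

lemma pick_state:
 assumes c: "core cap fl s A" and fl: "1 <= fl" and m: "md A = Pick" and l: "mleft A ~= 0"
 shows "rel_pmf (core cap (fl - 1)) (exec w n adj c_pick s) (mstep A)"
proof -
 have C: "prel s" "regs s 11 = mleft A" "regs s 12 = mhits A" "\<forall>x\<ge>regs s 8. mem s x = 0" "B0' <= regs s 8"
 "regs s 8 + RS * fl <= cap" "mhits A + fl <= F" "mleft A + 5 <= TOP" "cap <= TOP"
 using c m by (auto simp: core_def)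
 have P: "regs s (Suc 0) = card nonis" "regs s 6 = S0" "regs s 3 = N" "regs s 7 = RS"
 using C(1) by (auto simp: prel_def)
 have fl': "RS * fl = RS + RS * (fl - 1)" using fl by (cases fl) auto
 have n0: "0 < card nonis" using ne by (simp add: card_gt_0_iff)
 have mx: "max 1 (card nonis) = length VL" using n0 VL_facts(3) by simp
 have st: "mstep A = map_pmf (%i. A\<lparr>mfr := start (VL ! i), mX := (%_. 0), mG := [], md := Main\<rparr>) (pmf_of_set {..<length VL})"
 using m l by (simp add: mstep_def split: prod.splits)
 define rest where "rest = seqs (tl [
 Random 30 (Reg 1),
 Load 31 (Reg 30),
 Compute 14 Add (Reg 8) (Const 0),
 Compute 8 Add (Reg 8) (Reg 7),
 Store (Reg 6) (Const 0),
 Compute 30 Add (Reg 6) (Const 1), Store (Reg 30) (Const 0),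
 Compute 30 Add (Reg 6) (Const 2), Store (Reg 30) (Const 0),
 Compute 30 Add (Reg 6) (Const 3), Store (Reg 30) (Reg 31),
 Compute 30 Add (Reg 6) (Const 4), Store (Reg 30) (Reg 3),
 Compute 30 Add (Reg 6) (Const 5), Store (Reg 30) (Const 0),
 Compute 13 Add (Const 2) (Const 0),
 Compute 10 Add (Const 1) (Const 0)])"
 have ex: "exec w n adj c_pick s = map_pmf (%i. xx rest (set_reg 30 i s)) (pmf_of_set {..<length VL})"
 proof -
 have d: "deterministic rest" by (simp add: rest_def)
 have "exec w n adj c_pick s = bind_pmf (map_pmf (%i. set_reg 30 i s) (pmf_of_set {..<length VL})) (exec w n adj rest)"
 using mx P by (simp add: c_pick_def rest_def)
 then show ?thesis by (simp add: exec_dex[OF d] bind_map_pmf map_pmf_def[symmetric])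
 qed
 have VLn: "length VL <= n"
 proof -
 have "card nonis <= card {..<n}" by (rule card_mono) (auto simp: nonis_def)
 then show ?thesis using VL_facts(3) by simp
 qed
 have S5: "S0 + 5 <= TOP" using SB BT by simp
 have nw: "regs s 8 mod 2 ^ w = regs s 8" "(regs s 8 + RS) mod 2 ^ w = regs s 8 + RS"
 "Suc S0 mod 2 ^ w = Suc S0" "(S0 + 2) mod 2 ^ w = S0 + 2" "(S0 + 3) mod 2 ^ w = S0 + 3"
 "(S0 + 4) mod 2 ^ w = S0 + 4" "(S0 + 5) mod 2 ^ w = S0 + 5"
 using C S5 fl' by (auto intro!: nowrap)
 have key: "core cap (fl - 1) (xx rest (set_reg 30 i s)) (A\<lparr>mfr := start (VL ! i), mX := (%_. 0), mG := [], md := Main\<rparr>)"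
 if i: "i < length VL" for i
 proof -
 have vi: "mem s i = VL ! i" using C(1) i by (simp add: prel_def)
 define s' where "s' = xx rest (set_reg 30 i s)"
 have r: "regs s' 13 = 2" "regs s' 10 = 1" "regs s' 14 = regs s 8" "regs s' 8 = regs s 8 + RS"
 "r \<notin> {8, 10, 13, 14, 30, 31} ==> regs s' r = regs s r" for r
 using nw P by (simp_all add: s'_def rest_def set_reg_def)
 have me: "mem s' = (mem s)(S0 := 0, Suc S0 := 0, S0 + 2 := 0, S0 + 3 := VL ! i, S0 + 4 := N, S0 + 5 := 0)"
 using nw P vi by (simp add: s'_def rest_def set_reg_def)
 have big: "S0 + 5 < B0'" using SB by simp
 \<comment> \<open>Untouched memory represents \<open>mX = 0\<close> and empty lists of
   rings.\<close>
 have z: "mem s' x = 0" if "regs s 8 <= x" for x using that C(4,5) big by (simp add: me)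
 have pv: "\<forall>j<length VL. mem s' j = VL ! j"
 using C(1) VLn nS by (auto simp: me prel_def)
 have "frel (mem s') (start (VL ! i))" by (simp add: me start_def)
 moreover have "xrel (mem s') (regs s 8) (%_. 0)" using z by (simp add: xrel_def)
 moreover have "brel (mem s') (regs s 8) (encB [])" using z by (simp add: brel_def encB_def bucket_def badr_def)
 moreover have "2 + (fl - 1) <= F + 2" using C(7) by simp
 ultimately have "srel (fl - 1) s' (A\<lparr>mfr := start (VL ! i), mX := (%_. 0), mG := [], md := Main\<rparr>)"
 using r C by (simp add: srel_def start_def)
 moreover have "prel s'" using C(1) r(5)[of 0] r(5)[of 1] r(5)[of 2] r(5)[of 3] r(5)[of 6] r(5)[of 7] r(5)[of 9] r(5)[of 40] pv
 by (simp add: prel_def)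
 ultimately show ?thesis
 using r(1-4) r(5)[of 11] r(5)[of 12] C z fl' by (simp add: core_def rmode_def s'_def[symmetric])
 qed
 show ?thesis unfolding ex st pmf.rel_map
 by (rule rel_pmf_reflI) (use key set_unif[of "length VL"] n0 VL_facts(3) in auto)
qed

lemma draw_state:
 assumes c: "core cap fl s A" and t: "tops s A" and fl: "1 <= fl" and m: "md A = Draw c'" and inv: "minv A"
 shows "rel_pmf (core cap (fl - 1)) (exec w n adj c_draw s) (mstep A)"
proof -
 obtain u t c0 where h: "hd (mfr A) = (u, t, c0)" by (metis surj_pair)
 have C: "prel s" "regs s 11 = mleft A" "regs s 12 = mhits A" "\<forall>x\<ge>regs s 8. mem s x = 0" "B0' <= regs s 8"
 "regs s 8 + RS * fl <= cap" "mhits A + fl <= F" "mleft A + 5 <= TOP" "cap <= TOP" "srel fl s A"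
 "regs s 20 = c'"
 using c m by (auto simp: core_def rmode_def)
 have RSfl: "regs s 8 + RS * (fl - 1) <= cap" using C(6) mult_le_mono2[of "fl - 1" fl RS] by linarith
 have I: "finv (mX A) (mfr A)" "ginv (KD (mX A) u c') (mG A)" "topinv A" "mX A u = c0"
 using inv m h by (auto simp: minv_def Let_def)
 obtain y r where fr: "mfr A = (u, t, c0) # y # r" "c0 < t" "u \<in> nonis" "t <= N"
 using I(3,1) by (rule topinvE) (use h in auto)
 have T: "regs s 17 = u" "regs s 18 = t" "regs s 19 = c0" "regs s 28 = CC u" "regs s 29 = mX A u" "regs s 27 = len u" "regs s 31 = regs s 14 + u"
 using t m h fr by (auto simp: tops_def)
 have srel1: "srel (fl - 1) s A" using C(10) by (auto simp: srel_def)
 have Q0: "regs s 2 = Q" using C(1) by (simp add: prel_def)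
 have mx: "max 1 Q = Q" using Q2 by simp
 have tn: "t mod 2 ^ w = t" using fr(4) QT by (intro nowrap) (simp add: H_def)
 show ?thesis
 proof (cases "c' < CC u")
 case True
 have ex: "exec w n adj c_draw s = map_pmf (%g. set_reg 10 3 (set_reg 22 1 (set_reg 21 g (set_reg 30 1 s)))) (pmf_of_set {..<Q})"
 using True C(11) T Q0 mx by (simp add: c_draw_def bind_return_pmf bind_map_pmf map_pmf_def[symmetric] set_reg_def)
 have st: "mstep A = map_pmf (%g. A\<lparr>md := Fact c' g 1\<rparr>) (pmf_of_set {..<Q})"
 using True m h by (simp add: mstep_def)
 show ?thesis unfolding ex st pmf.rel_map
 by (rule rel_pmf_reflI) (use C RSfl srel1 fl in \<open>simp add: set_reg_def core_def prel_def rmode_def srel_def\<close>)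
 next
 case False
 have lQ: "len u <= Q" by (simp add: len_def)
 have nw: "(mX A u + len u) mod 2 ^ w = mX A u + len u"
 using I(4) fr lQ QT by (intro nowrap) (simp add: H_def)
 have st: "mstep A = return_pmf (A\<lparr>mX := (mX A)(u := mX A u + len u), md := Scan 0 t 0\<rparr>)"
 using False m h by (simp add: mstep_def)
 have d: "exec w n adj c_draw s = return_pmf (xx (seqs [Compute 30 Less (Reg 20) (Reg 28), Compute 30 Add (Reg 29) (Reg 27), Store (Reg 31) (Reg 30), c_scan0]) s)"
 using False C(11) T by (simp add: c_draw_def c_scan0_def bind_return_pmf set_reg_def)
 define s' where "s' = xx (seqs [Compute 30 Less (Reg 20) (Reg 28), Compute 30 Add (Reg 29) (Reg 27), Store (Reg 31) (Reg 30), c_scan0]) s"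
 have r: "regs s' 10 = 5" "regs s' 23 = 0" "regs s' 24 = t" "regs s' 25 = 0"
 "r \<notin> {10, 23, 24, 25, 30} ==> regs s' r = regs s r" for r
 using tn T by (simp_all add: s'_def c_scan0_def set_reg_def)
 have me: "mem s' = (mem s)(regs s 14 + u := mX A u + len u)"
 using nw T by (simp add: s'_def c_scan0_def set_reg_def)
 have un: "u < n" using nonis_n[OF fr(3)] .
 have nR: "n <= RS" by (simp add: RS_def)
 have b: "B0' <= regs s 14" "regs s 14 + RS <= regs s 8" using C(10) by (auto simp: srel_def)
 have frl: "frel (mem s') (mfr A)"
 proof -
 have "length (mfr A) + fl <= F + 2" using C(10) by (simp add: srel_def)
 then have "S0 + 3 * length (mfr A) <= B0'" using SB by simp
 then show ?thesis unfolding me using b C(10) by (subst frel_upd) (auto simp: srel_def)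
 qed
 have xr: "xrel (mem s') (regs s 14) ((mX A)(u := mX A u + len u))"
 using C(10) by (auto simp: me xrel_def srel_def)
 have br: "brel (mem s') (regs s 14) (encB (mG A))"
 proof -
 have "Rg (mG A) \<subseteq> cells" "distinct (map (%(a, w, \<tau>). ({a, w}, \<tau>)) (mG A))" using I(2) by (auto simp: ginv_def)
 then have "brel (mem s') (regs s 14) (encB (mG A)) = brel (mem s) (regs s 14) (encB (mG A))"
 using bucket_facts(1) un by (intro brel_cong) (auto simp: me encB_def)
 then show ?thesis using C(10) by (simp add: srel_def)
 qed
 have z: "\<forall>x\<ge>regs s 8. mem s' x = 0" using C(4) b un nR by (auto simp: me)
 have pv: "\<forall>j<length VL. mem s' j = VL ! j"
 proof -
 have "card nonis <= card {..<n}" by (rule card_mono) (auto simp: nonis_def)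
 then show ?thesis using C(1) VL_facts(3) nS SB b by (auto simp: me prel_def)
 qed
 have "core cap (fl - 1) s' (A\<lparr>mX := (mX A)(u := mX A u + len u), md := Scan 0 t 0\<rparr>)"
 using C RSfl srel1 frl xr br z pv b r(1-4) r(5)[of 0] r(5)[of 1] r(5)[of 2] r(5)[of 3] r(5)[of 6] r(5)[of 7] r(5)[of 8] r(5)[of 9]
 r(5)[of 11] r(5)[of 12] r(5)[of 13] r(5)[of 14] r(5)[of 40] fl
 by (simp add: core_def prel_def rmode_def srel_def)
 then show ?thesis unfolding st d s'_def by simp
 qed
qed

lemma fact_state:
 assumes c: "core cap fl s A" and t: "tops s A" and fl: "1 <= fl" and m: "md A = Fact c' g k" and inv: "minv A"
 shows "rel_pmf (core cap (fl - 1)) (exec w n adj c_fact s) (mstep A)"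
proof -
 obtain u t c0 where h: "hd (mfr A) = (u, t, c0)" by (metis surj_pair)
 have C: "prel s" "regs s 11 = mleft A" "regs s 12 = mhits A" "\<forall>x\<ge>regs s 8. mem s x = 0" "B0' <= regs s 8"
 "regs s 8 + RS * fl <= cap" "mhits A + fl <= F" "mleft A + 5 <= TOP" "cap <= TOP" "srel fl s A"
 "regs s 20 = c'" "regs s 21 = g" "regs s 22 = k" "regs s 10 = 3"
 using c m by (auto simp: core_def rmode_def)
 have RSfl: "regs s 8 + RS * (fl - 1) <= cap" using C(6) mult_le_mono2[of "fl - 1" fl RS] by linarith
 have I: "finv (mX A) (mfr A)" "topinv A" "c' < CC u" "g < Q" "1 <= k" "k <= g + 1"
 using inv m h by (auto simp: minv_def Let_def)
 obtain y r where fr: "mfr A = (u, t, c0) # y # r" "c0 < t" "u \<in> nonis" "t <= N"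
 using I(2,1) by (rule topinvE) (use h in auto)
 have T: "regs s 28 = CC u" using t m h fr by (auto simp: tops_def)
 have srel1: "srel (fl - 1) s A" using C(10) by (auto simp: srel_def)
 have Q0: "regs s 2 = Q" using C(1) by (simp add: prel_def)
 have CQ: "CC u <= Q" using nonis_len[OF fr(3)] by simp
 have kQ: "k * Q <= Q * Q" using I by (intro mult_le_mono1) simp
 have QQ: "2 * Q <= Q * Q" using Q2 by simp
 have nw: "k * Q mod 2 ^ w = k * Q" "Suc k mod 2 ^ w = Suc k" "CC u mod 2 ^ w = CC u" "(c' + g) mod 2 ^ w = c' + g"
 "x < k * Q ==> (x + k) mod 2 ^ w = x + k" for x
 proof -
 have *: "k * Q <= TOP" "Suc k <= TOP" "CC u <= TOP" "c' + g <= TOP" "x < k * Q ==> x + k <= TOP" for x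
 using kQ QT QQ I(3-6) CQ by linarith+
 show "k * Q mod 2 ^ w = k * Q" "Suc k mod 2 ^ w = Suc k" "CC u mod 2 ^ w = CC u" "(c' + g) mod 2 ^ w = c' + g"
 by (rule nowrap[OF *(1)] nowrap[OF *(2)] nowrap[OF *(3)] nowrap[OF *(4)])+
 show "(x + k) mod 2 ^ w = x + k" if "x < k * Q" for x by (rule nowrap[OF *(5)[OF that]])
 qed
 have mx: "max 1 (k * Q) = k * Q" using I(5) Q2 by simp
 have k0: "0 < k * Q" using I(5) Q2 by simp
 define rest where "rest = seqs [
 Compute 31 Add (Reg 31) (Reg 22),
 Compute 30 Less (Reg 21) (Reg 31),
 If (Reg 30)
 (seqs [Compute 30 Mod (Reg 22) (Const 2),
 If (Reg 30)
 (seqs [Compute 20 Add (Reg 20) (Reg 21), Compute 10 Add (Const 4) (Const 0)])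
 (seqs [Compute 20 Add (Reg 28) (Const 0), Compute 10 Add (Const 2) (Const 0)])])
 (Compute 22 Add (Reg 22) (Const 1))]"
 have ex: "exec w n adj c_fact s = map_pmf (%x. xx rest (set_reg 31 x (set_reg 30 (k * Q) s))) (pmf_of_set {..<k * Q})"
 proof -
 have d: "deterministic rest" by (simp add: rest_def)
 have "exec w n adj c_fact s = bind_pmf (map_pmf (%x. set_reg 31 x (set_reg 30 (k * Q) s)) (pmf_of_set {..<k * Q})) (exec w n adj rest)"
 using mx Q0 C(13) nw by (simp add: c_fact_def rest_def bind_return_pmf set_reg_def)
 then show ?thesis by (simp add: exec_dex[OF d] bind_map_pmf map_pmf_def[symmetric])
 qed
 have st: "mstep A = map_pmf (%x. A\<lparr>md := if x + k <= g then Fact c' g (k + 1)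
 else if odd k then Push (c' + g) else Draw (CC u)\<rparr>) (pmf_of_set {..<k * Q})"
 using m h by (simp add: mstep_def)
 have key: "core cap (fl - 1) (xx rest (set_reg 31 x (set_reg 30 (k * Q) s))) (A\<lparr>md := if x + k <= g then Fact c' g (k + 1)
 else if odd k then Push (c' + g) else Draw (CC u)\<rparr>)" if x: "x < k * Q" for x
 proof -
 consider "x + k <= g" | "~ x + k <= g" "odd k" | "~ x + k <= g" "even k" by blast
 then show ?thesis
 proof cases
 case 1
 then show ?thesis using nw(1-4) nw(5)[OF x] C RSfl srel1 T fl
 by (auto simp: rest_def set_reg_def core_def prel_def rmode_def srel_def)
 next
 case 2
 then show ?thesis using nw(1-4) nw(5)[OF x] C RSfl srel1 T fl
 by (auto simp: rest_def set_reg_def core_def prel_def rmode_def srel_def odd_iff_mod_2_eq_one)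
 next
 case 3
 then show ?thesis using nw(1-4) nw(5)[OF x] C RSfl srel1 T fl
 by (auto simp: rest_def set_reg_def core_def prel_def rmode_def srel_def even_iff_mod_2_eq_zero)
 qed
 qed
 show ?thesis unfolding ex st pmf.rel_map
 by (rule rel_pmf_reflI) (use key set_unif[OF k0] in auto)
qed

end


context ram
begin

lemma push_state:
 assumes R: "(rv, rt, ro, rl) = (17, 33, 32, 27) \<or> (rv, rt, ro, rl) = (32, 33, 17, 34)"
 and r: "regs s 0 = n" "regs s 9 = NB" "regs s 40 = ST" "regs s rv = v" "regs s rt = \<tau>" "regs s ro = z" "regs s rl = len v"
 and vn: "v < n" "\<tau> < H" "z < n" and m: "mem s (badr (regs s 14) v (\<tau> div len v)) = k" "k + 1 < ST"
 and top: "regs s 14 + RS <= TOP"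
 shows "mem (xx (c_push rv rt ro rl) s) = (mem s)(badr (regs s 14) v (\<tau> div len v) := k + 1,
 badr (regs s 14) v (\<tau> div len v) + (k + 1) := enc (\<tau>, z))"
 "r \<notin> {50, 51, 52} ==> regs (xx (c_push rv rt ro rl) s) r = regs s r"
proof -
 let ?i = "\<tau> div len v" and ?b = "regs s 14"
 have i: "?i < NB" using vn(2) by (simp add: NB_def) (meson div_le_dividend le_trans less_imp_le_nat less_Suc_eq_le)
 have br: "badr ?b v ?i + (k + 1) < ?b + RS" by (rule badr_range(2)[OF vn(1) i m(2)])
 have st: "1 <= ST" by (simp add: ST_def)
 have b1: "v * NB + ?i <= (v * NB + ?i) * ST" using st by simp
 have b2: "(v * NB + ?i) * ST <= badr ?b v ?i" "?b + n <= badr ?b v ?i" by (simp_all add: badr_def)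
 have en: "\<tau> * n + z <= TOP"
 proof -
 have "\<tau> * n + z < (\<tau> + 1) * n" using vn(3) by simp
 also have "... <= H * n" using vn(2) by (intro mult_le_mono1) simp
 finally show ?thesis using QT by simp
 qed
 have nw: "v * NB mod 2 ^ w = v * NB" "(v * NB + ?i) mod 2 ^ w = v * NB + ?i"
 "(v * NB + ?i) * ST mod 2 ^ w = (v * NB + ?i) * ST" "(?b + n) mod 2 ^ w = ?b + n"
 "(?b + n + (v * NB + ?i) * ST) mod 2 ^ w = badr ?b v ?i" "(k + 1) mod 2 ^ w = k + 1" "Suc k mod 2 ^ w = Suc k"
 "(badr ?b v ?i + (k + 1)) mod 2 ^ w = badr ?b v ?i + (k + 1)"
 "(badr ?b v ?i + Suc k) mod 2 ^ w = Suc (badr ?b v ?i + k)"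
 "\<tau> * n mod 2 ^ w = \<tau> * n" "(\<tau> * n + z) mod 2 ^ w = \<tau> * n + z"
 proof -
 have *: "(v * NB + ?i) * ST <= TOP" using b2 br top by linarith
 then have "v * NB + ?i <= TOP" using b1 by linarith
 then show "v * NB mod 2 ^ w = v * NB" "(v * NB + ?i) mod 2 ^ w = v * NB + ?i" by (simp_all only: nowrap add_leD1)
 show "(v * NB + ?i) * ST mod 2 ^ w = (v * NB + ?i) * ST" by (rule nowrap[OF *])
 qed (use b2 br top en in \<open>simp_all add: nowrap badr_def\<close>)
 have nw': "Suc (badr ?b v ?i + k) mod 2 ^ w = Suc (badr ?b v ?i + k)" using nw(9) by simp
 show "mem (xx (c_push rv rt ro rl) s) = (mem s)(badr ?b v ?i := k + 1, badr ?b v ?i + (k + 1) := enc (\<tau>, z))"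
 using R
 proof
 assume e: "(rv, rt, ro, rl) = (17, 33, 32, 27)"
 then have e': "rv = 17" "rt = 33" "ro = 32" "rl = 27" by (metis prod.inject)+
 have "regs s 17 = v" "regs s 33 = \<tau>" "regs s 32 = z" "regs s 27 = len v" using r(4-7) unfolding e' by fast+
 then show ?thesis unfolding e' using r(1-3) m(1) nw nw' by (simp add: c_push_def set_reg_def enc_def)
 next
 assume e: "(rv, rt, ro, rl) = (32, 33, 17, 34)"
 then have e': "rv = 32" "rt = 33" "ro = 17" "rl = 34" by (metis prod.inject)+
 have "regs s 32 = v" "regs s 33 = \<tau>" "regs s 17 = z" "regs s 34 = len v" using r(4-7) unfolding e' by fast+
 then show ?thesis unfolding e' using r(1-3) m(1) nw nw' by (simp add: c_push_def set_reg_def enc_def)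
 qed
 show "regs (xx (c_push rv rt ro rl) s) r = regs s r" if "r \<notin> {50, 51, 52}" for r
 proof -
 have "deterministic (c_push rv rt ro rl)" by (simp add: c_push_def)
 then have "xx (c_push rv rt ro rl) s \<in> set_pmf (exec w n adj (c_push rv rt ro rl) s)" by (simp add: exec_dex)
 then show ?thesis by (rule exec_writes) (use that in \<open>simp add: c_push_def\<close>)
 qed
qed

lemma length_VL_le: "length VL <= n"
proof -
 have "card nonis <= card {..<n}" by (rule card_mono) (auto simp: nonis_def)
 then show ?thesis using VL_facts(3) by simp
qed

lemma encB_snoc:
 "u ~= x ==> encB (G @ [(u, x, \<tau>)]) = (%v k. if v = x & k = \<tau> div len x then encB G x (\<tau> div len x) @ [enc (\<tau>, u)]
 else if v = u & k = \<tau> div len u then encB G u (\<tau> div len u) @ [enc (\<tau>, x)] else encB G v k)"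
proof (intro ext)
 fix v k assume ux: "u ~= x"
 have e: "bucket (G @ [(u, x, \<tau>)]) v k = bucket G v k @
 ((if u = v & \<tau> div len v = k then [(\<tau>, x)] else []) @ (if x = v & \<tau> div len v = k then [(\<tau>, u)] else []))"
 by (simp add: bucket_def)
 consider "v = x" "k = \<tau> div len x" | "v = u" "k = \<tau> div len u" | "~ (v = x & k = \<tau> div len x)" "~ (v = u & k = \<tau> div len u)"
 by blast
 then show "encB (G @ [(u, x, \<tau>)]) v k = (if v = x & k = \<tau> div len x then encB G x (\<tau> div len x) @ [enc (\<tau>, u)]
 else if v = u & k = \<tau> div len u then encB G u (\<tau> div len u) @ [enc (\<tau>, x)] else encB G v k)"
 proof cases
 case 3
 have "~ (u = v & \<tau> div len v = k)" "~ (x = v & \<tau> div len v = k)" using 3 by auto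
 then have "bucket (G @ [(u, x, \<tau>)]) v k = bucket G v k" unfolding e by (simp only: if_False append_Nil2)
 then show ?thesis unfolding encB_def using 3 by (simp only: if_False)
 next
 case 1
 then show ?thesis unfolding encB_def e using ux by simp
 next
 case 2
 then show ?thesis unfolding encB_def e using ux by simp
 qed
qed

lemma hit_state:
 assumes c: "core cap fl s A" and t: "tops s A" and fl: "1 <= fl" and m: "md A = Push c'" and inv: "minv A"
 shows "\<exists>A'. mstep A = return_pmf A' & core cap (fl - 1) (xx c_hit s) A'"
proof -
 obtain u t c0 where h: "hd (mfr A) = (u, t, c0)" by (metis surj_pair)
 have C: "prel s" "regs s 11 = mleft A" "regs s 12 = mhits A" "\<forall>x\<ge>regs s 8. mem s x = 0" "B0' <= regs s 8"
 "regs s 8 + RS * fl <= cap" "mhits A + fl <= F" "mleft A + 5 <= TOP" "cap <= TOP" "srel fl s A"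
 "regs s 20 = c'"
 using c m by (auto simp: core_def rmode_def)
 have RSfl: "regs s 8 + RS * (fl - 1) <= cap" using C(6) mult_le_mono2[of "fl - 1" fl RS] by linarith
 have I: "finv (mX A) (mfr A)" "ginv (KD (mX A) u c') (mG A)" "topinv A" "mX A u = c0"
 using inv m h by (auto simp: minv_def Let_def)
 obtain y r where fr: "mfr A = (u, t, c0) # y # r" "c0 < t" "u \<in> nonis" "t <= N"
 using I(3,1) by (rule topinvE) (use h in auto)
 have T: "regs s 17 = u" "regs s 18 = t" "regs s 19 = c0" "regs s 28 = CC u" "regs s 29 = mX A u" "regs s 27 = len u" "regs s 31 = regs s 14 + u"
 using t m h fr by (auto simp: tops_def)
 have srel1: "srel (fl - 1) s A" using C(10) by (auto simp: srel_def)
 have P: "regs s 0 = n" "regs s 2 = Q" "regs s 9 = NB" "regs s 40 = ST" using C(1) by (auto simp: prel_def)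
 show ?thesis
 proof (cases "c' < CC u")
 case False
 have "mstep A = return_pmf (A\<lparr>md := Draw c'\<rparr>)" using False m h by (simp add: mstep_def)
 moreover have "core cap (fl - 1) (xx c_hit s) (A\<lparr>md := Draw c'\<rparr>)"
 using False T C RSfl srel1 by (simp add: c_hit_def set_reg_def core_def prel_def rmode_def srel_def)
 ultimately show ?thesis by blast
 next
 case True
 let ?w = "mw u c'" and ?\<tau> = "mt (mX A) u c'" and ?b = "regs s 14"
 let ?A' = "A\<lparr>mG := pushG (mX A) u c' (mG A), md := Draw (c' + 1)\<rparr>"
 have st: "mstep A = return_pmf ?A'" using True m h by (simp add: mstep_def)
 have "minv ?A'" using minv_step[OF inv _ ne] st by simp
 then have G': "Rg (pushG (mX A) u c' (mG A)) \<subseteq> cells" "distinct (map (%(a, w, \<tau>). ({a, w}, \<tau>)) (pushG (mX A) u c' (mG A)))"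
 using h by (auto simp: minv_def Let_def ginv_def)
 have xc: "{u, ?w} \<in> E" "?\<tau> < H" "?w \<in> nonis" "?w ~= u"
 using xc_cells[of u c' "mX A", OF fr(3) True] I(4) fr by auto
 have un: "u < n" "?w < n" using nonis_n fr(3) xc(3) by auto
 have CQ: "CC u <= Q" using nonis_len[OF fr(3)] by simp
 have bT: "?b + RS <= TOP" "B0' <= ?b" "?b + RS <= regs s 8" using C(6,9,10) by (auto simp: srel_def)
 have nR: "n <= RS" by (simp add: RS_def)
 have dl: "c' div len u < deg u" "c' div len u <= c'" using mw_mem[OF fr(3) True] by auto
 have nw: "Suc (c' div len u) mod 2 ^ w = Suc (c' div len u)" "(mX A u + c' mod len u) mod 2 ^ w = ?\<tau>"
 "(?b + ?w) mod 2 ^ w = ?b + ?w" "Suc c' mod 2 ^ w = Suc c'"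
 proof -
 have "Suc (c' div len u) <= TOP" using dl(2) True CQ QT by linarith
 then show "Suc (c' div len u) mod 2 ^ w = Suc (c' div len u)" by (rule nowrap)
 qed (use True CQ QT dl xc(2) bT un nR in \<open>simp_all add: nowrap mt_def\<close>)
 have qn: "query_neighbor n adj u (Suc (c' div len u)) = ?w"
 using un dl by (simp add: query_neighbor_def mw_def deg_def)
 have xw: "mem s (?b + ?w) = mX A ?w" using C(10) un by (auto simp: srel_def xrel_def)
 define s0 where "s0 = xx c_hit1 (set_reg 30 1 s)"
 have s0: "regs s0 30 = (if ?\<tau> < mX A ?w then 1 else 0)" "regs s0 32 = ?w" "regs s0 33 = ?\<tau>" "mem s0 = mem s"
 "r \<notin> {30, 32, 33} ==> regs s0 r = regs s r" for r
 using T C(11) nw qn xw by (simp_all add: s0_def c_hit1_def set_reg_def)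
 define s1 where "s1 = (if ?\<tau> < mX A ?w then s0 else xx c_hit2 s0)"
 have hit: "xx c_hit s = set_reg 10 2 (set_reg 20 (binop_val w Add (regs s1 20) 1) s1)"
 using True T C(11) s0(1) by (simp add: c_hit_def s1_def s0_def set_reg_def)
 have fin: "core cap (fl - 1) (xx c_hit s) ?A'"
 if s1: "!!r. r \<notin> {30, 32, 33, 34, 50, 51, 52} ==> regs s1 r = regs s r"
 and m1: "!!x. x < ?b + n ==> mem s1 x = mem s x" "!!x. ?b + RS <= x ==> mem s1 x = mem s x"
 and br: "brel (mem s1) ?b (encB (pushG (mX A) u c' (mG A)))"
 proof -
 define s2 where "s2 = xx c_hit s"
 have r2: "regs s2 10 = 2" "regs s2 20 = c' + 1" "mem s2 = mem s1"
 "r \<notin> {10, 20, 30, 32, 33, 34, 50, 51, 52} ==> regs s2 r = regs s r" for r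
 using s1 C(11) nw by (simp_all add: s2_def hit set_reg_def)
 have "frel (mem s2) (mfr A)"
 proof -
 have "length (mfr A) + fl <= F + 2" using C(10) by (simp add: srel_def)
 then have "S0 + 3 * length (mfr A) <= ?b" using SB bT by simp
 then have "frel (mem s2) (mfr A) = frel (mem s) (mfr A)" using m1(1) by (intro frel_cong) (auto simp: r2)
 then show ?thesis using C(10) by (simp add: srel_def)
 qed
 moreover have "xrel (mem s2) ?b (mX A)" using C(10) m1(1) by (simp add: srel_def xrel_def r2)
 moreover have "\<forall>x\<ge>regs s 8. mem s2 x = 0" using C(4) m1(2) bT by (simp add: r2)
 moreover have "\<forall>j<length VL. mem s2 j = VL ! j"
 using C(1) m1(1) length_VL_le nS SB bT by (simp add: r2 prel_def)
 ultimately have "core cap (fl - 1) s2 ?A'"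
 using C RSfl srel1 br r2(1-3) r2(4)[of 0] r2(4)[of 1] r2(4)[of 2] r2(4)[of 3] r2(4)[of 6] r2(4)[of 7] r2(4)[of 8] r2(4)[of 9]
 r2(4)[of 11] r2(4)[of 12] r2(4)[of 13] r2(4)[of 14] r2(4)[of 40]
 by (simp add: core_def prel_def rmode_def srel_def)
 then show ?thesis by (simp add: s2_def)
 qed
 show ?thesis
 proof (cases "?\<tau> < mX A ?w")
 case True
 then have "s1 = s0" by (simp add: s1_def)
 then have "core cap (fl - 1) (xx c_hit s) ?A'"
 using s0 True C(10) by (intro fin) (auto simp: pushG_def srel_def)
 then show ?thesis using st by blast
 next
 case False
 let ?iu = "?\<tau> div len u" and ?iw = "?\<tau> div len ?w"
 have G: "pushG (mX A) u c' (mG A) = mG A @ [(u, ?w, ?\<tau>)]" using False by (simp add: pushG_def)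
 have lenG': "length (encB (mG A @ [(u, ?w, ?\<tau>)]) v i) < ST" for v i
 using bucket_facts(1)[OF G'] unfolding G by (simp add: encB_def)
 have lu: "length (encB (mG A) u ?iu) + 1 < ST" "length (encB (mG A) ?w ?iw) + 1 < ST"
 using lenG'[of u ?iu] lenG'[of ?w ?iw] xc(4) unfolding encB_snoc[OF xc(4)[symmetric]] by auto
 have lG: "length (encB (mG A) v i) < ST" for v i
 proof -
 have "length (encB (mG A) v i) <= length (encB (mG A @ [(u, ?w, ?\<tau>)]) v i)"
 by (simp add: encB_def bucket_def)
 then show ?thesis using lenG'[of v i] by simp
 qed
 have iNB: "?\<tau> div x < NB" for x using xc(2) by (simp add: NB_def) (meson div_le_dividend le_trans less_imp_le_nat less_Suc_eq_le)
 have br0: "brel (mem s0) ?b (encB (mG A))" using C(10) s0(4) by (simp add: srel_def)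
 have k0: "mem s0 (badr ?b u ?iu) = length (encB (mG A) u ?iu)" using br0 un iNB by (simp add: brel_def)
 define sa where "sa = xx (c_push 17 33 32 27) s0"
 have p0: "regs s0 0 = n" "regs s0 9 = NB" "regs s0 40 = ST" "regs s0 17 = u" "regs s0 27 = len u" "regs s0 14 = ?b" "regs s0 2 = Q"
 using s0(5) P T by auto
 note pa = push_state[of 17 33 32 27 s0 u ?\<tau> ?w "length (encB (mG A) u ?iu)"]
 have ma: "mem sa = (mem s0)(badr ?b u ?iu := length (encB (mG A) u ?iu) + 1,
 badr ?b u ?iu + (length (encB (mG A) u ?iu) + 1) := enc (?\<tau>, ?w))"
 unfolding sa_def using pa(1) p0 s0(2,3) un xc(2) k0 lu bT by simp
 have ra: "regs sa r = regs s0 r" if "r \<notin> {50, 51, 52}" for r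
 unfolding sa_def using pa(2)[of r] p0 s0(2,3) un xc(2) k0 lu bT that by simp
 define B1 where "B1 = (%v k. if v = u & k = ?iu then encB (mG A) u ?iu @ [enc (?\<tau>, ?w)] else encB (mG A) v k)"
 have bra: "brel (mem sa) ?b B1" unfolding ma B1_def by (rule brel_push[OF br0 un(1) iNB lu(1) lG])
 define sb where "sb = set_reg 34 (len ?w) (set_reg 34 (deg ?w) sa)"
 have qd: "query_degree n adj ?w = deg ?w" using un by (simp add: query_degree_def deg_def)
 have h2: "xx c_hit2 s0 = xx (c_push 32 33 17 34) sb"
 using ra[of 32] ra[of 2] s0(2) p0 qd
 by (simp add: c_hit2_def sa_def[symmetric] sb_def len_def set_reg_def)
 have mb: "mem sb = mem sa" "regs sb 34 = len ?w" "r ~= 34 ==> regs sb r = regs sa r" for r by (simp_all add: sb_def set_reg_def)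
 have B1w: "B1 ?w ?iw = encB (mG A) ?w ?iw" using xc(4) by (simp add: B1_def)
 have k1: "mem sb (badr ?b ?w ?iw) = length (encB (mG A) ?w ?iw)" using bra un iNB mb(1) B1w by (simp add: brel_def)
 have pb0: "regs sb 0 = n" "regs sb 9 = NB" "regs sb 40 = ST" "regs sb 17 = u" "regs sb 14 = ?b" "regs sb 32 = ?w" "regs sb 33 = ?\<tau>"
 using mb(3) ra p0 s0(2,3) by auto
 note pb = push_state[of 32 33 17 34 sb ?w ?\<tau> u "length (encB (mG A) ?w ?iw)"]
 have s1e: "s1 = xx (c_push 32 33 17 34) sb" using False h2 by (simp add: s1_def)
 have m1: "mem s1 = (mem sb)(badr ?b ?w ?iw := length (encB (mG A) ?w ?iw) + 1,
 badr ?b ?w ?iw + (length (encB (mG A) ?w ?iw) + 1) := enc (?\<tau>, u))"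
 unfolding s1e using pb(1) pb0 mb(2) un xc(2) k1 lu bT by simp
 have r1: "regs s1 r = regs sb r" if "r \<notin> {50, 51, 52}" for r
 unfolding s1e using pb(2)[of r] pb0 mb(2) un xc(2) k1 lu bT that by simp
 have B1l: "length (B1 v k) < ST" if "v < n" "k < NB" for v k using lu lG by (simp add: B1_def)
 have "brel (mem s1) ?b (%v k. if v = ?w & k = ?iw then B1 ?w ?iw @ [enc (?\<tau>, u)] else B1 v k)"
 using brel_push[OF bra un(2) iNB _ B1l, of "len ?w" "enc (?\<tau>, u)"] lu(2) unfolding m1 mb(1) B1w by simp
 moreover have "(%v k. if v = ?w & k = ?iw then B1 ?w ?iw @ [enc (?\<tau>, u)] else B1 v k) = encB (pushG (mX A) u c' (mG A))"
 unfolding G encB_snoc[OF xc(4)[symmetric]] B1w by (auto simp: B1_def fun_eq_iff)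
 ultimately have br1: "brel (mem s1) ?b (encB (pushG (mX A) u c' (mG A)))" by simp
 have st0: "0 < ST" by (simp add: ST_def)
 have far: "badr ?b v i + j ~= x" if "v < n" "i < NB" "j < ST" "x < ?b + n \<or> ?b + RS <= x" for v i j x
 using badr_range[OF that(1-3), of ?b] that(4) by linarith
 \<comment> \<open>Both pushes write inside the region of the sample and above its first
   \<open>n\<close> words, so vertex list, stack, \<open>mX\<close> and free memory are
   untouched.\<close>
 have same: "mem s1 x = mem s x" if "x < ?b + n \<or> ?b + RS <= x" for x
 using far[OF un(1) iNB lu(1) that, of "len u"] far[OF un(1) iNB st0 that, of "len u"]
 far[OF un(2) iNB lu(2) that, of "len ?w"] far[OF un(2) iNB st0 that, of "len ?w"]
 by (simp add: m1 mb(1) ma s0(4))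
 have "core cap (fl - 1) (xx c_hit s) ?A'"
 proof (rule fin)
 show "regs s1 r = regs s r" if "r \<notin> {30, 32, 33, 34, 50, 51, 52}" for r
 using that r1 mb(3) ra s0(5) by simp
 qed (use same br1 in auto)
 then show ?thesis using st by blast
 qed
 qed
qed

lemma scan_state:
 assumes c: "core cap fl s A" and t: "tops s A" and fl: "1 <= fl" and m: "md A = Scan j bt bw" and inv: "minv A"
 shows "\<exists>A'. mstep A = return_pmf A' & core cap (fl - 1) (xx c_scan s) A'"
proof -
 obtain u t c0 where h: "hd (mfr A) = (u, t, c0)" by (metis surj_pair)
 let ?i = "c0 div len u" and ?b = "regs s 14"
 let ?L = "bucket (mG A) u ?i"
 have C: "prel s" "regs s 11 = mleft A" "regs s 12 = mhits A" "\<forall>x\<ge>regs s 8. mem s x = 0" "B0' <= regs s 8"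
 "regs s 8 + RS * fl <= cap" "mhits A + fl <= F" "mleft A + 5 <= TOP" "cap <= TOP" "srel fl s A"
 "regs s 23 = j" "regs s 24 = bt" "regs s 25 = bw"
 using c m by (auto simp: core_def rmode_def)
 have RSfl: "regs s 8 + RS * (fl - 1) <= cap" using C(6) mult_le_mono2[of "fl - 1" fl RS] by linarith
 have I: "finv (mX A) (mfr A)" "ginv (KX (mX A)) (mG A)" "topinv A" "j <= length ?L" "scanl c0 t (take j ?L) = (bt, bw)"
 using inv m h by (auto simp: minv_def Let_def)
 obtain y r where fr: "mfr A = (u, t, c0) # y # r" "c0 < t" "u \<in> nonis" "t <= N"
 using I(3,1) by (rule topinvE) (use h in auto)
 have T: "regs s 17 = u" "regs s 18 = t" "regs s 19 = c0" "regs s 27 = len u" "regs s 30 = S0 + 3 * Suc (length r)"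
 using t m h fr by (auto simp: tops_def)
 have srel1: "srel (fl - 1) s A" using C(10) by (auto simp: srel_def)
 have P: "regs s 0 = n" "regs s 9 = NB" "regs s 40 = ST" using C(1) by (auto simp: prel_def)
 have G: "Rg (mG A) \<subseteq> cells" "distinct (map (%(a, w, \<tau>). ({a, w}, \<tau>)) (mG A))" using I(2) by (auto simp: ginv_def)
 have un: "u < n" using nonis_n fr(3) by auto
 have iNB: "?i < NB" using fr by (simp add: NB_def H_def) (meson div_le_dividend le_SucI le_trans less_imp_le_nat trans_le_add1 less_Suc_eq_le)
 have bT: "?b + RS <= TOP" "B0' <= ?b" "?b + RS <= regs s 8" using C(6,9,10) by (auto simp: srel_def)
 have lL: "length ?L < ST" by (rule bucket_facts(1)[OF G])
 have br: "brel (mem s) ?b (encB (mG A))" using C(10) by (simp add: srel_def)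
 have cnt: "mem s (badr ?b u ?i) = length ?L" and ent: "!!j. j < length ?L ==> mem s (badr ?b u ?i + (j + 1)) = enc (?L ! j)"
 using br un iNB by (auto simp: brel_def encB_def)
 have bj: "badr ?b u ?i + j' < ?b + RS" if "j' < ST" for j' by (rule badr_range(2)[OF un iNB that])
 have b0: "badr ?b u ?i <= TOP" using bj[of 0] bT by (simp add: ST_def)
 have st: "1 <= ST" by (simp add: ST_def)
 have b1: "u * NB + ?i <= (u * NB + ?i) * ST" using st by simp
 have b2: "(u * NB + ?i) * ST <= badr ?b u ?i" "?b + n <= badr ?b u ?i" by (simp_all add: badr_def)
 have nw: "u * NB mod 2 ^ w = u * NB" "(u * NB + ?i) mod 2 ^ w = u * NB + ?i"
 "(u * NB + ?i) * ST mod 2 ^ w = (u * NB + ?i) * ST" "(?b + n) mod 2 ^ w = ?b + n"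
 "(?b + n + (u * NB + ?i) * ST) mod 2 ^ w = badr ?b u ?i"
 proof -
 have *: "(u * NB + ?i) * ST <= TOP" using b2 b0 by linarith
 then have "u * NB + ?i <= TOP" using b1 by linarith
 then show "u * NB mod 2 ^ w = u * NB" "(u * NB + ?i) mod 2 ^ w = u * NB + ?i" by (simp_all only: nowrap add_leD1)
 show "(u * NB + ?i) * ST mod 2 ^ w = (u * NB + ?i) * ST" by (rule nowrap[OF *])
 qed (use b2 b0 in \<open>simp_all add: nowrap badr_def\<close>)
 define s0 where "s0 = xx c_scan1 s"
 have s0: "regs s0 50 = ?i" "regs s0 51 = badr ?b u ?i" "regs s0 53 = (if j < length ?L then 1 else 0)" "mem s0 = mem s"
 "r' \<notin> {50, 51, 52, 53} ==> regs s0 r' = regs s r'" for r'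
 using T P C(11) nw cnt by (simp_all add: s0_def c_scan1_def set_reg_def)
 have sc: "xx c_scan s = (if j < length ?L then xx c_scan2 s0 else xx c_scan3 s0)"
 using s0(3) by (simp add: c_scan_def s0_def[symmetric])
 note sps = scanl_spec[OF I(5)]
 have bt: "bt <= t" "bt < t ==> (bt, bw) \<in> set ?L"
 using sps in_set_takeD[of "(bt, bw)" j ?L] by auto
 have tT: "t + 2 <= TOP" using fr(4) QT by (simp add: H_def)
 show ?thesis
 proof (cases "j < length ?L")
 case True
 obtain \<tau> x where e: "?L ! j = (\<tau>, x)" by (metis surj_pair)
 have ex: "\<tau> < H" "x < n" using bucket_facts(2)[OF G nth_mem[OF True]] e by auto
 obtain bt' bw' where b': "scanf c0 (bt, bw) (?L ! j) = (bt', bw')" by (metis surj_pair)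
 let ?A' = "A\<lparr>md := Scan (j + 1) bt' bw'\<rparr>"
 have stp: "mstep A = return_pmf ?A'" using m h True b' by (simp add: mstep_def)
 have nw2: "Suc j mod 2 ^ w = Suc j" "(badr ?b u ?i + Suc j) mod 2 ^ w = badr ?b u ?i + Suc j"
 "\<tau> mod 2 ^ w = \<tau>" "x mod 2 ^ w = x"
 using bj[of "Suc j"] True lL bT ex QT by (simp_all add: nowrap)
 have dm: "enc (\<tau>, x) div n = \<tau>" "enc (\<tau>, x) mod n = x" using ex by (simp_all add: enc_def)
 have en: "mem s (badr ?b u ?i + Suc j) = enc (\<tau>, x)" using ent[OF True] e by simp
 define s2 where "s2 = xx c_scan2 s0"
 have r2: "regs s2 23 = Suc j" "regs s2 24 = bt'" "regs s2 25 = bw'" "mem s2 = mem s"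
 "r' \<notin> {23, 24, 25, 50, 51, 52, 53, 54} ==> regs s2 r' = regs s r'" for r'
 using s0 C(11-13) T P nw2 dm en b' e
 by (auto simp: s2_def c_scan2_def set_reg_def scanf_def split: if_splits)
 have "core cap (fl - 1) s2 ?A'"
 using C RSfl srel1 m r2(1-4) r2(5)[of 0] r2(5)[of 1] r2(5)[of 2] r2(5)[of 3] r2(5)[of 6] r2(5)[of 7] r2(5)[of 8] r2(5)[of 9]
 r2(5)[of 10] r2(5)[of 11] r2(5)[of 12] r2(5)[of 13] r2(5)[of 14] r2(5)[of 40] c
 by (simp add: core_def prel_def rmode_def srel_def)
 then show ?thesis using stp sc True by (auto simp: s2_def)
 next
 case False
 let ?fr = "if bt < t then (bw, bt, 0) # (u, t, bt + 1) # y # r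
 else (u, t, (c0 div len u + 1) * len u) # y # r"
 let ?A' = "A\<lparr>mfr := ?fr, md := Main\<rparr>"
 have stp: "mstep A = return_pmf ?A'" using m h False fr(1) by (simp add: mstep_def)
 have ln: "length (mfr A) + fl <= F + 2" "regs s 13 = Suc (Suc (length r))" "frel (mem s) (mfr A)"
 using C(10) fr by (auto simp: srel_def)
 have sT: "S0 + 3 * Suc (length r) + 5 < B0'" using ln(1) fr SB fl by simp
 then have nw3: "(3 + 3 * length r + S0 + 2) mod 2 ^ w = 5 + 3 * length r + S0"
 "(3 + 3 * length r + S0 + 3) mod 2 ^ w = 6 + 3 * length r + S0"
 "(3 + 3 * length r + S0 + 4) mod 2 ^ w = 7 + 3 * length r + S0"
 "(3 + 3 * length r + S0 + 5) mod 2 ^ w = 8 + 3 * length r + S0"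
 using BT by (simp_all add: nowrap)
 have spT: "Suc (Suc (Suc (length r))) mod 2 ^ w = Suc (Suc (Suc (length r)))"
 using sT BT by (intro nowrap) simp
 have sl: "(c0 div len u + 1) * len u <= mX A u"
 using next_block[OF fr(3), of "mX A u" c0] I(1) fr(3) inv m h by (auto simp: minv_def Let_def finv_def)
 have slT: "(c0 div len u + 1) * len u <= TOP"
 proof -
 have "len u <= Q" by (simp add: len_def)
 moreover have "c0 div len u * len u <= c0" by simp
 moreover have "Q + N <= TOP" using QT by (simp add: H_def)
 moreover have "c0 <= N" using fr by simp
 moreover have "(c0 div len u + 1) * len u = c0 div len u * len u + len u" by simp
 ultimately show ?thesis by linarith
 qed
 have nw4: "Suc (c0 div len u) mod 2 ^ w = Suc (c0 div len u)" "(len u + c0 div len u * len u) mod 2 ^ w = len u + c0 div len u * len u"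
 "Suc bt mod 2 ^ w = Suc bt"
 proof -
 have "c0 div len u <= c0" by simp
 then show "Suc (c0 div len u) mod 2 ^ w = Suc (c0 div len u)" using fr(2) tT by (intro nowrap) linarith
 qed (use slT bt tT in \<open>simp_all add: nowrap\<close>)
 have r30: "regs s0 30 = 3 + 3 * length r + S0" "regs s0 13 = Suc (Suc (length r))" "regs s0 24 = bt" "regs s0 18 = t" "regs s0 25 = bw" "regs s0 27 = len u"
 using s0(5) T ln C(12,13) by auto
 define s3 where "s3 = xx c_scan3 s0"
 have r3: "regs s3 10 = 1" "regs s3 13 = length ?fr"
 "mem s3 = (if bt < t then (mem s)(5 + 3 * length r + S0 := Suc bt, 6 + 3 * length r + S0 := bw, 7 + 3 * length r + S0 := bt, 8 + 3 * length r + S0 := 0)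
 else (mem s)(5 + 3 * length r + S0 := len u + c0 div len u * len u))"
 "r' \<notin> {10, 13, 50, 51, 52, 53, 54} ==> regs s3 r' = regs s r'" for r'
 using s0 r30 nw3 nw4 spT by (auto simp: s3_def c_scan3_def set_reg_def)
 have low: "mem s3 x = mem s x" if "x < S0 \<or> B0' <= x" for x
 using that sT by (auto simp: r3(3))
 have fr3: "frel (mem s3) ?fr"
 proof -
 have o: "mem s (S0 + 3 * Suc (length r)) = u" "mem s (S0 + 3 * Suc (length r) + 1) = t" "frel (mem s) (y # r)"
 using ln(3) unfolding fr(1) by auto
 have "frel (mem s3) (y # r) = frel (mem s) (y # r)"
 by (rule frel_cong) (auto simp: r3(3))
 moreover have "mem s3 (S0 + 3 * Suc (length r)) = u" "mem s3 (S0 + 3 * Suc (length r) + 1) = t"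
 using o by (auto simp: r3(3))
 moreover have "mem s3 (S0 + 3 * Suc (length r) + 2) = (if bt < t then Suc bt else len u + c0 div len u * len u)"
 by (simp add: r3(3) algebra_simps)
 moreover have "bt < t ==> mem s3 (S0 + 3 * Suc (Suc (length r))) = bw & mem s3 (S0 + 3 * Suc (Suc (length r)) + 1) = bt
 & mem s3 (S0 + 3 * Suc (Suc (length r)) + 2) = 0"
 by (simp add: r3(3) algebra_simps)
 ultimately show ?thesis using o(3) by simp
 qed
 have "srel (fl - 1) s3 ?A'"
 proof -
 have "xrel (mem s3) ?b (mX A)" using C(10) low bT by (simp add: srel_def xrel_def)
 moreover have "brel (mem s3) ?b (encB (mG A))"
 proof -
 have "brel (mem s3) ?b (encB (mG A)) = brel (mem s) ?b (encB (mG A))"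
 using low bT bucket_facts(1)[OF G] by (intro brel_cong) (auto simp: encB_def)
 then show ?thesis using br by simp
 qed
 moreover have "length ?fr + (fl - 1) <= F + 2" using ln(1) fr fl by simp
 ultimately show ?thesis using fr3 r3(2) r3(4)[of 8] r3(4)[of 14] bT by (simp add: srel_def)
 qed
 moreover have "\<forall>x\<ge>regs s 8. mem s3 x = 0" using low C(4,5) by simp
 moreover have "\<forall>i<length VL. mem s3 i = VL ! i" using low C(1) length_VL_le nS by (simp add: prel_def)
 ultimately have "core cap (fl - 1) s3 ?A'"
 using C RSfl r3(1) r3(4)[of 0] r3(4)[of 1] r3(4)[of 2] r3(4)[of 3] r3(4)[of 6] r3(4)[of 7] r3(4)[of 8] r3(4)[of 9]
 r3(4)[of 11] r3(4)[of 12] r3(4)[of 40]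
 by (simp add: core_def prel_def rmode_def)
 then show ?thesis using stp sc False by (auto simp: s3_def)
 qed
qed

end


context ram
begin

section \<open>Coupling of the program with the machine over a whole trial\<close>

lemma dispatch_state:
 assumes c: "core cap fl s A" and t: "tops s A" and fl: "1 <= fl" and inv: "minv A" and nd: "~ mdone A"
 shows "rel_pmf (core cap (fl - 1)) (exec w n adj c_dispatch s) (mstep A)"
proof -
 have c1: "core cap fl (set_reg 32 x s) A" for x by (rule core_cong[OF c]) (auto simp: set_reg_def)
 have t1: "tops (set_reg 32 x s) A" for x using t by (auto simp: tops_def set_reg_def split: prod.splits)
 have sr: "set_reg 32 x (set_reg 32 y s) = set_reg 32 x s" for x y by (simp add: set_reg_def)
 have sk: "exec w n adj Skip = return_pmf" by (rule ext) simp
 have R: "rmode s (md A)" using c by (simp add: core_def)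
 have det: "deterministic c_main" "deterministic c_hit" "deterministic c_scan"
 by (simp_all add: c_main_def c_scan0_def c_hit_def c_hit1_def c_hit2_def c_push_def c_scan_def c_scan1_def c_scan2_def c_scan3_def)
 show ?thesis
 proof (cases "md A")
 case Pick
 then have "exec w n adj c_dispatch s = exec w n adj c_pick s"
 using R by (simp add: c_dispatch_def rmode_def)
 moreover have "mleft A ~= 0" using nd Pick by (simp add: mdone_def)
 ultimately show ?thesis using pick_state[OF c fl Pick] by simp
 next
 case Main
 then have "exec w n adj c_dispatch s = return_pmf (xx c_main (set_reg 32 1 s))"
 using R by (simp add: c_dispatch_def rmode_def exec_dex[OF det(1)] sk bind_return_pmf set_reg_def bind_return_pmf')
 then show ?thesis using main_state[OF c1 t1 fl Main inv, of 1] by auto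
 next
 case (Draw c')
 then have "exec w n adj c_dispatch s = exec w n adj c_draw (set_reg 32 1 s)"
 using R by (simp add: c_dispatch_def rmode_def sk bind_return_pmf sr bind_return_pmf') (simp add: set_reg_def)
 then show ?thesis using draw_state[OF c1 t1 fl Draw inv, of 1] by simp
 next
 case (Fact c' g k)
 then have "exec w n adj c_dispatch s = exec w n adj c_fact (set_reg 32 1 s)"
 using R by (simp add: c_dispatch_def rmode_def sk bind_return_pmf sr bind_return_pmf') (simp add: set_reg_def)
 then show ?thesis using fact_state[OF c1 t1 fl Fact inv, of 1] by simp
 next
 case (Push c')
 then have "exec w n adj c_dispatch s = return_pmf (xx c_hit (set_reg 32 1 s))"
 using R by (simp add: c_dispatch_def rmode_def exec_dex[OF det(2)] sk bind_return_pmf sr bind_return_pmf') (simp add: set_reg_def)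
 then show ?thesis using hit_state[OF c1 t1 fl Push inv, of 1] by auto
 next
 case (Scan j bt bw)
 then have "exec w n adj c_dispatch s = return_pmf (xx c_scan (set_reg 32 0 s))"
 using R by (simp add: c_dispatch_def rmode_def exec_dex[OF det(3)] sk bind_return_pmf sr bind_return_pmf') (simp add: set_reg_def)
 then show ?thesis using scan_state[OF c1 t1 fl Scan inv, of 0] by auto
 qed
qed

lemma body_state:
 assumes r: "rel cap fl s A" and fl: "1 <= fl" and inv: "minv A" and nd: "~ mdone A"
 shows "rel_pmf (rel cap (fl - 1)) (exec w n adj c_body s) (mstep A)"
proof -
 have c: "core cap fl s A" "regs s 15 = fl" using r by (auto simp: rel_def)
 note pre = pre_state[OF c fl inv]
 have dpre: "deterministic c_pre" "deterministic c_post" by (simp_all add: c_pre_def c_post_def)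
 have ex: "exec w n adj c_body s = bind_pmf (exec w n adj c_dispatch (xx c_pre s)) (%s. return_pmf (xx c_post s))"
 proof -
 have "exec w n adj (Seq c_post Skip) = (%s. return_pmf (xx c_post s))"
 by (rule ext) (simp add: exec_dex[OF dpre(2)] bind_return_pmf)
 then show ?thesis by (simp add: c_body_def exec_dex[OF dpre(1)] bind_return_pmf)
 qed
 have d: "rel_pmf (core cap (fl - 1)) (exec w n adj c_dispatch (xx c_pre s)) (mstep A)"
 by (rule dispatch_state[OF pre(1,3) fl inv nd])
 have w15: "15 \<notin> writes c_dispatch"
 by (simp add: c_dispatch_def c_pick_def c_main_def c_draw_def c_fact_def
 c_hit_def c_hit1_def c_hit2_def c_scan_def c_scan1_def c_scan2_def c_scan3_def c_scan0_def c_push_def)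
 have "rel_pmf (%s A. core cap (fl - 1) s A & regs s 15 = fl - 1) (exec w n adj c_dispatch (xx c_pre s)) (mstep A)"
 proof (rule pmf.rel_mono_strong[OF d])
 fix s' A' assume "s' \<in> set_pmf (exec w n adj c_dispatch (xx c_pre s))" "core cap (fl - 1) s' A'"
 then show "core cap (fl - 1) s' A' & regs s' 15 = fl - 1"
 using exec_writes[of s' w n adj c_dispatch "xx c_pre s" 15] w15 pre(2) by simp
 qed
 then have "rel_pmf (rel cap (fl - 1)) (bind_pmf (exec w n adj c_dispatch (xx c_pre s)) (%s. return_pmf (xx c_post s)))
 (bind_pmf (mstep A) return_pmf)"
 by (rule rel_pmf_bindI) (use post_state in auto)
 then show ?thesis by (simp add: ex bind_return_pmf')
qed

abbreviation trial :: "nat => state => state pmf" where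
 "trial \<equiv> loop (%s. regs s 16 ~= 0) (exec w n adj c_body)"

text \<open>Each round couples one step of the program with one step of the machine, and
  \<open>rel_pmf\<close> composes along binds. The fuel left at the end varies, hence the
  existential.\<close>

lemma trial_state:
 "rel cap fl s A ==> minv A ==> rel_pmf (%s A. \<exists>fl. rel cap fl s A) (trial fl s) (mrun fl A)"
proof (induction fl arbitrary: s A)
 case 0
 then show ?case by auto
next
 case (Suc fl)
 show ?case
 proof (cases "mdone A")
 case True
 then have "regs s 16 = 0" using Suc.prems by (simp add: rel_def)
 then show ?thesis using True Suc.prems by auto
 next
 case False
 then have r: "regs s 16 ~= 0" using Suc.prems by (simp add: rel_def)
 have b: "rel_pmf (rel cap fl) (exec w n adj c_body s) (mstep A)"
 using body_state[OF Suc.prems(1) _ Suc.prems(2) False] by simp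
 have "rel_pmf (%s A. rel cap fl s A & minv A) (exec w n adj c_body s) (mstep A)"
 by (rule pmf.rel_mono_strong[OF b]) (use minv_step[OF Suc.prems(2) _ ne] in auto)
 then have "rel_pmf (%s A. \<exists>fl. rel cap fl s A) (bind_pmf (exec w n adj c_body s) (trial fl)) (bind_pmf (mstep A) (mrun fl))"
 by (rule rel_pmf_bindI) (use Suc.IH in auto)
 then show ?thesis using r False by simp
 qed
qed

lemma rel_pmf_ex: "rel_pmf R p q ==> x \<in> set_pmf p ==> \<exists>y\<in>set_pmf q. R x y"
 by (metis pmf.rel_cong rel_pmf_imp_rel_set rel_setD1)

lemma trial_cmp:
 assumes "rel cap fl s A" "minv A"
 shows "cmp w n adj (While (Reg 16) c_body) s (fl * Suc body_time + 1) (trial fl s)"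
proof (rule cmp_While[where I = "%s. \<exists>fl A. rel cap fl s A & minv A" and V = "%s. regs s 15"])
 show "cmp w n adj c_body s body_time (exec w n adj c_body s)" for s
 unfolding body_time_def by (rule cmp_exec[OF loopfree_body])
 fix s s' assume "\<exists>fl A. rel cap fl s A & minv A" and g: "regs s 16 ~= 0" and s': "s' \<in> set_pmf (exec w n adj c_body s)"
 then obtain fl A where r: "rel cap fl s A" "minv A" by blast
 then have nd: "1 <= fl" "~ mdone A" using g by (auto simp: rel_def)
 obtain A' where A': "A' \<in> set_pmf (mstep A)" "rel cap (fl - 1) s' A'"
 using rel_pmf_ex[OF body_state[OF r(1) nd(1) r(2) nd(2)] s'] by blast
 show "(\<exists>fl A. rel cap fl s' A & minv A) & regs s' 15 < regs s 15"
 using A'(2) minv_step[OF r(2) A'(1) ne] r(1) nd(1) by (auto simp: rel_def)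
qed (use assms in \<open>auto simp: rel_def\<close>)

end

lemma loop_writes: "s' \<in> set_pmf (loop P (exec w n adj c) m s) ==> r \<notin> writes c ==> regs s' r = regs s r"
proof (induction m arbitrary: s)
 case (Suc m)
 then show ?case using exec_writes by (fastforce split: if_splits)
qed simp

lemma finite_loop: "(!!s. finite (set_pmf (f s))) ==> finite (set_pmf (loop P f m s))"
 by (induction m arbitrary: s) auto

lemma writes_body: "writes c_body \<subseteq> {8..54} - {9, 40}"
 by (simp add: c_body_def c_pre_def c_dispatch_def c_post_def c_pick_def c_main_def c_draw_def c_fact_def
 c_hit_def c_hit1_def c_hit2_def c_scan_def c_scan1_def c_scan2_def c_scan3_def c_scan0_def c_push_def)

context ram
begin

lemma rel_pmf_prob_le:
 assumes "rel_pmf R p q" "!!x y. R x y ==> x \<in> A ==> y \<in> B"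
 shows "PR p A <= PR q B"
proof -
 obtain pq where pq: "!!x y. (x, y) \<in> set_pmf pq ==> R x y" "map_pmf fst pq = p" "map_pmf snd pq = q"
 using assms(1) by (auto elim!: rel_pmf.cases)
 have "PR p A = PR pq (fst -` A)" by (simp add: pq(2)[symmetric] measure_map_pmf)
 also have "... <= PR pq (snd -` B)"
 proof (rule measure_pmf.finite_measure_mono_AE)
 show "AE z in measure_pmf pq. z \<in> fst -` A --> z \<in> snd -` B"
 using pq(1) assms(2) by (force simp: AE_measure_pmf_iff)
 qed simp
 also have "... = PR q B" by (simp add: pq(3)[symmetric] measure_map_pmf)
 finally show ?thesis .
qed

text \<open>A trial, with the memory below \<open>TOP\<close> provided for \<open>j + 1\<close> trials.\<close>

lemma trial_bounds:
 assumes s: "prel s" "regs s 11 = t" "regs s 12 = 0" "regs s 10 = 0" "regs s 15 = F"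
 "regs s 16 ~= 0 \<longleftrightarrow> F ~= 0 & t ~= 0" "\<forall>x\<ge>regs s 8. mem s x = 0" "B0' <= regs s 8"
 "regs s 8 + RS * F * (j + 1) <= TOP" "t + 5 <= TOP"
 shows "cmp w n adj (While (Reg 16) c_body) s (F * Suc body_time + 1) (trial F s)"
 "s' \<in> set_pmf (trial F s) ==> prel s' & (\<forall>x\<ge>regs s' 8. mem s' x = 0) & B0' <= regs s' 8
 & regs s' 8 + RS * F * j <= TOP & regs s' 10 + regs s' 11 <= TOP & regs s' 12 <= F"
 "PR (trial F s) {s. regs s 10 + regs s 11 = 0 & B (regs s 12)} <= tail pm B t 0 + t * (\<eta> * (b + 37))"
 "1 <= F ==> PR (trial F s) {s. regs s 10 + regs s 11 ~= 0} <= t * (\<eta> * (b + 37) + (b + 36) * Ibar / F)"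
proof -
 define cap where "cap = regs s 8 + RS * F"
 have r: "rel cap F s (mstart t)"
 using s by (auto simp: rel_def core_def mstart_def rmode_def cap_def mdone_def)
 have capj: "cap + RS * F * j <= TOP" using s(9) by (simp add: cap_def algebra_simps)
 show "cmp w n adj (While (Reg 16) c_body) s (F * Suc body_time + 1) (trial F s)"
 by (rule trial_cmp[OF r minv_mstart])
 note R = trial_state[OF r minv_mstart]
 have dn: "regs x 10 + regs x 11 = 0 \<longleftrightarrow> mdone y" if "rel cap fl x y" for x y fl
 using that by (auto simp: rel_def core_def mdone_def rmode_def split: mode.splits)
 show "prel s' & (\<forall>x\<ge>regs s' 8. mem s' x = 0) & B0' <= regs s' 8
 & regs s' 8 + RS * F * j <= TOP & regs s' 10 + regs s' 11 <= TOP & regs s' 12 <= F" if s': "s' \<in> set_pmf (trial F s)"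
 proof -
 obtain fl y where y: "rel cap fl s' y" using rel_pmf_ex[OF R s'] by blast
 have "regs s' 10 <= 5" using y by (auto simp: rel_def core_def rmode_def split: mode.splits)
 then show ?thesis using y capj by (auto simp: rel_def core_def)
 qed
 have h: "regs x 12 = mhits y" if "rel cap fl x y" for x y fl using that by (simp add: rel_def core_def)
 have "PR (trial F s) {s. regs s 10 + regs s 11 = 0 & B (regs s 12)}
 <= PR (mrun F (mstart t)) {s. mdone s & B (mhits s)}"
 by (rule rel_pmf_prob_le[OF R]) (use dn h in auto)
 also note prob_trial_bad[OF ne]
 finally show "PR (trial F s) {s. regs s 10 + regs s 11 = 0 & B (regs s 12)} <= tail pm B t 0 + t * (\<eta> * (b + 37))" .
 have "PR (trial F s) {s. regs s 10 + regs s 11 ~= 0} <= PR (mrun F (mstart t)) {s. ~ mdone s}"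
 proof (rule rel_pmf_prob_le[OF R])
 fix x y assume "\<exists>fl. rel cap fl x y" "x \<in> {s. regs s 10 + regs s 11 ~= 0}"
 then obtain fl where "rel cap fl x y" "regs x 10 + regs x 11 ~= 0" by blast
 then show "y \<in> {s. ~ mdone s}" using dn[of fl x y] by auto
 qed
 also assume "1 <= F"
 note prob_trial_unfinished[OF ne this]
 finally show "PR (trial F s) {s. regs s 10 + regs s 11 ~= 0} <= t * (\<eta> * (b + 37) + (b + 36) * Ibar / F)" .
qed

end


section \<open>Repetition and preprocessing\<close>

text \<open>Register \<open>r\<close> counts the remaining attempts and is cleared when one
  finishes. The run fails if all \<open>i\<close> attempts stay unfinished, or if one finishes with
  a bad answer, with probability at most \<beta> each.\<close>

lemma prob_retry:
 assumes step: "!!s i. J s ==> regs s r = Suc i ==> finite (set_pmf (f s))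
 & (\<forall>s'\<in>set_pmf (f s). J s' & (fin s' & regs s' r = 0 \<or> ~ fin s' & regs s' r = i))
 & PR (f s) {s'. ~ fin s'} <= 1 / 2 & PR (f s) {s'. fin s' & bad s'} <= \<beta>"
 and \<beta>: "0 <= (\<beta>::real)"
 shows "J s ==> regs s r = i ==> i <= m ==>
 finite (set_pmf (loop (%s. regs s r ~= 0) f m s)) &
 PR (loop (%s. regs s r ~= 0) f m s) {s'. ~ (fin s' & ~ bad s')} <= (1 / 2) ^ i + i * \<beta>"
proof (induction m arbitrary: s i)
 case 0
 have "PR (loop (%s. regs s r ~= 0) f 0 s) {s'. ~ (fin s' & ~ bad s')} <= 1" by simp
 then show ?case using 0 by simp
next
 case (Suc m)
 show ?case
 proof (cases i)
 case 0
 have "PR (return_pmf s) {s'. ~ (fin s' & ~ bad s')} <= 1" by simp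
 then show ?thesis using 0 Suc.prems by simp
 next
 case (Suc i')
 let ?P = "%s. regs s r ~= 0" and ?U = "{s'. ~ (fin s' & ~ bad s')}"
 have r: "regs s r = Suc i'" using Suc Suc.prems by simp
 note st = step[OF Suc.prems(1) r]
 have fin: "finite (set_pmf (loop ?P f m s'))" if "s' \<in> set_pmf (f s)" for s'
 using st that Suc.IH[of s' "regs s' r"] Suc.prems(3) Suc by auto
 have m: "PR (loop ?P f m s') ?U
 <= of_bool (fin s' & bad s') + of_bool (~ fin s') * ((1 / 2) ^ i' + i' * \<beta>)" if s': "s' \<in> set_pmf (f s)" for s'
 proof (cases "fin s'")
 case True
 then have "regs s' r = 0" using st s' by auto
 then have "loop ?P f m s' = return_pmf s'" by (cases m) auto
 then show ?thesis using True by (simp add: measure_return_pmf indicator_def)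
 next
 case False
 then have "J s'" "regs s' r = i'" using st s' by auto
 then show ?thesis using Suc.IH[of s' i'] Suc.prems(3) Suc False by auto
 qed
 have ib: "0 <= i' * \<beta>" using \<beta> by simp
 have e: "loop ?P f (Suc m) s = bind_pmf (f s) (loop ?P f m)" using r by simp
 have "PR (loop ?P f (Suc m) s) ?U = EV (bind_pmf (f s) (loop ?P f m)) (%x. of_bool (x \<in> ?U))"
 unfolding e using E_prob[of "bind_pmf (f s) (loop ?P f m)" "%x. x \<in> ?U"] by simp
 also have "... = EV (f s) (%s'. PR (loop ?P f m s') ?U)"
 using st fin E_prob[of "loop ?P f m s'" "%x. x \<in> ?U" for s'] by (subst E_bind) auto
 also have "... <= EV (f s) (%s'. of_bool (fin s' & bad s') + of_bool (~ fin s') * ((1 / 2) ^ i' + i' * \<beta>))"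
 using st m by (intro E_mono) auto
 also have "... = PR (f s) {s'. fin s' & bad s'} + PR (f s) {s'. ~ fin s'} * ((1 / 2) ^ i' + i' * \<beta>)"
 using st by (simp add: E_add E_prob[symmetric])
 also have "... <= \<beta> + 1 / 2 * ((1 / 2) ^ i' + i' * \<beta>)"
 using st ib by (intro add_mono mult_right_mono) auto
 also have "... <= (1 / 2) ^ i + i * \<beta>" using Suc ib \<beta> by (simp add: algebra_simps)
 finally have "PR (loop ?P f (Suc m) s) ?U <= (1 / 2) ^ i + i * \<beta>" .
 moreover have "finite (set_pmf (loop ?P f (Suc m) s))" unfolding e using st fin by auto
 ultimately show ?thesis by blast
 qed
qed

section \<open>Deterministic preprocessing: capped powers of two, degrees, bit length\<close>

definition det :: "nat => nat => (nat => nat list) => com => state => nat => (state => bool) => bool" where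
 "det w n adj c s \<tau> R \<longleftrightarrow> (\<exists>s'. cmp w n adj c s \<tau> (return_pmf s') & R s')"

lemma det_dex: "deterministic c ==> loopfree c ==> R (dex w n adj c s) ==> det w n adj c s (time c) R"
 unfolding det_def using cmp_exec[of c w n adj s] by (auto simp: exec_dex)

lemma det_Seq:
 assumes "det w n adj c s \<tau> R" "!!s'. R s' ==> det w n adj d s' \<tau>' R'"
 shows "det w n adj (Seq c d) s (Suc (\<tau> + \<tau>')) R'"
proof -
 obtain s' where s': "cmp w n adj c s \<tau> (return_pmf s')" "R s'" using assms(1) by (auto simp: det_def)
 then obtain s'' where s'': "cmp w n adj d s' \<tau>' (return_pmf s'')" "R' s''" using assms(2) by (auto simp: det_def)
 have "cmp w n adj (Seq c d) s (Suc (\<tau> + \<tau>')) (bind_pmf (return_pmf s') (%_. return_pmf s''))"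
 by (rule cmp_Seq) (use s' s'' in auto)
 then show ?thesis using s'' by (auto simp: det_def bind_return_pmf)
qed

lemma det_mono: "det w n adj c s \<tau> R ==> \<tau> <= \<tau>' ==> (!!s. R s ==> R' s) ==> det w n adj c s \<tau>' R'"
 unfolding det_def using cmp_mono by blast

lemma det_While:
 assumes c: "deterministic c" "loopfree c"
 and step: "!!s. I s ==> regs s r ~= 0 ==> I (dex w n adj c s) & regs (dex w n adj c s) r < regs s r"
 shows "I s ==> regs s r <= m ==> det w n adj (While (Reg r) c) s (m * Suc (time c) + 1) (%s. I s & regs s r = 0)"
proof (induction m arbitrary: s)
 case 0
 then show ?case using cmp_While_False[of w s "Reg r" n adj c] by (auto simp: det_def)
next
 case (Suc m)
 show ?case
 proof (cases "regs s r = 0")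
 case True
 then show ?thesis using Suc.prems cmp_mono[OF cmp_While_False[of w s "Reg r" n adj c], of "Suc m * Suc (time c) + 1"]
 by (auto simp: det_def)
 next
 case False
 note st = step[OF Suc.prems(1) False]
 obtain s' where s': "cmp w n adj (While (Reg r) c) (dex w n adj c s) (m * Suc (time c) + 1) (return_pmf s')" "I s'" "regs s' r = 0"
 using Suc.IH[of "dex w n adj c s"] st Suc.prems(2) by (auto simp: det_def)
 have b: "cmp w n adj c s (time c) (return_pmf (dex w n adj c s))" using cmp_exec[OF c(2), of w n adj s] by (simp add: exec_dex[OF c(1)])
 have "cmp w n adj (While (Reg r) c) s (Suc (time c + (m * Suc (time c) + 1))) (bind_pmf (return_pmf (dex w n adj c s)) (%_. return_pmf s'))"
 by (rule cmp_While_True) (use False b s' in auto)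
 then show ?thesis using s' by (auto simp: det_def bind_return_pmf algebra_simps)
 qed
qed

text \<open>Doubles \<open>ry\<close> at most \<open>a\<close> times, but no more often than
  \<open>rx\<close> says. The depth \<open>a\<close> will depend on \<epsilon>, whereas the
  constants of the time and word bounds must not; the guard on \<open>rx\<close>, set to a multiple
  of the bit length of \<open>n\<close>, keeps both in check.\<close>

primrec nest :: "nat => nat => nat => com" where
 "nest rx ry 0 = Skip"
| "nest rx ry (Suc a) = If (Reg rx) (seqs [Compute ry Add (Reg ry) (Reg ry), Compute rx Sub (Reg rx) (Const 1), nest rx ry a]) Skip"

lemma nest_det:
 assumes "rx ~= ry" "0 < w"
 shows "regs s ry * 2 ^ regs s rx < 2 ^ w ==>
 det w n adj (nest rx ry a) s (8 * regs s rx + 2) (%s'. regs s' ry = regs s ry * 2 ^ min a (regs s rx) & mem s' = mem s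
 & (\<forall>r. r ~= rx --> r ~= ry --> regs s' r = regs s r))"
proof (induction a arbitrary: s)
 case 0
 have "det w n adj (nest rx ry 0) s 1 (%s'. s' = s)" using det_dex[of Skip "%s'. s' = s" w n adj s] by simp
 then show ?case by (rule det_mono) auto
next
 case (Suc a)
 show ?case
 proof (cases "regs s rx = 0")
 case True
 have "cmp w n adj (If (Reg rx) (seqs [Compute ry Add (Reg ry) (Reg ry), Compute rx Sub (Reg rx) (Const 1), nest rx ry a]) Skip) s (Suc 1) (return_pmf s)"
 using True cmp_exec[of Skip w n adj s] by (intro cmp_If) simp
 then show ?thesis using True by (auto simp: det_def)
 next
 case False
 then obtain x where x: "regs s rx = Suc x" by (cases "regs s rx") auto
 let ?s1 = "set_reg ry (regs s ry + regs s ry) s"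
 let ?s2 = "set_reg rx x ?s1"
 have "regs s ry * 2 <= regs s ry * 2 ^ Suc x" by (intro mult_le_mono2) simp
 then have lt: "regs s ry + regs s ry < 2 ^ w" using Suc.prems unfolding x by linarith
 have a1: "det w n adj (Compute ry Add (Reg ry) (Reg ry)) s 1 (%s'. s' = ?s1)"
 using det_dex[of "Compute ry Add (Reg ry) (Reg ry)" "%s'. s' = ?s1" w n adj s] lt by simp
 have a2: "det w n adj (Compute rx Sub (Reg rx) (Const 1)) ?s1 1 (%s'. s' = ?s2)"
 using det_dex[of "Compute rx Sub (Reg rx) (Const 1)" "%s'. s' = ?s2" w n adj ?s1] x assms by (simp add: set_reg_def)
 have v: "regs ?s2 ry = regs s ry + regs s ry" "regs ?s2 rx = x" "mem ?s2 = mem s"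
 "!!r. r ~= rx ==> r ~= ry ==> regs ?s2 r = regs s r" using assms by (simp_all add: set_reg_def)
 have p: "regs ?s2 ry * 2 ^ regs ?s2 rx < 2 ^ w" using Suc.prems x unfolding v by (simp add: algebra_simps)
 let ?R = "%s'. regs s' ry = regs s ry * 2 ^ min (Suc a) (regs s rx) & mem s' = mem s
 & (\<forall>r. r ~= rx --> r ~= ry --> regs s' r = regs s r)"
 have a3: "det w n adj (nest rx ry a) ?s2 (8 * x + 2) ?R"
 by (rule det_mono[OF Suc.IH[OF p]]) (use v x in \<open>auto simp: algebra_simps\<close>)
 have a4: "det w n adj Skip s' 1 ?R" if "?R s'" for s' using det_dex[of Skip ?R w n adj s'] that by simp
 have "det w n adj (seqs [Compute ry Add (Reg ry) (Reg ry), Compute rx Sub (Reg rx) (Const 1), nest rx ry a]) s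
 (Suc (1 + Suc (1 + Suc ((8 * x + 2) + 1)))) ?R"
 unfolding seqs.simps
 proof (rule det_Seq[OF a1])
 fix s' assume "s' = ?s1"
 then show "det w n adj (Seq (Compute rx Sub (Reg rx) (Const 1)) (Seq (nest rx ry a) Skip)) s' (Suc (1 + Suc ((8 * x + 2) + 1))) ?R"
 using det_Seq[OF a2, of "Seq (nest rx ry a) Skip" "Suc ((8 * x + 2) + 1)" ?R] det_Seq[OF a3 a4] by auto
 qed
 then obtain s' where s': "cmp w n adj (seqs [Compute ry Add (Reg ry) (Reg ry), Compute rx Sub (Reg rx) (Const 1), nest rx ry a]) s
 (Suc (1 + Suc (1 + Suc ((8 * x + 2) + 1)))) (return_pmf s')" "?R s'" by (auto simp: det_def)
 have "cmp w n adj (nest rx ry (Suc a)) s (Suc (Suc (1 + Suc (1 + Suc ((8 * x + 2) + 1))))) (return_pmf s')"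
 unfolding nest.simps by (rule cmp_If) (use s'(1) x in simp)
 then have "cmp w n adj (nest rx ry (Suc a)) s (8 * regs s rx + 2) (return_pmf s')" by (rule cmp_mono) (simp add: x)
 then show ?thesis using s'(2) by (auto simp: det_def)
 qed
qed

text \<open>Registers: 60 counter, 61 sum of the degrees, 62 maximum degree, 63 bit length \<open>lg\<close> of \<open>n\<close>,
  64 \<open>2 ^ lg\<close>.\<close>

definition c_deg :: com where "c_deg = seqs [
 Compute 71 Sub (Reg 0) (Reg 60),
 QueryDegree 72 (Reg 71),
 Compute 60 Sub (Reg 60) (Const 1),
 Compute 61 Add (Reg 61) (Reg 72),
 Compute 73 Less (Reg 62) (Reg 72),
 If (Reg 73) (Compute 62 Add (Reg 72) (Const 0)) Skip,
 If (Reg 72) (seqs [Store (Reg 1) (Reg 71), Compute 1 Add (Reg 1) (Const 1)]) Skip]"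

definition c_lg :: com where "c_lg = seqs [
 Compute 60 Div (Reg 60) (Const 2),
 Compute 63 Add (Reg 63) (Const 1),
 Compute 64 Add (Reg 64) (Reg 64)]"

definition c_prep :: com where "c_prep = seqs [
 Compute 60 Add (Reg 0) (Const 0),
 While (Reg 60) c_deg]"

context rgraph
begin

lemma deg_loop:
 assumes w: "n * n < 2 ^ w" "n + 2 < 2 ^ w" and n1: "1 <= n"
 and s: "regs s 0 = n" "regs s 60 = n" "regs s 61 = 0" "regs s 62 = 0" "regs s (Suc 0) = 0" "regs s 63 = 0" "mem s = (%_. 0)"
 shows "det w n adj (While (Reg 60) c_deg) s (n * Suc (time c_deg) + 1)
 (%s. regs s 0 = n & regs s 61 = (\<Sum>u<n. deg u) & (\<forall>u<n. deg u <= regs s 62) & (\<exists>u<n. regs s 62 = deg u)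
 & regs s (Suc 0) = length (filter (%u. 0 < deg u) [0..<n])
 & (\<forall>i<regs s (Suc 0). mem s i = filter (%u. 0 < deg u) [0..<n] ! i) & (\<forall>x\<ge>n. mem s x = 0) & regs s 60 = 0 & regs s 63 = 0)"
proof -
 define I where "I s \<longleftrightarrow> (\<exists>m\<le>n. regs s 60 = n - m & regs s 0 = n & regs s 61 = (\<Sum>u<m. deg u) & (\<forall>u<m. deg u <= regs s 62)
 & ((m = 0 & regs s 62 = 0) \<or> (\<exists>u<m. regs s 62 = deg u))
 & regs s (Suc 0) = length (filter (%u. 0 < deg u) [0..<m])
 & (\<forall>i. i < regs s (Suc 0) --> mem s i = filter (%u. 0 < deg u) [0..<m] ! i) & (\<forall>x\<ge>n. mem s x = 0) & regs s 63 = 0)" for s :: state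
 have dn: "deg u <= n" if "u < n" for u
 proof -
 have "set (adj u) \<subseteq> {..<n}" using that set_adj[of u] edgeD by blast
 then have "card (set (adj u)) <= card {..<n}" by (intro card_mono) auto
 then show ?thesis using distinct_adj[OF that] by (simp add: deg_def distinct_card)
 qed
 have w0: "0 < w" using w(2) by (cases w) auto
 have "det w n adj (While (Reg 60) c_deg) s (n * Suc (time c_deg) + 1) (%s. I s & regs s 60 = 0)"
 proof (rule det_While)
 fix s assume I: "I s" and p: "regs s 60 ~= 0"
 obtain m where m0: "m <= n" "regs s 60 = n - m" "regs s 0 = n" "regs s 61 = (\<Sum>u<m. deg u)" "\<forall>u<m. deg u <= regs s 62"
 "(m = 0 & regs s 62 = 0) \<or> (\<exists>u<m. regs s 62 = deg u)"
 "regs s (Suc 0) = length (filter (%u. 0 < deg u) [0..<m])"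
 "\<forall>i. i < regs s (Suc 0) --> mem s i = filter (%u. 0 < deg u) [0..<m] ! i" "\<forall>x\<ge>n. mem s x = 0" "regs s 63 = 0"
 using I unfolding I_def by (elim exE conjE) (rule that; assumption)
 have "m < n" using m0(1,2) p by simp
 note m = this m0(2-10)
 have q: "query_degree n adj m = deg m" using m(1) by (simp add: query_degree_def deg_def)
 have "(\<Sum>u<Suc m. deg u) <= (\<Sum>u<Suc m. n)" using dn m(1) by (intro sum_mono) auto
 also have "... <= n * n" using m(1) by (simp add: mult_le_mono1 Suc_le_eq del: mult_Suc)
 finally have nw: "((\<Sum>u<m. deg u) + deg m) mod 2 ^ w = (\<Sum>u<m. deg u) + deg m" using w(1) by simp
 have nw2: "deg m mod 2 ^ w = deg m" using dn[OF m(1)] w(2) by simp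
 have lf: "length (filter (%u. 0 < deg u) [0..<m]) <= m" by (metis length_filter_le length_upt minus_nat.diff_0)
 then have nw3: "Suc (length (filter (%u. 0 < deg u) [0..<m])) mod 2 ^ w = Suc (length (filter (%u. 0 < deg u) [0..<m]))"
 using m(1) w(2) by simp
 have sub: "n - (n - m) = m" using m(1) by simp
 let ?s = "dex w n adj c_deg s"
 have e1: "regs ?s 60 = n - Suc m" "regs ?s 0 = n" "regs ?s 61 = (\<Sum>u<Suc m. deg u)" "regs ?s 63 = 0"
 "regs ?s 62 = max (regs s 62) (deg m)"
 using m(1-4,10) q nw nw2 w0 sub by (simp_all add: c_deg_def set_reg_def max_def)
 have e2: "regs ?s (Suc 0) = length (filter (%u. 0 < deg u) [0..<Suc m])"
 "mem ?s = (if 0 < deg m then (mem s)(length (filter (%u. 0 < deg u) [0..<m]) := m) else mem s)"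
 using m(1-3,7) q nw nw2 nw3 w0 sub by (simp_all add: c_deg_def set_reg_def)
 have "I ?s" unfolding I_def
 proof (intro exI[of _ "Suc m"] conjI)
 show "(Suc m = 0 & regs ?s 62 = 0) \<or> (\<exists>u<Suc m. regs ?s 62 = deg u)"
 unfolding e1(5) using m(6) by (auto simp: max_def less_Suc_eq)
 show "\<forall>u<Suc m. deg u <= regs ?s 62" unfolding e1(5) using m(5) by (auto simp: less_Suc_eq le_max_iff_disj)
 show "\<forall>i. i < regs ?s (Suc 0) --> mem ?s i = filter (%u. 0 < deg u) [0..<Suc m] ! i"
 unfolding e2 using m(7,8) by (auto simp: nth_append less_Suc_eq)
 show "\<forall>x\<ge>n. mem ?s x = 0" unfolding e2 using m(1,9) lf by auto
 qed (use e1 e2 m(1) in auto)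
 then show "I ?s & regs ?s 60 < regs s 60" using e1(1) m(1,2) by simp
 qed (use s in \<open>auto simp: c_deg_def I_def\<close>)
 then show ?thesis
 proof (rule det_mono)
 fix s assume "I s & regs s 60 = 0"
 then show "regs s 0 = n & regs s 61 = (\<Sum>u<n. deg u) & (\<forall>u<n. deg u <= regs s 62) & (\<exists>u<n. regs s 62 = deg u)
 & regs s (Suc 0) = length (filter (%u. 0 < deg u) [0..<n])
 & (\<forall>i<regs s (Suc 0). mem s i = filter (%u. 0 < deg u) [0..<n] ! i) & (\<forall>x\<ge>n. mem s x = 0) & regs s 60 = 0 & regs s 63 = 0"
 unfolding I_def using n1 by (metis diff_is_0_eq dual_order.antisym not_one_le_zero)
 qed simp
qed

end

text \<open>With \<open>x\<close> and \<open>l\<close> the contents of registers 60 and 63, halving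
  keeps \<open>n\<close> at least \<open>x * 2 ^ l\<close> and below
  \<open>(x + 1) * 2 ^ l\<close>.\<close>

lemma lg_loop:
 assumes w: "2 * n < 2 ^ w" "2 < (2::nat) ^ w" and n: "1 <= n"
 and s: "regs s 60 = n" "regs s 63 = 0" "regs s 64 = 1"
 shows "det w n adj (While (Reg 60) c_lg) s (n * Suc (time c_lg) + 1)
 (%s'. regs s' 64 = 2 ^ regs s' 63 & n < 2 ^ regs s' 63 & 2 ^ regs s' 63 <= 2 * n & mem s' = mem s
 & (\<forall>r. r \<notin> {60, 63, 64} --> regs s' r = regs s r))"
proof -
 define I where "I s' \<longleftrightarrow> regs s' 64 = 2 ^ regs s' 63 & regs s' 60 * 2 ^ regs s' 63 <= n & n < (regs s' 60 + 1) * 2 ^ regs s' 63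
 & (regs s' 60 = 0 --> 2 ^ regs s' 63 <= 2 * n) & mem s' = mem s & (\<forall>r. r \<notin> {60, 63, 64} --> regs s' r = regs s r)" for s' :: state
 have w0: "0 < w" using w(2) by (cases w) auto
 have w2: "2 mod 2 ^ w = (2::nat)" using w(2) by simp
 have "det w n adj (While (Reg 60) c_lg) s (n * Suc (time c_lg) + 1) (%s'. I s' & regs s' 60 = 0)"
 proof (rule det_While)
 fix s' assume I: "I s'" and p: "regs s' 60 ~= 0"
 define x l where "x = regs s' 60" and "l = regs s' 63"
 have X: "x * 2 ^ l <= n" "n < (x + 1) * 2 ^ l" "0 < x" using I p by (auto simp: I_def x_def l_def)
 have "1 * 2 ^ l <= x * 2 ^ l" using X(3) by (intro mult_le_mono1) simp
 then have l: "2 ^ l <= n" using X(1) by linarith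
 then have l2: "(2::nat) ^ l + 2 ^ l < 2 ^ w" using w(1) by simp
 have "l < 2 ^ l" by (rule less_exp)
 then have nl: "Suc l < 2 ^ w" using l2 by linarith
 let ?s = "dex w n adj c_lg s'"
 have e: "regs ?s 60 = x div 2" "regs ?s 63 = Suc l" "regs ?s 64 = 2 ^ Suc l" "mem ?s = mem s'"
 "!!r. r \<notin> {60, 63, 64} ==> regs ?s r = regs s' r"
 using I w0 w2 l2 nl by (auto simp: c_lg_def set_reg_def I_def x_def l_def mult_2)
 have d: "x div 2 * 2 <= x" "x + 1 <= (x div 2 + 1) * 2" by simp_all
 have "x div 2 * 2 ^ Suc l <= x * 2 ^ l" using mult_le_mono1[OF d(1), of "2 ^ l"] by simp
 moreover have "(x + 1) * 2 ^ l <= (x div 2 + 1) * 2 ^ Suc l" using mult_le_mono1[OF d(2), of "2 ^ l"] by (simp add: algebra_simps)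
 ultimately have b: "x div 2 * 2 ^ Suc l <= n" "n < (x div 2 + 1) * 2 ^ Suc l" using X by linarith+
 have "I ?s" unfolding I_def e(1-4) using b l I e(5) by (auto simp: I_def)
 moreover have "x div 2 < x" using X(3) by simp
 ultimately show "I ?s & regs ?s 60 < regs s' 60" using e(1) by (simp add: x_def)
 qed (use s n in \<open>auto simp: c_lg_def I_def\<close>)
 then show ?thesis by (rule det_mono) (auto simp: I_def)
qed


section \<open>The estimates\<close>

text \<open>\<open>X\<close> is the mean number of matched vertices, \<open>Y\<close> its estimate
  with relative error \<open>1 / (2 * s)\<close>. The outputs are \<open>Y / 2\<close> scaled down
  and \<open>Y\<close> scaled up by a little more than the error, then rounded; strict inequalities
  between integers absorb the rounding. If \<open>s * \<epsilon>\<close> is large, the loss stays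
  within \<open>2 + \<epsilon>\<close>; if \<open>s >= 8 * \<nu>\<close>, it is less than one unit
  and the factor is 2.\<close>

lemma standard_outputs:
 fixes \<mu> \<nu> s mo co :: nat and X Y \<eta> \<epsilon> :: real
 assumes s: "4 <= s" and Y: "(2 * real s - 1) * X < 2 * real s * Y" "2 * real s * Y < (2 * real s + 1) * X"
 and mo: "s * Y <= mo * (2 * (real s + 1))" "(real mo - 1) * (2 * (real s + 1)) < s * Y"
 and co: "co * (real s - 1) <= s * Y" "s * Y < (real co + 1) * (real s - 1)"
 and X: "\<nu> * (1 - \<eta>) <= X" "X <= 2 * \<mu>" "\<mu> <= \<nu>" and \<eta>: "4 * real s * \<eta> <= 1" and \<epsilon>: "0 < \<epsilon>"
 and prec: "4 + 2 * \<epsilon> <= \<epsilon> * s \<or> 8 * \<nu> <= s"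
 shows "\<mu> / (2 + \<epsilon>) <= mo & mo <= \<mu> & \<nu> <= co & co <= (2 + \<epsilon>) * \<nu>"
proof -
 define S where "S = real s"
 have S: "4 <= S" using s by (simp add: S_def)
 have "real \<nu> * (4 * S * \<eta>) <= real \<nu> * 1" using \<eta> by (intro mult_left_mono) (auto simp: S_def)
 then have X1: "(4 * S - 1) * \<nu> <= 4 * S * X"
 using mult_left_mono[OF X(1), of "4 * S"] S by (simp add: algebra_simps)
 have Y': "(2 * S - 1) * X < 2 * S * Y" "2 * S * Y < (2 * S + 1) * X" using Y by (simp_all add: S_def)
 have mo': "S * Y <= mo * (2 * (S + 1))" "(real mo - 1) * (2 * (S + 1)) < S * Y" using mo by (simp_all add: S_def)
 have co': "co * (S - 1) <= S * Y" "S * Y < (real co + 1) * (S - 1)" using co by (simp_all add: S_def)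
 have b: "(2 * S - 1) * ((4 * S - 1) * \<nu>) <= 4 * S * ((2 * S - 1) * X)"
 using mult_left_mono[OF X1, of "2 * S - 1"] S by (simp add: algebra_simps)
 have up: "(2 * S + 1) * X <= (2 * S + 1) * (2 * \<mu>)" using X S by (intro mult_left_mono) auto
 have 1: "mo <= \<mu>"
 proof -
 have "(real mo - 1) * (4 * (S + 1)) < 2 * S * Y" using mo'(2) by (simp add: algebra_simps)
 also have "... < (2 * S + 1) * (2 * \<mu>)" using Y'(2) up by linarith
 also have "... <= \<mu> * (4 * (S + 1))" by (simp add: algebra_simps)
 finally have "(real mo - 1) * (4 * (S + 1)) < \<mu> * (4 * (S + 1))" .
 then have "real mo - 1 < \<mu>" using S by (simp add: mult_less_cancel_right)
 then show ?thesis by linarith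
 qed
 have 2: "(S - 2) * \<nu> <= 2 * S * mo"
 proof -
 have "8 * (S + 1) * ((S - 2) * \<nu>) <= (2 * S - 1) * ((4 * S - 1) * \<nu>)"
 proof -
 have "8 * (S + 1) * (S - 2) <= (2 * S - 1) * (4 * S - 1)" using S by (simp add: algebra_simps)
 then show ?thesis using mult_right_mono[of "8 * (S + 1) * (S - 2)" "(2 * S - 1) * (4 * S - 1)" "real \<nu>"] by (simp add: mult.assoc)
 qed
 also have "... <= 4 * S * ((2 * S - 1) * X)" by (rule b)
 also have "... <= 4 * S * (2 * S * Y)" using Y'(1) S by (intro mult_left_mono) auto
 also have "... = 8 * S * (S * Y)" by simp
 also have "... <= 8 * S * (mo * (2 * (S + 1)))" using mo'(1) S by (intro mult_left_mono) auto
 finally have "8 * (S + 1) * ((S - 2) * \<nu>) <= 8 * (S + 1) * (2 * S * mo)" by (simp add: mult_ac)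
 then show ?thesis using S by (simp add: mult_le_cancel_left)
 qed
 have 3: "\<nu> <= co"
 proof -
 have "8 * S * (S - 1) * \<nu> <= (2 * S - 1) * ((4 * S - 1) * \<nu>)"
 proof -
 have "8 * S * (S - 1) <= (2 * S - 1) * (4 * S - 1)" using S by (simp add: algebra_simps)
 then show ?thesis using mult_right_mono[of "8 * S * (S - 1)" "(2 * S - 1) * (4 * S - 1)" "real \<nu>"] by (simp add: mult.assoc)
 qed
 also have "... <= 4 * S * ((2 * S - 1) * X)" by (rule b)
 also have "... < 4 * S * (2 * S * Y)" using Y'(1) S by (intro mult_strict_left_mono) auto
 also have "... = 8 * S * (S * Y)" by simp
 also have "... < 8 * S * ((real co + 1) * (S - 1))" using co'(2) S by (intro mult_strict_left_mono) auto
 finally have "8 * S * (S - 1) * \<nu> < 8 * S * (S - 1) * (real co + 1)" by (simp only: mult_ac)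
 then have "\<nu> < real co + 1" using S by (simp add: mult_less_cancel_left)
 then show ?thesis by linarith
 qed
 have 4: "S * co <= (2 * S + 4) * \<nu>"
 proof -
 have "2 * (co * (S - 1)) <= 2 * S * Y" using co'(1) by simp
 also have "... <= (2 * S + 1) * (2 * \<mu>)" using Y'(2) up by linarith
 also have "... <= (2 * S + 1) * (2 * \<nu>)" using X(3) S by (intro mult_left_mono) auto
 finally have "co * (S - 1) <= (2 * S + 1) * \<nu>" by simp
 then have "S * (co * (S - 1)) <= S * ((2 * S + 1) * \<nu>)" using S by (intro mult_left_mono) auto
 also have "... <= (S - 1) * (2 * S + 4) * \<nu>"
 proof -
 have "S * (2 * S + 1) <= (S - 1) * (2 * S + 4)" using S by (simp add: algebra_simps)
 then show ?thesis using mult_right_mono[of "S * (2 * S + 1)" "(S - 1) * (2 * S + 4)" "real \<nu>"] by (simp add: mult.assoc)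
 qed
 finally have "(S - 1) * (S * co) <= (S - 1) * ((2 * S + 4) * \<nu>)" by (simp add: mult_ac)
 then show ?thesis using S by (simp add: mult_le_cancel_left)
 qed
 have \<nu>: "(2 + \<epsilon>) * mo >= \<nu> & co <= (2 + \<epsilon>) * \<nu>"
 proof (cases "8 * \<nu> <= s")
 case True
 then have "real (8 * \<nu>) <= real s" by (simp only: of_nat_le_iff)
 then have n: "8 * real \<nu> <= S" by (simp add: S_def)
 have "S * (real \<nu> - 1) < S * (2 * mo)" using 2 n S by (simp add: algebra_simps)
 then have "real \<nu> - 1 < 2 * mo" using S by (simp add: mult_less_cancel_left)
 then have m: "\<nu> <= 2 * mo" by linarith
 have "S * co < S * (2 * \<nu> + 1)" using 4 n S by (simp add: algebra_simps)
 then have "co < 2 * real \<nu> + 1" using S by (simp add: mult_less_cancel_left)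
 then have c: "co <= 2 * \<nu>" by linarith
 have "real \<nu> <= 2 * real mo" "real co <= 2 * real \<nu>" using m c by linarith+
 moreover have "0 <= \<epsilon> * mo" "0 <= \<epsilon> * \<nu>" using \<epsilon> by auto
 ultimately show ?thesis by (simp add: distrib_right)
 next
 case False
 then have p: "4 + 2 * \<epsilon> <= \<epsilon> * S" using prec by (simp add: S_def)
 have "2 * S * \<nu> <= (2 + \<epsilon>) * (S - 2) * \<nu>"
 using p by (intro mult_right_mono) (auto simp: algebra_simps)
 also have "... <= (2 + \<epsilon>) * (2 * S * mo)" using mult_left_mono[OF 2, of "2 + \<epsilon>"] \<epsilon> by (simp add: mult.assoc)
 finally have "2 * S * \<nu> <= 2 * S * ((2 + \<epsilon>) * mo)" by (simp add: mult_ac)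
 then have "\<nu> <= (2 + \<epsilon>) * mo" using S by (simp add: mult_le_cancel_left)
 moreover have "S * co <= S * ((2 + \<epsilon>) * \<nu>)"
 proof -
 have "(2 * S + 4) * \<nu> <= (S * (2 + \<epsilon>)) * \<nu>" using p \<epsilon> by (intro mult_right_mono) (auto simp: algebra_simps)
 then show ?thesis using 4 by (simp add: mult.assoc)
 qed
 then have "co <= (2 + \<epsilon>) * \<nu>" using S by (simp add: mult_le_cancel_left)
 ultimately show ?thesis by simp
 qed
 have "\<mu> <= mo * (2 + \<epsilon>)" using \<nu> X(3) by (simp add: mult.commute)
 then have "\<mu> / (2 + \<epsilon>) <= mo" using \<epsilon> by (simp add: pos_divide_le_eq)
 then show ?thesis using 1 3 \<nu> by simp
qed

text \<open>Once \<nu> lies between \<open>D / (2 * \<Delta>)\<close> and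
  \<open>2 * D * h / \<Delta>\<close>, the degrees alone determine it up to a factor
  \<open>4 * h\<close>, and \<mu> up to \<open>8 * h\<close> because of the factor 2 between the two
  numbers.\<close>

lemma low_outputs:
 fixes \<mu> \<nu> D \<Delta> h mo co :: nat and \<epsilon> :: real
 assumes \<Delta>: "1 <= \<Delta>" and h: "8 * h <= 2 + \<epsilon>"
 and D: "D <= 2 * \<Delta> * \<nu>" "\<nu> <= 2 * \<mu>" "\<mu> <= \<nu>" "\<nu> * \<Delta> <= 2 * D * h"
 and mo: "D <= mo * (4 * \<Delta>)" "(real mo - 1) * (4 * \<Delta>) < D"
 and co: "co * \<Delta> <= 2 * D * h" "2 * D * h < (co + 1) * \<Delta>"
 shows "\<mu> / (2 + \<epsilon>) <= mo & mo <= \<mu> & \<nu> <= co & co <= (2 + \<epsilon>) * \<nu>"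
proof -
 have e: "0 < 2 + \<epsilon> \<or> h = 0" using h by (cases h) auto
 have h0: "0 < D ==> \<nu> ~= 0" using D by (cases "\<nu>") auto
 have "D <= 2 * \<Delta> * (2 * \<mu>)" using D(1) mult_le_mono2[OF D(2), of "2 * \<Delta>"] by (rule le_trans)
 then have "D <= \<mu> * (4 * \<Delta>)" by (simp add: mult_ac)
 then have "(real mo - 1) * (4 * \<Delta>) < real (\<mu> * (4 * \<Delta>))" using mo(2) by linarith
 then have "(real mo - 1) * (4 * \<Delta>) < \<mu> * (4 * real \<Delta>)" by simp
 then have "real mo - 1 < \<mu>" using \<Delta> by (simp add: mult_less_cancel_right)
 then have 1: "mo <= \<mu>" by linarith
 have "\<nu> * \<Delta> < (co + 1) * \<Delta>" using D(4) co(2) by linarith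
 then have "\<nu> < co + 1" by (simp only: mult_less_cancel2)
 then have 2: "\<nu> <= co" by simp
 have "2 * D * h = D * (2 * h)" "2 * \<Delta> * \<nu> * (2 * h) = 4 * h * \<nu> * \<Delta>" by simp_all
 then have "co * \<Delta> <= 4 * h * \<nu> * \<Delta>" using co(1) mult_le_mono1[OF D(1), of "2 * h"] by linarith
 then have "co <= 4 * h * \<nu>" using \<Delta> by simp
 then have "real co <= real (4 * h) * \<nu>" by (metis of_nat_le_iff of_nat_mult)
 also have "... <= (2 + \<epsilon>) * \<nu>" using h by (intro mult_right_mono) auto
 finally have 3: "co <= (2 + \<epsilon>) * \<nu>" .
 have "\<mu> * \<Delta> <= \<nu> * \<Delta>" using D(3) by simp
 also have "... <= D * (2 * h)" using D(4) by (simp add: mult_ac)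
 also have "... <= mo * (4 * \<Delta>) * (2 * h)" using mo(1) by (rule mult_le_mono1)
 also have "... = 8 * h * mo * \<Delta>" by simp
 finally have "\<mu> <= 8 * h * mo" using \<Delta> by simp
 then have "real \<mu> <= real (8 * h) * mo" by (metis of_nat_le_iff of_nat_mult)
 also have "... <= (2 + \<epsilon>) * mo" using h by (intro mult_right_mono) auto
 finally have "\<mu> <= mo * (2 + \<epsilon>)" by (simp add: mult.commute)
 moreover have "\<mu> / (2 + \<epsilon>) <= mo" if "h = 0"
 proof -
 have "\<nu> = 0" using D(4) that \<Delta> by simp
 then show ?thesis using D(3) by simp
 qed
 ultimately have "\<mu> / (2 + \<epsilon>) <= mo" using e by (auto simp: pos_divide_le_eq)
 then show ?thesis using 1 2 3 by simp
qed

lemma ceil_div: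
 assumes "0 < (d::nat)"
 shows "x <= (x + d - 1) div d * d" "real ((x + d - 1) div d * d) < real x + d"
proof -
 have e: "(x + d - 1) div d * d + (x + d - 1) mod d = x + d - 1" by simp
 have m: "(x + d - 1) mod d < d" using assms by simp
 show "x <= (x + d - 1) div d * d" using e m assms by linarith
 have "(x + d - 1) div d * d < x + d" using e assms by linarith
 then show "real ((x + d - 1) div d * d) < real x + d" by (metis of_nat_add of_nat_less_iff)
qed

lemma floor_div:
 assumes "0 < (d::nat)"
 shows "x div d * d <= x" "x < (x div d + 1) * d"
proof -
 have e: "x div d * d + x mod d = x" by simp
 have m: "x mod d < d" using assms by simp
 show "x div d * d <= x" by simp
 show "x < (x div d + 1) * d" using e m unfolding distrib_right by linarith
qed

context rgraph_par
begin

text \<open>With fewer than \<theta> hits the sample is too small to be trusted and the estimate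
  comes from the degrees; \<open>\<theta> = 0\<close> switches this off.\<close>

definition mout :: "nat => nat => nat => nat => nat => nat => nat" where
 "mout \<Delta> t s \<theta> h x = (if x < \<theta> then (D + 4 * \<Delta> - 1) div (4 * \<Delta>)
 else (card nonis * x * s + 2 * t * (s + 1) - 1) div (2 * t * (s + 1)))"

definition cout :: "nat => nat => nat => nat => nat => nat => nat" where
 "cout \<Delta> t s \<theta> h x = (if x < \<theta> then 2 * D * h div \<Delta> else card nonis * x * s div (t * (s - 1)))"

definition valid :: "real => nat => nat => nat => nat => nat => nat => bool" where
 "valid \<epsilon> \<Delta> t s \<theta> h x \<longleftrightarrow> matching_approx (2 + \<epsilon>) E (mout \<Delta> t s \<theta> h x)
 & vertex_cover_approx (2 + \<epsilon>) n E (cout \<Delta> t s \<theta> h x)"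

lemma D_nonis: "D = (\<Sum>v\<in>nonis. deg v)"
 unfolding D_def nonis_def by (intro sum.mono_neutral_right) auto

lemma nonis_le_D: "card nonis <= D"
proof -
 have "card nonis = (\<Sum>v\<in>nonis. 1)" by simp
 also have "... <= D" unfolding D_nonis by (intro sum_mono) (auto simp: nonis_def)
 finally show ?thesis .
qed

lemma D_le_nonis: "(!!u. u < n ==> deg u <= \<Delta>) ==> D <= card nonis * \<Delta>"
proof -
 assume d: "!!u. u < n ==> deg u <= \<Delta>"
 have "D <= (\<Sum>v\<in>nonis. \<Delta>)" unfolding D_nonis by (intro sum_mono d) (auto simp: nonis_def)
 then show ?thesis by simp
qed

text \<open>The mean number of hits is \<open>t * pm\<close>. If it is at least
  \<open>A * s ^ 2 / 4\<close>, the Chernoff bound with relative error \<open>1 / (2 * s)\<close>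
  has exponent \<open>A / 64\<close>, and whichever estimate the threshold selects is valid. If it
  is smaller, \<open>\<theta> = A * s ^ 2\<close> hits are unlikely, and below \<theta> the estimate
  from degrees is valid.\<close>

lemma valid_tail:
 fixes \<epsilon> :: real and A Z t s h \<theta> \<Delta> :: nat
 assumes ne: "nonis ~= {}" and \<Delta>: "!!u. u < n ==> deg u <= \<Delta>" and s: "4 <= s" and A: "1 <= A" and \<epsilon>: "0 < \<epsilon>"
 and Z: "Z = 2 * A * \<Delta> * s\<^sup>2 div h" and t: "t = card nonis * Z div D"
 and \<eta>: "4 * real s * \<eta> <= 1" and prec: "4 + 2 * \<epsilon> <= \<epsilon> * s \<or> 8 * n <= s"
 and cs: "\<theta> = 0 & h = 1 \<or> \<theta> = A * s\<^sup>2 & 8 * h <= 2 + \<epsilon> & 1 <= h"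
 shows "tail pm (%x. ~ valid \<epsilon> \<Delta> t s \<theta> h x) t 0 <= 2 * exp (- (A / 64))"
proof -
 define \<mu> \<nu> n' where "\<mu> = matching_number E" and "\<nu> = vertex_cover_number n E" and "n' = card nonis"
 define X where "X = n' * pm"
 have fin: "finite nonis" by (simp add: nonis_def)
 have n0: "1 <= n'" using ne fin by (simp add: n'_def card_gt_0_iff Suc_le_eq)
 have nD: "n' <= D" using nonis_le_D by (simp add: n'_def)
 have Dn: "D <= n' * \<Delta>" using D_le_nonis[OF \<Delta>] by (simp add: n'_def)
 have \<Delta>1: "1 <= \<Delta>" using Dn nD n0 by (cases \<Delta>) auto
 have \<eta>1: "\<eta> <= 1 / 16"
 proof (cases "\<eta> <= 0")
 case False
 have "4 * 4 * \<eta> <= 4 * real s * \<eta>" using s False by (intro mult_right_mono mult_left_mono) auto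
 then show ?thesis using \<eta> by linarith
 qed simp
 have X: "\<nu> * (1 - \<eta>) <= X" "X <= 2 * \<mu>" "\<nu> <= 2 * \<mu>"
 using matched_good_bounds \<eta>1 pm_eq[OF ne] by (auto simp: X_def n'_def \<mu>_def \<nu>_def)
 have mn: "\<mu> <= \<nu>" unfolding \<mu>_def \<nu>_def by (rule mu_le_nu)
 have Dc: "D <= 2 * \<Delta> * \<nu>" unfolding \<nu>_def by (rule D_le_cover[OF \<Delta>])
 have \<nu>n: "\<nu> <= n"
 proof -
 obtain S where S: "vertex_cover n E S" "card S = \<nu>" unfolding \<nu>_def using ex_min_cover by blast
 then have "card S <= card {..<n}" by (intro card_mono) (auto simp: vertex_cover_def)
 then show ?thesis using S by simp
 qed
 have X15: "15 / 16 * \<nu> <= X" using X(1) mult_left_mono[of "15 / 16" "1 - \<eta>" "real \<nu>"] \<eta>1 by (simp add: mult.commute)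
 have p: "0 <= pm" "pm <= 1" using pm_range by auto
 have Xn: "X <= n'" "0 <= X" using p by (auto simp: X_def mult_left_le)
 have D0: "0 < D" using nD n0 by simp
 have t1: "n' * Z < (t + 1) * D" "t * D <= n' * Z" using floor_div[OF D0, of "n' * Z"] t by (auto simp: n'_def)
 have valid: "valid \<epsilon> \<Delta> t s \<theta> h x \<longleftrightarrow> \<mu> / (2 + \<epsilon>) <= mout \<Delta> t s \<theta> h x & mout \<Delta> t s \<theta> h x <= \<mu>
 & \<nu> <= cout \<Delta> t s \<theta> h x & cout \<Delta> t s \<theta> h x <= (2 + \<epsilon>) * \<nu>" for x
 by (simp add: valid_def matching_approx_def vertex_cover_approx_def \<mu>_def \<nu>_def)
 define \<delta> where "\<delta> = 1 / (2 * real s)"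
 have \<delta>: "0 < \<delta>" "\<delta> <= 1" "\<delta> <= 1 / 8" using s by (auto simp: \<delta>_def divide_simps)
 have std: "valid \<epsilon> \<Delta> t s \<theta> h x"
 if x: "~ x < \<theta>" "1 <= t" "(1 - \<delta>) * (t * pm) < x" "x < (1 + \<delta>) * (t * pm)" for x
 proof -
 define Y where "Y = n' * x / t"
 have t0: "0 < real t" using x(2) by simp
 have s0: "0 < real s" using s by simp
 have Yt: "Y * t = n' * x" using t0 by (simp add: Y_def)
 have xY: "2 * real s * real n' * real x = 2 * real s * Y * t" using Yt by simp
 have Y1: "(2 * real s - 1) * X < 2 * real s * Y"
 proof -
 have "2 * real s * real n' * ((1 - \<delta>) * (t * pm)) < 2 * real s * real n' * real x"
 using x(3) s0 n0 by (intro mult_strict_left_mono) auto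
 moreover have "2 * real s * real n' * ((1 - \<delta>) * (t * pm)) = (2 * real s - 1) * X * t"
 using s0 by (simp add: \<delta>_def X_def field_simps)
 ultimately have "(2 * real s - 1) * X * t < 2 * real s * Y * t" using xY by linarith
 then show ?thesis using t0 by (simp add: mult_less_cancel_right)
 qed
 have Y2: "2 * real s * Y < (2 * real s + 1) * X"
 proof -
 have "2 * real s * real n' * real x < 2 * real s * real n' * ((1 + \<delta>) * (t * pm))"
 using x(4) s0 n0 by (intro mult_strict_left_mono) auto
 moreover have "2 * real s * real n' * ((1 + \<delta>) * (t * pm)) = (2 * real s + 1) * X * t"
 using s0 by (simp add: \<delta>_def X_def field_simps)
 ultimately have "2 * real s * Y * t < (2 * real s + 1) * X * t" using xY by linarith
 then show ?thesis using t0 by (simp add: mult_less_cancel_right)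
 qed
 have d1: "0 < 2 * t * (s + 1)" "0 < t * (s - 1)" using x(2) s by auto
 let ?m = "mout \<Delta> t s \<theta> h x" and ?c = "cout \<Delta> t s \<theta> h x"
 have m: "n' * x * s <= ?m * (2 * t * (s + 1))" "real (?m * (2 * t * (s + 1))) < real (n' * x * s) + real (2 * t * (s + 1))"
 using ceil_div[OF d1(1), of "n' * x * s"] x(1) by (simp_all add: mout_def n'_def)
 have c: "?c * (t * (s - 1)) <= n' * x * s" "n' * x * s < (?c + 1) * (t * (s - 1))"
 using floor_div[OF d1(2), of "n' * x * s"] x(1) by (simp_all add: cout_def n'_def)
 have sY: "real (n' * x * s) = s * Y * t" using Yt by simp
 have sm: "real (s - 1) = real s - 1" using s by (simp add: of_nat_diff)
 have "s * Y * t <= ?m * (2 * (real s + 1)) * t"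
 unfolding sY[symmetric] using m(1)[folded of_nat_le_iff[where 'a = real]] by (simp add: algebra_simps)
 then have m1: "s * Y <= ?m * (2 * (real s + 1))" using t0 by (simp add: mult_le_cancel_right)
 have "(real ?m - 1) * (2 * (real s + 1)) * t < s * Y * t"
 unfolding sY[symmetric] using m(2) by (simp add: algebra_simps)
 then have m2: "(real ?m - 1) * (2 * (real s + 1)) < s * Y" using t0 by (simp add: mult_less_cancel_right)
 have "?c * (real s - 1) * t <= s * Y * t"
 unfolding sY[symmetric] using c(1)[folded of_nat_le_iff[where 'a = real]] sm by (simp add: mult_ac)
 then have c1: "?c * (real s - 1) <= s * Y" using t0 by (simp add: mult_le_cancel_right)
 have "s * Y * t < (real ?c + 1) * (real s - 1) * t"
 proof -
 have "real (n' * x * s) < real ((?c + 1) * (t * (s - 1)))" using c(2) by (simp only: of_nat_less_iff)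
 also have "... = (real ?c + 1) * (real s - 1) * t" by (simp only: of_nat_mult of_nat_add of_nat_1 sm mult_ac)
 finally show ?thesis unfolding sY .
 qed
 then have c2: "s * Y < (real ?c + 1) * (real s - 1)" using t0 by (simp add: mult_less_cancel_right)
 have "4 + 2 * \<epsilon> <= \<epsilon> * s \<or> 8 * \<nu> <= s" using prec \<nu>n by auto
 then show ?thesis unfolding valid
 using standard_outputs[OF s Y1 Y2 m1 m2 c1 c2 X(1,2) mn \<eta> \<epsilon>] by simp
 qed
 \<comment> \<open>A small mean bounds \<open>X\<close>, and with it \<nu>, by a multiple of
   \<open>D * h / \<Delta>\<close>, as \<open>low_outputs\<close> requires.\<close>
 have low: "valid \<epsilon> \<Delta> t s \<theta> h x" if x: "x < \<theta>" "t * pm <= 2 * \<theta>" for x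
 proof -
 have h: "8 * h <= 2 + \<epsilon>" "1 <= h" and \<theta>: "\<theta> = A * s\<^sup>2" using cs x(1) by auto
 have "4 * 4 <= s * s" using s by (intro mult_le_mono) auto
 moreover have "1 * (s * s) <= A * (s * s)" using A by (rule mult_le_mono1)
 ultimately have th4: "4 <= \<theta>" unfolding \<theta> power2_eq_square by linarith
 have "2 * A * \<Delta> * s\<^sup>2 < (Z + 1) * h" using floor_div(2)[of h "2 * A * \<Delta> * s\<^sup>2"] h(2) Z by simp
 then have "2 * \<theta> * \<Delta> <= (Z + 1) * h" using \<theta> by (simp add: mult_ac)
 then have z: "2 * real \<theta> * \<Delta> <= (Z + 1) * real h" by (metis of_nat_le_iff of_nat_mult of_nat_numeral)
 have "real (n' * Z) <= real ((t + 1) * D)" using t1(1) by (simp only: of_nat_le_iff less_imp_le)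
 then have "real (n' * Z) * pm <= real ((t + 1) * D) * pm" using p(1) by (rule mult_right_mono)
 then have "Z * X <= (t * pm + pm) * D" by (simp add: X_def algebra_simps)
 also have "... <= (2 * real \<theta> + 1) * real D" using x(2) p(2) by (intro mult_right_mono) auto
 finally have zx: "Z * X <= (2 * real \<theta> + 1) * real D" .
 have XD: "X <= real D" using Xn nD by linarith
 have "2 * real \<theta> * \<Delta> * X <= (real Z + 1) * real h * X" using z Xn(2) by (intro mult_right_mono) (simp_all add: add.commute)
 also have "... = real h * (Z * X + X)" by (simp add: algebra_simps)
 also have "... <= real h * ((2 * real \<theta> + 1) * real D + real D)" using zx XD by (intro mult_left_mono) auto
 also have "... = 2 * (real h * real D * (real \<theta> + 1))" by (simp add: algebra_simps)
 also have "... <= 2 * (real h * real D * (5 / 4 * real \<theta>))" using th4 by (intro mult_left_mono) auto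
 finally have "real \<theta> * (real \<Delta> * X) <= real \<theta> * (5 / 4 * (real h * real D))" by (simp add: mult_ac)
 then have dx: "real \<Delta> * X <= 5 / 4 * (real h * real D)" using th4 by (simp add: mult_le_cancel_left)
 have "real \<Delta> * (15 / 16 * real \<nu>) <= real \<Delta> * X" using X15 by (intro mult_left_mono) auto
 then have d4: "15 / 16 * (real \<nu> * real \<Delta>) <= 5 / 4 * (real D * real h)" using dx by (simp add: mult_ac)
 have "0 <= real D * real h" by simp
 then have "real \<nu> * real \<Delta> <= 2 * (real D * real h)" using d4 by linarith
 then have "real (\<nu> * \<Delta>) <= real (2 * D * h)" by simp
 then have nd: "\<nu> * \<Delta> <= 2 * D * h" by (simp only: of_nat_le_iff)
 have d: "0 < 4 * \<Delta>" "0 < \<Delta>" using \<Delta>1 by auto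
 let ?m = "mout \<Delta> t s \<theta> h x" and ?c = "cout \<Delta> t s \<theta> h x"
 have m: "D <= ?m * (4 * \<Delta>)" "real (?m * (4 * \<Delta>)) < real D + real (4 * \<Delta>)"
 using ceil_div[OF d(1), of D] x(1) by (simp_all add: mout_def)
 then have m2: "(real ?m - 1) * (4 * \<Delta>) < D" by (simp add: algebra_simps)
 have c: "?c * \<Delta> <= 2 * D * h" "2 * D * h < (?c + 1) * \<Delta>"
 using floor_div[OF d(2), of "2 * D * h"] x(1) by (simp_all add: cout_def)
 show ?thesis unfolding valid
 by (rule low_outputs[OF \<Delta>1 h(1) Dc X(3) mn nd m(1) m2 c])
 qed
 have ch: "tail pm (%x. ~ valid \<epsilon> \<Delta> t s \<theta> h x) t 0 <= 2 * exp (- (A / 64))"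
 if big: "A * s\<^sup>2 / 4 <= t * pm"
 proof -
 have "0 < real (A * s\<^sup>2)" using A s by simp
 then have tp: "0 < t * pm" using big by linarith
 then have t1: "1 <= t" by (cases t) auto
 have "tail pm (%x. ~ valid \<epsilon> \<Delta> t s \<theta> h x) t 0 <= 2 * exp (- (t * pm * \<delta>\<^sup>2 / 4))"
 proof (rule chernoff[OF p \<delta>(1,2)])
 fix x assume nv: "~ valid \<epsilon> \<Delta> t s \<theta> h x"
 show "real x <= (1 - \<delta>) * (t * pm) \<or> (1 + \<delta>) * (t * pm) <= real x"
 proof (rule ccontr)
 assume "~ ?thesis"
 then have r: "(1 - \<delta>) * (t * pm) < x" "x < (1 + \<delta>) * (t * pm)" by auto
 then have "x < \<theta>" using std[OF _ t1 r] nv by blast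
 \<comment> \<open>Fewer than \<theta> hits within relative error 1/8 force the mean below
   \<open>2 * \<theta>\<close>, so the estimate from degrees is valid as well.\<close>
 moreover have "7 / 8 * (t * pm) <= (1 - \<delta>) * (t * pm)" using tp \<delta>(3) by (intro mult_right_mono) auto
 then have "7 / 8 * (t * pm) < \<theta>" using r(1) calculation by linarith
 then have "t * pm <= 2 * \<theta>" by simp
 ultimately show False using low nv by blast
 qed
 qed
 also have "... <= 2 * exp (- (A / 64))"
 proof -
 have "real s ~= 0" using s by simp
 then have e: "\<delta>\<^sup>2 * (real A * (real s)\<^sup>2) = real A / 4" by (simp add: \<delta>_def power2_eq_square field_simps)
 have "real A * (real s)\<^sup>2 / 4 * \<delta>\<^sup>2 <= t * pm * \<delta>\<^sup>2" using big by (intro mult_right_mono) auto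
 moreover have "real A * (real s)\<^sup>2 / 4 * \<delta>\<^sup>2 = \<delta>\<^sup>2 * (real A * (real s)\<^sup>2) / 4" by simp
 ultimately have "A / 64 <= t * pm * \<delta>\<^sup>2 / 4" using e by linarith
 then show ?thesis by simp
 qed
 finally show ?thesis .
 qed
 show ?thesis
 proof (cases "A * s\<^sup>2 / 4 <= t * pm")
 case True
 then show ?thesis by (rule ch)
 next
 case small: False
 \<comment> \<open>Without a threshold \<open>Z\<close> is not reduced, and
   \<open>D_le_cover\<close> makes the mean at least \<open>15 / 32 * A * s ^ 2\<close>, contrary to
   its being small.\<close>
 have \<theta>: "\<theta> = A * s\<^sup>2"
 proof (rule ccontr)
 assume "\<theta> ~= A * s\<^sup>2"
 then have Z': "Z = 2 * A * \<Delta> * s\<^sup>2" using cs Z by auto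
 have "2 * A * s\<^sup>2 * D <= 2 * A * s\<^sup>2 * (n' * \<Delta>)" using Dn by (rule mult_le_mono2)
 also have "... = n' * Z" by (simp add: Z')
 finally have nz: "2 * A * s\<^sup>2 * D <= n' * Z" .
 have "1 * 1 <= A * s\<^sup>2" using A s by (intro mult_le_mono) auto
 then have "2 * D <= 2 * A * s\<^sup>2 * D" using mult_le_mono1[of 1 "A * s\<^sup>2" "2 * D"] by (simp add: mult_ac)
 then have "n' * Z <= 2 * (t * D)" using t1(1) nz unfolding distrib_right by linarith
 then have "real (n' * Z) * pm <= real (2 * (t * D)) * pm" using p(1) by (intro mult_right_mono) (simp_all only: of_nat_le_iff)
 then have a: "Z * X <= 2 * D * (t * pm)" by (simp add: X_def mult_ac)
 have "real D <= 2 * \<Delta> * real \<nu>" using Dc by (metis of_nat_le_iff of_nat_mult of_nat_numeral)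
 moreover have "\<Delta> * (15 / 16 * \<nu>) <= \<Delta> * X" using X15 by (intro mult_left_mono) auto
 ultimately have "15 / 32 * D <= \<Delta> * X" by simp
 then have "2 * real A * (real s)\<^sup>2 * (15 / 32 * D) <= 2 * real A * (real s)\<^sup>2 * (\<Delta> * X)" by (intro mult_left_mono) auto
 also have "... = Z * X" by (simp add: Z')
 finally have "real D * (15 / 32 * (real A * (real s)\<^sup>2)) <= real D * (t * pm)" using a by (simp add: mult_ac)
 then have "15 / 32 * (real A * (real s)\<^sup>2) <= t * pm" using D0 by (simp add: mult_le_cancel_left)
 moreover have "t * pm < real A * (real s)\<^sup>2 / 4" using small by simp
 moreover have "0 <= real A * (real s)\<^sup>2" by simp
 ultimately show False by linarith
 qed
 have "tail pm (%x. ~ valid \<epsilon> \<Delta> t s \<theta> h x) t 0 <= exp (- (real \<theta> / 2))"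
 proof (rule tail_large[OF p])
 show th: "t * pm <= real \<theta> / 4" using small \<theta> by simp
 fix x assume "~ valid \<epsilon> \<Delta> t s \<theta> h x"
 then show "real \<theta> <= real x" using low[of x] th by (cases "x < \<theta>") auto
 qed
 also have "... <= exp (- (A / 64))"
 proof -
 have "A * 1 <= A * s\<^sup>2" using s by (intro mult_le_mono2) auto
 then have "A <= \<theta>" unfolding \<theta> by linarith
 then have "real A <= real \<theta>" by simp
 then show ?thesis by simp
 qed
 also have "... <= 2 * exp (- (A / 64))" by simp
 finally show ?thesis .
 qed
qed

end


section \<open>The algorithm\<close>

definition pow_com :: "nat => nat => nat => com" where
 "pow_com r rm e = seqs (replicate e (Compute r Mul (Reg r) (Reg rm)))"

lemma pow_com_simps [simp]: "deterministic (pow_com r rm e)" "loopfree (pow_com r rm e)"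
 by (induction e) (auto simp: pow_com_def)

lemma dex_pow:
 assumes "r ~= rm"
 shows "1 <= regs s rm ==> regs s r * regs s rm ^ e < 2 ^ w ==>
 dex w n adj (pow_com r rm e) s = set_reg r (regs s r * regs s rm ^ e) s"
proof (induction e arbitrary: s)
 case 0
 then show ?case by (simp add: pow_com_def set_reg_def)
next
 case (Suc e)
 have "regs s r * regs s rm * 1 <= regs s r * regs s rm * regs s rm ^ e"
 using Suc.prems(1) by (intro mult_le_mono2) simp
 moreover have "regs s r * regs s rm ^ Suc e = regs s r * regs s rm * regs s rm ^ e" by simp
 ultimately have lt: "regs s r * regs s rm < 2 ^ w" using Suc.prems(2) by linarith
 have "dex w n adj (pow_com r rm (Suc e)) s = dex w n adj (pow_com r rm e) (set_reg r (regs s r * regs s rm) s)"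
 using lt by (simp add: pow_com_def)
 also have "... = set_reg r (regs s r * regs s rm * regs s rm ^ e) (set_reg r (regs s r * regs s rm) s)"
 using Suc.IH[of "set_reg r (regs s r * regs s rm) s"] Suc.prems assms by (simp add: set_reg_def mult_ac)
 finally show ?case by (simp add: set_reg_def mult_ac)
qed

definition c_par1 :: "nat => nat => com" where "c_par1 B c0 = seqs [
 Compute 65 Mul (Reg 63) (Const B),
 Compute 66 Mul (Reg 63) (Const c0),
 Compute 74 Add (Reg 63) (Const 0),
 Compute 67 Add (Const 32) (Const 0)]"

definition c_par2 :: "nat => com" where "c_par2 J = seqs [
 Compute 74 Mul (Reg 63) (Const J),
 Compute 68 Add (Const 1) (Const 0)]"

definition c_par3 :: "nat => nat => com" where "c_par3 e th = seqs [
 Compute 2 Add (Reg 0) (Const 0),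
 pow_com 2 64 e,
 Compute 3 Mul (Reg 65) (Reg 2),
 Compute 75 Mul (Reg 67) (Reg 67),
 Compute 75 Mul (Reg 66) (Reg 75),
 Compute 69 Mul (Reg 75) (Const th),
 Compute 76 Mul (Reg 62) (Reg 75),
 Compute 76 Add (Reg 76) (Reg 76),
 Compute 76 Div (Reg 76) (Reg 68),
 Compute 77 Mul (Reg 1) (Reg 76),
 Compute 4 Div (Reg 77) (Reg 61),
 Compute 79 Add (Reg 65) (Const 40),
 Compute 5 Add (Reg 76) (Const 0),
 pow_com 5 79 7]"

definition c_par4 :: "nat => com" where "c_par4 k = seqs [
 Compute 6 Add (Reg 0) (Const 0),
 Compute 8 Add (Reg 5) (Const 3),
 Compute 8 Mul (Reg 8) (Const 3),
 Compute 8 Add (Reg 0) (Reg 8),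
 Compute 81 Add (Reg 3) (Reg 2),
 Compute 9 Add (Reg 81) (Const 1),
 Compute 40 Mul (Reg 81) (Reg 0),
 Compute 40 Add (Reg 40) (Const 1),
 Compute 7 Mul (Reg 0) (Reg 9),
 Compute 7 Mul (Reg 7) (Reg 40),
 Compute 7 Add (Reg 0) (Reg 7),
 Compute 70 Mul (Reg 63) (Const (k + 2)),
 Compute 12 Add (Const 0) (Const 0)]"

definition c_init :: com where "c_init = seqs [
 Compute 70 Sub (Reg 70) (Const 1),
 Compute 10 Add (Const 0) (Const 0),
 Compute 11 Add (Reg 4) (Const 0),
 Compute 12 Add (Const 0) (Const 0),
 Compute 15 Add (Reg 5) (Const 0),
 Compute 82 Less (Const 0) (Reg 5),
 Compute 83 Less (Const 0) (Reg 4),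
 Compute 16 Mul (Reg 82) (Reg 83)]"

definition c_fin :: com where "c_fin = seqs [
 Compute 82 Add (Reg 10) (Reg 11),
 If (Reg 82) Skip (Compute 70 Add (Const 0) (Const 0))]"

definition c_try :: com where "c_try = seqs [c_init, While (Reg 16) c_body, c_fin]"

definition c_out :: com where "c_out = seqs [
 Compute 82 Less (Reg 12) (Reg 69),
 If (Reg 82)
 (seqs [Compute 83 Mul (Reg 62) (Const 4),
 Compute 84 Add (Reg 61) (Reg 83),
 Compute 84 Sub (Reg 84) (Const 1),
 Compute 0 Div (Reg 84) (Reg 83),
 Compute 84 Add (Reg 61) (Reg 61),
 Compute 84 Mul (Reg 84) (Reg 68),
 Compute 1 Div (Reg 84) (Reg 62)])
 (seqs [Compute 84 Mul (Reg 1) (Reg 12),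
 Compute 84 Mul (Reg 84) (Reg 67),
 Compute 83 Add (Reg 4) (Reg 4),
 Compute 85 Add (Reg 67) (Const 1),
 Compute 83 Mul (Reg 83) (Reg 85),
 Compute 86 Add (Reg 84) (Reg 83),
 Compute 86 Sub (Reg 86) (Const 1),
 Compute 0 Div (Reg 86) (Reg 83),
 Compute 85 Sub (Reg 67) (Const 1),
 Compute 83 Mul (Reg 4) (Reg 85),
 Compute 1 Div (Reg 84) (Reg 83)])]"

lemma loop_inv:
 "(!!s s'. I s ==> P s ==> s' \<in> set_pmf (f s) ==> I s') ==> I s ==> s' \<in> set_pmf (loop P f m s) ==> I s'"
proof (induction m arbitrary: s)
 case (Suc m)
 show ?case
 proof (cases "P s")
 case True
 then obtain s1 where s1: "s1 \<in> set_pmf (f s)" "s' \<in> set_pmf (loop P f m s1)" using Suc.prems(3) by auto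
 have i1: "I s1" by (rule Suc.prems(1)[OF Suc.prems(2) True s1(1)])
 show ?thesis
 proof (rule Suc.IH[OF _ i1 s1(2)])
 show "I y" if "I x" "P x" "y \<in> set_pmf (f x)" for x y using that by (rule Suc.prems(1))
 qed
 qed (use Suc.prems in simp)
qed simp

text \<open>All values occurring in a run.\<close>

definition tvals :: "nat => nat => nat => nat => nat => nat => nat => nat => nat => nat => nat => nat => nat => nat => nat => nat => nat => nat => nat list" where
 "tvals B c0 J th k n lg \<Delta> D n' s h M b A Q Z F = (let AS = A * (s * s); N = b * Q; H = N + Q; K = lg * (k + 2);
 B0 = n + (F + 3) * 3; RS = n + n * (H + 1) * (H * n + 1) in
 [B, c0, J, th, k + 2, 40, M, lg, n, b, A, lg * J, s, h, Q, N, s * s, AS, AS * th, \<Delta> * AS, \<Delta> * AS + \<Delta> * AS, n' * Z, Z + 5, b + 40, F,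
 (F + 3) * 3, B0, H + 1, H * n + 1, n * (H + 1), n * (H + 1) * (H * n + 1), RS, K,
 B0 + RS * F * K, Q * Q + H * n + Q + H + n + F + 5,
 \<Delta> * 4, D + \<Delta> * 4, D + D, (D + D) * h, n' * F, n' * F * s, Z + Z, s + 1, (Z + Z) * (s + 1), n' * F * s + (Z + Z) * (s + 1), M * 32, M ^ J])"

locale algo = rgraph_par +
 fixes w lg M \<Delta> B c0 J e th k a1 a2 :: nat
 assumes ne: "nonis ~= {}" and Meq: "M = 2 ^ lg" and nM: "n < M" and lg1: "1 <= lg" and be: "b = B * lg" and q0e: "q0 = M ^ e"
 and \<Delta>: "!!u. u < n ==> deg u <= \<Delta>"
begin

definition n' :: nat where "n' = card nonis"
definition A :: nat where "A = lg * c0"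
text \<open>The precision, of order \<open>1 / \<epsilon>\<close>. At the cap it is
  \<open>32 * M\<close>, more than \<open>8 * n\<close>, where counts are already resolved to the
  unit and finer precision is pointless.\<close>

definition sv :: nat where "sv = 32 * 2 ^ min a1 lg"
text \<open>The divisor of the sample size for large \<epsilon>. With the \<open>J\<close> chosen
  later, the cap \<open>M ^ J\<close> exceeds the numerator of \<open>Z\<close>, so that no sample
  is taken.\<close>

definition hv :: nat where "hv = 2 ^ min a2 (lg * J)"
definition AS :: nat where "AS = A * (sv * sv)"
definition Z :: nat where "Z = (\<Delta> * AS + \<Delta> * AS) div hv"
definition t :: nat where "t = n' * Z div D"
definition F :: nat where "F = Z * (b + 40) ^ 7"
definition B0' :: nat where "B0' = n + (F + 3) * 3"
definition K :: nat where "K = lg * (k + 2)"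
definition RSv :: nat where "RSv = n + n * (H + 1) * (H * n + 1)"
definition vals :: "nat list" where
 "vals = tvals B c0 J th k n lg \<Delta> D n' sv hv M b A Q Z F"
text \<open>The sum is a convenient common bound for all listed values.\<close>

definition TOP :: nat where "TOP = sum_list vals"

lemma in_vals: "x \<in> set vals ==> x <= TOP"
 unfolding TOP_def by (rule member_le_sum_list) auto

lemma vals: "list_all (%x. x <= TOP) [B, c0, J, th, k + 2, 40, M, lg, n, b, A, lg * J, sv, hv, Q, N, sv * sv, AS, AS * th, \<Delta> * AS, \<Delta> * AS + \<Delta> * AS,
 n' * Z, Z + 5, b + 40, F, (F + 3) * 3, B0', H + 1, H * n + 1, n * (H + 1), n * (H + 1) * (H * n + 1), RSv, K,
 B0' + RSv * F * K, Q * Q + H * n + Q + H + n + F + 5,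
 \<Delta> * 4, D + \<Delta> * 4, D + D, (D + D) * hv, n' * F, n' * F * sv, Z + Z, sv + 1, (Z + Z) * (sv + 1), n' * F * sv + (Z + Z) * (sv + 1), M * 32, M ^ J]"
proof -
 have "vals = [B, c0, J, th, k + 2, 40, M, lg, n, b, A, lg * J, sv, hv, Q, N, sv * sv, AS, AS * th, \<Delta> * AS, \<Delta> * AS + \<Delta> * AS,
 n' * Z, Z + 5, b + 40, F, (F + 3) * 3, B0', H + 1, H * n + 1, n * (H + 1), n * (H + 1) * (H * n + 1), RSv, K,
 B0' + RSv * F * K, Q * Q + H * n + Q + H + n + F + 5,
 \<Delta> * 4, D + \<Delta> * 4, D + D, (D + D) * hv, n' * F, n' * F * sv, Z + Z, sv + 1, (Z + Z) * (sv + 1), n' * F * sv + (Z + Z) * (sv + 1), M * 32, M ^ J]"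
 unfolding vals_def tvals_def Let_def AS_def K_def B0'_def RSv_def H_def unfolding NbQ by (rule refl)
 then show ?thesis using in_vals by (metis list_all_iff)
qed

end

locale algo_w = algo +
 assumes TOPw: "TOP < 2 ^ w"
begin

lemma vT:
 shows "B <= TOP" "c0 <= TOP" "J <= TOP" "th <= TOP" "k + 2 <= TOP" "40 <= TOP" 
 "M <= TOP" "lg <= TOP" "n <= TOP" "b <= TOP" "A <= TOP" "lg * J <= TOP" 
 "sv <= TOP" "hv <= TOP" "Q <= TOP" "N <= TOP" "sv * sv <= TOP" "AS <= TOP" 
 "AS * th <= TOP" "\<Delta> * AS <= TOP" "\<Delta> * AS + \<Delta> * AS <= TOP" "n' * Z <= TOP" "Z + 5 <= TOP" "b + 40 <= TOP" 
 "F <= TOP" "(F + 3) * 3 <= TOP" "B0' <= TOP" "H + 1 <= TOP" "H * n + 1 <= TOP" "n * (H + 1) <= TOP" 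
 "n * (H + 1) * (H * n + 1) <= TOP" "RSv <= TOP" "K <= TOP" "B0' + RSv * F * K <= TOP" "Q * Q + H * n + Q + H + n + F + 5 <= TOP" "\<Delta> * 4 <= TOP" 
 "D + \<Delta> * 4 <= TOP" "D + D <= TOP" "(D + D) * hv <= TOP" "n' * F <= TOP" "n' * F * sv <= TOP" "Z + Z <= TOP" 
 "sv + 1 <= TOP" "(Z + Z) * (sv + 1) <= TOP" "n' * F * sv + (Z + Z) * (sv + 1) <= TOP" "M * 32 <= TOP" "M ^ J <= TOP"
 using vals[unfolded list.pred_inject simp_thms] apply -
 by (elim conjE, assumption)+

lemma tZ: "t <= Z"
proof -
 have "n' * Z <= D * Z" using nonis_le_D by (intro mult_le_mono1) (simp add: n'_def)
 then have "n' * Z div D <= D * Z div D" by (rule div_le_mono)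
 also have "... <= Z" by (cases "D = 0") auto
 finally show ?thesis by (simp add: t_def)
qed

sublocale ram n E adj Q N b q0 w F n B0' TOP
proof unfold_locales
 show "n + 3 * (F + 3) <= B0'" by (simp add: B0'_def)
 show "5 <= TOP" using vT(23) by linarith
qed (use ne TOPw vT(27,35) in auto)

lemma RSv: "RSv = RS"
 by (simp add: RSv_def RS_def NB_def ST_def)

lemma lt: "x <= TOP ==> x < 2 ^ w"
 using TOPw by simp

lemma par1_state:
 assumes "regs s 63 = lg"
 shows "regs (xx (c_par1 B c0) s) 65 = b" "regs (xx (c_par1 B c0) s) 66 = A" "regs (xx (c_par1 B c0) s) 74 = lg"
 "regs (xx (c_par1 B c0) s) 67 = 32" "mem (xx (c_par1 B c0) s) = mem s"
 "r \<notin> {65, 66, 67, 74} ==> regs (xx (c_par1 B c0) s) r = regs s r"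
proof -
 have "40 < (2::nat) ^ w" by (rule lt[OF vT(6)])
 then have 1: "32 mod 2 ^ w = (32::nat)" by simp
 have "B mod 2 ^ w = B" "c0 mod 2 ^ w = c0" "lg * B mod 2 ^ w = lg * B" "lg * c0 mod 2 ^ w = lg * c0" "lg mod 2 ^ w = lg"
 using vT(1,2,8,10,11) by (simp_all add: nowrap be A_def mult.commute)
 then show "regs (xx (c_par1 B c0) s) 65 = b" "regs (xx (c_par1 B c0) s) 66 = A" "regs (xx (c_par1 B c0) s) 74 = lg"
 "regs (xx (c_par1 B c0) s) 67 = 32"
 using assms 1 by (simp_all add: c_par1_def set_reg_def be A_def mult.commute)
qed (simp_all add: c_par1_def set_reg_def)

lemma par2_state:
 assumes "regs s 63 = lg"
 shows "regs (xx (c_par2 J) s) 74 = lg * J" "regs (xx (c_par2 J) s) 68 = 1" "mem (xx (c_par2 J) s) = mem s"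
 "r \<notin> {68, 74} ==> regs (xx (c_par2 J) s) r = regs s r"
proof -
 have "J mod 2 ^ w = J" "lg * J mod 2 ^ w = lg * J" using vT(3,12) by (simp_all add: nowrap)
 then show "regs (xx (c_par2 J) s) 74 = lg * J" "regs (xx (c_par2 J) s) 68 = 1"
 using assms w0 by (simp_all add: c_par2_def set_reg_def)
qed (simp_all add: c_par2_def set_reg_def)

lemma par3_state:
 assumes "regs s 0 = n" "regs s (Suc 0) = n'" "regs s 61 = D" "regs s 62 = \<Delta>" "regs s 64 = M" "regs s 65 = b" "regs s 66 = A"
 "regs s 67 = sv" "regs s 68 = hv"
 defines "s' \<equiv> xx (c_par3 e th) s"
 shows "regs s' 2 = Q" "regs s' 3 = N" "regs s' 69 = AS * th" "regs s' 4 = t" "regs s' 5 = F" "mem s' = mem s"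
 "r \<notin> {2, 3, 4, 5, 69, 75, 76, 77, 79} ==> regs s' r = regs s r"
proof -
 have M1: "1 <= M" using nM by simp
 define s1 where "s1 = set_reg 2 Q s"
 have q: "n * M ^ e = Q" by (simp add: Qn q0e)
 have n2: "n mod 2 ^ w = n" using vT(9) by (simp add: nowrap)
 have Q2w: "Q < 2 ^ w" by (rule lt[OF vT(15)])
 have 1: "xx (pow_com 2 64 e) (xx (Compute 2 Add (Reg 0) (Const 0)) s) = s1"
 using dex_pow[of 2 64 "set_reg 2 n s" e w n adj] assms(1,5) M1 n2 Q2w q by (simp add: set_reg_def s1_def)
 let ?c2 = "seqs [Compute 3 Mul (Reg 65) (Reg 2),
 Compute 75 Mul (Reg 67) (Reg 67),
 Compute 75 Mul (Reg 66) (Reg 75),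
 Compute 69 Mul (Reg 75) (Const th),
 Compute 76 Mul (Reg 62) (Reg 75),
 Compute 76 Add (Reg 76) (Reg 76),
 Compute 76 Div (Reg 76) (Reg 68),
 Compute 77 Mul (Reg 1) (Reg 76),
 Compute 4 Div (Reg 77) (Reg 61),
 Compute 79 Add (Reg 65) (Const 40),
 Compute 5 Add (Reg 76) (Const 0)]"
 define s2 where "s2 = xx ?c2 s1"
 have nw: "b * Q mod 2 ^ w = b * Q" "sv * sv mod 2 ^ w = sv * sv" "A * (sv * sv) mod 2 ^ w = A * (sv * sv)" "th mod 2 ^ w = th"
 "A * (sv * sv) * th mod 2 ^ w = A * (sv * sv) * th" "\<Delta> * (A * (sv * sv)) mod 2 ^ w = \<Delta> * (A * (sv * sv))"
 "(\<Delta> * (A * (sv * sv)) + \<Delta> * (A * (sv * sv))) mod 2 ^ w = \<Delta> * (A * (sv * sv)) + \<Delta> * (A * (sv * sv))"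
 "n' * Z mod 2 ^ w = n' * Z" "(b + 40) mod 2 ^ w = b + 40" "Z mod 2 ^ w = Z" "40 mod 2 ^ w = (40::nat)"
 using vT(4,6,16-24) by (simp_all add: nowrap AS_def[symmetric] NbQ[symmetric])
 have r1: "regs s1 0 = n" "regs s1 (Suc 0) = n'" "regs s1 61 = D" "regs s1 62 = \<Delta>" "regs s1 65 = b" "regs s1 66 = A"
 "regs s1 67 = sv" "regs s1 68 = hv" "regs s1 2 = Q" using assms by (auto simp: s1_def set_reg_def)
 have z: "(\<Delta> * (A * (sv * sv)) + \<Delta> * (A * (sv * sv))) div hv = Z" by (simp add: Z_def AS_def)
 have r2: "regs s2 3 = N" "regs s2 69 = AS * th" "regs s2 4 = t" "regs s2 79 = b + 40" "regs s2 5 = Z" "regs s2 2 = Q" "mem s2 = mem s"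
 using r1 nw z by (simp_all add: s2_def set_reg_def NbQ AS_def t_def s1_def)
 have r2': "r \<notin> {2, 3, 4, 5, 69, 75, 76, 77, 79} ==> regs s2 r = regs s r" for r
 by (simp add: s2_def set_reg_def s1_def)
 have F2w: "Z * (b + 40) ^ 7 < 2 ^ w" using lt[OF vT(25)] by (simp add: F_def)
 have "s' = xx (pow_com 5 79 7) s2"
 unfolding s'_def s2_def 1[symmetric] c_par3_def seqs.simps dex.simps by (rule refl)
 also have "... = set_reg 5 F s2" using dex_pow[of 5 79 s2 7 w n adj] r2 F2w by (simp add: F_def)
 finally have s': "s' = set_reg 5 F s2" .
 show "regs s' 2 = Q" "regs s' 3 = N" "regs s' 69 = AS * th" "regs s' 4 = t" "regs s' 5 = F" "mem s' = mem s"
 using r2 by (simp_all add: s' set_reg_def)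
 show "regs s' r = regs s r" if "r \<notin> {2, 3, 4, 5, 69, 75, 76, 77, 79}"
 using r2'[OF that] that by (simp add: s' set_reg_def)
qed

lemma par4_state:
 assumes "regs s 0 = n" "regs s 2 = Q" "regs s 3 = N" "regs s 5 = F" "regs s 63 = lg"
 defines "s' \<equiv> xx (c_par4 k) s"
 shows "regs s' 6 = n" "regs s' 8 = B0'" "regs s' 9 = NB" "regs s' 40 = ST" "regs s' 7 = RS" "regs s' 70 = K" "regs s' 12 = 0" "mem s' = mem s"
 "r \<notin> {6, 7, 8, 9, 12, 40, 70, 81} ==> regs s' r = regs s r"
proof -
 have nw: "n mod 2 ^ w = n" "(F + 3) mod 2 ^ w = F + 3" "(F + 3) * 3 mod 2 ^ w = (F + 3) * 3" "(n + (F + 3) * 3) mod 2 ^ w = n + (F + 3) * 3"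
 "(N + Q) mod 2 ^ w = N + Q" "Suc (N + Q) mod 2 ^ w = Suc (N + Q)" "(N + Q) * n mod 2 ^ w = (N + Q) * n" "Suc ((N + Q) * n) mod 2 ^ w = Suc ((N + Q) * n)"
 "n * Suc (N + Q) mod 2 ^ w = n * Suc (N + Q)" "n * Suc (N + Q) * Suc ((N + Q) * n) mod 2 ^ w = n * Suc (N + Q) * Suc ((N + Q) * n)"
 "(n + n * Suc (N + Q) * Suc ((N + Q) * n)) mod 2 ^ w = n + n * Suc (N + Q) * Suc ((N + Q) * n)"
 "(k + 2) mod 2 ^ w = k + 2" "lg * (k + 2) mod 2 ^ w = lg * (k + 2)" "Suc (Suc k) mod 2 ^ w = Suc (Suc k)" "lg * Suc (Suc k) mod 2 ^ w = lg * Suc (Suc k)"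
 using vT(5,8,9,25-33) by (simp_all add: nowrap H_def B0'_def RSv_def K_def del: mult_Suc mult_Suc_right)
 show "regs s' 6 = n" "regs s' 8 = B0'" "regs s' 9 = NB" "regs s' 40 = ST" "regs s' 7 = RS" "regs s' 70 = K" "regs s' 12 = 0"
 using assms(1-5) nw w0
 by (simp_all add: s'_def c_par4_def set_reg_def B0'_def NB_def ST_def RS_def H_def K_def del: mult_Suc mult_Suc_right)
 show "mem s' = mem s" by (simp add: s'_def c_par4_def set_reg_def)
 show "regs s' r = regs s r" if "r \<notin> {6, 7, 8, 9, 12, 40, 70, 81}"
 using that by (simp add: s'_def c_par4_def set_reg_def)
qed

definition ready :: "state => bool" where
 "ready s \<longleftrightarrow> prel s & (\<forall>x\<ge>regs s 8. mem s x = 0) & B0' <= regs s 8 & regs s 8 + RS * F * regs s 70 <= TOP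
 & regs s 4 = t & regs s 5 = F & regs s 61 = D & regs s 62 = \<Delta> & regs s 67 = sv & regs s 68 = hv
 & regs s 69 = AS * th & regs s 12 <= F"

definition fin :: "state => bool" where "fin s \<longleftrightarrow> regs s 10 + regs s 11 = 0"

definition attempt :: "state => state pmf" where
 "attempt s = map_pmf (xx c_fin) (trial F (xx c_init s))"

lemma init_state:
 assumes "ready s" "regs s 70 = Suc i"
 defines "s' \<equiv> xx c_init s"
 shows "prel s'" "regs s' 11 = t" "regs s' 12 = 0" "regs s' 10 = 0" "regs s' 15 = F"
 "regs s' 16 ~= 0 \<longleftrightarrow> F ~= 0 & t ~= 0" "\<forall>x\<ge>regs s' 8. mem s' x = 0" "B0' <= regs s' 8"
 "regs s' 8 + RS * F * (i + 1) <= TOP" "t + 5 <= TOP" "regs s' 70 = i"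
 "r \<notin> {10, 11, 12, 15, 16, 70, 82, 83} ==> regs s' r = regs s r"
proof -
 have nw: "t mod 2 ^ w = t" "F mod 2 ^ w = F" using vT(23,25) tZ by (simp_all add: nowrap)
 have R: "regs s 4 = t" "regs s 5 = F" using assms(1) by (auto simp: ready_def)
 have m: "mem s' = mem s" and r: "r \<notin> {10, 11, 12, 15, 16, 70, 82, 83} ==> regs s' r = regs s r" for r
 by (simp_all add: s'_def c_init_def set_reg_def)
 show "regs s' 11 = t" "regs s' 12 = 0" "regs s' 10 = 0" "regs s' 15 = F" "regs s' 16 ~= 0 \<longleftrightarrow> F ~= 0 & t ~= 0" "regs s' 70 = i"
 using R nw w0 assms(2) by (simp_all add: s'_def c_init_def set_reg_def)
 show "prel s'" using assms(1) r[of 0] r[of 1] r[of 2] r[of 3] r[of 6] r[of 7] r[of 9] r[of 40] m by (simp add: ready_def prel_def)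
 show "\<forall>x\<ge>regs s' 8. mem s' x = 0" "B0' <= regs s' 8" "regs s' 8 + RS * F * (i + 1) <= TOP"
 using assms(1,2) r[of 8] m by (simp_all add: ready_def)
 show "t + 5 <= TOP" using vT(23) tZ by simp
 show "regs s' r = regs s r" if "r \<notin> {10, 11, 12, 15, 16, 70, 82, 83}" using r that by blast
qed

lemma attempt_cmp:
 assumes "ready s" "regs s 70 = Suc i"
 shows "cmp w n adj c_try s (Suc (time c_init + Suc ((F * Suc body_time + 1) + Suc (time c_fin + 1)))) (attempt s)"
proof -
 have d: "deterministic c_init" "deterministic c_fin" "loopfree c_init" "loopfree c_fin"
 by (simp_all add: c_init_def c_fin_def)
 have c1: "cmp w n adj c_init s (time c_init) (return_pmf (xx c_init s))"
 using cmp_exec[OF d(3), of w n adj s] by (simp add: exec_dex[OF d(1)])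
 have c3: "cmp w n adj (Seq c_fin Skip) s' (Suc (time c_fin + 1)) (return_pmf (xx c_fin s'))" for s'
 proof -
 have "cmp w n adj (Seq c_fin Skip) s' (Suc (time c_fin + 1)) (bind_pmf (return_pmf (xx c_fin s')) return_pmf)"
 using cmp_exec[OF d(4), of w n adj s'] cmp_exec[of Skip w n adj]
 by (intro cmp_Seq) (simp_all add: exec_dex[OF d(2)])
 then show ?thesis by (simp add: bind_return_pmf)
 qed
 note ini = init_state[OF assms]
 have c2: "cmp w n adj (Seq (While (Reg 16) c_body) (Seq c_fin Skip)) (xx c_init s) (Suc ((F * Suc body_time + 1) + Suc (time c_fin + 1))) (attempt s)"
 unfolding attempt_def map_pmf_def
 by (rule cmp_Seq[OF trial_bounds(1)[OF ini(1-10)] c3])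
 have "cmp w n adj c_try s (Suc (time c_init + Suc ((F * Suc body_time + 1) + Suc (time c_fin + 1)))) (bind_pmf (return_pmf (xx c_init s)) (%_. attempt s))"
 unfolding c_try_def seqs.simps by (rule cmp_Seq[OF c1]) (use c2 in auto)
 then show ?thesis by (simp add: bind_return_pmf)
qed

lemma attempt_step:
 fixes \<beta> :: real and bad :: "nat => bool"
 assumes "ready s" "regs s 70 = Suc i"
 and half: "1 <= t ==> t * (\<eta> * (b + 37) + (b + 36) * Ibar / F) <= 1 / 2"
 and tl: "tail pm bad t 0 + t * (\<eta> * (b + 37)) <= \<beta>"
 shows "finite (set_pmf (attempt s))"
 "s' \<in> set_pmf (attempt s) ==> ready s' & (fin s' & regs s' 70 = 0 \<or> ~ fin s' & regs s' 70 = i)"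
 "PR (attempt s) {s'. ~ fin s'} <= 1 / 2"
 "PR (attempt s) {s'. fin s' & bad (regs s' 12)} <= \<beta>"
proof -
 note ini = init_state[OF assms(1,2)]
 note tb = trial_bounds[OF ini(1-10)]
 have fr: "r \<notin> {70, 82} ==> regs (xx c_fin s') r = regs s' r" "mem (xx c_fin s') = mem s'" for r s'
 by (simp_all add: c_fin_def set_reg_def)
 have ff: "fin (xx c_fin s') = fin s'" for s' by (simp add: fin_def fr)
 show "finite (set_pmf (attempt s))"
 unfolding attempt_def by (simp add: finite_loop finite_exec)
 show "ready s' & (fin s' & regs s' 70 = 0 \<or> ~ fin s' & regs s' 70 = i)" if at: "s' \<in> set_pmf (attempt s)"
 proof -
 obtain s1 where s1: "s1 \<in> set_pmf (trial F (xx c_init s))" "s' = xx c_fin s1" using at by (auto simp: attempt_def)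
 note T = tb(2)[OF s1(1)]
 have wb: "r \<notin> writes c_body" if "r \<in> {4, 5, 61, 62, 67, 68, 69, 70}" for r
 proof
 assume "r \<in> writes c_body"
 then have "r \<in> {8..54} - {9, 40}" using writes_body by blast
 then show False using that by auto
 qed
 have same: "regs s1 r = regs s r" if "r \<in> {4, 5, 61, 62, 67, 68, 69}" for r
 proof -
 have "regs s1 r = regs (xx c_init s) r" by (rule loop_writes[OF s1(1)]) (rule wb, use that in auto)
 also have "... = regs s r" by (rule ini(12)) (use that in auto)
 finally show ?thesis .
 qed
 have "regs s1 70 = regs (xx c_init s) 70" by (rule loop_writes[OF s1(1)]) (rule wb, simp)
 then have s70: "regs s1 70 = i" using ini(11) by simp
 have nw: "(regs s1 10 + regs s1 11) mod 2 ^ w = regs s1 10 + regs s1 11" using T by (intro nowrap) simp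
 have s70': "regs s' 70 = (if fin s1 then 0 else i)"
 using nw s70 w0 by (simp add: s1(2) c_fin_def set_reg_def fin_def)
 have T5: "regs s1 8 + RS * F * i <= TOP" using T by blast
 have "RS * F * regs s' 70 <= RS * F * i" unfolding s70' by simp
 then have cap: "regs s1 8 + RS * F * regs s' 70 <= TOP" using T5 by linarith
 have "regs s' r = regs s1 r" if "r \<notin> {70, 82}" for r using fr(1)[OF that] s1(2) by simp
 note f = this[of 0] this[of "Suc 0"] this[of 2] this[of 3] this[of 4] this[of 5] this[of 6] this[of 7] this[of 8] this[of 9] this[of 12]
 this[of 40] this[of 61] this[of 62] this[of 67] this[of 68] this[of 69]
 have me: "mem s' = mem s1" using fr(2) s1(2) by simp
 have "ready s'"
 using cap me T assms(1) same[of 4] same[of 5] same[of 61] same[of 62] same[of 67] same[of 68] same[of 69] f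
 by (simp add: ready_def prel_def)
 then show ?thesis using s70' ff[of s1] s1(2) by auto
 qed
 show "PR (attempt s) {s'. ~ fin s'} <= 1 / 2"
 proof -
 have e: "PR (attempt s) {s'. ~ fin s'} = PR (trial F (xx c_init s)) {s. regs s 10 + regs s 11 ~= 0}"
 by (simp add: attempt_def measure_map_pmf vimage_def ff) (simp add: fin_def)
 show ?thesis
 \<comment> \<open>With no samples to take the loop is not entered and the attempt counts as
   finished; Markov's bound enters from \<open>t = 1\<close> on.\<close>
 proof (cases "t = 0")
 case True
 then have "trial F (xx c_init s) = return_pmf (xx c_init s)" using ini(6) by (cases F) auto
 then show ?thesis unfolding e using ini(2,4) True by (simp add: measure_return_pmf)
 next
 case False
 then have "1 <= F" using tZ by (cases "Z = 0") (auto simp: F_def Suc_le_eq)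
 moreover have "1 <= t" using False by simp
 ultimately show ?thesis unfolding e by (intro order_trans[OF tb(4) half])
 qed
 qed
 have "PR (attempt s) {s'. fin s' & bad (regs s' 12)}
 = PR (trial F (xx c_init s)) {s. regs s 10 + regs s 11 = 0 & bad (regs s 12)}"
 by (simp add: attempt_def measure_map_pmf vimage_def ff fr) (simp add: fin_def)
 also note tb(3)
 also note tl
 finally show "PR (attempt s) {s'. fin s' & bad (regs s' 12)} <= \<beta>" .
qed

lemma out_state:
 assumes "ready s"
 shows "regs (xx c_out s) 0 = mout \<Delta> t sv (AS * th) hv (regs s 12)" "regs (xx c_out s) (Suc 0) = cout \<Delta> t sv (AS * th) hv (regs s 12)"
proof -
 define x where "x = regs s 12"
 have R: "regs s (Suc 0) = n'" "regs s 4 = t" "regs s 61 = D" "regs s 62 = \<Delta>" "regs s 67 = sv" "regs s 68 = hv" "regs s 69 = AS * th" "x <= F"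
 using assms by (auto simp: ready_def prel_def x_def n'_def)
 have p1: "n' * x <= n' * F" using R(8) by simp
 then have p2: "n' * x * sv <= n' * F * sv" by simp
 have p3: "(t + t) * (sv + 1) <= (Z + Z) * (sv + 1)" using tZ by (intro mult_le_mono1) simp
 have p4: "t * (sv - 1) <= (t + t) * (sv + 1)" by (intro mult_le_mono) auto
 have nw: "\<Delta> * 4 mod 2 ^ w = \<Delta> * 4" "(D + \<Delta> * 4) mod 2 ^ w = D + \<Delta> * 4" "(D + D) mod 2 ^ w = D + D" "(D + D) * hv mod 2 ^ w = (D + D) * hv"
 "n' * x mod 2 ^ w = n' * x" "n' * x * sv mod 2 ^ w = n' * x * sv" "(t + t) mod 2 ^ w = t + t" "Suc sv mod 2 ^ w = Suc sv"
 "(t + t) * Suc sv mod 2 ^ w = (t + t) * Suc sv" "(n' * x * sv + (t + t) * Suc sv) mod 2 ^ w = n' * x * sv + (t + t) * Suc sv"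
 "t * (sv - Suc 0) mod 2 ^ w = t * (sv - Suc 0)"
 proof -
 note * = vT(36-43,45)
 show "\<Delta> * 4 mod 2 ^ w = \<Delta> * 4" "(D + \<Delta> * 4) mod 2 ^ w = D + \<Delta> * 4" "(D + D) mod 2 ^ w = D + D" "(D + D) * hv mod 2 ^ w = (D + D) * hv"
 by (rule nowrap[OF *(1)] nowrap[OF *(2)] nowrap[OF *(3)] nowrap[OF *(4)])+
 show "n' * x mod 2 ^ w = n' * x" "n' * x * sv mod 2 ^ w = n' * x * sv" by (rule nowrap, rule le_trans[OF p1 *(5)], rule nowrap, rule le_trans[OF p2 *(6)])
 have "t + t <= TOP" using *(7) tZ by linarith
 then show "(t + t) mod 2 ^ w = t + t" by (rule nowrap)
 show "Suc sv mod 2 ^ w = Suc sv" using *(8) by (intro nowrap) simp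
 have f: "(t + t) * (sv + 1) <= TOP" "n' * x * sv + (t + t) * (sv + 1) <= TOP" "t * (sv - 1) <= TOP" using p2 p3 p4 *(9) by linarith+
 have q: "sv + 1 = Suc sv" "sv - 1 = sv - Suc 0" by simp_all
 show "(t + t) * Suc sv mod 2 ^ w = (t + t) * Suc sv" "(n' * x * sv + (t + t) * Suc sv) mod 2 ^ w = n' * x * sv + (t + t) * Suc sv"
 "t * (sv - Suc 0) mod 2 ^ w = t * (sv - Suc 0)"
 by (rule nowrap[OF f(1)[unfolded q]] nowrap[OF f(2)[unfolded q]] nowrap[OF f(3)[unfolded q]])+
 qed
 have d: "D + D = 2 * D" "t + t = 2 * t" by simp_all
 show "regs (xx c_out s) 0 = mout \<Delta> t sv (AS * th) hv (regs s 12)" "regs (xx c_out s) (Suc 0) = cout \<Delta> t sv (AS * th) hv (regs s 12)"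
 using R nw w0 unfolding x_def mout_def cout_def n'_def[symmetric] d[symmetric] Suc_eq_plus1[symmetric] mult.commute[of 4]
 by (simp_all add: c_out_def set_reg_def del: mult_Suc mult_Suc_right)
qed

definition try_time :: nat where
 "try_time = Suc (time c_init + Suc ((F * Suc body_time + 1) + Suc (time c_fin + 1)))"

lemma run_attempts:
 fixes \<epsilon> \<beta> :: real
 assumes s: "ready s" "regs s 70 = K"
 and half: "1 <= t ==> t * (\<eta> * (b + 37) + (b + 36) * Ibar / F) <= 1 / 2"
 and tl: "tail pm (%x. ~ valid \<epsilon> \<Delta> t sv (AS * th) hv x) t 0 + t * (\<eta> * (b + 37)) <= \<beta>" and \<beta>: "0 <= \<beta>"
 shows "\<exists>D'. cmp w n adj (seqs [While (Reg 70) c_try, c_out]) s (Suc ((K * Suc try_time + 1) + Suc (time c_out + 1))) D'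
 & 1 - ((1 / 2) ^ K + K * \<beta>) <= PR D' {s. matching_approx (2 + \<epsilon>) E (real (regs s 0)) & vertex_cover_approx (2 + \<epsilon>) n E (real (regs s 1))}"
proof -
 let ?P = "%s. regs s 70 ~= 0"
 define W where "W = loop ?P attempt K s"
 have suc: "\<exists>i. regs s 70 = Suc i" if "?P s" for s using that by (cases "regs s 70") auto
 have w1: "cmp w n adj (While (Reg 70) c_try) s (K * Suc try_time + 1) W"
 unfolding W_def
 proof (rule cmp_While[where I = ready and V = "%s. regs s 70"])
 show "cmp w n adj c_try s try_time (attempt s)" if r: "ready s" "regs s 70 ~= 0" for s
 proof -
 obtain i where "regs s 70 = Suc i" using suc[OF r(2)] by blast
 then show ?thesis unfolding try_time_def using attempt_cmp r(1) by blast
 qed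
 show "ready s' & regs s' 70 < regs s 70" if r: "ready s" "regs s 70 ~= 0" "s' \<in> set_pmf (attempt s)" for s s'
 proof -
 obtain i where i: "regs s 70 = Suc i" using suc[OF r(2)] by blast
 show ?thesis using attempt_step(2)[OF r(1) i half tl r(3)] i by auto
 qed
 qed (use s in auto)
 have d: "deterministic c_out" "loopfree c_out" by (simp_all add: c_out_def)
 have w2: "cmp w n adj (Seq c_out Skip) s' (Suc (time c_out + 1)) (return_pmf (xx c_out s'))" for s'
 proof -
 have "cmp w n adj (Seq c_out Skip) s' (Suc (time c_out + 1)) (bind_pmf (return_pmf (xx c_out s')) return_pmf)"
 using cmp_exec[OF d(2), of w n adj s'] cmp_exec[of Skip w n adj]
 by (intro cmp_Seq) (simp_all add: exec_dex[OF d(1)])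
 then show ?thesis by (simp add: bind_return_pmf)
 qed
 have c: "cmp w n adj (seqs [While (Reg 70) c_try, c_out]) s (Suc ((K * Suc try_time + 1) + Suc (time c_out + 1))) (map_pmf (xx c_out) W)"
 unfolding seqs.simps map_pmf_def by (rule cmp_Seq[OF w1 w2])
 have inv: "ready s'" if "s' \<in> set_pmf W" for s'
 proof (rule loop_inv[where I = ready, OF _ s(1) that[unfolded W_def]])
 fix s s' assume r: "ready s" "regs s 70 ~= 0" "s' \<in> set_pmf (attempt s)"
 obtain i where i: "regs s 70 = Suc i" using suc[OF r(2)] by blast
 show "ready s'" using attempt_step(2)[OF r(1) i half tl r(3)] by blast
 qed
 let ?bad = "%s. ~ valid \<epsilon> \<Delta> t sv (AS * th) hv (regs s 12)"
 have "PR W {s'. ~ (fin s' & ~ ?bad s')} <= (1 / 2) ^ K + K * \<beta>"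
 unfolding W_def
 by (rule conjunct2, rule prob_retry[where J = ready]) (use attempt_step[OF _ _ half tl] s \<beta> in auto)
 moreover have "1 - PR W {s'. ~ (fin s' & ~ ?bad s')} = PR W (- {s'. ~ (fin s' & ~ ?bad s')})"
 using measure_pmf.prob_compl[of "{s'. ~ (fin s' & ~ ?bad s')}" W] by (simp add: Compl_eq_Diff_UNIV)
 moreover have "PR W (- {s'. ~ (fin s' & ~ ?bad s')})
 <= PR (map_pmf (xx c_out) W) {s. matching_approx (2 + \<epsilon>) E (real (regs s 0)) & vertex_cover_approx (2 + \<epsilon>) n E (real (regs s 1))}"
 unfolding measure_map_pmf
 proof (rule measure_pmf.finite_measure_mono_AE)
 show "AE s in measure_pmf W. s \<in> - {s'. ~ (fin s' & ~ ?bad s')} --> s \<in> xx c_out -`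
 {s. matching_approx (2 + \<epsilon>) E (real (regs s 0)) & vertex_cover_approx (2 + \<epsilon>) n E (real (regs s 1))}"
 using out_state[OF inv] by (simp add: AE_measure_pmf_iff valid_def)
 qed simp
 ultimately show ?thesis using c by (intro exI[of _ "map_pmf (xx c_out) W"]) linarith
qed

end


section \<open>Polynomial bounds\<close>

text \<open>An instance as the bounds see it. One multiple of \<open>log n\<close> must suffice as
  word length for all \<epsilon>, so every value has to be bounded by a fixed power of
  \<open>xM\<close>; \<epsilon> enters through \<open>xs\<close> and \<open>xh\<close>, which are
  capped.\<close>

record inst =
 xn :: nat
 xlg :: nat
 xM :: nat
 xd :: nat
 xD :: nat
 xp :: nat
 xs :: nat
 xh :: nat

definition insts :: "nat => inst set" where
 "insts J = {i. 2 <= xM i & xn i <= xM i & xlg i <= xM i & xd i <= xM i & xD i <= xM i * xM i & xp i <= xM i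
 & xs i <= 32 * xM i & xh i <= xM i ^ J}"

definition pbd :: "nat => (inst => nat) => bool" where
 "pbd J f \<longleftrightarrow> (\<exists>e. \<forall>i\<in>insts J. f i <= xM i ^ e)"

lemma pbdI: "(!!i. i \<in> insts J ==> f i <= xM i ^ e) ==> pbd J f"
 unfolding pbd_def by blast

lemma pbd_const: "pbd J (%i. c)"
proof (rule pbdI[where e = c])
 fix i assume "i \<in> insts J"
 then have "2 ^ c <= xM i ^ c" by (intro power_mono) (auto simp: insts_def)
 moreover have "c < 2 ^ c" by (rule less_exp)
 ultimately show "c <= xM i ^ c" by linarith
qed

lemma pbd_add: "pbd J f ==> pbd J g ==> pbd J (%i. f i + g i)"
proof -
 assume "pbd J f" "pbd J g"
 then obtain a b where a: "!!i. i \<in> insts J ==> f i <= xM i ^ a" and b: "!!i. i \<in> insts J ==> g i <= xM i ^ b"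
 unfolding pbd_def by blast
 show ?thesis
 proof (rule pbdI[where e = "a + b + 1"])
 fix i assume i: "i \<in> insts J"
 then have M: "2 <= xM i" by (simp add: insts_def)
 then have "xM i ^ a <= xM i ^ (a + b)" "xM i ^ b <= xM i ^ (a + b)" by (auto intro!: power_increasing)
 moreover have "2 * xM i ^ (a + b) <= xM i * xM i ^ (a + b)" using M by (rule mult_le_mono1)
 moreover have "xM i ^ (a + b + 1) = xM i * xM i ^ (a + b)" by simp
 ultimately show "f i + g i <= xM i ^ (a + b + 1)" using a[OF i] b[OF i] by linarith
 qed
qed

lemma pbd_mult: "pbd J f ==> pbd J g ==> pbd J (%i. f i * g i)"
proof -
 assume "pbd J f" "pbd J g"
 then obtain a b where a: "!!i. i \<in> insts J ==> f i <= xM i ^ a" and b: "!!i. i \<in> insts J ==> g i <= xM i ^ b"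
 unfolding pbd_def by blast
 show ?thesis
 by (rule pbdI[where e = "a + b"]) (use a b in \<open>auto simp: power_add intro: mult_le_mono\<close>)
qed

lemma pbd_power: "pbd J f ==> pbd J (%i. f i ^ c)"
 by (induction c) (auto intro: pbd_const[where c = 1, simplified] pbd_mult)

lemma pbd_le: "pbd J f ==> (!!i. i \<in> insts J ==> g i <= f i) ==> pbd J g"
 unfolding pbd_def by (meson le_trans)

lemma pbd_div: "pbd J f ==> pbd J (%i. f i div g i)"
 by (erule pbd_le) simp

lemma pbd_base: "pbd J xn" "pbd J xlg" "pbd J xM" "pbd J xd" "pbd J xD" "pbd J xp" "pbd J xs" "pbd J xh"
proof -
 show M: "pbd J xM" by (rule pbdI[where e = 1]) simp
 show "pbd J xn" "pbd J xlg" "pbd J xd" "pbd J xp" by (rule pbd_le[OF M], simp add: insts_def)+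
 show "pbd J xD" by (rule pbd_le[OF pbd_mult[OF M M]]) (simp add: insts_def)
 show "pbd J xs" by (rule pbd_le[OF pbd_mult[OF pbd_const[where c = 32] M]]) (simp add: insts_def)
 show "pbd J xh" by (rule pbdI[where e = J]) (simp add: insts_def)
qed

lemmas pbd_intros = pbd_const pbd_base pbd_add pbd_mult pbd_power pbd_div

lemma pbd_tvals:
 assumes "pbd J b" "pbd J A" "pbd J Q" "pbd J Z" "pbd J F"
 shows "pbd J (%i. sum_list (tvals B c0 J' th k (xn i) (xlg i) (xd i) (xD i) (xp i) (xs i) (xh i) (xM i) (b i) (A i) (Q i) (Z i) (F i)))"
 unfolding tvals_def Let_def sum_list.Cons sum_list.Nil by (intro pbd_intros assms)

definition Zf :: "nat => inst => nat" where
 "Zf c0 i = (xd i * (xlg i * c0 * (xs i * xs i)) + xd i * (xlg i * c0 * (xs i * xs i))) div xh i"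

definition topf :: "nat => nat => nat => nat => nat => nat => inst => nat" where
 "topf B c0 J e th k i = sum_list (tvals B c0 J th k (xn i) (xlg i) (xd i) (xD i) (xp i) (xs i) (xh i) (xM i)
 (B * xlg i) (xlg i * c0) (xn i * xM i ^ e) (Zf c0 i) (Zf c0 i * (B * xlg i + 40) ^ 7))"

lemma pbd_topf: "pbd J (topf B c0 J e th k)"
 unfolding topf_def Zf_def by (intro pbd_tvals pbd_intros)

text \<open>Collects the factors against which \<open>\<eta> * (b + 37)\<close> has to be small in
  the final estimate; its degree \<open>g\<close> fixes the exponents \<open>e\<close> and
  \<open>B\<close>.\<close>

definition slack :: "nat => nat => inst => nat" where
 "slack c0 k i = xlg i * (k + 2) * (xd i * (xlg i * c0 * (xs i * xs i)) + xd i * (xlg i * c0 * (xs i * xs i))) * xM i ^ (k + 1)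
 + 4 * (xd i * (xlg i * c0 * (xs i * xs i)) + xd i * (xlg i * c0 * (xs i * xs i))) + 4 * xs i"

lemma pbd_slack: "pbd J (slack c0 k)"
 unfolding slack_def by (intro pbd_intros)

context rgraph
begin

lemma finite_dirs': "finite dirs" by (rule finite_dirs)

lemma D_le: "D <= n * n"
proof -
 have "dirs \<subseteq> {..<n} \<times> {..<n}" using edgeD by (auto simp: dirs_def)
 then have "card dirs <= card ({..<n} \<times> {..<n})" by (intro card_mono) auto
 then show ?thesis by (simp add: card_dirs)
qed

lemma card_E_le: "card E <= n * n"
proof -
 have "E \<subseteq> (%(a, b). {a, b}) ` dirs"
 proof
 fix e assume e: "e \<in> E"
 then obtain u w where "e = {u, w}" by (rule edgeE)
 then show "e \<in> (%(a, b). {a, b}) ` dirs" using e by (auto simp: dirs_def)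
 qed
 then have "card E <= card ((%(a, b). {a, b}) ` dirs)" by (intro card_mono finite_imageI finite_dirs)
 also have "... <= card dirs" by (rule card_image_le[OF finite_dirs])
 finally show ?thesis using D_le by (simp add: card_dirs)
qed

end

text \<open>Measured in powers of \<open>M\<close>, the tie term is at most
  \<open>M ^ (j + 5) / M ^ e\<close>, and the other failures are damped by
  \<open>exp (- b) <= 1 / M ^ B\<close>. So \<open>e\<close> comes first, and \<open>B\<close> has
  to beat it because the number of ticks contains \<open>Q\<close>, which may be as large as
  \<open>M ^ (e + 1)\<close>.\<close>

lemma (in rgraph_par) eta_small:
 assumes M: "M = 2 ^ lg" "n < M" "1 <= lg" and b: "b = B * lg" and q: "q0 = M ^ e"
 and j: "j = g + 8" and e: "e = 2 * j + g + 7" and B: "B = 2 * j + e + g + 7"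
 shows "\<eta> * (b + 37) * M ^ g <= 1"
proof -
 define m where "m = real M"
 have M2: "2 <= M" using M(1,3) by (cases lg) auto
 have m2: "2 <= m" using M2 by (simp add: m_def)
 have m0: "0 < m" "1 <= m" using m2 by auto
 \<comment> \<open>\<open>b + 37\<close> contains \<open>B\<close>, which in turn grows with
   \<open>j\<close>. This is no vicious circle since \<open>B + 38\<close> is linear in
   \<open>g\<close> while \<open>2 ^ j = 256 * 2 ^ g\<close>.\<close>
 have gy: "6 * g + 84 <= 256 * y" if "g < y" for y :: nat using that by linarith
 have "B + 38 = 6 * g + 84" "(2::nat) ^ j = 256 * 2 ^ g" by (simp_all add: B e j power_add)
 then have jB: "B + 38 <= 2 ^ j" using gy[OF less_exp] by (simp only:)
 have lM: "lg <= M" using less_exp[of lg] M(1) by simp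
 have "(B + 38) * lg <= 2 ^ j * M" using jB lM by (rule mult_le_mono)
 also have "... <= M ^ j * M" using M2 by (intro mult_le_mono1 power_mono) auto
 also have "(B + 38) * lg = b + 38 * lg" unfolding b distrib_right ..
 finally have "b + 38 * lg <= M ^ (j + 1)" by (simp add: mult.commute)
 then have b37: "b + 37 <= M ^ (j + 1)" "b + 1 <= M ^ (j + 1)" using M(3) by linarith+
 have b37r: "real b + 37 <= m ^ (j + 1)" "real b + 1 <= m ^ (j + 1)"
 using b37[folded of_nat_le_iff[where 'a = real]] by (simp_all add: m_def)
 have Q0: "0 < real Q" using Q2 by simp
 have "1 * M ^ e <= Q" unfolding Qn q using n1 by (rule mult_le_mono1)
 then have Qm: "m ^ e <= Q" unfolding m_def by (metis mult_1 of_nat_le_iff of_nat_power)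
 have "Q <= M * M ^ e" unfolding Qn q using M(2) by (intro mult_le_mono1) simp
 then have Qu: "Q <= m ^ (e + 1)" unfolding m_def by (metis Suc_eq_plus1 of_nat_le_iff of_nat_power power_Suc)
 have "card E <= M * M" using card_E_le M(2) mult_le_mono[of n M n M] by simp
 then have "card E <= m\<^sup>2" unfolding m_def by (metis of_nat_le_iff of_nat_mult power2_eq_square)
 then have "(real (card E))\<^sup>2 <= (m\<^sup>2)\<^sup>2" by (intro power_mono) auto
 then have cE: "(real (card E))\<^sup>2 <= m ^ 4" by simp
 have "H = (b + 1) * Q" unfolding H_def by (simp add: NbQ)
 then have "real H = real ((b + 1) * Q)" by (rule arg_cong)
 then have Hr: "real H = (real b + 1) * real Q" by (simp add: algebra_simps)
 have f1: "real H * (real (card E))\<^sup>2 / (real Q)\<^sup>2 = (real b + 1) * (real (card E))\<^sup>2 / Q"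
 unfolding Hr using Q0 by (simp add: power2_eq_square)
 have f2: "(real b + 1) * (real (card E))\<^sup>2 / Q <= m ^ (j + 1) * m ^ 4 / m ^ e"
 using b37r cE Qm m0 by (intro frac_le mult_mono) auto
 have g1: "real n * (2 * real N + 4 * real b + 4) <= m * (m\<^sup>2 * m ^ (j + 1) * m ^ (e + 1))"
 proof (rule mult_mono)
 show "real n <= m" using M(2) by (simp add: m_def)
 have "2 * real N + 4 * real b + 4 <= 4 * ((real b + 1) * Q)"
 proof -
 have "(real b + 1) * 2 <= (real b + 1) * Q" using Q2 by (intro mult_left_mono) auto
 moreover have "0 <= real Q" by simp
 ultimately show ?thesis by (simp add: NbQ algebra_simps)
 qed
 also have "... <= m\<^sup>2 * (m ^ (j + 1) * m ^ (e + 1))"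
 using b37r Qu m2 m0 power_mono[of 2 m 2] by (intro mult_mono) auto
 finally show "2 * real N + 4 * real b + 4 <= m\<^sup>2 * m ^ (j + 1) * m ^ (e + 1)" by (simp add: mult.assoc)
 qed (use m0 in auto)
 have ex: "exp (- real b) <= 1 / m ^ B"
 proof -
 have "(2::real) <= exp 1" using exp_ge_add_one_self[of 1] by simp
 then have "2 ^ b <= exp (1::real) ^ b" by (intro power_mono) auto
 also have "... = exp (real b)" by (simp add: exp_of_nat_mult[symmetric])
 also have "(2::real) ^ b = m ^ B" by (simp add: m_def M(1) b power_mult[symmetric] mult.commute)
 finally show ?thesis using m0 by (simp add: exp_minus divide_simps)
 qed
 have g2: "real n * (2 * real N + 4 * real b + 4) * exp (- real b) <= m * (m\<^sup>2 * m ^ (j + 1) * m ^ (e + 1)) * (1 / m ^ B)"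
 by (rule mult_mono[OF g1 ex]) (use m0 in auto)
 have eta: "\<eta> <= m ^ (j + 1) * m ^ 4 / m ^ e + m * (m\<^sup>2 * m ^ (j + 1) * m ^ (e + 1)) * (1 / m ^ B)"
 proof -
 have r: "real (2 * N + 4 * b + 4) = 2 * real N + 4 * real b + 4" by simp
 show ?thesis unfolding \<eta>_def r using add_mono[OF f2[folded f1] g2] by (simp only:)
 qed
 have X: "0 <= (real b + 37) * m ^ g" "(real b + 37) * m ^ g <= m ^ (j + 1) * m ^ g"
 using b37r m0 by (auto intro: mult_right_mono)
 have gen: "(x / y + z * (1 / u)) * v = x * v / y + z * v / u" for x y z u v :: real by (simp add: distrib_right)
 have gen2: "m ^ x / m ^ Suc x = 1 / m" for x using m0 by simp
 have "\<eta> * ((real b + 37) * m ^ g) <= (m ^ (j + 1) * m ^ 4 / m ^ e + m * (m\<^sup>2 * m ^ (j + 1) * m ^ (e + 1)) * (1 / m ^ B)) * (m ^ (j + 1) * m ^ g)"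
 by (rule mult_mono[OF eta X(2) _ X(1)]) (use m0 in auto)
 also have "... = m ^ (j + 1) * m ^ 4 * (m ^ (j + 1) * m ^ g) / m ^ e + m * (m\<^sup>2 * m ^ (j + 1) * m ^ (e + 1)) * (m ^ (j + 1) * m ^ g) / m ^ B"
 by (rule gen)
 also have "m ^ (j + 1) * m ^ 4 * (m ^ (j + 1) * m ^ g) = m ^ (2 * j + g + 6)"
 by (simp add: power_add mult_2 eval_nat_numeral mult_ac)
 also have "m * (m\<^sup>2 * m ^ (j + 1) * m ^ (e + 1)) * (m ^ (j + 1) * m ^ g) = m ^ (2 * j + e + g + 6)"
 by (simp add: power_add mult_2 eval_nat_numeral mult_ac)
 also have "m ^ (2 * j + g + 6) / m ^ e = 1 / m"
 proof -
 have "e = Suc (2 * j + g + 6)" by (simp add: e)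
 then show ?thesis by (simp only: gen2)
 qed
 also have "m ^ (2 * j + e + g + 6) / m ^ B = 1 / m"
 proof -
 have "B = Suc (2 * j + e + g + 6)" by (simp add: B)
 then show ?thesis by (simp only: gen2)
 qed
 also have "1 / m + 1 / m <= 1" using m2 m0 by (simp add: field_simps)
 finally show ?thesis by (simp add: m_def mult.assoc add.commute)
qed

section \<open>Correctness of the algorithm\<close>

definition c_setup :: "nat => nat => nat => nat => nat => nat => nat => nat => com" where
 "c_setup B c0 J e th k a1 a2 = Seq (Compute 60 Add (Reg 0) (Const 0)) (Seq (Compute 64 Add (Const 1) (Const 0))
 (Seq (While (Reg 60) c_lg) (Seq (c_par1 B c0) (Seq (nest 74 67 a1) (Seq (c_par2 J) (Seq (nest 74 68 a2)
 (Seq (c_par3 e th) (c_par4 k))))))))"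

definition setup_time :: "nat => nat => nat => nat => nat => nat => nat => nat => nat" where
 "setup_time B c0 J e th k n lg = Suc (1 + Suc (1 + Suc ((n * Suc (time c_lg) + 1) + Suc (time (c_par1 B c0) + Suc ((8 * lg + 2)
 + Suc (time (c_par2 J) + Suc ((8 * (lg * J) + 2) + Suc (time (c_par3 e th) + time (c_par4 k)))))))))"

lemma pow2_unique:
 assumes "n < 2 ^ x" "2 ^ x <= 2 * n" "n < 2 ^ y" "2 ^ y <= 2 * (n::nat)"
 shows "x = y"
proof -
 have "x <= y" if "n < 2 ^ y" "2 ^ x <= 2 * n" for x y :: nat
 proof -
 have "(2::nat) ^ x < 2 ^ Suc y" using that by simp
 then have "x < Suc y" by (rule power_less_imp_less_exp[rotated]) simp
 then show ?thesis by simp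
 qed
 from this[OF assms(3,2)] this[OF assms(1,4)] show ?thesis by simp
qed

context algo_w
begin

lemma setup_state:
 assumes s: "regs s 0 = n" "regs s (Suc 0) = n'" "regs s 61 = D" "regs s 62 = \<Delta>" "regs s 63 = 0"
 "\<forall>i<length VL. mem s i = VL ! i" "\<forall>x\<ge>n. mem s x = 0"
 and M2n: "M <= 2 * n" and w2n: "2 * n < 2 ^ w"
 shows "det w n adj (c_setup B c0 J e th k a1 a2) s (setup_time B c0 J e th k n lg) (%s. ready s & regs s 70 = K)"
proof -
 define com where "com s' \<longleftrightarrow> regs s' 0 = n & regs s' (Suc 0) = n' & regs s' 61 = D & regs s' 62 = \<Delta> & mem s' = mem s" for s' :: state
 define q where "q s' \<longleftrightarrow> com s' & regs s' 63 = lg & regs s' 64 = M" for s' :: state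
 have n1': "1 <= n" by (rule n1)
 have nT: "n < 2 ^ w" by (rule lt[OF vT(9)])
 have w2: "2 < (2::nat) ^ w" using lt[OF vT(6)] by simp
 have c1: "det w n adj (Compute 60 Add (Reg 0) (Const 0)) s 1 (%s'. com s' & regs s' 60 = n & regs s' 63 = 0)"
 using det_dex[of "Compute 60 Add (Reg 0) (Const 0)" "%s'. com s' & regs s' 60 = n & regs s' 63 = 0" w n adj s] s nT
 by (simp add: com_def set_reg_def)
 have c2: "det w n adj (Compute 64 Add (Const 1) (Const 0)) s' 1 (%s'. com s' & regs s' 60 = n & regs s' 63 = 0 & regs s' 64 = 1)"
 if "com s' & regs s' 60 = n & regs s' 63 = 0" for s'
 using det_dex[of "Compute 64 Add (Const 1) (Const 0)" "%s'. com s' & regs s' 60 = n & regs s' 63 = 0 & regs s' 64 = 1" w n adj s'] that w0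
 by (simp add: com_def set_reg_def)
 have c3: "det w n adj (While (Reg 60) c_lg) s' (n * Suc (time c_lg) + 1) q"
 if a: "com s' & regs s' 60 = n & regs s' 63 = 0 & regs s' 64 = 1" for s'
 proof -
 have a': "regs s' 60 = n" "regs s' 63 = 0" "regs s' 64 = 1" using a by auto
 show ?thesis
 proof (rule det_mono[OF lg_loop[OF w2n w2 n1' a']])
 fix x :: state assume x: "regs x 64 = 2 ^ regs x 63 & n < 2 ^ regs x 63 & 2 ^ regs x 63 <= 2 * n & mem x = mem s' &
 (\<forall>r. r \<notin> {60, 63, 64} --> regs x r = regs s' r)"
 then have "regs x 63 = lg" using pow2_unique[of n "regs x 63" lg] nM M2n Meq by simp
 then show "q x" using x a Meq by (auto simp: q_def com_def)
 qed simp
 qed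
 have c4: "det w n adj (c_par1 B c0) s' (time (c_par1 B c0)) (%s'. q s' & regs s' 65 = b & regs s' 66 = A & regs s' 74 = lg & regs s' 67 = 32)"
 if "q s'" for s'
 proof (rule det_dex)
 have l: "regs s' 63 = lg" using that by (simp add: q_def)
 note p = par1_state[OF l]
 show "q (xx (c_par1 B c0) s') & regs (xx (c_par1 B c0) s') 65 = b & regs (xx (c_par1 B c0) s') 66 = A &
 regs (xx (c_par1 B c0) s') 74 = lg & regs (xx (c_par1 B c0) s') 67 = 32"
 using p(1-5) p(6)[of 0] p(6)[of "Suc 0"] p(6)[of 61] p(6)[of 62] p(6)[of 63] p(6)[of 64] that by (simp add: q_def com_def)
 qed (simp_all add: c_par1_def)
 have c5: "det w n adj (nest 74 67 a1) s' (8 * lg + 2) (%s'. q s' & regs s' 65 = b & regs s' 66 = A & regs s' 67 = sv)"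
 if a: "q s' & regs s' 65 = b & regs s' 66 = A & regs s' 74 = lg & regs s' 67 = 32" for s'
 proof -
 have "M * 32 < 2 ^ w" by (rule lt[OF vT(46)])
 then have "regs s' 67 * 2 ^ regs s' 74 < 2 ^ w" using a Meq by (simp add: mult.commute)
 from det_mono[OF nest_det[where rx = 74 and ry = 67 and a = a1, OF _ w0 this, simplified] _, of "8 * lg + 2"
 "%s'. q s' & regs s' 65 = b & regs s' 66 = A & regs s' 67 = sv"]
 show ?thesis using a by (auto simp: q_def com_def sv_def)
 qed
 have c6: "det w n adj (c_par2 J) s' (time (c_par2 J)) (%s'. q s' & regs s' 65 = b & regs s' 66 = A & regs s' 67 = sv & regs s' 74 = lg * J & regs s' 68 = 1)"
 if "q s' & regs s' 65 = b & regs s' 66 = A & regs s' 67 = sv" for s'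
 proof (rule det_dex)
 have l: "regs s' 63 = lg" using that by (simp add: q_def)
 note p = par2_state[OF l]
 show "q (xx (c_par2 J) s') & regs (xx (c_par2 J) s') 65 = b & regs (xx (c_par2 J) s') 66 = A & regs (xx (c_par2 J) s') 67 = sv &
 regs (xx (c_par2 J) s') 74 = lg * J & regs (xx (c_par2 J) s') 68 = 1"
 using p(1-3) p(4)[of 0] p(4)[of "Suc 0"] p(4)[of 61] p(4)[of 62] p(4)[of 63] p(4)[of 64] p(4)[of 65] p(4)[of 66] p(4)[of 67] that
 by (simp add: q_def com_def)
 qed (simp_all add: c_par2_def)
 have c7: "det w n adj (nest 74 68 a2) s' (8 * (lg * J) + 2) (%s'. q s' & regs s' 65 = b & regs s' 66 = A & regs s' 67 = sv & regs s' 68 = hv)"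
 if a: "q s' & regs s' 65 = b & regs s' 66 = A & regs s' 67 = sv & regs s' 74 = lg * J & regs s' 68 = 1" for s'
 proof -
 have "M ^ J < 2 ^ w" by (rule lt[OF vT(47)])
 then have "regs s' 68 * 2 ^ regs s' 74 < 2 ^ w" using a Meq by (simp add: power_mult)
 from det_mono[OF nest_det[where rx = 74 and ry = 68 and a = a2, OF _ w0 this, simplified] _, of "8 * (lg * J) + 2"
 "%s'. q s' & regs s' 65 = b & regs s' 66 = A & regs s' 67 = sv & regs s' 68 = hv"]
 show ?thesis using a by (auto simp: q_def com_def hv_def)
 qed
 have c8: "det w n adj (c_par3 e th) s' (time (c_par3 e th)) (%s'. com s' & regs s' 63 = lg & regs s' 2 = Q & regs s' 3 = N & regs s' 69 = AS * th
 & regs s' 4 = t & regs s' 5 = F & regs s' 67 = sv & regs s' 68 = hv)"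
 if a: "q s' & regs s' 65 = b & regs s' 66 = A & regs s' 67 = sv & regs s' 68 = hv" for s'
 proof (rule det_dex)
 have l: "regs s' 0 = n" "regs s' (Suc 0) = n'" "regs s' 61 = D" "regs s' 62 = \<Delta>" "regs s' 64 = M" "regs s' 65 = b" "regs s' 66 = A"
 "regs s' 67 = sv" "regs s' 68 = hv" using a by (auto simp: q_def com_def)
 note p = par3_state[OF l]
 show "com (xx (c_par3 e th) s') & regs (xx (c_par3 e th) s') 63 = lg & regs (xx (c_par3 e th) s') 2 = Q & regs (xx (c_par3 e th) s') 3 = N
 & regs (xx (c_par3 e th) s') 69 = AS * th & regs (xx (c_par3 e th) s') 4 = t & regs (xx (c_par3 e th) s') 5 = F
 & regs (xx (c_par3 e th) s') 67 = sv & regs (xx (c_par3 e th) s') 68 = hv"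
 using p(1-6) p(7)[of 0] p(7)[of "Suc 0"] p(7)[of 61] p(7)[of 62] p(7)[of 63] p(7)[of 67] p(7)[of 68] a by (simp add: q_def com_def)
 qed (simp_all add: c_par3_def)
 have c9: "det w n adj (c_par4 k) s' (time (c_par4 k)) (%s. ready s & regs s 70 = K)"
 if a: "com s' & regs s' 63 = lg & regs s' 2 = Q & regs s' 3 = N & regs s' 69 = AS * th
 & regs s' 4 = t & regs s' 5 = F & regs s' 67 = sv & regs s' 68 = hv" for s'
 proof (rule det_dex)
 have l: "regs s' 0 = n" "regs s' 2 = Q" "regs s' 3 = N" "regs s' 5 = F" "regs s' 63 = lg" using a by (auto simp: com_def)
 note p = par4_state[OF l]
 have cap: "B0' + RS * F * K <= TOP" using vT(34) unfolding RSv .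
 have z: "\<forall>x\<ge>B0'. mem s x = 0" using s(7) by (simp add: B0'_def)
 show "ready (xx (c_par4 k) s') & regs (xx (c_par4 k) s') 70 = K"
 using p(1-8) p(9)[of 0] p(9)[of "Suc 0"] p(9)[of 61] p(9)[of 62] p(9)[of 67] p(9)[of 68] p(9)[of 69]
 p(9)[of 2] p(9)[of 3] p(9)[of 4] p(9)[of 5] a s(6) cap z
 by (simp add: ready_def prel_def com_def n'_def)
 qed (simp_all add: c_par4_def)
 show ?thesis unfolding c_setup_def setup_time_def
 by (rule det_Seq[OF c1], rule det_Seq[OF c2], assumption, rule det_Seq[OF c3], assumption, rule det_Seq[OF c4], assumption,
 rule det_Seq[OF c5], assumption, rule det_Seq[OF c6], assumption, rule det_Seq[OF c7], assumption, rule det_Seq[OF c8], assumption,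
 rule c9)
qed

end


text \<open>Up to 14, \<open>2 ^ a1\<close> is the least power of two not below
  \<open>1 / \<epsilon>\<close>. Beyond, \<open>(2 + \<epsilon>) / 8\<close> exceeds 2, and rounding
  it down to a power of two gives a divisor that still grows linearly with \<epsilon>.\<close>

lemma eps_choice:
 fixes \<epsilon> :: real
 assumes "0 < \<epsilon>"
 obtains a1 a2 th :: nat where "1 <= \<epsilon> * 2 ^ a1"
 "th = 0 & a2 = 0 & 2 ^ a1 <= 14 / \<epsilon> \<or> th = 1 & a1 = 0 & 8 * 2 ^ a2 <= 2 + \<epsilon> & \<epsilon> <= 16 * 2 ^ a2"
proof (cases "\<epsilon> <= 14")
 case True
 obtain a0 where a0: "1 / \<epsilon> < 2 ^ a0" using real_arch_pow[of 2 "1 / \<epsilon>"] by auto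
 define a where "a = (LEAST a. 1 <= \<epsilon> * 2 ^ a)"
 have "1 <= \<epsilon> * 2 ^ a0" using a0 assms by (simp add: pos_divide_less_eq mult.commute less_imp_le)
 then have a: "1 <= \<epsilon> * 2 ^ a" unfolding a_def by (rule LeastI)
 have "2 ^ a <= 14 / \<epsilon>"
 proof (cases a)
 case 0
 then show ?thesis using True assms by (simp add: pos_le_divide_eq)
 next
 case (Suc a')
 have "~ 1 <= \<epsilon> * 2 ^ a'" using not_less_Least[of a' "%a. 1 <= \<epsilon> * 2 ^ a"] Suc unfolding a_def by simp
 then have "\<epsilon> * 2 ^ a <= 14" using Suc by simp
 then show ?thesis using assms by (simp add: pos_le_divide_eq mult.commute)
 qed
 then show thesis using that[of a 0 0] a by simp
next
 case False
 let ?x = "(2 + \<epsilon>) / 8"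
 define m where "m = nat \<lfloor>?x\<rfloor>"
 have m: "real m <= ?x" "?x < real m + 1"   proof -
 have "0 <= \<lfloor>?x\<rfloor>" using False by simp
 then have "real m = real_of_int \<lfloor>?x\<rfloor>" by (simp add: m_def)
 then show "real m <= ?x" "?x < real m + 1" using of_int_floor_le[of ?x] real_of_int_floor_add_one_gt[of ?x] by linarith+
 qed
 have "1 < real m" using m(2) False by simp
 then have "1 <= m" by simp
 then obtain a where a: "2 ^ a <= m" "m < 2 ^ (a + 1)" using ex_power_ivl1[of 2 m] by auto
 have "real (2 ^ a) <= real m" using a(1) by (simp only: of_nat_le_iff)
 then have r1: "2 ^ a <= real m" by (simp only: of_nat_power of_nat_numeral)
 have "m + 1 <= 2 ^ (a + 1)" using a(2) by simp
 then have "real (m + 1) <= real (2 ^ (a + 1))" by (simp only: of_nat_le_iff)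
 moreover have "real (2 ^ (a + 1)) = 2 * 2 ^ a" by simp
 moreover have "real (m + 1) = real m + 1" by simp
 ultimately have r2: "real m + 1 <= 2 * 2 ^ a" by linarith
 have gen: "8 * y <= 2 + \<epsilon> & \<epsilon> <= 16 * y" if y: "y <= real m" "real m + 1 <= 2 * y" for y :: real
 proof -
 have "8 * real m <= 2 + \<epsilon>" "2 + \<epsilon> < 8 * (real m + 1)" using m by simp_all
 then show ?thesis using y by (linarith | (simp; fail) | (auto; fail) | (smt (verit)))
 qed
 have c1: "8 * 2 ^ a <= 2 + \<epsilon>" by (rule conjunct1[OF gen[OF r1 r2]])
 have c2: "\<epsilon> <= 16 * 2 ^ a" by (rule conjunct2[OF gen[OF r1 r2]])
 from c1 c2 show thesis using that[of 0 1 a] False by simp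
qed

context algo_w
begin

text \<open>Three requirements meet here: an attempt ends within its fuel with probability at least
  1/2, a finished one is valid by \<open>valid_tail\<close>, and the errors of \<open>K\<close>
  attempts add up to at most \<open>1 / n ^ k\<close>.\<close>

lemma finale:
 fixes \<epsilon> :: real
 assumes c0: "c0 = 64 * (2 * k + 8)" and g: "\<eta> * (b + 37) * M ^ g <= 1"
 and sl: "lg * (k + 2) * (\<Delta> * AS + \<Delta> * AS) * M ^ (k + 1) + 4 * (\<Delta> * AS + \<Delta> * AS) + 4 * sv <= M ^ g"
 and \<epsilon>: "0 < \<epsilon>" "1 <= \<epsilon> * 2 ^ a1" and cs: "th = 0 & a2 = 0 \<or> th = 1 & 8 * 2 ^ a2 <= 2 + \<epsilon>"
 and s: "ready s" "regs s 70 = K"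
 shows "\<exists>D'. cmp w n adj (seqs [While (Reg 70) c_try, c_out]) s (Suc ((K * Suc try_time + 1) + Suc (time c_out + 1))) D'
 & 1 - 1 / real n ^ k <= PR D' {s. matching_approx (2 + \<epsilon>) E (real (regs s 0)) & vertex_cover_approx (2 + \<epsilon>) n E (real (regs s 1))}"
proof -
 define m where "m = real M"
 define Zm where "Zm = \<Delta> * AS + \<Delta> * AS"
 define e' where "e' = \<eta> * (b + 37)"
 define G where "G = real (M ^ g)"
 have M2: "2 <= M" using Meq lg1 by (cases lg) auto
 have m2: "2 <= m" using M2 by (simp add: m_def)
 have e0: "0 <= \<eta>" unfolding \<eta>_def by (intro add_nonneg_nonneg) auto
 then have e'0: "0 <= e'" by (simp add: e'_def)
 have eG: "e' * G <= 1" using g by (simp add: e'_def G_def)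
 have small: "real x * e' <= 1" if "x <= M ^ g" for x
 proof -
 have "real x * e' <= G * e'" using that e'0 unfolding G_def by (intro mult_right_mono) (simp_all only: of_nat_le_iff)
 then show ?thesis using eG by (simp add: mult.commute)
 qed
 have "Z <= Zm" unfolding Z_def Zm_def by (rule div_le_dividend)
 then have Z: "t <= Zm" using tZ by linarith
 have sl': "K * Zm * M ^ (k + 1) <= M ^ g" "4 * Zm <= M ^ g" "4 * sv <= M ^ g" using sl unfolding K_def Zm_def by linarith+
 have t4: "4 * (t * e') <= 1" using small[of "4 * t"] sl'(2) Z by simp
 have half: "t * (\<eta> * (b + 37) + (b + 36) * Ibar / F) <= 1 / 2" if t1: "1 <= t"
 proof -
 define p where "p = real b + 40"
 define c where "c = real n'"
 have p: "40 <= p" by (simp add: p_def)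
 have fin: "finite nonis" by (simp add: nonis_def)
 have c0': "0 < c" using ne fin by (simp add: c_def n'_def card_gt_0_iff)
 have Z1: "1 <= Z" using tZ t1 by linarith
 have "t * D <= n' * Z" by (simp add: t_def)
 then have tD: "t * real D <= c * Z" unfolding c_def by (metis of_nat_le_iff of_nat_mult)
 have tZr: "real t <= real Z" using tZ by simp
 have tdc: "real t * real D / c <= real Z" using tD c0' by (simp add: pos_divide_le_eq mult.commute)
 have "(c + real L * real D * real b) / c = 1 + real L * real b * (real D / c)" using c0' by (simp add: add_divide_distrib)
 moreover have "Ibar = 2 * real B0 * ((c + real L * real D * real b) / c) + 2" by (simp add: Ibar_def c_def n'_def)
 ultimately have "Ibar = 2 * real B0 * (1 + real L * real b * (real D / c)) + 2" by (simp only:)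
 then have "real t * Ibar = 2 * real B0 * (real t + real L * real b * (real t * real D / c)) + 2 * real t"
 by (simp add: algebra_simps)
 also have "... <= 2 * real B0 * (real Z + real L * real b * real Z) + 2 * real Z"
 using tdc tZr by (intro add_mono mult_left_mono) auto
 also have "... = real Z * (2 * real B0 * (1 + real L * real b) + 2)" by (simp add: algebra_simps)
 also have "... <= real Z * (61 * p ^ 4)"
 proof (intro mult_left_mono)
 have B0p: "real B0 <= 2 * p" by (simp add: B0_def p_def)
 have "real L <= (2 * p) * (7 * p)" unfolding L_def of_nat_mult by (intro mult_mono) (auto simp: p_def)
 then have "real L * real b <= (2 * p) * (7 * p) * p" using p by (intro mult_mono) (auto simp: p_def)
 moreover have "1 <= p * p * p" using p mult_mono[of 1 p 1 p] mult_mono[of 1 "p * p" 1 p] by simp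
 ultimately have Lb: "1 + real L * real b <= 15 * (p * p * p)" by (simp add: mult_ac)
 have "2 * real B0 * (1 + real L * real b) <= 2 * (2 * p) * (15 * (p * p * p))"
 using B0p Lb p by (intro mult_mono) auto
 moreover have "2 <= p * (p * p * p)" using p \<open>1 <= p * p * p\<close> mult_mono[of 2 p 1 "p * p * p"] by simp
 moreover have "p ^ 4 = p * (p * p * p)" by (simp add: eval_nat_numeral)
 moreover have "2 * (2 * p) * (15 * (p * p * p)) = 60 * (p * (p * p * p))" by simp
 ultimately show "2 * real B0 * (1 + real L * real b) + 2 <= 61 * p ^ 4" by linarith
 qed simp
 finally have tI: "t * Ibar <= Z * (61 * p ^ 4)" .
 have i0: "0 <= real t * Ibar" by (simp add: Ibar_def)
 have "(real b + 36) * (t * Ibar) <= p * (Z * (61 * p ^ 4))" by (rule mult_mono[OF _ tI _ i0]) (simp_all add: p_def)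
 \<comment> \<open>The mean work is of order \<open>Z * p ^ 5\<close>, so the fuel
   \<open>Z * p ^ 7\<close> has two powers to spare, and \<open>p >= 40\<close> makes them cover the
   constant 244. With \<open>t4\<close>, both parts of the failure probability are at most
   1/4.\<close>
 moreover have "4 * (p * (Z * (61 * p ^ 4))) <= Z * p ^ 7"
 proof -
 have "40 * 40 <= p * p" using p by (intro mult_mono) auto
 then have "244 * p ^ 5 <= (p * p) * p ^ 5" using p by (intro mult_right_mono) auto
 then have "Z * (244 * p ^ 5) <= Z * ((p * p) * p ^ 5)" by (intro mult_left_mono) auto
 then show ?thesis by (simp add: eval_nat_numeral mult_ac)
 qed
 moreover have Fp: "real F = Z * p ^ 7" by (simp add: F_def p_def)
 ultimately have "4 * ((real b + 36) * (t * Ibar)) <= real F" by linarith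
 moreover have F0: "0 < real F" using Z1 by (simp add: F_def)
 ultimately have "(real b + 36) * (t * Ibar) / real F <= 1 / 4" by (simp add: pos_divide_le_eq)
 moreover have "t * (\<eta> * (b + 37) + (b + 36) * Ibar / F) = t * e' + (real b + 36) * (t * Ibar) / real F"
 proof -
 have gq: "t' * (u + x * I / f) = t' * u + x * (t' * I) / f" for t' u x I f :: real by (simp add: distrib_left)
 have r36: "real (b + 36) = real b + 36" by simp
 show ?thesis unfolding e'_def r36 by (rule gq)
 qed
 ultimately show ?thesis using t4 by linarith
 qed
 have A: "A = lg * c0" by (rule A_def)
 have A1: "1 <= A" unfolding A using lg1 by (simp add: c0)
 have prec: "4 + 2 * \<epsilon> <= \<epsilon> * sv \<or> 8 * n <= sv"
 proof (cases "a1 <= lg")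
 case True
 have "\<epsilon> * 1 <= \<epsilon> * 2 ^ a1" using \<epsilon>(1) by (intro mult_left_mono) auto
 moreover have "\<epsilon> * real sv = 32 * (\<epsilon> * 2 ^ a1)" using True by (simp add: sv_def min_def)
 ultimately have "4 + 2 * \<epsilon> <= \<epsilon> * real sv" using \<epsilon>(2) by linarith
 then show ?thesis ..
 next
 case False
 then have "sv = 32 * M" using Meq by (simp add: sv_def min_def)
 then show ?thesis using nM by simp
 qed
 have sv4: "4 <= sv" by (simp add: sv_def)
 have tail: "tail pm (%x. ~ valid \<epsilon> \<Delta> t sv (AS * th) hv x) t 0 <= 2 * exp (- (A / 64))"
 proof (rule valid_tail[OF ne \<Delta> sv4 A1 \<epsilon>(1)])
 have "\<Delta> * AS + \<Delta> * AS = 2 * A * \<Delta> * sv\<^sup>2" by (simp add: AS_def power2_eq_square)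
 then show "Z = 2 * A * \<Delta> * sv\<^sup>2 div hv" by (simp add: Z_def)
 show "t = card nonis * Z div D" by (simp add: t_def n'_def)
 have "\<eta> * 1 <= \<eta> * (b + 37)" using e0 by (intro mult_left_mono) auto
 then have "4 * real sv * \<eta> <= 4 * real sv * e'" unfolding e'_def by (intro mult_left_mono) auto
 then show "4 * real sv * \<eta> <= 1" using small[OF sl'(3)] by simp
 show "AS * th = 0 & hv = 1 \<or> AS * th = A * sv\<^sup>2 & real (8 * hv) <= 2 + \<epsilon> & 1 <= hv"
 proof (cases "th = 0")
 case True
 then have "a2 = 0" using cs by auto
 then have "hv = 1" unfolding hv_def by simp
 moreover have "AS * th = 0" unfolding True by (rule mult_0_right)
 ultimately show ?thesis by blast
 next
 case False
 then have c: "th = 1" "8 * 2 ^ a2 <= 2 + \<epsilon>" using cs by auto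
 have "(2::real) ^ min a2 (lg * J) <= 2 ^ a2" by (intro power_increasing) auto
 moreover have "real hv = 2 ^ min a2 (lg * J)" by (simp add: hv_def)
 moreover have "real (8 * hv) = 8 * real hv" by simp
 ultimately have h8: "real (8 * hv) <= 2 + \<epsilon>" using c(2) by linarith
 have h1: "1 <= hv" by (simp add: hv_def)
 have "AS * th = A * sv\<^sup>2" unfolding AS_def c(1) by (simp add: power2_eq_square)
 then show ?thesis using h8 h1 by blast
 qed
 qed (use prec in auto)
 define \<beta> where "\<beta> = 2 * exp (- (A / 64)) + t * e'"
 have \<beta>: "0 <= \<beta>" using e'0 by (simp add: \<beta>_def)
 have tl: "tail pm (%x. ~ valid \<epsilon> \<Delta> t sv (AS * th) hv x) t 0 + t * (\<eta> * (b + 37)) <= \<beta>"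
 using tail by (simp add: \<beta>_def e'_def)
 have "(1 / 2) ^ K + K * \<beta> <= 1 / real n ^ k"
 proof -
 have m0: "0 < m" using m2 by simp
 have pw: "(1 / 2) ^ (lg * x) = 1 / m ^ x" for x
 by (simp add: m_def Meq power_mult power_one_over)
 have 1: "(1 / 2) ^ K = 1 / m ^ (k + 2)" unfolding K_def by (rule pw)
 have 2: "exp (- (A / 64)) <= 1 / m ^ (2 * k + 8)"
 proof -
 \<comment> \<open>The origin of \<open>c0 = 64 * (2 * k + 8)\<close>: as
   \<open>exp (- 1) <= 1 / 2\<close> and \<open>2 ^ lg = M\<close>, the tail falls below
   \<open>1 / M ^ (2 * k + 8)\<close>.\<close>
 have "A / 64 = real (lg * (2 * k + 8))" unfolding A by (simp add: c0)
 then have "exp (- (A / 64)) = exp (- 1) ^ (lg * (2 * k + 8))" by (simp add: exp_of_nat_mult[symmetric])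
 also have "... <= (1 / 2) ^ (lg * (2 * k + 8))"
 proof (rule power_mono)
 have "(2::real) <= exp 1" using exp_ge_add_one_self[of 1] by simp
 then show "exp (- 1) <= (1 / 2 :: real)" by (simp add: exp_minus divide_simps)
 qed simp
 finally show ?thesis unfolding pw .
 qed
 have K: "2 * K <= M ^ (k + 4)"
 proof -
 have "k + 2 < 2 ^ (k + 2)" by (rule less_exp)
 also have "2 ^ (k + 2) <= M ^ (k + 2)" using M2 by (rule power_mono) simp
 finally have "k + 2 <= M ^ (k + 2)" by simp
 moreover have "lg <= M" using Meq less_exp[of lg] by simp
 ultimately have "2 * (lg * (k + 2)) <= M * (M * M ^ (k + 2))" using M2 by (intro mult_le_mono)
 then show ?thesis by (simp add: K_def eval_nat_numeral)
 qed
 then have Kr: "2 * real K <= m ^ (k + 4)" unfolding m_def by (metis of_nat_le_iff of_nat_mult of_nat_numeral of_nat_power)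
 have "2 * real K * exp (- (A / 64)) <= m ^ (k + 4) * (1 / m ^ (2 * k + 8))" using Kr 2 m0 by (intro mult_mono) auto
 also have "... = 1 / m ^ (k + 4)"
 proof -
 have "2 * k + 8 = (k + 4) + (k + 4)" by simp
 then have "m ^ (2 * k + 8) = m ^ (k + 4) * m ^ (k + 4)" by (simp only: power_add)
 then show ?thesis using m0 by simp
 qed
 finally have 3: "2 * real K * exp (- (A / 64)) <= 1 / m ^ (k + 4)" .
 have 4: "real K * (t * e') <= 1 / m ^ (k + 1)"
 proof -
 have "K * t * M ^ (k + 1) <= K * Zm * M ^ (k + 1)" using Z by (intro mult_le_mono) auto
 then have "real (K * t * M ^ (k + 1)) * e' <= 1" using sl'(1) by (intro small) linarith
 then have "real K * (t * e') * m ^ (k + 1) <= 1" by (simp add: m_def mult_ac)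
 then show ?thesis using m0 by (simp add: pos_le_divide_eq)
 qed
 \<comment> \<open>The three error terms take the shares 1/4, 1/16 and 1/2 of
   \<open>1 / m ^ k\<close>.\<close>
 have 5: "1 / m ^ (k + 2) <= 1 / 4 * (1 / m ^ k)" "1 / m ^ (k + 4) <= 1 / 16 * (1 / m ^ k)" "1 / m ^ (k + 1) <= 1 / 2 * (1 / m ^ k)"
 proof -
 have r: "1 / m ^ (k + x) <= 1 / 2 ^ x * (1 / m ^ k)" for x
 proof -
 have "2 ^ x <= m ^ x" using m2 by (intro power_mono) auto
 then have "2 ^ x * m ^ k <= m ^ (k + x)" using m0 by (simp add: power_add mult.commute)
 then have "1 / m ^ (k + x) <= 1 / (2 ^ x * m ^ k)" using m0 by (intro divide_left_mono) auto
 then show ?thesis by simp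
 qed
 show "1 / m ^ (k + 2) <= 1 / 4 * (1 / m ^ k)" "1 / m ^ (k + 4) <= 1 / 16 * (1 / m ^ k)" "1 / m ^ (k + 1) <= 1 / 2 * (1 / m ^ k)"
 using r[of 2] r[of 4] r[of 1] by simp_all
 qed
 have "real K * \<beta> = 2 * real K * exp (- (A / 64)) + real K * (t * e')" by (simp add: \<beta>_def algebra_simps)
 moreover have "0 <= 1 / m ^ k" using m0 by simp
 ultimately have "(1 / 2) ^ K + K * \<beta> <= 1 / m ^ k" using 1 3 4 5 by linarith
 also have "... <= 1 / real n ^ k"
 using n1 nM by (intro divide_left_mono power_mono) (auto simp: m_def)
 finally show ?thesis .
 qed
 then show ?thesis using run_attempts[OF s half tl \<beta>] by (auto intro: order_trans)
qed

end

context algo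
begin

text \<open>The retries, \<open>A\<close> and the seventh power of \<open>b + 40\<close> contribute
  nine factors \<open>lg\<close>. The constant is \<open>401408 = 2 * 448 ^ 2\<close>, where
  \<open>448 = 32 * 14\<close> bounds \<open>sv * \<epsilon>\<close> for small \<epsilon>.\<close>

lemma work_bound:
 fixes \<epsilon> :: real
 assumes J: "J = 2048 * c0 + 2" and \<Delta>n: "\<Delta> <= n" and \<epsilon>: "0 < \<epsilon>"
 and ch: "th = 0 & a2 = 0 & 2 ^ a1 <= 14 / \<epsilon> \<or> th = 1 & a1 = 0 & 8 * 2 ^ a2 <= 2 + \<epsilon> & \<epsilon> <= 16 * 2 ^ a2"
 shows "real (lg * F) <= real (B + 40) ^ 7 * (real c0 * 401408 * (real n + real \<Delta> / \<epsilon>\<^sup>2 * real lg ^ 18))"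
proof -
 define l d where "l = real lg" and "d = real \<Delta>"
 have l1: "1 <= l" using lg1 by (simp add: l_def)
 have d0: "0 <= d" "d <= real n" using \<Delta>n by (simp_all add: d_def)
 have Zm: "real (\<Delta> * AS + \<Delta> * AS) = 2 * (l * c0 * d) * (real sv)\<^sup>2"
 by (simp add: AS_def A_def l_def d_def power2_eq_square)
 have Zr: "real Z <= real (\<Delta> * AS + \<Delta> * AS) / real hv" unfolding Z_def by (rule of_nat_div_le_of_nat)
 have "b + 40 <= (B + 40) * lg" using lg1 by (simp add: be distrib_right)
 then have "real (b + 40) <= real (B + 40) * l" unfolding l_def by (metis of_nat_le_iff of_nat_mult)
 then have "real (b + 40) ^ 7 <= (real (B + 40) * l) ^ 7" by (intro power_mono) auto
 then have "l * (Z * real (b + 40) ^ 7) <= l * (Z * (real (B + 40) * l) ^ 7)" using l1 by (intro mult_left_mono) auto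
 moreover have "real (lg * F) = l * (Z * real (b + 40) ^ 7)" by (simp add: F_def l_def)
 moreover have p8: "l ^ 8 = l * l ^ 7" using power_Suc[of l 7] by simp
 moreover have "l * (Z * (real (B + 40) * l) ^ 7) = real (B + 40) ^ 7 * (l ^ 8 * Z)"
 unfolding p8 power_mult_distrib by (simp only: mult_ac)
 ultimately have F1: "real (lg * F) <= real (B + 40) ^ 7 * (l ^ 8 * Z)" by linarith
 have p9: "l ^ 9 = l * l ^ 8" using power_Suc[of l 8] by simp
 have "l ^ 8 * Z <= real c0 * 401408 * (real n + d / \<epsilon>\<^sup>2 * l ^ 18)"
 proof (cases "th = 0")
 case True
 then have c: "a2 = 0" "2 ^ a1 <= 14 / \<epsilon>" using ch by auto
 have "(2::real) ^ min a1 lg <= 2 ^ a1" by (intro power_increasing) auto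
 moreover have "real sv = 32 * 2 ^ min a1 lg" "448 / \<epsilon> = 32 * (14 / \<epsilon>)" by (simp_all add: sv_def)
 ultimately have "real sv <= 448 / \<epsilon>" using c(2) by linarith
 then have "(real sv)\<^sup>2 <= (448 / \<epsilon>)\<^sup>2" by (intro power_mono) auto
 then have z2: "2 * (l * c0 * d) * (real sv)\<^sup>2 <= 2 * (l * c0 * d) * (448 / \<epsilon>)\<^sup>2" using l1 d0 by (intro mult_left_mono) auto
 have hv1: "hv = 1" unfolding hv_def using c(1) by simp
 have "real Z <= 2 * (l * c0 * d) * (real sv)\<^sup>2" using Zr unfolding Zm hv1 by simp
 then have "real Z <= 2 * (l * c0 * d) * (448 / \<epsilon>)\<^sup>2" using z2 by (rule order_trans)
 then have "l ^ 8 * Z <= l ^ 8 * (2 * (l * c0 * d) * (448 / \<epsilon>)\<^sup>2)" using l1 by (intro mult_left_mono) auto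
 also have "... = real c0 * 401408 * (d / \<epsilon>\<^sup>2 * l ^ 9)" by (simp add: power_divide p9 mult_ac)
 also have "... <= real c0 * 401408 * (real n + d / \<epsilon>\<^sup>2 * l ^ 18)"
 proof -
 have "d / \<epsilon>\<^sup>2 * l ^ 9 <= d / \<epsilon>\<^sup>2 * l ^ 18" using l1 d0 by (intro mult_left_mono power_increasing) auto
 then show ?thesis by (intro mult_left_mono) auto
 qed
 finally show ?thesis .
 next
 case False
 then have c: "a1 = 0" "\<epsilon> <= 16 * 2 ^ a2" using ch by auto
 have s32: "sv = 32" unfolding sv_def using c(1) by simp
 show ?thesis
 proof (cases "a2 <= lg * J")
 case True
 then have h: "\<epsilon> <= 16 * real hv" using c(2) by (simp add: hv_def min_def)
 have h0: "0 < real hv" by (simp add: hv_def)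
 have "real Z <= 2048 * (l * c0 * d) / real hv" using Zr unfolding Zm by (simp add: s32)
 also have "... <= 2048 * (l * c0 * d) * (16 / \<epsilon>)"
 proof -
 have "1 / real hv <= 16 / \<epsilon>" using h h0 \<epsilon> by (simp add: divide_simps)
 then have "2048 * (l * c0 * d) * (1 / real hv) <= 2048 * (l * c0 * d) * (16 / \<epsilon>)" using l1 d0 by (intro mult_left_mono) auto
 then show ?thesis by simp
 qed
 finally have "l ^ 8 * Z <= l ^ 8 * (2048 * (l * c0 * d) * (16 / \<epsilon>))" using l1 by (intro mult_left_mono) auto
 also have "... = real c0 * 32768 * (d * (l ^ 9 / \<epsilon>))" by (simp add: p9 mult_ac)
 also have "... <= real c0 * 401408 * (real n + d / \<epsilon>\<^sup>2 * l ^ 18)"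
 proof -
 define x where "x = l ^ 9 / \<epsilon>"
 \<comment> \<open>For large \<epsilon> the work is linear in \<open>1 / \<epsilon>\<close>, whereas
   the claim has \<open>1 / \<epsilon> ^ 2\<close>. Since \<open>d <= n\<close>, the excess goes
   into the linear term; squaring \<open>l ^ 9\<close> is the reason for the exponent 18.\<close>
 have "x <= 1 + x\<^sup>2"
 proof -
 have "0 <= (x - 1 / 2)\<^sup>2" by simp
 then show ?thesis by (simp add: power2_eq_square algebra_simps)
 qed
 then have "d * x <= d * (1 + x\<^sup>2)" using d0(1) by (rule mult_left_mono)
 also have "... = d + d / \<epsilon>\<^sup>2 * l ^ 18" by (simp add: x_def power_divide power_mult[symmetric] algebra_simps)
 finally have y: "d * x <= real n + d / \<epsilon>\<^sup>2 * l ^ 18" using d0(2) by linarith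
 have "0 <= d * x" using d0 l1 \<epsilon> by (simp add: x_def)
 then have "real c0 * 32768 * (d * x) <= real c0 * 401408 * (d * x)" by (intro mult_right_mono) auto
 also have "... <= real c0 * 401408 * (real n + d / \<epsilon>\<^sup>2 * l ^ 18)" using y by (intro mult_left_mono) auto
 finally show ?thesis by (simp add: x_def)
 qed
 finally show ?thesis .
 next
 case False
 then have "hv = 2 ^ (lg * J)" by (simp add: hv_def min_def)
 then have h: "hv = M ^ J" by (simp add: Meq power_mult)
 have M2: "2 <= M" using Meq lg1 by (cases lg) auto
 have "2048 * c0 < 2 ^ (2048 * c0)" by (rule less_exp)
 also have "(2::nat) ^ (2048 * c0) <= M ^ (2048 * c0)" using M2 by (rule power_mono) simp
 finally have p: "2048 * c0 <= M ^ (2048 * c0)" by simp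
 have "lg < M" using Meq less_exp[of lg] by simp
 have "\<Delta> <= M" using \<Delta>n nM by simp
 then have "lg * \<Delta> <= lg * M" by (rule mult_le_mono2)
 moreover have "lg * M < M * M" using \<open>lg < M\<close> M2 by simp
 ultimately have q: "lg * \<Delta> < M * M" by linarith
 have "\<Delta> * AS + \<Delta> * AS = 2048 * c0 * (lg * \<Delta>)" by (simp add: AS_def A_def s32)
 also have "... <= M ^ (2048 * c0) * (lg * \<Delta>)" using p by (rule mult_le_mono1)
 also have "... < M ^ (2048 * c0) * (M * M)" using q M2 by simp
 also have "... = hv"
 proof -
 have "M ^ J = M ^ (2048 * c0) * (M * M)" unfolding J by (simp add: mult_ac)
 then show ?thesis by (simp only: h)
 qed
 finally have "Z = 0" by (simp add: Z_def)
 then show ?thesis using d0 l1 by simp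
 qed
 qed
 then have "real (B + 40) ^ 7 * (l ^ 8 * Z) <= real (B + 40) ^ 7 * (real c0 * 401408 * (real n + d / \<epsilon>\<^sup>2 * l ^ 18))"
 by (intro mult_left_mono) auto
 then show ?thesis using F1 unfolding l_def d_def by linarith
qed

end

text \<open>Everything outside the trials is at most linear in \<open>n\<close>, because
  \<open>lg <= n\<close>.\<close>

lemma total_time:
 fixes n lg :: nat
 assumes "lg <= n" "1 <= n"
 shows "Suc (Suc (1 + (n * Suc a + 1)) + Suc (Suc ((Suc (1 + Suc (1 + Suc ((n * Suc cl + 1) + Suc (p1 + Suc ((8 * lg + 2)
 + Suc (p2 + Suc ((8 * (lg * J) + 2) + Suc (p3 + p4))))))))) +
 Suc ((lg * (k + 2) * Suc (Suc (ci + Suc ((F * Suc bt + 1) + Suc (cf + 1)))) + 1) + Suc (co + 1)))))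
 <= (Suc a + Suc cl + 8 + 8 * J + (k + 2) * (ci + cf + 20) + (p1 + p2 + p3 + p4 + co + 60)) * n + (k + 2) * Suc bt * (lg * F)"
proof -
 have 1: "lg * 8 <= n * 8" "lg * (8 * J) <= n * (8 * J)" "lg * ((k + 2) * (ci + cf + 6)) <= n * ((k + 2) * (ci + cf + 6))"
 using assms(1) by (simp_all only: mult_le_mono1)
 have 3: "n * ((k + 2) * (ci + cf + 6)) <= n * ((k + 2) * (ci + cf + 20))" by (intro mult_le_mono2) simp
 have e: "lg * (k + 2) * Suc (Suc (ci + Suc ((F * Suc bt + 1) + Suc (cf + 1)))) = (k + 2) * Suc bt * (lg * F) + lg * ((k + 2) * (ci + cf + 6))"
 by (simp add: algebra_simps)
 have r: "(a1 + a2 + 8 + c3 + c4 + c5) * n = a1 * n + a2 * n + n * 8 + c3 * n + c4 * n + c5 * n" for a1 a2 c3 c4 c5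
 by (simp add: algebra_simps)
 have gen: "Suc (Suc (1 + (x1 + 1)) + Suc (Suc (Suc (1 + Suc (1 + Suc ((x2 + 1) + Suc (p1 + Suc ((8 * lg + 2)
 + Suc (p2 + Suc ((y3 + 2) + Suc (p3 + p4)))))))) + Suc ((z + u + 1) + Suc (co + 1)))))
 <= (x1 + x2 + n * 8 + x3 + v + q) + z"
 if "lg * 8 <= n * 8" "y3 <= x3" "u <= v" "p1 + p2 + p3 + p4 + co + 60 <= q" for x1 x2 x3 y3 z u v q
 using that by linarith
 have c: "8 * (lg * J) = lg * (8 * J)" "n * Suc a = Suc a * n" "n * Suc cl = Suc cl * n" by simp_all
 have 2: "p1 + p2 + p3 + p4 + co + 60 <= (p1 + p2 + p3 + p4 + co + 60) * n" using assms(2) by simp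
 have 4: "lg * (8 * J) <= 8 * J * n" using 1(2) by (simp add: mult.commute)
 have 5: "lg * ((k + 2) * (ci + cf + 6)) <= (k + 2) * (ci + cf + 20) * n" using 1(3) 3 by (simp only: mult.commute[of _ n])
 show ?thesis unfolding e r c by (rule gen[OF 1(1) 4 5 2])
qed

lemma matching_number_empty: "matching_number {} = 0"
proof -
 have "{M. matching {} M} = {{}}" by (auto simp: matching_def)
 then show ?thesis by (simp add: matching_number_def)
qed

lemma vertex_cover_number_empty: "vertex_cover_number n {} = 0"
proof -
 have "finite {S. vertex_cover n {} S}" by (rule finite_subset[of _ "Pow {..<n}"]) (auto simp: vertex_cover_def)
 moreover have "{} \<in> {S. vertex_cover n {} S}" by (simp add: vertex_cover_def)
 ultimately have "vertex_cover_number n {} <= card ({} :: nat set)" unfolding vertex_cover_number_def by (intro Min_le finite_imageI imageI)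
 then show ?thesis by simp
qed

definition prog :: "nat => nat => nat => nat => nat => nat => nat => nat => com" where
 "prog B c0 J e th k a1 a2 = Seq (Seq (Compute 60 Add (Reg 0) (Const 0)) (While (Reg 60) c_deg))
 (If (Reg 61) (Seq (c_setup B c0 J e th k a1 a2) (seqs [While (Reg 70) c_try, c_out]))
 (Seq (Compute 0 Add (Const 0) (Const 0)) (Compute 1 Add (Const 0) (Const 0))))"


lemma time_par3: "time (c_par3 e th) = time (c_par3 e 0)"
 by (simp add: c_par3_def)

lemma main_case:
 fixes \<epsilon> :: real
 assumes c0: "c0 = 64 * (2 * k + 8)" and J: "J = 2048 * c0 + 2" and sl: "!!i. i \<in> insts J ==> slack c0 k i <= xM i ^ g"
 and j: "j = g + 8" and e: "e = 2 * j + g + 7" and B: "B = 2 * j + e + g + 7"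
 and top: "!!i. i \<in> insts J ==> topf B c0 J e th k i <= xM i ^ \<tau>"
 and \<epsilon>: "0 < \<epsilon>" "1 <= \<epsilon> * 2 ^ a1"
 and ch: "th = 0 & a2 = 0 & 2 ^ a1 <= 14 / \<epsilon> \<or> th = 1 & a1 = 0 & 8 * 2 ^ a2 <= 2 + \<epsilon> & \<epsilon> <= 16 * 2 ^ a2"
 and C1: "C1 = Suc (time c_deg) + Suc (time c_lg) + 8 + 8 * J + (k + 2) * (time c_init + time c_fin + 20)
 + (time (c_par1 B c0) + time (c_par2 J) + time (c_par3 e 0) + time (c_par4 k) + time c_out + 60)"
 and CW: "CW = real ((k + 2) * Suc body_time) * (real (B + 40) ^ 7 * (real c0 * 401408))"
 and C: "C = real C1 + CW * 2 ^ 18"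
 and n1: "1 <= n" and sg: "simple_graph n E" and al: "adjacency_lists n E adj"
 and w: "real (2 * \<tau> + 3) * log 2 (real n + 1) <= real w"
 shows "\<exists>T. real T <= C * real n + C * (real (max_degree n E) / \<epsilon>\<^sup>2) * log 2 (real n) ^ 18
 & (\<forall>cfg\<in>set_pmf (run w n adj T (initial (prog B c0 J e th k a1 a2) n)). halted cfg)
 & 1 - 1 / real n ^ k <= PR (run w n adj T (initial (prog B c0 J e th k a1 a2) n))
 {cfg. matching_approx (2 + \<epsilon>) E (matching_estimate cfg) & vertex_cover_approx (2 + \<epsilon>) n E (vertex_cover_estimate cfg)}"
proof -
 let ?P = "prog B c0 J e th k a1 a2"
 have W: "(n + 1) ^ (2 * \<tau> + 3) <= 2 ^ w"
 proof -
 have "(real n + 1) ^ (2 * \<tau> + 3) = (real n + 1) powr real (2 * \<tau> + 3)" by (subst powr_realpow) auto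
 also have "... = 2 powr (real (2 * \<tau> + 3) * log 2 (real n + 1))" by (simp add: powr_def log_def)
 also have "... <= 2 powr (real w)" using w by (intro powr_mono) auto
 also have "... = 2 ^ w" by (simp add: powr_realpow)
 finally have "real ((n + 1) ^ (2 * \<tau> + 3)) <= real (2 ^ w)" by (simp add: add.commute)
 then show ?thesis by (simp only: of_nat_le_iff)
 qed
 have "(n + 1) ^ 3 <= (n + 1) ^ (2 * \<tau> + 3)" by (rule power_increasing) auto
 then have W3: "(n + 1) ^ 3 <= 2 ^ w" using W by linarith
 have c3: "(n + 1) ^ 3 = n * n * n + 3 * (n * n) + 3 * n + 1" by (simp add: eval_nat_numeral algebra_simps)
 have w1: "n * n < 2 ^ w" "n + 2 < 2 ^ w" "2 * n < 2 ^ w" using W3 n1 unfolding c3 by linarith+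
 have n2w: "n < 2 ^ w" using w1(2) by linarith
 have w0: "0 < w" using w1(2) by (cases w) auto
 interpret G: rgraph n E adj 2 0 by unfold_locales (use sg al in auto)
 define s0 :: state where "s0 = \<lparr>regs = (%_. 0)(0 := n), mem = (%_. 0)\<rparr>"
 have ini: "initial ?P n = ([?P], s0)" by (simp add: initial_def s0_def)
 let ?c = "Seq (Compute 60 Add (Reg 0) (Const 0)) (While (Reg 60) c_deg)"
 let ?t1 = "Suc (1 + (n * Suc (time c_deg) + 1))"
 have d0: "det w n adj (Compute 60 Add (Reg 0) (Const 0)) s0 1 (%s. s = set_reg 60 n s0)"
 using det_dex[of "Compute 60 Add (Reg 0) (Const 0)" "%s. s = set_reg 60 n s0" w n adj s0] n2w by (simp add: s0_def)
 have r60: "regs (set_reg 60 n s0) 0 = n" "regs (set_reg 60 n s0) 60 = n" "regs (set_reg 60 n s0) 61 = 0" "regs (set_reg 60 n s0) 62 = 0"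
 "regs (set_reg 60 n s0) (Suc 0) = 0" "regs (set_reg 60 n s0) 63 = 0" "mem (set_reg 60 n s0) = (%_. 0)"
 by (simp_all add: s0_def set_reg_def)
 define R where "R s \<longleftrightarrow> regs s 0 = n & regs s 61 = (\<Sum>u<n. G.deg u) & (\<forall>u<n. G.deg u <= regs s 62) & (\<exists>u<n. regs s 62 = G.deg u)
 & regs s (Suc 0) = length (filter (%u. 0 < G.deg u) [0..<n])
 & (\<forall>i<regs s (Suc 0). mem s i = filter (%u. 0 < G.deg u) [0..<n] ! i) & (\<forall>x\<ge>n. mem s x = 0) & regs s 60 = 0 & regs s 63 = 0" for s :: state
 have dl: "det w n adj (While (Reg 60) c_deg) (set_reg 60 n s0) (n * Suc (time c_deg) + 1) R"
 unfolding R_def by (rule G.deg_loop[OF w1(1,2) n1 r60])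
 have "det w n adj ?c s0 ?t1 R" by (rule det_Seq[OF d0]) (simp only: dl)
 then obtain s1 where s1a: "cmp w n adj ?c s0 ?t1 (return_pmf s1)" and R1: "R s1" unfolding det_def by blast
 have s1b: "regs s1 0 = n" "regs s1 61 = G.D" "\<forall>u<n. G.deg u <= regs s1 62"
 "\<exists>u<n. regs s1 62 = G.deg u" "regs s1 (Suc 0) = length (filter (%u. 0 < G.deg u) [0..<n])"
 "\<forall>i<regs s1 (Suc 0). mem s1 i = filter (%u. 0 < G.deg u) [0..<n] ! i" "\<forall>x\<ge>n. mem s1 x = 0" "regs s1 63 = 0"
 using R1 unfolding R_def G.D_def by blast+
 note s1 = s1a s1b
 have CW0: "0 <= CW" unfolding CW by (intro mult_nonneg_nonneg) auto
 have fin: ?thesis if c: "cmp w n adj ?P s0 T D'" and T: "real T <= C * real n + C * (real (max_degree n E) / \<epsilon>\<^sup>2) * log 2 (real n) ^ 18"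
 and p: "1 - 1 / real n ^ k <= PR D' {s. matching_approx (2 + \<epsilon>) E (real (regs s 0)) & vertex_cover_approx (2 + \<epsilon>) n E (real (regs s 1))}" for T D'
 proof -
 have r: "run w n adj T (initial ?P n) = map_pmf (Pair []) D'" unfolding ini by (rule cmp_run[OF c])
 show ?thesis
 by (rule exI[of _ T]) (use T p in \<open>simp add: r halted_def matching_estimate_def vertex_cover_estimate_def vimage_def\<close>)
 qed
 show ?thesis
 \<comment> \<open>An edgeless graph is answered by two zeros: there is no vertex to sample and no
   \<open>D\<close> to divide by.\<close>
 proof (cases "G.D = 0")
 case True
 have "G.dirs = {}" using True G.card_dirs G.finite_dirs by simp
 have E: "E = {}"
 proof (rule ccontr)
 assume "E ~= {}"
 then obtain f where f: "f \<in> E" by blast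
 then obtain u v where "f = {u, v}" by (rule G.edgeE)
 then have "(u, v) \<in> G.dirs" using f by (simp add: G.dirs_def)
 then show False using \<open>G.dirs = {}\<close> by simp
 qed
 let ?d = "Seq (Compute 0 Add (Const 0) (Const 0)) (Compute 1 Add (Const 0) (Const 0))"
 define s2 where "s2 = dex w n adj ?d s1"
 have s2: "regs s2 0 = 0" "regs s2 1 = 0" by (simp_all add: s2_def set_reg_def)
 have c2: "cmp w n adj ?d s1 (time ?d) (return_pmf s2)"
 using cmp_exec[of ?d w n adj s1] exec_dex[of ?d w n adj s1] by (simp add: s2_def)
 have "cmp w n adj ?P s0 (Suc (?t1 + Suc (time ?d))) (bind_pmf (return_pmf s1) (%_. return_pmf s2))"
 unfolding prog_def
 proof (rule cmp_Seq[OF s1(1)])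
 fix s' assume "s' \<in> set_pmf (return_pmf s1)"
 then have s': "s' = s1" by simp
 show "cmp w n adj (If (Reg 61) (Seq (c_setup B c0 J e th k a1 a2) (seqs [While (Reg 70) c_try, c_out])) ?d) s' (Suc (time ?d)) (return_pmf s2)"
 by (rule cmp_If) (use c2 s1(3) True s' in simp)
 qed
 then have c: "cmp w n adj ?P s0 (Suc (?t1 + Suc (time ?d))) (return_pmf s2)" by (simp add: bind_return_pmf)
 show ?thesis
 proof (rule fin[OF c])
 have "Suc (?t1 + Suc (time ?d)) = n * Suc (time c_deg) + 8" by simp
 also have "... <= C1 * n"
 proof -
 have "8 * 1 <= 8 * n" using n1 by (rule mult_le_mono2)
 moreover have "(Suc (time c_deg) + 8) * n <= C1 * n" unfolding C1 by (intro mult_le_mono1) simp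
 ultimately show ?thesis by (simp add: algebra_simps)
 qed
 finally have "real (Suc (?t1 + Suc (time ?d))) <= real C1 * real n" by (metis of_nat_le_iff of_nat_mult)
 also have "... <= C * real n" using CW0 by (intro mult_right_mono) (auto simp: C)
 also have "... <= C * real n + C * (real (max_degree n E) / \<epsilon>\<^sup>2) * log 2 (real n) ^ 18"
 using CW0 n1 by (auto simp: C intro!: mult_nonneg_nonneg add_nonneg_nonneg zero_le_power)
 finally show "real (Suc (?t1 + Suc (time ?d))) <= C * real n + C * (real (max_degree n E) / \<epsilon>\<^sup>2) * log 2 (real n) ^ 18" .
 show "1 - 1 / real n ^ k <= PR (return_pmf s2) {s. matching_approx (2 + \<epsilon>) E (real (regs s 0)) & vertex_cover_approx (2 + \<epsilon>) n E (real (regs s 1))}"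
 using s2 by (simp add: E matching_approx_def vertex_cover_approx_def matching_number_empty vertex_cover_number_empty measure_return_pmf)
 qed
 next
 case D0: False
 have n2: "2 <= n"
 proof -
 have "G.dirs ~= {}" using D0 G.card_dirs by auto
 then obtain u v where "{u, v} \<in> E" by (auto simp: G.dirs_def)
 then show ?thesis using G.edgeD[of u v] by linarith
 qed
 define \<Delta> where "\<Delta> = regs s1 62"
 \<comment> \<open>\<open>lg\<close> will be the bit length of \<open>n\<close>, so that
   \<open>n < M <= 2 * n\<close> and bounds in powers of \<open>M\<close> become bounds in powers of
   \<open>n + 1\<close>.\<close>
 obtain x where x: "2 ^ x <= n" "n < 2 ^ (x + 1)" using ex_power_ivl1[of 2 n] n1 by auto
 define lg M b q0 Q N where "lg = x + 1" and "M = (2::nat) ^ lg" and "b = B * lg" and "q0 = M ^ e" and "Q = n * q0" and "N = b * Q"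
 have lg1: "1 <= lg" and nM: "n < M" and M2n: "M <= 2 * n" using x by (auto simp: lg_def M_def)
 have M2: "2 <= M" using nM n2 by linarith
 have B1: "1 <= B" by (simp add: B)
 have q01: "1 <= q0" using M2 by (simp add: q0_def)
 have Q2: "2 <= Q" using n2 q01 mult_le_mono[of 2 n 1 q0] by (simp add: Q_def)
 have lgb: "lg <= b" using B1 by (simp add: b_def)
 have nb: "n <= 2 ^ b"
 proof -
 have "(2::nat) ^ lg <= 2 ^ b" using lgb by (intro power_increasing) auto
 then have "M <= 2 ^ b" unfolding M_def .
 then show ?thesis using nM by linarith
 qed
 interpret A0: rgraph_par n E adj Q N b q0
 by unfold_locales (use sg al Q2 nb lgb lg1 in \<open>auto simp: N_def Q_def\<close>)
 have ne: "A0.nonis ~= {}"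
 proof
 assume "A0.nonis = {}"
 then have "A0.D = 0" by (simp add: A0.D_nonis)
 then show False using D0 by simp
 qed
 have \<Delta>d: "!!u. u < n ==> A0.deg u <= \<Delta>" using s1(4) by (simp add: \<Delta>_def)
 interpret A: algo n E adj Q N b q0 w lg M \<Delta> B c0 J e th k a1 a2
 by unfold_locales (use ne nM lg1 \<Delta>d in \<open>auto simp: M_def b_def q0_def\<close>)
 obtain u where u: "u < n" "\<Delta> = G.deg u" using s1(5) by (auto simp: \<Delta>_def)
 have du: "\<Delta> = card (neighbors E u)"
 proof -
 have "distinct (adj u)" "set (adj u) = neighbors E u" using al u(1) by (auto simp: adjacency_lists_def)
 then show ?thesis using u(2) by (metis G.deg_def distinct_card)
 qed
 then have \<Delta>m: "\<Delta> <= max_degree n E" unfolding max_degree_def using u(1) by (intro Max_ge) auto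
 have \<Delta>n: "\<Delta> <= n"
 proof -
 have "neighbors E u \<subseteq> {..<n}" using G.edgeD by (auto simp: neighbors_def)
 then have "card (neighbors E u) <= card {..<n}" by (intro card_mono) auto
 then show ?thesis by (simp add: du)
 qed
 define i where "i = \<lparr>xn = n, xlg = lg, xM = M, xd = \<Delta>, xD = A0.D, xp = A.n', xs = A.sv, xh = A.hv\<rparr>"
 have i: "i \<in> insts J"
 proof -
 have "A0.D <= M * M" using A0.D_le mult_le_mono[of n M n M] nM by simp
 moreover have "A.n' <= n"
 proof -
 have "card A0.nonis <= card {..<n}" by (intro card_mono) (auto simp: A0.nonis_def)
 then show ?thesis by (simp add: A.n'_def)
 qed
 moreover have "lg <= M" using less_exp[of lg] by (simp add: M_def)
 moreover have "(2::nat) ^ min a1 lg <= 2 ^ lg" "(2::nat) ^ min a2 (lg * J) <= 2 ^ (lg * J)" by (auto intro!: power_increasing)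
 ultimately show ?thesis using M2 nM \<Delta>n
 by (simp add: insts_def i_def A.sv_def A.hv_def M_def power_mult)
 qed
 have TOP: "A.TOP = topf B c0 J e th k i"
 unfolding A.TOP_def A.vals_def topf_def A.F_def Zf_def A.Z_def A.AS_def A.A_def
 by (simp add: i_def b_def Q_def q0_def)
 have "A.TOP < 2 ^ w"
 proof -
 have "A.TOP <= M ^ \<tau>" using top[OF i] by (simp add: TOP i_def)
 also have "M <= (n + 1) ^ 2" using M2n by (simp add: power2_eq_square)
 then have "M ^ \<tau> <= ((n + 1) ^ 2) ^ \<tau>" by (intro power_mono) auto
 also have "... = (n + 1) ^ (2 * \<tau>)" by (simp only: power_mult)
 also have "... < (n + 1) ^ (2 * \<tau> + 3)" using n1 by (intro power_strict_increasing) auto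
 also note W
 finally show ?thesis .
 qed
 then interpret AW: algo_w n E adj Q N b q0 w lg M \<Delta> B c0 J e th k a1 a2 by unfold_locales
 have sl': "lg * (k + 2) * (\<Delta> * A.AS + \<Delta> * A.AS) * M ^ (k + 1) + 4 * (\<Delta> * A.AS + \<Delta> * A.AS) + 4 * A.sv <= M ^ g"
 using sl[OF i] unfolding slack_def A.AS_def A.A_def by (simp add: i_def)
 have eta: "A0.\<eta> * (real b + 37) * real (M ^ g) <= 1"
 using A0.eta_small[OF M_def nM lg1 b_def q0_def j e B] by simp
 have s1': "regs s1 (Suc 0) = A.n'" "\<forall>i<length A0.VL. mem s1 i = A0.VL ! i"
 using s1(6,7) A0.VL_facts(3) by (simp_all add: A.n'_def A0.VL_def)
 obtain s2 where s2: "cmp w n adj (c_setup B c0 J e th k a1 a2) s1 (setup_time B c0 J e th k n lg) (return_pmf s2)" "AW.ready s2" "regs s2 70 = A.K"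
 using AW.setup_state[OF s1(2) s1'(1) s1(3) \<Delta>_def[symmetric] s1(9) s1'(2) s1(8) M2n w1(3)] unfolding det_def by blast
 have cs: "th = 0 & a2 = 0 \<or> th = 1 & 8 * 2 ^ a2 <= 2 + \<epsilon>" using ch by auto
 obtain D' where D': "cmp w n adj (seqs [While (Reg 70) c_try, c_out]) s2 (Suc ((A.K * Suc AW.try_time + 1) + Suc (time c_out + 1))) D'"
 "1 - 1 / real n ^ k <= PR D' {s. matching_approx (2 + \<epsilon>) E (real (regs s 0)) & vertex_cover_approx (2 + \<epsilon>) n E (real (regs s 1))}"
 using AW.finale[OF c0 _ sl' \<epsilon> cs s2(2,3)] eta by auto
 let ?t2 = "Suc (setup_time B c0 J e th k n lg + Suc ((A.K * Suc AW.try_time + 1) + Suc (time c_out + 1)))"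
 let ?m = "Seq (c_setup B c0 J e th k a1 a2) (seqs [While (Reg 70) c_try, c_out])"
 have c2: "cmp w n adj ?m s1 ?t2 (bind_pmf (return_pmf s2) (%_. D'))"
 by (rule cmp_Seq[OF s2(1)]) (use D'(1) in simp)
 have "cmp w n adj ?P s0 (Suc (?t1 + Suc ?t2)) (bind_pmf (return_pmf s1) (%_. D'))"
 unfolding prog_def
 proof (rule cmp_Seq[OF s1(1)])
 fix s' assume "s' \<in> set_pmf (return_pmf s1)"
 then have s': "s' = s1" by simp
 have "cmp w n adj ?m s1 ?t2 D'" using c2 by (simp add: bind_return_pmf)
 then show "cmp w n adj (If (Reg 61) ?m (Seq (Compute 0 Add (Const 0) (Const 0)) (Compute 1 Add (Const 0) (Const 0)))) s' (Suc ?t2) D'"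
 using s1(3) D0 s' by (intro cmp_If) simp
 qed
 then have c: "cmp w n adj ?P s0 (Suc (?t1 + Suc ?t2)) D'" by (simp add: bind_return_pmf)
 show ?thesis
 proof (rule fin[OF c _ D'(2)])
 define X where "X = real (max_degree n E) / \<epsilon>\<^sup>2"
 define l where "l = log 2 (real n)"
 have X0: "0 <= X" by (simp add: X_def)
 have l1: "1 <= l" unfolding l_def using n2 by (simp add: le_log_iff)
 have "x < n" by (rule less_le_trans[OF less_exp x(1)])
 then have lgn: "lg <= n" by (simp add: lg_def)
 have lgl: "real lg <= 2 * l"
 proof -
 have "real (2 ^ x) <= real n" using x(1) by (simp only: of_nat_le_iff)
 then have "log 2 (2 ^ x) <= l" unfolding l_def by (intro log_mono) auto
 then have "real x <= l" by (simp add: log_nat_power)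
 then show ?thesis using l1 by (simp add: lg_def)
 qed
 have "Suc (?t1 + Suc ?t2) <= C1 * n + (k + 2) * Suc body_time * (lg * A.F)"
 using total_time[OF lgn n1, of "time c_deg" "time c_lg" "time (c_par1 B c0)" "time (c_par2 J)" J "time (c_par3 e th)" "time (c_par4 k)" k
 "time c_init" A.F body_time "time c_fin" "time c_out"]
 unfolding setup_time_def AW.try_time_def A.K_def C1 time_par3[of e th] .
 then have "real (Suc (?t1 + Suc ?t2)) <= real (C1 * n + (k + 2) * Suc body_time * (lg * A.F))" by (simp only: of_nat_le_iff)
 also have "... = real C1 * real n + real ((k + 2) * Suc body_time) * real (lg * A.F)" by (simp only: of_nat_add of_nat_mult)
 also have "... <= real C1 * real n + CW * (real n + X * (2 * l) ^ 18)"
 proof -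
 have "real \<Delta> / \<epsilon>\<^sup>2 * real lg ^ 18 <= X * (2 * l) ^ 18"
 unfolding X_def using \<Delta>m lgl by (intro mult_mono divide_right_mono power_mono) auto
 then have "real c0 * 401408 * (real n + real \<Delta> / \<epsilon>\<^sup>2 * real lg ^ 18) <= real c0 * 401408 * (real n + X * (2 * l) ^ 18)"
 by (intro mult_left_mono) auto
 then have "real (B + 40) ^ 7 * (real c0 * 401408 * (real n + real \<Delta> / \<epsilon>\<^sup>2 * real lg ^ 18)) <= real (B + 40) ^ 7 * (real c0 * 401408 * (real n + X * (2 * l) ^ 18))"
 by (rule mult_left_mono) simp
 then have "real (lg * A.F) <= real (B + 40) ^ 7 * (real c0 * 401408 * (real n + X * (2 * l) ^ 18))"
 using A.work_bound[OF J \<Delta>n \<epsilon>(1) ch] by linarith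
 then have "real ((k + 2) * Suc body_time) * real (lg * A.F) <= real ((k + 2) * Suc body_time) * (real (B + 40) ^ 7 * (real c0 * 401408 * (real n + X * (2 * l) ^ 18)))"
 by (intro mult_left_mono) auto
 then show ?thesis unfolding CW by (simp only: mult.assoc)
 qed
 also have "... = (real C1 + CW) * real n + CW * 2 ^ 18 * X * l ^ 18" by (simp add: power_mult_distrib algebra_simps)
 also have "... <= C * real n + C * X * l ^ 18"
 proof (intro add_mono mult_right_mono)
 show "real C1 + CW <= C" unfolding C using CW0 by simp
 show "CW * 2 ^ 18 <= C" unfolding C by simp
 qed (use X0 l1 in auto)
 finally show "real (Suc (?t1 + Suc ?t2)) <= C * real n + C * (real (max_degree n E) / \<epsilon>\<^sup>2) * log 2 (real n) ^ 18"
 unfolding X_def l_def .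
 qed
 qed
qed

theorem theorem1p2:
  fixes k :: nat
  shows "\<exists>(C::real) (\<kappa>::real) (c::nat). \<forall>\<epsilon>::real. \<epsilon> > 0 \<longrightarrow>
    (\<exists>P::com. \<forall>(n::nat) (E::nat set set) (adj::nat \<Rightarrow> nat list) (w::nat).
       n \<ge> 1 \<longrightarrow> simple_graph n E \<longrightarrow> adjacency_lists n E adj \<longrightarrow>
       \<kappa> * log 2 (real n + 1) \<le> real w \<longrightarrow>
       (\<exists>T::nat.
          real T \<le> C * real n + C * (real (max_degree n E) / \<epsilon>\<^sup>2) * log 2 (real n) ^ c \<and>
          (\<forall>cfg \<in> set_pmf (run w n adj T (initial P n)). halted cfg) \<and>
          measure_pmf.prob (run w n adj T (initial P n))
            {cfg. matching_approx (2 + \<epsilon>) E (matching_estimate cfg) \<and>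
                  vertex_cover_approx (2 + \<epsilon>) n E (vertex_cover_estimate cfg)}
            \<ge> 1 - 1 / real n ^ k))"
proof -
 \<comment> \<open>The order of choice avoids circles: \<open>c0\<close> and \<open>J\<close> depend
   on \<open>k\<close>, the degree \<open>g\<close> of \<open>slack\<close> on these, the exponents
   \<open>j\<close>, \<open>e\<close>, \<open>B\<close> on \<open>g\<close>, and the word length on
   all of them.\<close>
 define c0 J where "c0 = 64 * (2 * k + 8)" and "J = 2048 * c0 + 2"
 obtain g where g: "!!i. i \<in> insts J ==> slack c0 k i <= xM i ^ g" using pbd_slack[of J c0 k] unfolding pbd_def by blast
 define j e B where "j = g + 8" and "e = 2 * j + g + 7" and "B = 2 * j + e + g + 7"
 obtain \<tau>0 where t0: "!!i. i \<in> insts J ==> topf B c0 J e 0 k i <= xM i ^ \<tau>0" using pbd_topf[of J B c0 e 0 k] unfolding pbd_def by blast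
 obtain \<tau>1 where t1: "!!i. i \<in> insts J ==> topf B c0 J e 1 k i <= xM i ^ \<tau>1" using pbd_topf[of J B c0 e 1 k] unfolding pbd_def by blast
 \<comment> \<open>\<open>th\<close> depends on \<epsilon> and takes two values; one exponent must
   serve both, because the word length is fixed before \<epsilon>.\<close>
 define \<tau> where "\<tau> = \<tau>0 + \<tau>1"
 have top: "topf B c0 J e th k i <= xM i ^ \<tau>" if "th = 0 \<or> th = 1" "i \<in> insts J" for th i
 proof -
 have "2 <= xM i" using that(2) by (simp add: insts_def)
 then have "xM i ^ \<tau>0 <= xM i ^ \<tau>" "xM i ^ \<tau>1 <= xM i ^ \<tau>" by (auto simp: \<tau>_def intro!: power_increasing)
 then show ?thesis using that t0[OF that(2)] t1[OF that(2)] by auto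
 qed
 define C1 where "C1 = Suc (time c_deg) + Suc (time c_lg) + 8 + 8 * J + (k + 2) * (time c_init + time c_fin + 20)
 + (time (c_par1 B c0) + time (c_par2 J) + time (c_par3 e 0) + time (c_par4 k) + time c_out + 60)"
 define CW where "CW = real ((k + 2) * Suc body_time) * (real (B + 40) ^ 7 * (real c0 * 401408))"
 define C where "C = real C1 + CW * 2 ^ 18"
 show ?thesis
 proof (rule exI[of _ C], rule exI[of _ "real (2 * \<tau> + 3)"], rule exI[of _ 18], intro allI impI)
 fix \<epsilon> :: real assume \<epsilon>: "\<epsilon> > 0"
 obtain a1 a2 th :: nat where a: "1 <= \<epsilon> * 2 ^ a1"
 "th = 0 & a2 = 0 & 2 ^ a1 <= 14 / \<epsilon> \<or> th = 1 & a1 = 0 & 8 * 2 ^ a2 <= 2 + \<epsilon> & \<epsilon> <= 16 * 2 ^ a2"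
 using eps_choice[OF \<epsilon>] by blast
 have th: "th = 0 \<or> th = 1" using a(2) by auto
 show "\<exists>P. \<forall>n E adj w. n >= 1 --> simple_graph n E --> adjacency_lists n E adj -->
 real (2 * \<tau> + 3) * log 2 (real n + 1) <= real w -->
 (\<exists>T. real T <= C * real n + C * (real (max_degree n E) / \<epsilon>\<^sup>2) * log 2 (real n) ^ 18 &
 (\<forall>cfg \<in> set_pmf (run w n adj T (initial P n)). halted cfg) &
 PR (run w n adj T (initial P n))
 {cfg. matching_approx (2 + \<epsilon>) E (matching_estimate cfg) &
 vertex_cover_approx (2 + \<epsilon>) n E (vertex_cover_estimate cfg)} >= 1 - 1 / real n ^ k)"
 by (rule exI[of _ "prog B c0 J e th k a1 a2"], intro allI impI)
 (rule main_case[OF c0_def J_def g j_def e_def B_def top[OF th] \<epsilon> a C1_def CW_def C_def])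
 qed
qed

end
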